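(* Let $m\geq 2$ be an integer, let $V\in\mathbb N^m$ be a nonzero vector, and let $(L_n)_{n\geq 0}$ be the discrete-time fringe node process with parameter $m$ and initial condition $L_0=V$. Then: (i) (Small phases) if $m\leq 59$, then, as $n\to\infty$, $\dfrac{L_n-nP^{-1}v_1}{\sqrt n}$ converges in distribution to a centered Gaussian vector; (ii) (Large phases) if $m\geq 60$, then there is a complex-valued random variable $W^{DT}$ such that, as $n\to\infty$, $$L_n=nP^{-1}v_1+2\Re\left(n^{\lambda_2}W^{DT}P^{-1}v_2\right)+o\left(n^{\sigma_2}\right)$$ almost surely and in $\mathrm L^p$ for every $p\geq 1$; moreover $W^{DT}$ has the same distribution as the almost sure limit $\lim_{n\to\infty}n^{-\lambda_2}u_2(G_n)$, where $(G_n)_{n\ge 0}$ is the discrete-time gap process with $G_0=PV$ (this limit is the random variable $W$ for which $G_n=nv_1+2\Re(n^{\lambda_2}Wv_2)+o(n^{\sigma_2})$ almost surely and in every $\mathrm L^p$, $p\ge1$).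
   Context: Let $(e_k)_{1\le k\le m}$ be the canonical basis of $\mathbb R^m$ and let $w_k=-e_k+e_{k+1}$ for $1\le k\le m-1$, $w_m=2e_1-e_m$. Let $P=\mathrm{Diag}(m,m+1,\dots,2m-1)$. For a vector $X$, $|X|$ is the sum of its coordinates. Fringe node process: the Markov chain $(L_n)_{n\ge0}$ with values in $\mathbb N^m\setminus\{0\}$ and transitions $$\mathbb P\left(L_{n+1}=L_n+w_k\mid L_n\right)=\frac{(m+k-1)L_n^{(k)}}{K_n},\quad 1\le k\le m,\qquad K_n=\sum_{k=1}^m(m+k-1)L_n^{(k)}=n+|PL_0|,$$ where $L_n^{(k)}$ is the $k$-th coordinate. (It counts fringe nodes of each type in a B-tree, a node of type $k$ having $m+k-1$ insertion gaps.) Gap process: the Pólya urn process with replacement matrix $R_m$, where $(R_m)_{k,k}=-(m+k-1)$ for $1\le k\le m$, $(R_m)_{k,k+1}=m+k$ for $1\le k\le m-1$, $(R_m)_{m,1}=2m$, other entries $0$; i.e. the Markov chain such that, conditionally on $G_n$, $G_{n+1}=G_n+(\text{$k$-th row of }R_m)$ with probability $G_n^{(k)}/|G_n|$. Spectral notation: the characteristic polynomial of $R_m$ is $\chi_m(X)=\prod_{k=m}^{2m-1}(X+k)-\frac{(2m)!}{m!}$. Its roots are simple, $1$ is the root with largest real part, and two distinct roots with the same real part are complex conjugate. For $m\ge 60$, $\lambda_2=\sigma_2+i\tau_2$ denotes the root having the second largest real part $\sigma_2$ and positive imaginary part $\tau_2$. For a root $\lambda$ put $$H_{m+1}(X)=\sum_{k=1}^m\frac1{X+k},\qquad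 u(\lambda)(x_1,\dots,x_m)=\sum_{k=1}^m\left(\prod_{j=0}^{k-2}\frac{\lambda+m+j}{1+m+j}\right)x_k,$$ and let $v(\lambda)\in\mathbb C^m$ be the vector with $k$-th coordinate $$\frac{1}{(m+\lambda)H_{m+1}(m+\lambda-1)}\prod_{j=1}^{k-1}\frac{m+j}{m+j+\lambda}.$$ Put $v_1=v(1)=\frac1{H_{m+1}(m)}\left(\frac1{m+1},\dots,\frac1{2m}\right)$, $v_2=v(\lambda_2)$, $u_2=u(\lambda_2)$. $\Re$ of a complex vector is taken coordinatewise. *)

theory Defs
  imports "HOL-Probability.Probability" "HOL-Library.Landau_Symbols"
begin

text \<open>
  The parameter \<open>m\<close> is the cardinality of a linearly ordered finite index type \<open>'m\<close>, so that
  \<open>real ^ 'm\<close> is Euclidean \<open>m\<close>-space. The coordinates are numbered \<open>1, \<dots>, m\<close> along the order: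
  \<open>idx i\<close> is the rank of the index \<open>i\<close>.
\<close>

definition idx :: "'m::{finite,linorder} \<Rightarrow> nat" where
  "idx i = card {j. j \<le> i}"

definition e_vec :: "nat \<Rightarrow> real ^ 'm::{finite,linorder}" where
  "e_vec k = (\<chi> i. if idx i = k then 1 else 0)"

definition coord_sum :: "real ^ 'm::finite \<Rightarrow> real" where
  "coord_sum x = (\<Sum>i\<in>UNIV. x $ i)"

definition nonzero_nat_vecs :: "(real ^ 'm::finite) set" where
  "nonzero_nat_vecs = {x. (\<forall>i. x $ i \<in> \<nat>) \<and> x \<noteq> 0}"

definition markov_chain ::
  "'w measure \<Rightarrow> 's set \<Rightarrow> ('s \<Rightarrow> 's \<Rightarrow> real) \<Rightarrow> 's \<Rightarrow> (nat \<Rightarrow> 'w \<Rightarrow> 's) \<Rightarrow> bool" where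
  "markov_chain M S p x0 X \<longleftrightarrow>
     prob_space M \<and>
     (\<forall>n. X n \<in> M \<rightarrow>\<^sub>M count_space S) \<and>
     (AE \<omega> in M. X 0 \<omega> = x0) \<and>
     (\<forall>n x. \<P>(\<omega> in M. \<forall>i\<le>Suc n. X i \<omega> = x i) =
            \<P>(\<omega> in M. \<forall>i\<le>n. X i \<omega> = x i) * p (x n) (x (Suc n)))"

text \<open>Transition probabilities of the walk that adds \<open>d i\<close> to \<open>x\<close> with probability \<open>q x i\<close>.\<close>

definition step_prob ::
  "('s::plus \<Rightarrow> 'i::finite \<Rightarrow> real) \<Rightarrow> ('i \<Rightarrow> 's) \<Rightarrow> 's \<Rightarrow> 's \<Rightarrow> real" where
  "step_prob q d x y = (\<Sum>i\<in>UNIV. if y = x + d i then q x i else 0)"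

definition w_vec :: "nat \<Rightarrow> real ^ 'm::{finite,linorder}" where
  "w_vec k = (if k < CARD('m) then - e_vec k + e_vec (k + 1)
              else 2 *\<^sub>R e_vec 1 - e_vec CARD('m))"

definition P_mat :: "'a::field ^ 'm::{finite,linorder} ^ 'm::{finite,linorder}" where
  "P_mat = (\<chi> i j. if i = j then of_nat (CARD('m) + idx i - 1) else 0)"

definition fringe_process ::
  "'w measure \<Rightarrow> real ^ 'm::{finite,linorder} \<Rightarrow> (nat \<Rightarrow> 'w \<Rightarrow> real ^ 'm::{finite,linorder}) \<Rightarrow> bool" where
  "fringe_process M V L \<longleftrightarrow>
     markov_chain M nonzero_nat_vecs
       (step_prob
          (\<lambda>x i. real (CARD('m) + idx i - 1) * x $ i /
                 (\<Sum>j\<in>UNIV. real (CARD('m) + idx j - 1) * x $ j))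
          (\<lambda>i. w_vec (idx i)))
       V L"

definition R_mat :: "real ^ 'm::{finite,linorder} ^ 'm::{finite,linorder}" where
  "R_mat = (\<chi> i j.
     if j = i then - real (CARD('m) + idx i - 1)
     else if idx j = idx i + 1 then real (CARD('m) + idx i)
     else if idx i = CARD('m) \<and> idx j = 1 then real (2 * CARD('m))
     else 0)"

definition gap_process ::
  "'w measure \<Rightarrow> real ^ 'm::{finite,linorder} \<Rightarrow> (nat \<Rightarrow> 'w \<Rightarrow> real ^ 'm::{finite,linorder}) \<Rightarrow> bool" where
  "gap_process M x0 G \<longleftrightarrow>
     markov_chain M nonzero_nat_vecs
       (step_prob (\<lambda>x i. x $ i / coord_sum x) (\<lambda>i. row i R_mat))
       x0 G"

text \<open>The characteristic polynomial of the replacement matrix \<open>R_mat\<close> of size \<open>m\<close>.\<close>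

definition chi_poly :: "nat \<Rightarrow> complex poly" where
  "chi_poly m = (\<Prod>k=m..2*m-1. [:of_nat k, 1:]) - [:fact (2*m) / fact m:]"

definition sigma2 :: "nat \<Rightarrow> real" where
  "sigma2 m = (let A = Re ` {z. poly (chi_poly m) z = 0} in Max (A - {Max A}))"

definition lambda2 :: "nat \<Rightarrow> complex" where
  "lambda2 m = (THE z. poly (chi_poly m) z = 0 \<and> Re z = sigma2 m \<and> Im z > 0)"

text \<open>\<open>H_fun m\<close> is the function usually written $H_{m+1}$.\<close>

definition H_fun :: "nat \<Rightarrow> 'a::field \<Rightarrow> 'a" where
  "H_fun m X = (\<Sum>k=1..m. 1 / (X + of_nat k))"

definition u_form :: "complex \<Rightarrow> real ^ 'm::{finite,linorder} \<Rightarrow> complex" where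
  "u_form l x = (\<Sum>i\<in>UNIV.
     (\<Prod>j\<in>{0..<idx i - 1}. (l + of_nat (CARD('m) + j)) / of_nat (1 + CARD('m) + j))
       * of_real (x $ i))"

definition v_vec :: "'a::field \<Rightarrow> 'a ^ 'm::{finite,linorder}" where
  "v_vec l = (\<chi> i.
     1 / ((of_nat CARD('m) + l) * H_fun CARD('m) (of_nat CARD('m) + l - 1))
       * (\<Prod>j\<in>{1..<idx i}. of_nat (CARD('m) + j) / (of_nat (CARD('m) + j) + l)))"

definition Re_vec :: "complex ^ 'm::finite \<Rightarrow> real ^ 'm::finite" where
  "Re_vec z = (\<chi> i. Re (z $ i))"

text \<open>The law \<open>N(0, \<sigma>\<^sup>2)\<close>, where \<open>\<sigma> = 0\<close> gives the Dirac mass at \<open>0\<close>.\<close>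

definition centered_normal :: "real \<Rightarrow> real measure" where
  "centered_normal \<sigma> =
     (if \<sigma> = 0 then return borel 0 else density lborel (normal_density 0 \<sigma>))"

text \<open>
  A random vector is Gaussian if all its linear combinations are; the covariance matrix may be
  singular (as it has to be for the fringe node process, in which \<open>|P L\<^sub>n|\<close> is deterministic).
\<close>

definition centered_gaussian :: "'v::euclidean_space measure \<Rightarrow> bool" where
  "centered_gaussian \<mu> \<longleftrightarrow>
     prob_space \<mu> \<and> sets \<mu> = sets borel \<and>
     (\<forall>a. \<exists>\<sigma>\<ge>0. distr \<mu> borel (\<lambda>x. a \<bullet> x) = centered_normal \<sigma>)"

text \<open>The library's weak convergence is only for measures on the real line.\<close>

definition converges_in_law ::
  "'w measure \<Rightarrow> (nat \<Rightarrow> 'w \<Rightarrow> 'v::topological_space) \<Rightarrow> 'v measure \<Rightarrow> bool" where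
  "converges_in_law M X \<mu> \<longleftrightarrow>
     (\<forall>f::'v \<Rightarrow> real. continuous_on UNIV f \<and> bounded (range f) \<longrightarrow>
        (\<lambda>n. \<integral>\<omega>. f (X n \<omega>) \<partial>M) \<longlonglongrightarrow> (\<integral>x. f x \<partial>\<mu>))"

text \<open>\<open>E n = o(n\<^sup>s)\<close> almost surely and in \<open>L\<^sup>p\<close> for every real \<open>p \<ge> 1\<close>.\<close>

definition small_o_as_Lp ::
  "'w measure \<Rightarrow> (nat \<Rightarrow> 'w \<Rightarrow> 'v::real_normed_vector) \<Rightarrow> real \<Rightarrow> bool" where
  "small_o_as_Lp M E s \<longleftrightarrow>
     (AE \<omega> in M. (\<lambda>n. norm (E n \<omega>)) \<in> o(\<lambda>n. real n powr s)) \<and>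
     (\<forall>p\<ge>1. (\<forall>n. integrable M (\<lambda>\<omega>. norm (E n \<omega>) powr p)) \<and>
        (\<lambda>n. (\<integral>\<omega>. norm (E n \<omega>) powr p \<partial>M) powr (1 / p)) \<in> o(\<lambda>n. real n powr s))"

end

theory Submission
  imports Defs "HOL-Computational_Algebra.Fundamental_Theorem_Algebra"
begin

text \<open>
  The map \<open>x \<mapsto> P x\<close> turns the fringe node process into the gap process, a balanced urn whose
  drift is diagonalised by the forms \<open>u_form l\<close>: for each root \<open>l\<close> of the characteristic polynomial,
  \<open>u_form l (G n)\<close> divided by \<open>growth K l 0 n = (\<Prod>j<n. 1 + l / (K + j))\<close>, which is of order
  \<open>n powr l\<close>, is a martingale.

  A root with real part at least 1/2 satisfies an equation between moduli and one between arguments.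
  On the line \<open>Re z = 1/2\<close> both are monotone in \<open>m\<close> (the moduli in the relevant range), so numerical estimates at \<open>m = 59\<close> and
  \<open>m = 60\<close> decide on which side of 1/2 the second largest real part lies.

  Large phases: an Azuma type exponential estimate bounds all moments of the martingale differences by
  powers of \<open>n\<close>. This yields a limit with a polynomial rate in every \<open>L\<^sup>p\<close>, hence, by summing
  moments of high order, also almost surely; no martingale convergence theorem is needed.

  Small phases: in a fixed direction the normalised process is a martingale sum with uniformly small
  increments whose conditional variances are asymptotically deterministic, because \<open>G n / n\<close> tends
  to \<open>v_vec 1\<close>. Its characteristic function is therefore compared step by step with a Gaussian one.
  Convergence of characteristic functions and a bound on second moments give convergence in law, by
  approximation with trigonometric polynomials on a large torus.
\<close>

section \<open>Roots of the characteristic polynomial\<close>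

text \<open>The exponent 1/2 is where two sources of growth balance. By time \<open>n\<close> an
  increment made at step \<open>k\<close> has been multiplied by a factor of order
  \<open>(n / k) powr Re l\<close>. The squares of these contributions add up to order
  \<open>n\<close> if \<open>Re l < 1/2\<close>, and to order \<open>n powr (2 * Re l)\<close> if
  \<open>Re l > 1/2\<close>; in the second case the early increments dominate and leave a random
  limit.

  Two constraints fix the numbers 9.08 and 9.13. At \<open>m = 59\<close> the modulus equation keeps
  the imaginary part below 9.08, and the arguments at 9.08 add up to about 6.267, below 2 pi. At
  \<open>m = 60\<close> the imaginary part on the line is above 9.13, and the arguments at 9.13 add
  up to about 6.302. The margins are small, so the estimates are carried out with integers.

  A chain with a fixed start and finitely many steps has finitely many trajectories of each length.
  Every function of the history is therefore integrable, and conditional expectations become finite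
  sums over the next step. The limit covariance is singular, because the total number of gaps is
  deterministic; so the Gaussian limit is built from its quadratic form and not from a
  density.\<close>

lemma prod_strict_mono:
  fixes f g :: "'a \<Rightarrow> real"
  assumes "finite A" "A \<noteq> {}" "\<And>k. k \<in> A \<Longrightarrow> 0 \<le> f k \<and> f k < g k"
  shows "prod f A < prod g A"
proof -
  obtain i where "i \<in> A" using assms(2) by auto
  with assms show ?thesis by (intro prod_mono_strict[of i]) (auto intro: less_imp_le le_less_trans)
qed


text \<open>With the constant written as a product over the same range, \<open>z + k\<close> can be
  compared with \<open>k + 1\<close> factor by factor.\<close>

lemma chi_root_iff:
  assumes "m \<ge> 1"
  shows "poly (chi_poly m) z = 0 \<longleftrightarrow>
     (\<Prod>k=m..<2*m. z + of_nat k) = of_real (\<Prod>k=m..<2*m. real k + 1)"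
proof -
  have *: "(\<Prod>k=m..<m+n. real k + 1) = fact (m+n) / fact m" for n
    proof (induction n)
    case (Suc n)
    then show ?case by (simp only: add_Suc_right prod.atLeastLessThan_Suc le_add1 fact_Suc) (simp add: field_simps)
  qed simp
  have "{m..2*m-1} = {m..<2*m}" using assms by auto
  then have "poly (chi_poly m) z =
     (\<Prod>k=m..<2*m. z + of_nat k) - complex_of_real (fact (2*m) / fact m)"
    by (simp add: chi_poly_def poly_prod add.commute)
  also have "fact (2*m) / fact m = (\<Prod>k=m..<2*m. real k + 1)"
    using *[of m] by (simp add: mult_2)
  finally show ?thesis by (simp only: right_minus_eq)
qed

lemma chi_root_norm:
  assumes "m \<ge> 1" "poly (chi_poly m) z = 0"
  shows "(\<Prod>k=m..<2*m. cmod (z + of_nat k)) = (\<Prod>k=m..<2*m. real k + 1)"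
proof -
  have "cmod (\<Prod>k=m..<2*m. z + of_nat k) = \<bar>\<Prod>k=m..<2*m. real k + 1\<bar>"
    using assms(2) unfolding chi_root_iff[OF assms(1)] by (metis norm_of_real)
  also have "\<dots> = (\<Prod>k=m..<2*m. real k + 1)"
    by (intro abs_of_nonneg prod_nonneg) auto
  finally show ?thesis by (simp only: prod_norm)
qed

lemma chi_root_one: "m \<ge> 1 \<Longrightarrow> poly (chi_poly m) 1 = 0"
  by (simp add: chi_root_iff add.commute of_real_prod)

text \<open>For any other such \<open>z\<close>, each \<open>z + k\<close> has modulus larger than
  \<open>k + 1\<close>, so the product of the moduli is too large.\<close>

lemma chi_root_Re_ge_1:
  assumes m: "m \<ge> 1" and z: "poly (chi_poly m) z = 0" and "Re z \<ge> 1"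
  shows "z = 1"
proof (rule ccontr)
  assume "z \<noteq> 1"
  have "cmod (z + of_nat k) > real k + 1" for k
  proof (cases "Im z = 0")
    case True
    then have "Re z > 1" using \<open>z \<noteq> 1\<close> assms(3)
      by (metis complex_eqI le_neq_trans one_complex.sel(1) one_complex.sel(2))
    then show ?thesis using complex_Re_le_cmod[of "z + of_nat k"] by simp
  next
    case False
    have "(real k + 1)\<^sup>2 < (Re z + real k)\<^sup>2 + (Im z)\<^sup>2"
      using power_mono[of "real k + 1" "Re z + real k" 2] assms(3) False
      by (smt (verit) of_nat_0_le_iff zero_less_power2)
    then show ?thesis by (simp add: cmod_def real_less_rsqrt)
  qed
  then have "(\<Prod>k=m..<2*m. real k + 1) < (\<Prod>k=m..<2*m. cmod (z + of_nat k))"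
    using m by (intro prod_strict_mono) (auto intro: less_imp_le)
  then show False using chi_root_norm[OF m z] by simp
qed

text \<open>For real \<open>z\<close> strictly between \<open>-m\<close> and 1 each factor is
  positive and smaller than \<open>k + 1\<close>, so the product is too small.\<close>

lemma chi_root_real:
  assumes m: "m \<ge> 1" and z: "poly (chi_poly m) z = 0" and "Re z > - real m" "Im z = 0"
  shows "z = 1"
proof -
  have "Re z \<ge> 1"
  proof (rule ccontr)
    assume "\<not> Re z \<ge> 1"
    have "(\<Prod>k=m..<2*m. cmod (z + of_nat k)) < (\<Prod>k=m..<2*m. real k + 1)"
      using m assms(3,4) \<open>\<not> Re z \<ge> 1\<close> by (intro prod_strict_mono) (auto simp: cmod_eq_Re)
    then show False using chi_root_norm[OF m z] by simp
  qed
  then show ?thesis using chi_root_Re_ge_1[OF m z] by simp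
qed

lemma chi_root_cnj:
  assumes "m \<ge> 1" "poly (chi_poly m) z = 0"
  shows "poly (chi_poly m) (cnj z) = 0"
proof -
  have "cnj (\<Prod>k=m..<2*m. z + of_nat k) = (\<Prod>k=m..<2*m. cnj z + of_nat k)" by simp
  then show ?thesis using assms(2) unfolding chi_root_iff[OF assms(1)] by (metis complex_cnj_complex_of_real)
qed

text \<open>With the real part fixed, every factor grows in modulus with the absolute imaginary
  part, so the modulus equation determines the latter.\<close>

lemma chi_root_same_Re:
  assumes m: "m \<ge> 1" and z: "poly (chi_poly m) z = 0" and w: "poly (chi_poly m) w = 0"
    and "Re z = Re w"
  shows "w = z \<or> w = cnj z"
proof -
  have *: "\<not> \<bar>Im z\<bar> < \<bar>Im w\<bar>" if "poly (chi_poly m) z = 0" "poly (chi_poly m) w = 0" "Re z = Re w" for z w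
  proof
    assume "\<bar>Im z\<bar> < \<bar>Im w\<bar>"
    then have "cmod (z + of_nat k) < cmod (w + of_nat k)" for k
      using that(3) by (simp add: cmod_def abs_le_square_iff[symmetric] flip: not_le)
    then have "(\<Prod>k=m..<2*m. cmod (z + of_nat k)) < (\<Prod>k=m..<2*m. cmod (w + of_nat k))"
      using m by (intro prod_strict_mono) (auto intro: less_imp_le)
    then show False using chi_root_norm[OF m] that by simp
  qed
  have "\<bar>Im z\<bar> = \<bar>Im w\<bar>" using *[OF z w] *[OF w z] assms(4) by linarith
  then show ?thesis using assms(4) by (auto simp: complex_eq_iff abs_eq_iff)
qed

lemma chi_root_nonpole:
  assumes "m \<ge> 1" "poly (chi_poly m) z = 0" "k \<in> {m..<2*m}"
  shows "z + of_nat k \<noteq> 0"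
proof
  assume "z + of_nat k = 0"
  then have "(\<Prod>k=m..<2*m. z + of_nat k) = 0" using assms(3) by (intro prod_zero) auto
  then have "(\<Prod>k=m..<2*m. real k + 1) = 0" using assms(2) unfolding chi_root_iff[OF assms(1)] by (metis of_real_eq_0_iff)
  moreover have "(\<Prod>k=m..<2*m. real k + 1) > 0" by (intro prod_pos) auto
  ultimately show False by simp
qed

text \<open>At a multiple root the logarithmic derivative vanishes, which forces the root to lie
  between two zeros of the product, where the product is too small.\<close>

lemma chi_root_simple:
  assumes m: "m \<ge> 1" and z: "poly (chi_poly m) z = 0"
  shows "(\<Sum>k=m..<2*m. 1 / (z + of_nat k)) \<noteq> 0"
proof
  assume eq: "(\<Sum>k=m..<2*m. 1 / (z + of_nat k)) = 0"
  define N where "N = (\<lambda>k. (Re z + real k)\<^sup>2 + (Im z)\<^sup>2)"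
  have N: "N k > 0" if "k \<in> {m..<2*m}" for k
    using chi_root_nonpole[OF m z that] unfolding N_def
    by (metis Im_complex_of_real Re_complex_of_real add.commute add_cancel_right_left complex_eq_iff sum_power2_gt_zero_iff of_real_of_nat_eq plus_complex.sel zero_complex.sel)
  have Re: "Re (1 / (z + of_nat k)) = (Re z + real k) / N k"
   and Im: "Im (1 / (z + of_nat k)) = - Im z / N k" for k
    by (simp_all add: Re_divide Im_divide N_def)
  \<comment> \<open>This imaginary part is \<open>- Im z\<close> times a positive number, so a
    multiple root would have to be real.\<close>
  have "0 = Im (\<Sum>k=m..<2*m. 1 / (z + of_nat k))" using eq by simp
  also have "\<dots> = - Im z * (\<Sum>k=m..<2*m. 1 / N k)" by (simp only: Im_sum Im) (simp add: sum_distrib_left sum_negf)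
  finally have "Im z * (\<Sum>k=m..<2*m. 1 / N k) = 0" by simp
  moreover have "(\<Sum>k=m..<2*m. 1 / N k) > 0" using m N by (intro sum_pos) auto
  ultimately have im: "Im z = 0" by simp
  have sum0: "(\<Sum>k=m..<2*m. (Re z + real k) / N k) = 0"
    using arg_cong[OF eq, of Re] by (simp only: Re_sum Re) simp
  have lo: "Re z > - real (2*m)"
  proof (rule ccontr)
    assume "\<not> Re z > - real (2*m)"
    then have "(\<Sum>k=m..<2*m. (Re z + real k) / N k) < (\<Sum>k=m..<2*m. 0)"
      using m N by (intro sum_strict_mono) (auto simp: divide_less_0_iff)
    with sum0 show False by simp
  qed
  have hi: "Re z < - real m"
  proof (rule ccontr)
    assume "\<not> Re z < - real m"
    then have ge: "Re z + real k \<ge> 0" if "k \<in> {m..<2*m}" for k using that by auto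
    have "(Re z + real k) / N k > 0" if "k \<in> {m..<2*m}" for k
    proof -
      have "Re z + real k \<noteq> 0" using N[OF that] im unfolding N_def by auto
      then show ?thesis using ge[OF that] N[OF that] by simp
    qed
    then have "(\<Sum>k=m..<2*m. (Re z + real k) / N k) > 0" using m by (intro sum_pos) auto
    with sum0 show False by simp
  qed
  have "(\<Prod>k=m..<2*m. cmod (z + of_nat k)) < (\<Prod>k=m..<2*m. real k + 1)"
  proof (intro prod_strict_mono)
    fix k assume "k \<in> {m..<2*m}"
    then have "real m \<le> real k" "real k + 1 \<le> 2 * real m" by auto
    then have "\<bar>Re z + real k\<bar> < real k + 1" using lo hi by auto
    then show "0 \<le> cmod (z + of_nat k) \<and> cmod (z + of_nat k) < real k + 1"
      using im by (auto simp: cmod_eq_Re)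
  qed (use m in auto)
  then show False using chi_root_norm[OF m z] by simp
qed

lemma degree_chi_poly: "m \<ge> 1 \<Longrightarrow> degree (chi_poly m) = m"
  and chi_poly_nonzero: "m \<ge> 1 \<Longrightarrow> chi_poly m \<noteq> 0"
proof -
  assume m: "m \<ge> 1"
  let ?p = "\<Prod>k=m..2*m-1. [:of_nat k :: complex, 1:]"
  have "degree ?p = (\<Sum>k=m..2*m-1. degree [:of_nat k :: complex, 1:])"
    by (intro degree_prod_eq_sum_degree) auto
  also have "\<dots> = m" using m by simp
  finally have d: "degree ?p = m" .
  show "degree (chi_poly m) = m"
    unfolding chi_poly_def
    by (subst diff_conv_add_uminus, subst degree_add_eq_left) (use d m in auto)
  then show "chi_poly m \<noteq> 0" using m by auto
qed

text \<open>The derivative at a root is the non-zero product times the logarithmic derivative, hence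
  non-zero by \<open>chi_root_simple\<close>. That there are exactly \<open>m\<close> roots is what
  makes the eigenforms a basis in \<open>spectral_decomposition\<close>.\<close>

lemma card_chi_roots:
  assumes m: "m \<ge> 1"
  shows "card {z. poly (chi_poly m) z = 0} = m"
proof -
  have "poly (pderiv (chi_poly m)) z \<noteq> 0" if z: "poly (chi_poly m) z = 0" for z
  proof -
    have eq: "{m..2*m-1} = {m..<2*m}" using m by auto
    have "poly (pderiv (chi_poly m)) z
        = (\<Sum>k=m..<2*m. \<Prod>j\<in>{m..<2*m}-{k}. z + of_nat j)"
      unfolding chi_poly_def eq
      by (simp add: pderiv_diff pderiv_prod poly_sum poly_prod pderiv_pCons add.commute)
    also have "\<dots> = (\<Sum>k=m..<2*m. (\<Prod>j=m..<2*m. z + of_nat j) * (1 / (z + of_nat k)))"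
      by (intro sum.cong refl) (use chi_root_nonpole[OF m z] in \<open>auto simp: prod.remove\<close>)
    also have "\<dots> = (\<Prod>j=m..<2*m. z + of_nat j) * (\<Sum>k=m..<2*m. 1 / (z + of_nat k))"
      by (simp add: sum_distrib_left)
    also have "\<dots> \<noteq> 0" using chi_root_simple[OF m z] chi_root_nonpole[OF m z] by auto
    finally show ?thesis .
  qed
  then have "rsquarefree (chi_poly m)" by (auto simp: rsquarefree_roots)
  then have dec: "chi_poly m = smult (lead_coeff (chi_poly m)) (\<Prod>z|poly (chi_poly m) z = 0. [:-z, 1:])"
    by (simp add: complex_poly_decompose_rsquarefree)
  have "degree (chi_poly m) = degree (\<Prod>z|poly (chi_poly m) z = 0. [:-z, 1:])"
    using chi_poly_nonzero[OF m] by (subst dec) simp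
  also have "\<dots> = (\<Sum>z|poly (chi_poly m) z = 0. degree [:-z, 1:])"
    by (intro degree_prod_eq_sum_degree) auto
  finally have "card {z. poly (chi_poly m) z = 0} = degree (chi_poly m)" by simp
  then show ?thesis using degree_chi_poly[OF m] by simp
qed

section \<open>Moduli and arguments on the line \<open>Re z = 1/2\<close>\<close>

text \<open>If \<open>1/2 + i y\<close> is a root, then \<open>arg_sum y m\<close> is a multiple of \<open>2 * pi\<close> and
  \<open>mod_prod (y\<^sup>2) m = 1\<close>, since \<open>(2m)! / m!\<close> is the product of the numbers \<open>k + 1\<close> for \<open>m \<le> k < 2m\<close>.\<close>

definition arg_sum :: "real \<Rightarrow> nat \<Rightarrow> real" where
  "arg_sum y m = (\<Sum>k=m..<2*m. arctan (y / (real k + 1/2)))"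

lemma sum_block_Suc:
  fixes f :: "nat \<Rightarrow> real"
  shows "sum f {Suc m..<2 * Suc m} = sum f {m..<2*m} + f (2*m) + f (2*m+1) - f m"
proof -
  have "f m + sum f {Suc m..<2 * Suc m} = sum f {m..<2 * Suc m}"
    by (subst (2) sum.atLeast_Suc_lessThan) auto
  then show ?thesis by simp
qed

text \<open>Passing from \<open>m\<close> to \<open>m + 1\<close> removes the angle at
  \<open>k = m\<close> and adds those at \<open>2 * m\<close> and \<open>2 * m + 1\<close>, so the
  claim is \<open>arctan r \<le> arctan p + arctan q\<close>.\<close>

lemma arg_sum_step:
  assumes "y > 0"
  shows "arg_sum y m \<le> arg_sum y (Suc m)"
proof -
  define p q r where "p = y / (2 * real m + 1/2)" and "q = y / (2 * real m + 3/2)" and "r = y / (real m + 1/2)"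
  have pos: "p > 0" "q > 0" "r > 0" using assms by (auto simp: p_def q_def r_def)
  \<comment> \<open>Convexity of the reciprocal: \<open>r\<close> is
    \<open>2 * y / (2 * m + 1)\<close>, and \<open>2 * m + 1\<close> is the midpoint of the
    denominators of \<open>p\<close> and \<open>q\<close>.\<close>
  have "r \<le> p + q"
    unfolding p_def q_def r_def using assms
    by (auto simp: divide_simps) (auto simp: algebra_simps)
  have "arctan r \<le> arctan p + arctan q"
  proof (cases "p * q < 1")
    case True
    have "p + q \<le> (p + q) / (1 - p * q)" using True pos by (simp add: field_simps)
    then have "arctan r \<le> arctan ((p + q) / (1 - p * q))"
      using \<open>r \<le> p + q\<close> by (intro arctan_monotone') linarith
    also have "\<dots> = arctan p + arctan q"
      using True pos by (subst arctan_add_small) auto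
    finally show ?thesis .
  next
    case False
    \<comment> \<open>Outside the range of the addition formula the two angles together already
      reach a right angle.\<close>
    then have "1 / p \<le> q" using pos by (simp add: field_simps)
    then have "arctan (1/p) \<le> arctan q" by (rule arctan_monotone')
    moreover have "arctan (1/p) = pi/2 - arctan p" using arctan_inverse[of p] pos by (auto simp: inverse_eq_divide)
    ultimately show ?thesis using arctan_ubound[of r] by linarith
  qed
  then show ?thesis
    unfolding arg_sum_def sum_block_Suc p_def q_def r_def by (simp add: algebra_simps)
qed

lemma arg_sum_mono: "y > 0 \<Longrightarrow> m \<le> n \<Longrightarrow> arg_sum y m \<le> arg_sum y n"
  by (rule lift_Suc_mono_le[of "arg_sum y"]) (auto intro: arg_sum_step)

text \<open>Squared modulus of \<open>(1/2 + i y + k) / (k + 1)\<close> for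
  \<open>Y = y\<^sup>2\<close>. Taking squares keeps the value rational for rational
  \<open>y\<close>.\<close>

definition mod_ratio :: "real \<Rightarrow> nat \<Rightarrow> real" where
  "mod_ratio Y k = ((real k + 1/2)\<^sup>2 + Y) / (real k + 1)\<^sup>2"

lemma mod_ratio_pos: "Y > 0 \<Longrightarrow> mod_ratio Y k > 0"
  unfolding mod_ratio_def by (intro divide_pos_pos add_nonneg_pos) auto

definition mod_prod :: "real \<Rightarrow> nat \<Rightarrow> real" where
  "mod_prod Y m = (\<Prod>k=m..<2*m. mod_ratio Y k)"

lemma mod_prod_Suc:
  assumes "Y > 0"
  shows "mod_prod Y (Suc m) * mod_ratio Y m = mod_prod Y m * (mod_ratio Y (2*m) * mod_ratio Y (2*m+1))"
proof -
  have "mod_ratio Y m * prod (mod_ratio Y) {Suc m..<2 * Suc m} = prod (mod_ratio Y) {m..<2 * Suc m}"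
    by (subst (2) prod.atLeast_Suc_lessThan) auto
  then show ?thesis by (simp add: mod_prod_def mult_ac)
qed

lemma frac_le_iff_cross:
  fixes a b c d :: real
  assumes "b > 0" "d > 0"
  shows "a / b \<le> c / d \<longleftrightarrow> a * d \<le> c * b"
  using assms by (simp add: field_simps)

text \<open>With \<open>a = 2 * m + 1\<close> the inequality multiplies out to
  \<open>(Y + 1/4)\<^sup>2 \<le> 2 * a\<^sup>2 * (Y + 1/4)\<close>. The interval from 82 to 84
  contains the squares of 9.08 and 9.13.\<close>

lemma mod_ratio_step:
  assumes "m \<ge> 41" "82 \<le> Y" "Y \<le> 84"
  shows "mod_ratio Y (2*m) * mod_ratio Y (2*m+1) \<le> mod_ratio Y m"
proof -
  define a where "a = 2 * real m + 1"
  have "83 * 83 \<le> a * a" using assms by (intro mult_mono) (auto simp: a_def)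
  then have "Y + 1/4 \<le> 2 * a\<^sup>2" using assms by (simp add: power2_eq_square)
  then have "(Y + 1/4) * (Y + 1/4) \<le> (Y + 1/4) * (2 * a\<^sup>2)"
    using assms by (intro mult_left_mono) auto
  then have "((a - 1/2)\<^sup>2 + Y) * ((a + 1/2)\<^sup>2 + Y) \<le> ((a/2)\<^sup>2 + Y) * (a\<^sup>2 * 4)"
    by (simp add: power2_eq_square algebra_simps)
  then have "((a - 1/2)\<^sup>2 + Y) * ((a + 1/2)\<^sup>2 + Y) * (real m + 1)\<^sup>2 \<le> ((a/2)\<^sup>2 + Y) * (a\<^sup>2 * 4) * (real m + 1)\<^sup>2"
    by (intro mult_right_mono) auto
  also have "\<dots> = ((a/2)\<^sup>2 + Y) * (a\<^sup>2 * (2 * real m + 2)\<^sup>2)" by (simp add: power2_eq_square algebra_simps)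
  finally have "((2 * real m + 1/2)\<^sup>2 + Y) * ((2 * real m + 3/2)\<^sup>2 + Y) * (real m + 1)\<^sup>2
        \<le> ((real m + 1/2)\<^sup>2 + Y) * ((2 * real m + 1)\<^sup>2 * (2 * real m + 2)\<^sup>2)"
    by (simp add: a_def add_divide_distrib add_ac)
  then show ?thesis
    unfolding mod_ratio_def times_divide_times_eq
    by (intro iffD2[OF frac_le_iff_cross]) (auto simp: add_ac)
qed

lemma mod_prod_step:
  assumes "m \<ge> 41" "82 \<le> Y" "Y \<le> 84"
  shows "mod_prod Y (Suc m) \<le> mod_prod Y m"
proof -
  have pos: "mod_ratio Y m > 0" using assms by (intro mod_ratio_pos) auto
  have "mod_prod Y (Suc m) * mod_ratio Y m \<le> mod_prod Y m * mod_ratio Y m"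
    using mod_prod_Suc[of Y m] mod_ratio_step[OF assms] assms
    by (simp only:) (intro mult_left_mono, auto intro!: prod_nonneg less_imp_le[OF mod_ratio_pos] simp: mod_prod_def simp del: prod.op_ivl_Suc)
  then show ?thesis using pos by simp
qed

lemma mod_prod_antimono:
  assumes "41 \<le> m" "m \<le> n" "82 \<le> Y" "Y \<le> 84"
  shows "mod_prod Y n \<le> mod_prod Y m"
  using assms(2)
proof (induction n rule: dec_induct)
  case (step n)
  then show ?case using mod_prod_step[of n Y] assms by force
qed simp

text \<open>A factor is at least 1 exactly when \<open>k + 3/4 \<le> Y\<close>. Here
  \<open>k\<close> is at most 81, which explains the pair 41 and 82: below 41 all factors are large,
  above it the product decreases in \<open>m\<close>.\<close>

lemma mod_prod_ge_1_small:
  assumes "m \<le> 41" "82 \<le> Y"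
  shows "mod_prod Y m \<ge> 1"
  unfolding mod_prod_def
proof (rule prod_ge_1)
  fix k assume "k \<in> {m..<2*m}"
  then have "real k \<le> 81" using assms by auto
  then show "1 \<le> mod_ratio Y k" unfolding mod_ratio_def
    using assms(2) by (simp add: power2_eq_square) (auto simp: algebra_simps)
qed

section \<open>Rigorous numerics for the two threshold cases\<close>

lemma arctan_le_quintic:
  fixes x :: real assumes "x \<ge> 0" shows "arctan x \<le> x - x^3/3 + x^5/5"
proof -
  define f where "f = (\<lambda>x::real. x - x^3/3 + x^5/5 - arctan x)"
  have "f 0 \<le> f x"
  proof (rule DERIV_nonneg_imp_nondecreasing[OF assms], intro exI conjI)
    fix t :: real
    show "(f has_real_derivative 1 - t^2 + t^4 - inverse (1 + t^2)) (at t)"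
      unfolding f_def by (auto intro!: derivative_eq_intros)
    have p: "1 + t^2 > 0" by (simp add: add_pos_nonneg)
    have "(1 - t^2 + t^4) * (1 + t^2) = 1 + (t^3)^2" by algebra
    then have "1 \<le> (1 - t^2 + t^4) * (1 + t^2)" by simp
    then show "1 - t^2 + t^4 - inverse (1 + t^2) \<ge> 0" using p by (simp add: inverse_eq_divide divide_le_eq)
  qed
  then show ?thesis by (simp add: f_def)
qed

lemma arctan_ge_cubic:
  fixes x :: real assumes "x \<ge> 0" shows "x - x^3/3 \<le> arctan x"
proof -
  define f where "f = (\<lambda>x::real. arctan x - (x - x^3/3))"
  have "f 0 \<le> f x"
  proof (rule DERIV_nonneg_imp_nondecreasing[OF assms], intro exI conjI)
    fix t :: real
    show "(f has_real_derivative inverse (1 + t^2) - (1 - t^2)) (at t)"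
      unfolding f_def by (auto intro!: derivative_eq_intros)
    have p: "1 + t^2 > 0" by (simp add: add_pos_nonneg)
    have "(1 - t^2) * (1 + t^2) = 1 - (t^2)^2" by algebra
    then have "(1 - t^2) * (1 + t^2) \<le> 1" by simp
    then show "inverse (1 + t^2) - (1 - t^2) \<ge> 0" using p by (simp add: inverse_eq_divide le_divide_eq)
  qed
  then show ?thesis by (simp add: f_def)
qed

text \<open>Brings a sum into the shape that \<open>code_simp\<close> can evaluate: a fold over an
  explicit list of integers. \<open>prod_int_upto\<close> does the same for products.\<close>

lemma sum_int_upto:
  assumes "int a = a'" "int b = b' + 1"
  shows "(\<Sum>k=a..<b. h (int k)) = sum_list (map h [a'..b'])"
proof -
  have "(\<Sum>k=a..<b. h (int k)) = sum h (int ` {a..<b})" by (simp add: sum.reindex)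
  also have "int ` {a..<b} = set [a'..b']" using assms by (auto simp: image_int_atLeastLessThan)
  also have "sum h \<dots> = sum_list (map h [a'..b'])" by (rule sum.distinct_set_conv_list) simp
  finally show ?thesis .
qed

lemma prod_int_upto:
  assumes "int a = a'" "int b = b' + 1"
  shows "(\<Prod>k=a..<b. h (int k)) = prod_list (map h [a'..b'])"
proof -
  have "(\<Prod>k=a..<b. h (int k)) = prod h (int ` {a..<b})" by (simp add: prod.reindex)
  also have "int ` {a..<b} = set [a'..b']" using assms by (auto simp: image_int_atLeastLessThan)
  also have "prod h \<dots> = prod_list (map h [a'..b'])" by (rule prod.distinct_set_conv_list) simp
  finally show ?thesis .
qed

text \<open>For the rational value \<open>y = b / (2 * c)\<close>, multiplication by
  \<open>(2 * c)\<^sup>2\<close> turns numerator and denominator into integers.\<close>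

lemma mod_ratio_as_quotient:
  assumes "c > 0"
  shows "mod_ratio ((b / (2*c))\<^sup>2) k = ((2 * real k + 1)^2 * c^2 + b^2) / ((2 * real k + 2)^2 * c^2)"
proof -
  have "(2 * real k + 2)^2 * c^2 = (2 * c)^2 * (real k + 1)^2"
    "(2 * real k + 1)^2 * c^2 + b^2 = (2 * c)^2 * ((real k + 1/2)\<^sup>2 + (b / (2*c))\<^sup>2)"
    using assms by (simp_all add: power2_eq_square field_simps)
  then show ?thesis unfolding mod_ratio_def using assms by simp
qed

text \<open>The solution \<open>y\<close> of \<open>mod_prod (y\<^sup>2) m = 1\<close> is at most 9.08 for \<open>m = 59\<close> and at least 9.13 for
  \<open>m = 60\<close>. After clearing denominators these are inequalities between integers.\<close>

lemma mod_prod_59: "mod_prod ((454/(2*25))\<^sup>2) 59 \<ge> 1"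
proof -
  define f g where "f = (\<lambda>k::int. (2 * k + 2)^2 * 25^2)" and "g = (\<lambda>k::int. (2 * k + 1)^2 * 25^2 + 454^2)"
  have "prod_list (map f [59..117]) \<le> prod_list (map g [59..117])"
    unfolding f_def g_def by code_simp
  then have le: "(\<Prod>k=59..<118. f (int k)) \<le> (\<Prod>k=59..<118. g (int k))"
    by (simp only: prod_int_upto[of 59 59 118 117] of_nat_numeral)
  have f: "f k > 0" if "k \<ge> 0" for k using that by (auto simp: f_def)
  have g: "mod_ratio ((454/(2*25))\<^sup>2) k = real_of_int (g (int k)) / real_of_int (f (int k))" for k
    using mod_ratio_as_quotient[of 25 454] by (simp add: f_def g_def)
  have "mod_prod ((454/(2*25))\<^sup>2) 59 = real_of_int (\<Prod>k=59..<118. g (int k)) / real_of_int (\<Prod>k=59..<118. f (int k))"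
    unfolding mod_prod_def g prod_dividef of_int_prod by simp
  moreover have "(\<Prod>k=59..<118. f (int k)) > 0" by (intro prod_pos) (auto intro: f)
  ultimately show ?thesis using le by (simp del: of_int_prod)
qed

lemma mod_prod_60: "mod_prod ((913/(2*50))\<^sup>2) 60 \<le> 1"
proof -
  define f g where "f = (\<lambda>k::int. (2 * k + 2)^2 * 50^2)" and "g = (\<lambda>k::int. (2 * k + 1)^2 * 50^2 + 913^2)"
  have "prod_list (map g [60..119]) \<le> prod_list (map f [60..119])"
    unfolding f_def g_def by code_simp
  then have le: "(\<Prod>k=60..<120. g (int k)) \<le> (\<Prod>k=60..<120. f (int k))"
    by (simp only: prod_int_upto[of 60 60 120 119] of_nat_numeral)
  have f: "f k > 0" if "k \<ge> 0" for k using that by (auto simp: f_def)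
  have g: "mod_ratio ((913/(2*50))\<^sup>2) k = real_of_int (g (int k)) / real_of_int (f (int k))" for k
    using mod_ratio_as_quotient[of 50 913] by (simp add: f_def g_def)
  have "mod_prod ((913/(2*50))\<^sup>2) 60 = real_of_int (\<Prod>k=60..<120. g (int k)) / real_of_int (\<Prod>k=60..<120. f (int k))"
    unfolding mod_prod_def g prod_dividef of_int_prod by simp
  moreover have "(\<Prod>k=60..<120. f (int k)) > 0" by (intro prod_pos) (auto intro: f)
  ultimately show ?thesis using le by (simp del: of_int_prod)
qed

text \<open>Rounds a term of the sum upwards, so that only integers have to be added.\<close>

lemma real_le_div_plus_one:
  fixes n d :: int
  shows "real_of_int n / real_of_int d \<le> real_of_int (n div d + 1)"
  using floor_correct[of "real_of_int n / real_of_int d"] by (simp add: floor_divide_of_int_eq)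

lemma arg_sum_59: "arg_sum (454/(2*25)) 59 < 2 * pi"
proof -
  \<comment> \<open>\<open>h k\<close> is the quintic bound at
    \<open>454 / (25 * (2 * k + 1))\<close>, scaled by a million and rounded up. The 59 roundings
    cost at most 0.00006 of a slack of about 0.016. The linear bound for arctan would give a sum of
    about 6.29 and miss 2 pi.\<close>
  define h where "h = (\<lambda>k::int. (15*454*(25*(2*k+1))^4 - 5*454^3*(25*(2*k+1))^2+3*454^5) * 10^6 div (15*(25*(2*k+1))^5) + 1)"
  have "sum_list (map h [59..117]) < 2 * 3141590"
    unfolding h_def by code_simp
  then have sum: "(\<Sum>k=59..<118. h (int k)) < 2 * 3141590"
    by (simp only: sum_int_upto[of 59 59 118 117] of_nat_numeral)
  have bound: "arctan (454/(2*25) / (real k + 1/2)) \<le> real_of_int (h (int k)) / 10^6" for k :: nat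
  proof -
    have aux: "a / b = a * 10^6 / b / 10^6" for a b :: real by simp
    define A E where "A = (454::real)" and "E = 25 * (2 * real k + 1)"
    have E: "E > 0" by (auto simp: E_def)
    have x: "454/(2*25) / (real k + 1/2) = A / E" unfolding A_def E_def by (simp add: divide_simps)
    have "arctan (A / E) \<le> A / E - (A / E)^3/3 + (A / E)^5/5"
      using E by (intro arctan_le_quintic) (auto simp: A_def)
    also have "\<dots> = (15*A*E^4 - 5*A^3*E^2 + 3*A^5) / (15*E^5)"
      using E by (simp add: field_simps power_divide) (simp add: eval_nat_numeral algebra_simps)
    also have "\<dots> = real_of_int ((15*454*(25*(2*int k+1))^4 - 5*454^3*(25*(2*int k+1))^2+3*454^5) * 10^6) /
       real_of_int (15*(25*(2*int k+1))^5) / 10^6" unfolding A_def E_def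
      by (subst aux) (simp only: of_int_mult of_int_add of_int_diff of_int_power of_int_numeral of_int_of_nat_eq of_int_1)
    also have "\<dots> \<le> real_of_int (h (int k)) / 10^6"
      unfolding h_def by (intro divide_right_mono real_le_div_plus_one) (rule zero_le_power, simp)
    finally show ?thesis unfolding x .
  qed
  have "arg_sum (454/(2*25)) 59 = (\<Sum>k=59..<118. arctan (454/(2*25) / (real k + 1/2)))"
    unfolding arg_sum_def by (intro sum.cong) auto
  also have "\<dots> \<le> (\<Sum>k=59..<118. real_of_int (h (int k)) / 10^6)"
    by (intro sum_mono bound)
  also have "\<dots> = real_of_int (\<Sum>k=59..<118. h (int k)) / 10^6"
    by (simp only: of_int_sum sum_divide_distrib)
  also have "\<dots> < real_of_int (2 * 3141590) / 10^6"
    by (rule divide_strict_right_mono) (simp_all only: of_int_less_iff sum, simp)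
  also have "\<dots> \<le> 2 * pi" using pi_approx by simp
  finally show ?thesis .
qed

lemma arg_sum_60: "arg_sum (913/(2*50)) 60 > 2 * pi"
proof -
  \<comment> \<open>The cubic bound at \<open>913 / (50 * (2 * k + 1))\<close>, scaled by a million.
    A plain \<open>div\<close> rounds down, as a lower estimate requires; accordingly 3.1416 is a
    decimal above pi, whereas 3.14159 in \<open>arg_sum_59\<close> is one below.\<close>
  define h where "h = (\<lambda>k::int. (3*913*(50*(2*k+1))^2 - 913^3) * 10^6 div (3*(50*(2*k+1))^3))"
  have "sum_list (map h [60..119]) > 2 * 3141600"
    unfolding h_def by code_simp
  then have sum: "(\<Sum>k=60..<120. h (int k)) > 2 * 3141600"
    by (simp only: sum_int_upto[of 60 60 120 119] of_nat_numeral)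
  have bound: "arctan (913/(2*50) / (real k + 1/2)) \<ge> real_of_int (h (int k)) / 10^6" for k :: nat
  proof -
    have aux: "a / b = a * 10^6 / b / 10^6" for a b :: real by simp
    define A E where "A = (913::real)" and "E = 50 * (2 * real k + 1)"
    have E: "E > 0" by (auto simp: E_def)
    have x: "913/(2*50) / (real k + 1/2) = A / E" unfolding A_def E_def by (simp add: divide_simps)
    have "real_of_int (h (int k)) / 10^6 \<le> real_of_int ((3*913*(50*(2*int k+1))^2 - 913^3) * 10^6) /
       real_of_int (3*(50*(2*int k+1))^3) / 10^6"
      unfolding h_def by (intro divide_right_mono real_of_int_div4) (rule zero_le_power, simp)
    also have "\<dots> = (3*A*E^2 - A^3) / (3*E^3)" unfolding A_def E_def
      by (subst (2) aux) (simp only: of_int_mult of_int_add of_int_diff of_int_power of_int_numeral of_int_of_nat_eq of_int_1)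
    also have "\<dots> = A / E - (A / E)^3/3"
      using E by (simp add: field_simps power_divide) (simp add: eval_nat_numeral algebra_simps)
    also have "\<dots> \<le> arctan (A / E)"
      using E by (intro arctan_ge_cubic) (auto simp: A_def)
    finally show ?thesis unfolding x .
  qed
  have "2 * pi \<le> real_of_int (2 * 3141600) / 10^6" using pi_approx by simp
  also have "\<dots> < real_of_int (\<Sum>k=60..<120. h (int k)) / 10^6"
    by (rule divide_strict_right_mono) (simp_all only: of_int_less_iff sum, simp)
  also have "\<dots> = (\<Sum>k=60..<120. real_of_int (h (int k)) / 10^6)"
    by (simp only: of_int_sum sum_divide_distrib)
  also have "\<dots> \<le> (\<Sum>k=60..<120. arctan (913/(2*50) / (real k + 1/2)))"
    by (intro sum_mono bound)
  also have "\<dots> = arg_sum (913/(2*50)) 60"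
    unfolding arg_sum_def by (intro sum.cong) auto
  finally show ?thesis .
qed

section \<open>The threshold for the second largest real part\<close>

lemma polar_right_half_plane:
  assumes "a > 0"
  shows "Complex a b = of_real (sqrt (a\<^sup>2 + b\<^sup>2)) * cis (arctan (b / a))"
proof -
  have "Complex a b = rcis (cmod (Complex a b)) (Arg (Complex a b))" by (simp add: rcis_cmod_Arg)
  also have "Arg (Complex a b) = arctan (b / a)" using assms by (simp add: arg_conv_arctan)
  finally show ?thesis by (simp add: rcis_def cmod_def)
qed

text \<open>All factors lie in the right half plane, so each argument is an arctan. The arguments
  are added without reduction, which is essential for comparing their sum with 2 pi.\<close>

lemma prod_polar:
  assumes "x > - real m"
  shows "(\<Prod>k=m..<2*m. Complex x y + of_nat k) =
    of_real (\<Prod>k=m..<2*m. sqrt ((x + real k)\<^sup>2 + y\<^sup>2)) * cis (\<Sum>k=m..<2*m. arctan (y / (x + real k)))"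
proof -
  have cis_sum: "cis (sum f S) = (\<Prod>k\<in>S. cis (f k))" if "finite S" for f and S :: "nat set"
    using that by (induction S) (auto simp flip: cis_mult)
  have "Complex x y + of_nat k = of_real (sqrt ((x + real k)\<^sup>2 + y\<^sup>2)) * cis (arctan (y / (x + real k)))"
    if "k \<in> {m..<2*m}" for k
  proof -
    have "Complex x y + of_nat k = Complex (x + real k) y" by (simp add: complex_eq_iff)
    then show ?thesis using polar_right_half_plane[of "x + real k" y] that assms by auto
  qed
  then have "(\<Prod>k=m..<2*m. Complex x y + of_nat k) =
    (\<Prod>k=m..<2*m. of_real (sqrt ((x + real k)\<^sup>2 + y\<^sup>2)) * cis (arctan (y / (x + real k))))"
    by (intro prod.cong refl) blast
  then show ?thesis by (simp add: prod.distrib cis_sum of_real_prod)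
qed

text \<open>If the real part were at least 1/2, the modulus equation would force the imaginary part
  below 9.08. The arguments would then add up to something strictly between 0 and 2 pi, and the
  product could not be a positive real.\<close>

lemma chi_root_Re_small:
  assumes m: "m \<ge> 1" "m \<le> 59" and z: "poly (chi_poly m) z = 0" "z \<noteq> 1"
  shows "Re z < 1/2"
proof (rule ccontr)
  assume "\<not> Re z < 1/2"
  then have x: "Re z \<ge> 1/2" by simp
  define z' where "z' = (if Im z \<ge> 0 then z else cnj z)"
  define x y where "x = Re z'" and "y = Im z'"
  have z': "poly (chi_poly m) z' = 0" using z chi_root_cnj[OF m(1)] by (auto simp: z'_def)
  have "z' \<noteq> 1" using z by (auto simp: z'_def)
  have x: "x \<ge> 1/2" using x by (auto simp: x_def z'_def)
  have "y \<ge> 0" by (auto simp: y_def z'_def)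
  moreover have "y \<noteq> 0" using chi_root_real[OF m(1) z'] \<open>z' \<noteq> 1\<close> x by (auto simp: x_def y_def)
  ultimately have y: "y > 0" by simp
  have eq: "z' = Complex x y" by (simp add: x_def y_def)
  have pr: "(\<Prod>k=m..<2*m. sqrt ((x + real k)\<^sup>2 + y\<^sup>2)) = (\<Prod>k=m..<2*m. real k + 1)"
    using chi_root_norm[OF m(1) z'] unfolding eq by (simp add: cmod_def)
  define b :: real where "b = 454/(2*25)"
  have "1 \<le> mod_prod (b\<^sup>2) m"
  proof (cases "m \<le> 41")
    case True
    then show ?thesis by (intro mod_prod_ge_1_small) (auto simp: b_def power2_eq_square)
  next
    case False
    then have "mod_prod (b\<^sup>2) 59 \<le> mod_prod (b\<^sup>2) m"
      using m by (intro mod_prod_antimono) (auto simp: b_def power2_eq_square)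
    then show ?thesis using mod_prod_59 unfolding b_def by linarith
  qed
  have "y \<le> b"
  proof (rule ccontr)
    assume "\<not> y \<le> b"
    then have "b\<^sup>2 < y\<^sup>2" by (intro power_strict_mono) (auto simp: b_def)
    have "mod_prod (b\<^sup>2) m < (\<Prod>k=m..<2*m. ((x + real k)\<^sup>2 + y\<^sup>2) / (real k + 1)\<^sup>2)"
      unfolding mod_prod_def mod_ratio_def using x \<open>b\<^sup>2 < y\<^sup>2\<close> m
      by (intro prod_strict_mono conjI divide_strict_right_mono add_le_less_mono power_mono) auto
    also have "\<dots> = (\<Prod>k=m..<2*m. sqrt ((x + real k)\<^sup>2 + y\<^sup>2))\<^sup>2 / (\<Prod>k=m..<2*m. real k + 1)\<^sup>2"
      by (simp add: prod_dividef prod_power_distrib)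
    also have "\<dots> = 1" unfolding pr by (subst divide_self) (auto simp: prod_zero_iff)
    finally show False using \<open>1 \<le> mod_prod (b\<^sup>2) m\<close> by linarith
  qed
  define \<theta> where "\<theta> = (\<Sum>k=m..<2*m. arctan (y / (x + real k)))"
  have "\<theta> > 0" unfolding \<theta>_def using m x y by (intro sum_pos) auto
  \<comment> \<open>Each angle decreases in \<open>x\<close> and increases in \<open>y\<close>, so
    \<open>x = 1/2\<close> and \<open>y = b\<close> is the worst case.\<close>
  have "\<theta> \<le> arg_sum b m"
    unfolding \<theta>_def arg_sum_def using x y \<open>y \<le> b\<close>
    by (intro sum_mono arctan_monotone' frac_le) auto
  also have "\<dots> \<le> arg_sum b 59" using m by (intro arg_sum_mono) (auto simp: b_def)
  also have "\<dots> < 2 * pi" using arg_sum_59 by (simp only: b_def)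
  finally have "\<theta> < 2 * pi" .
  have "of_real (\<Prod>k=m..<2*m. real k + 1) * cis \<theta> = complex_of_real (\<Prod>k=m..<2*m. real k + 1)"
    using prod_polar[of m x y] x z' unfolding chi_root_iff[OF m(1)] eq pr \<theta>_def by simp
  moreover have "complex_of_real (\<Prod>k=m..<2*m. real k + 1) \<noteq> 0"
    by (simp only: of_real_eq_0_iff) (auto simp: prod_zero_iff)
  ultimately have "cis \<theta> = 1" by (metis mult_cancel_left1)
  then have "cos \<theta> = 1" by (simp add: complex_eq_iff)
  then consider n :: nat where "\<theta> = real n * 2 * pi" | n :: nat where "\<theta> = - (real n * 2 * pi)"
    unfolding cos_one_2pi by blast
  then show False
  proof cases
    case 1
    have "n = 0 \<or> real n \<ge> 1" by auto
    then show False using \<open>\<theta> > 0\<close> \<open>\<theta> < 2 * pi\<close> 1 mult_right_mono[of 1 "real n" pi] by auto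
  next
    case 2
    have "real n * 2 * pi \<ge> 0" by simp
    then show False using \<open>\<theta> > 0\<close> 2 by linarith
  qed
qed

text \<open>The graph of \<open>Y\<close> is a level set of \<open>F\<close>, hence closed, and a
  map into a compact set with closed graph is continuous. No derivative of \<open>F\<close> is
  involved.\<close>

lemma continuous_on_implicit:
  fixes F :: "real \<times> real \<Rightarrow> real"
  assumes "compact S" "compact K" "continuous_on (S \<times> K) F"
    and Y: "\<And>x. x \<in> S \<Longrightarrow> Y x \<in> K \<and> F (x, Y x) = c"
    and u: "\<And>x y. x \<in> S \<Longrightarrow> y \<in> K \<Longrightarrow> F (x, y) = c \<Longrightarrow> y = Y x"
  shows "continuous_on S Y"
proof (rule continuous_from_closed_graph[OF assms(2)])
  have "(\<lambda>x. (x, Y x)) ` S = (S \<times> K) \<inter> F -` {c}" using Y by (auto dest: u)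
  moreover have "closed ((S \<times> K) \<inter> F -` {c})"
    using assms by (intro continuous_closed_preimage) (auto intro: compact_imp_closed compact_Times)
  ultimately show "closed ((\<lambda>x. (x, Y x)) ` S)" by simp
qed (use Y in auto)

text \<open>Follow the curve on which the product of the \<open>z + k\<close> has modulus \<open>(2m)! / m!\<close>, from real part 1/2 to
  the root 1. Its argument runs from a value above \<open>2 * pi\<close> to 0, so it is \<open>2 * pi\<close> at some point.\<close>

lemma chi_root_Re_large:
  assumes m: "m \<ge> 60"
  shows "\<exists>z. poly (chi_poly m) z = 0 \<and> z \<noteq> 1 \<and> Re z > 1/2"
proof -
  \<comment> \<open>At height \<open>2 * m\<close> every factor has modulus at least
    \<open>k + 1\<close> (\<open>FB\<close>), so the curve stays inside the strip
    \<open>K\<close>.\<close>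
  define S K where "S = {1/2..1::real}" and "K = {0..2 * real m}"
  define F where "F = (\<lambda>(x::real, y::real). \<Prod>k=m..<2*m. sqrt ((x + real k)\<^sup>2 + y\<^sup>2))"
  define C where "C = (\<Prod>k=m..<2*m. real k + 1)"
  have contF: "continuous_on A F" for A
    unfolding F_def case_prod_beta by (intro continuous_intros)
  have mono: "F (x, y) < F (x, y')" if "x \<in> S" "0 \<le> y" "y < y'" for x y y'
    unfolding F_def prod.case using that m power_strict_mono[of y y' 2]
    by (intro prod_strict_mono) (auto simp: S_def)
  have F0: "F (x, 0) \<le> C" if "x \<in> S" for x
    unfolding F_def C_def using that by (auto intro!: prod_mono simp: S_def)
  have FB: "C \<le> F (x, 2 * real m)" for x
    unfolding F_def C_def prod.case
  proof (intro prod_mono conjI)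
    fix k assume "k \<in> {m..<2*m}"
    then have "(real k + 1)\<^sup>2 \<le> (2 * real m)\<^sup>2" by (intro power_mono) auto
    then have "sqrt ((real k + 1)\<^sup>2) \<le> sqrt ((x + real k)\<^sup>2 + (2 * real m)\<^sup>2)"
      by (intro real_sqrt_le_mono) (smt (verit) zero_le_power2)
    then show "real k + 1 \<le> sqrt ((x + real k)\<^sup>2 + (2 * real m)\<^sup>2)" by simp
  qed auto
  have "\<exists>y\<in>K. F (x, y) = C" if "x \<in> S" for x
  proof -
    have "continuous_on {0..2 * real m} (\<lambda>y. F (x, y))"
      by (rule continuous_on_compose2[OF contF[of UNIV]]) (auto intro!: continuous_intros)
    with IVT'[of "\<lambda>y. F (x, y)" 0 C "2 * real m", OF F0[OF that] FB[of x]]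
    obtain y where "0 \<le> y" "y \<le> 2 * real m" "F (x, y) = C" by auto
    then show ?thesis unfolding K_def by (intro bexI[of _ y]) simp_all
  qed
  then have "\<forall>x\<in>S. \<exists>y. y \<in> K \<and> F (x, y) = C" by blast
  from bchoice[OF this] obtain Y where Y: "\<And>x. x \<in> S \<Longrightarrow> Y x \<in> K \<and> F (x, Y x) = C" by blast
  have uniq: "y = Y x" if "x \<in> S" "y \<in> K" "F (x, y) = C" for x y
  proof -
    have "0 \<le> y" "0 \<le> Y x" "F (x, Y x) = C" using Y[OF that(1)] that(2) unfolding K_def by simp_all
    then show ?thesis using mono[OF that(1), of y "Y x"] mono[OF that(1), of "Y x" y] that(3)
      by (cases y "Y x" rule: linorder_cases) simp_all
  qed
  have contY: "continuous_on S Y"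
    by (rule continuous_on_implicit[of S K F Y C]) (use Y uniq contF in \<open>simp_all add: S_def K_def\<close>)
  define \<Theta> where "\<Theta> = (\<lambda>x. \<Sum>k=m..<2*m. arctan (Y x / (x + real k)))"
  have cont\<Theta>: "continuous_on S \<Theta>"
    unfolding \<Theta>_def using m by (intro continuous_intros contY) (auto simp: S_def)
  have "Y 1 = 0"
  proof -
    have "F (1, 0) = C" unfolding F_def C_def by (auto intro!: prod.cong)
    then show ?thesis using uniq[of 1 0] by (auto simp: S_def K_def)
  qed
  then have \<Theta>1: "\<Theta> 1 = 0" by (simp add: \<Theta>_def)
  define b :: real where "b = 913/(2*50)"
  \<comment> \<open>This is \<open>mod_prod (b\<^sup>2) m \<le> 1\<close> in disguise. As
    \<open>F\<close> increases with height, the curve passes above 9.13 at real part 1/2.\<close>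
  have "F (1/2, b) \<le> C"
  proof -
    have "mod_prod (b\<^sup>2) m \<le> mod_prod (b\<^sup>2) 60"
      using m by (intro mod_prod_antimono) (auto simp: b_def power2_eq_square)
    also have "\<dots> \<le> 1" using mod_prod_60 by (simp only: b_def)
    also have "mod_prod (b\<^sup>2) m = (F (1/2, b) / C)\<^sup>2"
      unfolding mod_prod_def mod_ratio_def F_def C_def
      by (simp add: prod_dividef prod_power_distrib power_divide add.commute)
    finally have "\<bar>F (1/2, b) / C\<bar> \<le> 1" by (simp only: abs_square_le_1)
    then have "F (1/2, b) / C \<le> 1" by linarith
    moreover have "C > 0" unfolding C_def by (intro prod_pos) auto
    ultimately show ?thesis by simp
  qed
  then have Yb: "b \<le> Y (1/2)"
  proof -
    have half: "1/2 \<in> S" by (simp add: S_def)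
    have "0 \<le> Y (1/2)" "F (1/2, Y (1/2)) = C" using Y[OF half] unfolding K_def by simp_all
    then show ?thesis using mono[OF half, of "Y (1/2)" b] \<open>F (1/2, b) \<le> C\<close> by linarith
  qed
  have "2 * pi < arg_sum b 60" using arg_sum_60 by (simp only: b_def)
  also have "\<dots> \<le> arg_sum b m" using m by (intro arg_sum_mono) (auto simp: b_def)
  also have "\<dots> \<le> \<Theta> (1/2)"
    unfolding \<Theta>_def arg_sum_def using Yb
    by (intro sum_mono arctan_monotone') (auto intro!: divide_right_mono simp: add.commute)
  finally have \<Theta>2: "2 * pi < \<Theta> (1/2)" .
  obtain x where x: "1/2 \<le> x" "x \<le> 1" "\<Theta> x = 2 * pi"
    using IVT2'[of \<Theta> 1 "2*pi" "1/2"] \<Theta>1 \<Theta>2 cont\<Theta> by (auto simp: S_def)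
  define z where "z = Complex x (Y x)"
  have xS: "x \<in> S" using x by (simp add: S_def)
  have "(\<Prod>k=m..<2*m. z + of_nat k) = of_real (F (x, Y x)) * cis (\<Theta> x)"
    unfolding z_def F_def \<Theta>_def prod.case using x by (intro prod_polar) auto
  also have "\<dots> = of_real C" using Y[OF xS] x by (simp add: complex_eq_iff)
  finally have "poly (chi_poly m) z = 0" using m unfolding chi_root_iff[OF order_trans[OF _ m], simplified] C_def by simp
  moreover have "x \<noteq> 1" using x \<Theta>1 by auto
  moreover have "x \<noteq> 1/2" using x \<Theta>2 by (metis less_irrefl)
  moreover have "z \<noteq> 1" using \<open>x \<noteq> 1\<close> by (auto simp: z_def complex_eq_iff)
  ultimately show ?thesis using x by (intro exI[of _ z]) (auto simp: z_def)
qed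

text \<open>\<open>sigma2\<close> deletes the largest value from the set of real parts, whereas here
  the root 1 is deleted from the set of roots. Both give the same because no other root has real
  part at least 1.\<close>

lemma sigma2_Max:
  assumes m: "m \<ge> 2"
  shows "sigma2 m = Max (Re ` ({z. poly (chi_poly m) z = 0} - {1}))"
    and "finite ({z. poly (chi_poly m) z = 0} - {1})"
    and "{z. poly (chi_poly m) z = 0} - {1} \<noteq> {}"
proof -
  let ?R = "{z. poly (chi_poly m) z = 0}"
  have m1: "m \<ge> 1" using m by simp
  have fin: "finite ?R" using chi_poly_nonzero[OF m1] by (rule poly_roots_finite)
  then show "finite (?R - {1})" by simp
  have one: "1 \<in> ?R" using chi_root_one[OF m1] by simp
  have "card (?R - {1}) = m - 1" using card_chi_roots[OF m1] one fin by simp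
  then show "?R - {1} \<noteq> {}" using m by (metis card.empty diff_is_0_eq not_less_eq_eq numeral_2_eq_2 One_nat_def)
  have "Max (Re ` ?R) = 1"
  proof (rule Max_eqI)
    show "1 \<in> Re ` ?R" using one by (metis image_eqI one_complex.sel(1))
  next
    fix y assume "y \<in> Re ` ?R"
    then show "y \<le> 1" using chi_root_Re_ge_1[OF m1] by fastforce
  qed (use fin in auto)
  moreover have "Re ` ?R - {1} = Re ` (?R - {1})" using chi_root_Re_ge_1[OF m1] by fastforce
  ultimately show "sigma2 m = Max (Re ` (?R - {1}))" by (simp add: sigma2_def Let_def)
qed

lemma sigma2_attained:
  assumes "m \<ge> 2"
  obtains z where "poly (chi_poly m) z = 0" "z \<noteq> 1" "Re z = sigma2 m"
proof -
  have "sigma2 m \<in> Re ` ({z. poly (chi_poly m) z = 0} - {1})"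
    unfolding sigma2_Max(1)[OF assms] using sigma2_Max(2,3)[OF assms] by (intro Max_in) auto
  then obtain z where "z \<in> {z. poly (chi_poly m) z = 0} - {1}" "sigma2 m = Re z" by blast
  then show ?thesis using that[of z] by simp
qed

lemma Re_le_sigma2:
  assumes "m \<ge> 2" "poly (chi_poly m) z = 0" "z \<noteq> 1"
  shows "Re z \<le> sigma2 m"
  unfolding sigma2_Max(1)[OF assms(1)] using sigma2_Max(2)[OF assms(1)] assms(2,3) by (intro Max_ge) auto

lemma sigma2_less_1:
  assumes "m \<ge> 2" shows "sigma2 m < 1"
  using sigma2_attained[OF assms] chi_root_Re_ge_1[of m] assms
  by (metis not_le one_le_numeral order_trans)

lemma sigma2_large:
  assumes "m \<ge> 60" shows "sigma2 m > 1/2"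
proof -
  obtain z where "poly (chi_poly m) z = 0" "z \<noteq> 1" "Re z > 1/2" using chi_root_Re_large[OF assms] by blast
  then show ?thesis using Re_le_sigma2[of m z] assms by linarith
qed

text \<open>The definite description is legitimate: a root with real part \<open>sigma2\<close>
  cannot be real, since 1 is the only real root above \<open>-m\<close>, and equal real parts leave
  only a conjugate pair.\<close>

lemma lambda2_props:
  assumes m: "m \<ge> 60"
  shows "poly (chi_poly m) (lambda2 m) = 0" "Re (lambda2 m) = sigma2 m" "Im (lambda2 m) > 0"
proof -
  have m1: "m \<ge> 1" "m \<ge> 2" using m by auto
  obtain z where z: "poly (chi_poly m) z = 0" "z \<noteq> 1" "Re z = sigma2 m" using sigma2_attained[OF m1(2)] .
  have im: "Im z \<noteq> 0" using chi_root_real[OF m1(1) z(1)] z sigma2_large[OF m] by auto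
  define w where "w = (if Im z > 0 then z else cnj z)"
  have w: "poly (chi_poly m) w = 0" "Re w = sigma2 m" "Im w > 0"
    using z im chi_root_cnj[OF m1(1)] by (auto simp: w_def)
  have "\<exists>!z. poly (chi_poly m) z = 0 \<and> Re z = sigma2 m \<and> Im z > 0"
  proof (rule ex1I[of _ w])
    fix v assume v: "poly (chi_poly m) v = 0 \<and> Re v = sigma2 m \<and> 0 < Im v"
    then show "v = w" using chi_root_same_Re[OF m1(1) w(1), of v] w by auto
  qed (use w in auto)
  from theI'[OF this] show "poly (chi_poly m) (lambda2 m) = 0" "Re (lambda2 m) = sigma2 m" "Im (lambda2 m) > 0"
    by (auto simp: lambda2_def)
qed

lemma Re_less_sigma2:
  assumes m: "m \<ge> 60" and z: "poly (chi_poly m) z = 0" "z \<noteq> 1" "z \<noteq> lambda2 m" "z \<noteq> cnj (lambda2 m)"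
  shows "Re z < sigma2 m"
proof -
  have "Re z \<noteq> sigma2 m"
    using chi_root_same_Re[OF _ lambda2_props(1)[OF m] z(1)] m z lambda2_props(2)[OF m] by auto
  then show ?thesis using Re_le_sigma2[of m z] m z by force
qed

section \<open>Eigenforms of the replacement matrix\<close>

lemma idx_bij: "bij_betw idx (UNIV::'m::{finite,linorder} set) {1..CARD('m)}"
proof -
  have inj: "inj (idx :: 'm \<Rightarrow> nat)"
  proof (rule injI)
    fix i j :: 'm assume eq: "idx i = idx j"
    have "\<not> i < j" if "idx i = idx j" for i j :: 'm
    proof
      assume "i < j"
      then have "{k. k \<le> i} \<subseteq> {k. k \<le> j}" "j \<in> {k. k \<le> j} - {k. k \<le> i}" by auto
      then have "{k. k \<le> i} \<subset> {k. k \<le> j}" by blast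
      then have "idx i < idx j" unfolding idx_def by (intro psubset_card_mono) auto
      with that show False by simp
    qed
    from this[OF eq] this[OF eq[symmetric]] show "i = j" by simp
  qed
  have "idx i \<in> {1..CARD('m)}" for i :: 'm
  proof -
    have "card {i} \<le> idx i" unfolding idx_def by (intro card_mono) auto
    moreover have "idx i \<le> CARD('m)" unfolding idx_def by (intro card_mono) auto
    ultimately show ?thesis by simp
  qed
  then have sub: "range (idx :: 'm \<Rightarrow> nat) \<subseteq> {1..CARD('m)}" by auto
  have "card (range (idx :: 'm \<Rightarrow> nat)) = CARD('m)" by (rule card_image[OF inj])
  then have "range (idx :: 'm \<Rightarrow> nat) = {1..CARD('m)}" using sub by (intro card_subset_eq) auto
  then show ?thesis using inj by (simp add: bij_betw_def)
qed

lemma idx_ge_1: "idx (i::'m::{finite,linorder}) \<ge> 1"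
  using bij_betwE[OF idx_bij, THEN bspec, of i] by auto

lemma idx_le:
  fixes i :: "'m::{finite,linorder}"
  shows "idx i \<le> CARD('m)"
  using bij_betwE[OF idx_bij, THEN bspec, of i] by auto

lemma idx_eq_iff [simp]:
  fixes i j :: "'m::{finite,linorder}"
  shows "idx i = idx j \<longleftrightarrow> i = j"
  using idx_bij[where ?'m='m] by (auto simp: bij_betw_def inj_def)

lemma sum_idx: "(\<Sum>i\<in>(UNIV::'m::{finite,linorder} set). f (idx i)) = (\<Sum>k=1..CARD('m). f k)"
  by (rule sum.reindex_bij_betw[OF idx_bij])

definition u_coeff :: "nat \<Rightarrow> complex \<Rightarrow> nat \<Rightarrow> complex" where
  "u_coeff m l k = (\<Prod>j\<in>{0..<k - 1}. (l + of_nat (m + j)) / of_nat (1 + m + j))"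

lemma u_form_eq: "u_form l (x::real^'m::{finite,linorder}) = (\<Sum>i\<in>UNIV. u_coeff CARD('m) l (idx i) * of_real (x $ i))"
  by (simp add: u_form_def u_coeff_def)

lemma u_form_add: "u_form l (x + y) = u_form l x + u_form l y"
  by (simp add: u_form_eq algebra_simps sum.distrib)

lemma u_coeff_one: "u_coeff m 1 k = 1"
proof -
  have "(1 + of_nat (m + j)) / of_nat (1 + m + j) = (1::complex)" for j
  proof -
    have "(1 + of_nat (m + j)) = (of_nat (Suc (m + j)) :: complex)" by simp
    then show ?thesis using of_nat_neq_0[where 'a=complex, of "m + j"] by simp
  qed
  then show ?thesis unfolding u_coeff_def by (intro prod.neutral) blast
qed

lemma u_form_one: "u_form 1 x = of_real (coord_sum x)"
  by (simp add: u_form_eq u_coeff_one coord_sum_def)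

lemma u_form_cnj: "u_form (cnj l) x = cnj (u_form l x)"
  by (simp add: u_form_eq u_coeff_def)

lemma u_coeff_Suc: "k \<ge> 1 \<Longrightarrow> u_coeff m l (Suc k) = u_coeff m l k * ((l + of_nat (m + k - 1)) / of_nat (m + k))"
  unfolding u_coeff_def by (cases k) auto

lemma R_mat_row_sum:
  fixes i :: "'m::{finite,linorder}" and f :: "nat \<Rightarrow> complex"
  assumes m: "CARD('m) \<ge> 2"
  shows "(\<Sum>j\<in>UNIV. f (idx j) * of_real (row i R_mat $ j)) =
    (if idx i < CARD('m) then of_nat (CARD('m) + idx i) * f (idx i + 1) else of_nat (2 * CARD('m)) * f 1)
      - of_nat (CARD('m) + idx i - 1) * f (idx i)"
proof -
  define g where "g = (\<lambda>k. f k * of_real (if k = idx i then - real (CARD('m) + idx i - 1)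
     else if k = idx i + 1 then real (CARD('m) + idx i)
     else if idx i = CARD('m) \<and> k = 1 then real (2 * CARD('m)) else 0))"
  \<comment> \<open>The column of the positive entry, that is, the cyclic successor of the row
    index. It differs from the row index because there are at least two types.\<close>
  define k' where "k' = (if idx i < CARD('m) then idx i + 1 else 1)"
  have k': "k' \<in> {1..CARD('m)}" "k' \<noteq> idx i" "idx i \<in> {1..CARD('m)}"
    using m idx_ge_1[of i] idx_le[of i] by (auto simp: k'_def)
  have "(\<Sum>j\<in>UNIV. f (idx j) * of_real (row i R_mat $ j)) = (\<Sum>j\<in>UNIV. g (idx (j::'m)))"
    by (intro sum.cong) (auto simp: g_def R_mat_def row_def)
  also have "\<dots> = (\<Sum>k=1..CARD('m). g k)" by (rule sum_idx)
  also have "\<dots> = (\<Sum>k\<in>{idx i, k'}. g k)"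
    using k' by (intro sum.mono_neutral_right) (auto simp: g_def k'_def split: if_splits)
  also have "\<dots> = g (idx i) + g k'" using k' by simp
  finally show ?thesis using k' m by (auto simp: g_def k'_def algebra_simps)
qed

text \<open>The coefficients of \<open>u_form l\<close> form a right eigenvector of
  \<open>R_mat\<close>. The rows before the last one are just the recursion
  \<open>u_coeff_Suc\<close>; the last row closes the cycle by the characteristic equation.\<close>

lemma u_form_row:
  fixes i :: "'m::{finite,linorder}"
  assumes m: "CARD('m) \<ge> 2" and l: "poly (chi_poly CARD('m)) l = 0"
  shows "u_form l (row i R_mat) = l * u_coeff CARD('m) l (idx i)"
proof -
  let ?m = "CARD('m)" and ?k = "idx i"
  have k: "?k \<ge> 1" "?k \<le> ?m" by (rule idx_ge_1 idx_le)+
  have m1: "?m \<ge> 1" using m by simp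
  show ?thesis
  proof (cases "?k < ?m")
    case True
    have "of_nat (?m + ?k) * u_coeff ?m l (?k + 1) = u_coeff ?m l ?k * (l + of_nat (?m + ?k - 1))"
    proof -
      have "of_nat (?m + ?k) \<noteq> (0::complex)" using k by (simp only: of_nat_eq_0_iff)
      then show ?thesis using u_coeff_Suc[OF k(1), of ?m l] by (simp del: of_nat_add)
    qed
    then show ?thesis using True unfolding u_form_eq R_mat_row_sum[OF m] by (simp add: algebra_simps)
  next
    case False
    then have km: "?k = ?m" using k by simp
    have shift: "(\<Prod>k=?m..<2*?m. f k) = (\<Prod>j\<in>{0..<?m}. f (?m + j))" for f :: "nat \<Rightarrow> complex"
      using prod.shift_bounds_nat_ivl[of f 0 ?m ?m] by (simp add: mult_2 add.commute)
    \<comment> \<open>The characteristic equation: continued to index \<open>m + 1\<close>, the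
      recursion returns to the value 1 that it has at index 1.\<close>
    have "u_coeff ?m l (Suc ?m) = 1"
    proof -
      have "(\<Prod>j\<in>{0..<?m}. l + of_nat (?m + j)) = (\<Prod>j\<in>{0..<?m}. of_nat (1 + ?m + j))"
        using l unfolding chi_root_iff[OF m1] of_real_prod shift by (simp add: add_ac)
      moreover have "(\<Prod>j\<in>{0..<?m}. of_nat (1 + ?m + j) :: complex) \<noteq> 0"
        by (subst prod_zero_iff) (auto simp del: of_nat_add of_nat_Suc)
      ultimately show ?thesis unfolding u_coeff_def prod_dividef by simp
    qed
    then have "u_coeff ?m l ?m * ((l + of_nat (?m + ?m - 1)) / of_nat (?m + ?m)) = 1"
      using u_coeff_Suc[OF m1, of ?m l] by (simp only:)
    moreover have "of_nat (?m + ?m) \<noteq> (0::complex)" using m1 by (simp only: of_nat_eq_0_iff)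
    ultimately have "u_coeff ?m l ?m * (l + of_nat (2 * ?m - 1)) = of_nat (2 * ?m)"
      unfolding mult_2 by (metis div_by_1 divide_divide_eq_right eq_divide_eq_1 mult_1 nonzero_eq_divide_eq times_divide_eq_right)
    moreover have "u_coeff ?m l 1 = 1" by (simp add: u_coeff_def)
    ultimately have "of_nat (2 * ?m) * u_coeff ?m l 1 - of_nat (?m + ?m - 1) * u_coeff ?m l ?m = l * u_coeff ?m l ?m"
      unfolding mult_2 by (metis add_diff_cancel_right' distrib_left mult.commute mult.right_neutral)
    then show ?thesis unfolding u_form_eq R_mat_row_sum[OF m] km by (simp only: less_irrefl if_False)
  qed
qed

text \<open>The eigenvalue equation for the root 1, whose form is the coordinate sum. It expresses
  that the urn is balanced.\<close>

lemma coord_sum_row: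
  fixes i :: "'m::{finite,linorder}"
  assumes m: "CARD('m) \<ge> 2"
  shows "coord_sum (row i (R_mat :: real^'m::{finite,linorder}^'m::{finite,linorder})) = 1"
proof -
  have "of_real (coord_sum (row i (R_mat :: real^'m::{finite,linorder}^'m::{finite,linorder}))) = (1::complex)"
    using u_form_row[OF m chi_root_one, of i] m unfolding u_form_one by (simp add: u_coeff_one)
  then show ?thesis by (simp only: of_real_eq_1_iff)
qed

text \<open>The difference of consecutive values is \<open>l - l'\<close> times the products in \<open>u_v_product\<close> (up to the factor
  \<open>H_fun\<close>), so the sum of these products telescopes.\<close>

definition biorth_aux :: "nat \<Rightarrow> complex \<Rightarrow> complex \<Rightarrow> nat \<Rightarrow> complex" where
  "biorth_aux m l l' n = (\<Prod>j<n. (l + of_nat (m + j)) / (l' + of_nat (m + j)))"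

text \<open>Identifies the normalising constant of \<open>v_vec\<close> with the logarithmic
  derivative of the product, which is non-zero by \<open>chi_root_simple\<close>.\<close>

lemma H_fun_eq: "m \<ge> 1 \<Longrightarrow> H_fun m (of_nat m + l - 1) = (\<Sum>k=m..<2*m. 1 / (l + of_nat k :: complex))"
proof -
  assume m: "m \<ge> 1"
  have "H_fun m (of_nat m + l - 1) = (\<Sum>k=1..m. 1 / (l + of_nat (m + k - 1)))"
    unfolding H_fun_def using m by (intro sum.cong refl) (auto simp: of_nat_diff algebra_simps)
  also have "\<dots> = (\<Sum>k=m..<2*m. 1 / (l + of_nat k))"
    by (rule sum.reindex_bij_witness[of _ "\<lambda>k. k + 1 - m" "\<lambda>k. m + k - 1"]) (use m in auto)
  finally show ?thesis .
qed

text \<open>The factors \<open>m + j\<close> of the two products cancel, and only the quotients in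
  \<open>biorth_aux\<close> remain.\<close>

lemma u_v_product:
  assumes m: "m \<ge> 1" and k: "k \<ge> 1" "k \<le> m" and l': "poly (chi_poly m) l' = 0"
  shows "u_coeff m l k * (1 / ((of_nat m + l') * H_fun m (of_nat m + l' - 1))
       * (\<Prod>j\<in>{1..<k}. of_nat (m + j) / (of_nat (m + j) + l')))
     = biorth_aux m l l' (k - 1) / (l' + of_nat (m + (k - 1))) / H_fun m (of_nat m + l' - 1)"
proof -
  define h where "h = H_fun m (of_nat m + l' - 1)"
  have "u_coeff m l k * (1 / ((of_nat m + l') * h) * (\<Prod>j\<in>{1..<k}. of_nat (m + j) / (of_nat (m + j) + l')))
     = biorth_aux m l l' (k - 1) / (l' + of_nat (m + (k - 1))) / h" using k
  proof (induction k rule: nat_induct_at_least)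
    case base
    then show ?case by (simp add: u_coeff_def biorth_aux_def add.commute)
  next
    case (Suc k)
    define p where "p = (\<Prod>j\<in>{1..<k}. of_nat (m + j) / (of_nat (m + j) + l'))"
    define b where "b = biorth_aux m l l' (k - 1)"
    have IH: "u_coeff m l k * (1 / ((of_nat m + l') * h) * p) = b / (l' + of_nat (m + (k - 1))) / h"
      using Suc unfolding p_def b_def by simp
    have p: "(\<Prod>j\<in>{1..<Suc k}. of_nat (m + j) / (of_nat (m + j) + l')) = p * (of_nat (m + k) / (of_nat (m + k) + l'))"
      using Suc.hyps unfolding p_def by (subst prod.atLeastLessThan_Suc) auto
    have b: "biorth_aux m l l' (Suc k - 1) = b * ((l + of_nat (m + (k - 1))) / (l' + of_nat (m + (k - 1))))"
      unfolding b_def biorth_aux_def using Suc.hyps by (cases k) auto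
    have "u_coeff m l (Suc k) * (1 / ((of_nat m + l') * h) * (p * (of_nat (m + k) / (of_nat (m + k) + l'))))
       = (u_coeff m l k * (1 / ((of_nat m + l') * h) * p)) * ((l + of_nat (m + (k - 1))) / (of_nat (m + k) + l'))"
      unfolding u_coeff_Suc[OF Suc.hyps] using Suc.hyps by (simp add: Suc_diff_le flip: of_nat_add)
    also have "\<dots> = biorth_aux m l l' (Suc k - 1) / (l' + of_nat (m + (Suc k - 1))) / h"
      unfolding IH b by (simp add: add.commute mult_ac)
    finally show ?case unfolding p .
  qed
  then show ?thesis by (simp add: h_def)
qed

text \<open>For \<open>l = l'\<close> all quotients are 1 and the sum is the normalising constant.
  Otherwise the sum telescopes between two equal values, because the full product over
  \<open>k\<close> is the same number at every root.\<close>

lemma u_v_biorthogonal: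
  assumes m: "CARD('m::{finite,linorder}) \<ge> 2" and l: "poly (chi_poly CARD('m::{finite,linorder})) l = 0"
    and l': "poly (chi_poly CARD('m::{finite,linorder})) l' = 0"
  shows "(\<Sum>i\<in>(UNIV::'m::{finite,linorder} set). u_coeff CARD('m::{finite,linorder}) l (idx i) * (v_vec l' :: complex^'m::{finite,linorder}) $ i) = (if l = l' then 1 else 0)"
proof -
  let ?m = "CARD('m)"
  define h where "h = H_fun ?m (of_nat ?m + l' - 1)"
  have m1: "?m \<ge> 1" using m by simp
  have h: "h \<noteq> 0" "h = (\<Sum>k=?m..<2*?m. 1 / (l' + of_nat k))"
    using chi_root_simple[OF m1 l'] by (simp_all add: h_def H_fun_eq[OF m1])
  have nz: "l' + of_nat (?m + j) \<noteq> 0" if "j < ?m" for j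
    using chi_root_nonpole[OF m1 l', of "?m + j"] that by auto
  have shift: "(\<Sum>k=?m..<2*?m. f k) = (\<Sum>j<?m. f (?m + j))" for f :: "nat \<Rightarrow> complex"
    using sum.shift_bounds_nat_ivl[of f 0 ?m ?m] by (simp add: mult_2 add.commute atLeast0LessThan)
  have shiftp: "(\<Prod>k=?m..<2*?m. f k) = (\<Prod>j<?m. f (?m + j))" for f :: "nat \<Rightarrow> complex"
    using prod.shift_bounds_nat_ivl[of f 0 ?m ?m] by (simp add: mult_2 add.commute atLeast0LessThan)
  have "(\<Sum>i\<in>UNIV. u_coeff ?m l (idx i) * (v_vec l' :: complex^'m::{finite,linorder}) $ i) =
     (\<Sum>i\<in>(UNIV::'m set). biorth_aux ?m l l' (idx i - 1) / (l' + of_nat (?m + (idx i - 1))) / h)"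
    unfolding v_vec_def h_def vec_lambda_beta
    by (intro sum.cong refl u_v_product m1 idx_ge_1 idx_le l')
  also have "\<dots> = (\<Sum>k=1..?m. biorth_aux ?m l l' (k - 1) / (l' + of_nat (?m + (k - 1))) / h)"
    by (rule sum_idx)
  also have "\<dots> = (\<Sum>j<?m. biorth_aux ?m l l' j / (l' + of_nat (?m + j))) / h"
    unfolding sum_divide_distrib
    by (rule sum.reindex_bij_witness[of _ Suc "\<lambda>k. k - 1"]) auto
  also have "\<dots> = (if l = l' then 1 else 0)"
  proof (cases "l = l'")
    case True
    have "biorth_aux ?m l l' j = 1" if "j < ?m" for j
      unfolding biorth_aux_def True using nz that by (intro prod.neutral) auto
    then have "(\<Sum>j<?m. biorth_aux ?m l l' j / (l' + of_nat (?m + j))) = h"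
      unfolding h(2) shift by (intro sum.cong) auto
    then show ?thesis using h True by simp
  next
    case False
    have step: "biorth_aux ?m l l' (Suc j) - biorth_aux ?m l l' j = (l - l') * (biorth_aux ?m l l' j / (l' + of_nat (?m + j)))"
      if "j < ?m" for j
      using nz[OF that] unfolding biorth_aux_def by (simp add: field_simps)
    have "(l - l') * (\<Sum>j<?m. biorth_aux ?m l l' j / (l' + of_nat (?m + j)))
        = (\<Sum>j<?m. biorth_aux ?m l l' (Suc j) - biorth_aux ?m l l' j)"
      unfolding sum_distrib_left using step by (intro sum.cong) auto
    also have "\<dots> = biorth_aux ?m l l' ?m - biorth_aux ?m l l' 0" by (rule sum_lessThan_telescope)
    also have "biorth_aux ?m l l' ?m = 1"
    proof -
      have "(\<Prod>j<?m. l + of_nat (?m + j)) = (\<Prod>j<?m. l' + of_nat (?m + j))"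
        using l l' unfolding chi_root_iff[OF m1] shiftp by (simp only:)
      moreover have "(\<Prod>j<?m. l' + of_nat (?m + j)) \<noteq> 0" using nz by (subst prod_zero_iff) auto
      ultimately show ?thesis unfolding biorth_aux_def prod_dividef by simp
    qed
    finally show ?thesis using False by (simp add: biorth_aux_def)
  qed
  finally show ?thesis .
qed

text \<open>There are as many roots as coordinates, so the forms and the dual vectors give square
  matrices. Biorthogonality says that one is a left inverse of the other; read as a right inverse it
  is the expansion of \<open>x\<close>.\<close>

lemma spectral_decomposition:
  fixes x :: "real^'m::{finite,linorder}"
  assumes m: "CARD('m) \<ge> 2"
  shows "of_real (x $ i) = (\<Sum>l | poly (chi_poly CARD('m)) l = 0. u_form l x * v_vec l $ i)"
proof -
  let ?m = "CARD('m)" and ?R = "{l. poly (chi_poly CARD('m)) l = 0}"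
  have m1: "?m \<ge> 1" using m by simp
  have "card ?R = card (UNIV :: 'm set)" by (rule card_chi_roots[OF m1])
  moreover have "finite ?R" using chi_poly_nonzero[OF m1] by (rule poly_roots_finite)
  ultimately obtain \<phi> :: "'m \<Rightarrow> complex" where \<phi>: "bij_betw \<phi> UNIV ?R"
    by (metis finite_same_card_bij finite)
  define A :: "complex^'m::{finite,linorder}^'m::{finite,linorder}" where "A = (\<chi> j i. u_coeff ?m (\<phi> j) (idx i))"
  define B :: "complex^'m::{finite,linorder}^'m::{finite,linorder}" where "B = (\<chi> i j. v_vec (\<phi> j) $ i)"
  have root: "poly (chi_poly ?m) (\<phi> j) = 0" for j using bij_betwE[OF \<phi>] by auto
  have inj: "\<phi> j = \<phi> k \<longleftrightarrow> j = k" for j k using \<phi> by (auto simp: bij_betw_def inj_def)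
  have "A ** B = mat 1"
    unfolding A_def B_def matrix_matrix_mult_def mat_def
    using u_v_biorthogonal[OF m root root] by (simp add: vec_eq_iff inj)
  then have "B ** A = mat 1" by (simp add: matrix_left_right_inverse)
  then have eq: "(\<Sum>k\<in>UNIV. B $ i $ k * A $ k $ j) = (if i = j then 1 else 0)" for i j
    by (simp add: matrix_matrix_mult_def mat_def vec_eq_iff)
  have "(\<Sum>l\<in>?R. u_form l x * v_vec l $ i) = (\<Sum>k\<in>UNIV. u_form (\<phi> k) x * v_vec (\<phi> k) $ i)"
    by (rule sum.reindex_bij_betw[OF \<phi>, symmetric])
  also have "\<dots> = (\<Sum>k\<in>UNIV. \<Sum>j\<in>UNIV. of_real (x $ j) * (B $ i $ k * A $ k $ j))"
    by (simp add: u_form_eq A_def B_def sum_distrib_left sum_distrib_right algebra_simps)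
  also have "\<dots> = (\<Sum>j\<in>UNIV. of_real (x $ j) * (\<Sum>k\<in>UNIV. B $ i $ k * A $ k $ j))"
    unfolding sum_distrib_left by (rule sum.swap)
  also have "\<dots> = of_real (x $ i)" unfolding eq by (simp add: if_distrib cong: if_cong)
  finally show ?thesis by simp
qed

lemma v_vec_cnj: "v_vec (cnj l) $ i = cnj (v_vec l $ i)"
  by (simp add: v_vec_def H_fun_def)

lemma v_vec_of_real: "(v_vec (of_real l) :: complex^'m::{finite,linorder}) $ i = of_real (v_vec l $ i)"
  by (simp add: v_vec_def H_fun_def)

lemma u_form_v1:
  assumes m: "CARD('m::{finite,linorder}) \<ge> 2" and l: "poly (chi_poly CARD('m::{finite,linorder})) l = 0"
  shows "u_form l (v_vec 1 :: real^'m::{finite,linorder}) = (if l = 1 then 1 else 0)"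
proof -
  have "CARD('m) \<ge> 1" using m by simp
  then show ?thesis
    using u_v_biorthogonal[OF m l chi_root_one] v_vec_of_real[of 1, where ?'m='m] by (simp add: u_form_eq)
qed

lemma P_mat_mult: "(P_mat *v x) $ i = of_nat (CARD('m) + idx i - 1) * (x::'a::field^'m::{finite,linorder}) $ i"
proof -
  have "(P_mat *v x) $ i = (\<Sum>j\<in>UNIV. if i = j then of_nat (CARD('m) + idx i - 1) * x $ j else 0)"
    unfolding P_mat_def matrix_vector_mult_def vec_lambda_beta by (intro sum.cong) auto
  also have "\<dots> = of_nat (CARD('m) + idx i - 1) * x $ i" by simp
  finally show ?thesis .
qed

lemma P_mat_inv:
  "(matrix_inv P_mat *v x) $ i = (x::'a::{field_char_0}^'m::{finite,linorder}) $ i / of_nat (CARD('m) + idx i - 1)"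
proof -
  have nz: "of_nat (CARD('m) + idx i - 1) \<noteq> (0::'a)" for i :: 'm
  proof -
    have "0 < CARD('m)" by simp
    then have "CARD('m) + idx i - 1 \<noteq> 0" using idx_ge_1[of i] by linarith
    then show ?thesis by (metis of_nat_eq_0_iff)
  qed
  define Q :: "'a^'m::{finite,linorder}^'m::{finite,linorder}" where "Q = (\<chi> i j. if i = j then 1 / of_nat (CARD('m) + idx i - 1) else 0)"
  have "Q ** P_mat = mat 1"
    unfolding matrix_matrix_mult_def Q_def P_mat_def mat_def
    using nz by (auto simp: vec_eq_iff if_distrib[where f="\<lambda>x. x * _"] cong: if_cong)
  moreover from this have "P_mat ** Q = mat 1" by (simp add: matrix_left_right_inverse)
  ultimately have "invertible (P_mat :: 'a^'m::{finite,linorder}^'m::{finite,linorder})" unfolding invertible_def by blast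
  have "P_mat ** matrix_inv (P_mat :: 'a^'m::{finite,linorder}^'m::{finite,linorder}) = mat 1"
    using \<open>invertible P_mat\<close> unfolding invertible_def matrix_inv_def by (rule someI2_ex) blast
  then have "P_mat *v (matrix_inv P_mat *v x) = x" by (simp add: matrix_vector_mul_assoc)
  then have "of_nat (CARD('m) + idx i - 1) * (matrix_inv P_mat *v x) $ i = x $ i"
    by (metis P_mat_mult)
  then show ?thesis using nz[of i] by (metis nonzero_mult_div_cancel_left)
qed

lemma P_mat_w_vec:
  assumes m: "CARD('m::{finite,linorder}) \<ge> 2"
  shows "P_mat *v (w_vec (idx i) :: real^'m::{finite,linorder}) = row i R_mat"
proof (simp only: vec_eq_iff, rule allI)
  fix j :: 'm
  have "idx i \<le> CARD('m)" "idx i \<ge> 1" by (rule idx_le idx_ge_1)+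
  moreover have "idx j \<le> CARD('m)" by (rule idx_le)
  moreover have "idx i \<noteq> idx j" if "j \<noteq> i" using that by simp
  ultimately show "(P_mat *v (w_vec (idx i) :: real^'m::{finite,linorder})) $ j = row i R_mat $ j"
    unfolding P_mat_mult using m
    by (cases "j = i") (auto simp: row_def R_mat_def w_vec_def e_vec_def of_nat_diff, metis idx_eq_iff)
qed

section \<open>Markov chains and sums of martingale increments\<close>

text \<open>Distinct indices may give the same displacement. The weights \<open>q\<close> are
  controlled on \<open>S\<close> only, which is where the chain lives.\<close>

locale step_chain = prob_space M for M :: "'w measure" +
  fixes S :: "'s::plus set" and q :: "'s \<Rightarrow> 'i::finite \<Rightarrow> real" and d :: "'i \<Rightarrow> 's"
    and x0 :: 's and X :: "nat \<Rightarrow> 'w \<Rightarrow> 's"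
  assumes chain: "markov_chain M S (step_prob q d) x0 X"
    and countable_S: "countable S"
    and q_nonneg: "x \<in> S \<Longrightarrow> q x i \<ge> 0"
    and q_sum: "x \<in> S \<Longrightarrow> (\<Sum>i\<in>UNIV. q x i) = 1"
begin

definition hist :: "nat \<Rightarrow> 'w \<Rightarrow> 's list" where
  "hist n \<omega> = map (\<lambda>i. X i \<omega>) [0..<Suc n]"

lemma hist_Suc: "hist (Suc n) \<omega> = hist n \<omega> @ [X (Suc n) \<omega>]"
  and last_hist [simp]: "last (hist n \<omega>) = X n \<omega>"
  and length_hist [simp]: "length (hist n \<omega>) = Suc n"
  and nth_hist: "i \<le> n \<Longrightarrow> hist n \<omega> ! i = X i \<omega>"
  by (auto simp: hist_def simp del: upt_Suc simp: upt_Suc_append nth_append)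

lemma X_measurable: "X n \<in> M \<rightarrow>\<^sub>M count_space S"
  using chain by (simp add: markov_chain_def)

lemma X_in_S: "\<omega> \<in> space M \<Longrightarrow> X n \<omega> \<in> S"
  using measurable_space[OF X_measurable] by simp

lemma X_eq_sets: "{\<omega>\<in>space M. X n \<omega> = x} \<in> sets M"
proof (cases "x \<in> S")
  case True
  have "X n -` {x} \<inter> space M \<in> sets M" using True by (intro measurable_sets[OF X_measurable]) auto
  moreover have "X n -` {x} \<inter> space M = {\<omega>\<in>space M. X n \<omega> = x}" by auto
  ultimately show ?thesis by simp
next
  case False
  then have "{\<omega>\<in>space M. X n \<omega> = x} = {}" using X_in_S by auto
  then show ?thesis by (simp only: sets.empty_sets)
qed

lemma hist_eq_iff: "hist n \<omega> = xs \<longleftrightarrow> length xs = Suc n \<and> (\<forall>i\<le>n. X i \<omega> = xs ! i)"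
  by (auto simp: list_eq_iff_nth_eq nth_hist less_Suc_eq_le)

lemma hist_eq_sets: "{\<omega>\<in>space M. hist n \<omega> = xs} \<in> sets M"
proof (cases "length xs = Suc n")
  case True
  then have "{\<omega>\<in>space M. hist n \<omega> = xs} = (\<Inter>i\<in>{..n}. {\<omega>\<in>space M. X i \<omega> = xs ! i})"
    by (auto simp: hist_eq_iff)
  then show ?thesis using X_eq_sets by auto
next
  case False
  then have "{\<omega>\<in>space M. hist n \<omega> = xs} = {}" by (auto simp: hist_eq_iff)
  then show ?thesis by (simp only: sets.empty_sets)
qed

lemma hist_measurable: "hist n \<in> M \<rightarrow>\<^sub>M count_space (lists S)"
proof (subst measurable_count_space_eq_countable)
  show "countable (lists S)" using countable_S by (rule countable_lists)
  have "hist n -` {xs} \<inter> space M \<in> sets M" for xs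
  proof -
    have "hist n -` {xs} \<inter> space M = {\<omega>\<in>space M. hist n \<omega> = xs}" by auto
    then show ?thesis using hist_eq_sets by simp
  qed
  moreover have "hist n \<in> space M \<rightarrow> lists S" using X_in_S by (auto simp: hist_def)
  ultimately show "hist n \<in> space M \<rightarrow> lists S \<and> (\<forall>a\<in>lists S. hist n -` {a} \<inter> space M \<in> sets M)" by blast
qed

lemma measurable_hist [measurable]: "(\<lambda>\<omega>. g (hist n \<omega>)) \<in> borel_measurable M"
  for g :: "'s list \<Rightarrow> 'b::topological_space"
  by (rule measurable_compose[OF hist_measurable]) simp

lemma measurable_X [measurable]: "(\<lambda>\<omega>. g (X n \<omega>)) \<in> borel_measurable M"
  for g :: "'s \<Rightarrow> 'b::topological_space"
  by (rule measurable_compose[OF X_measurable]) simp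

text \<open>All candidate trajectories; some of them may leave \<open>S\<close> and then have
  probability 0.\<close>

primrec paths :: "nat \<Rightarrow> 's list set" where
  "paths 0 = {[x0]}"
| "paths (Suc n) = (\<Union>xs\<in>paths n. (\<lambda>y. xs @ [y]) ` (\<lambda>i. last xs + d i) ` UNIV)"

definition path_weight :: "'s list \<Rightarrow> real" where
  "path_weight xs = (\<Prod>i<length xs - 1. step_prob q d (xs ! i) (xs ! Suc i))"

lemma finite_paths: "finite (paths n)"
  by (induction n) auto

lemma length_paths: "xs \<in> paths n \<Longrightarrow> length xs = Suc n"
  by (induction n arbitrary: xs) auto

lemma prob_hist_Suc:
  assumes "length xs = Suc n"
  shows "prob {\<omega>\<in>space M. hist (Suc n) \<omega> = xs @ [y]} = prob {\<omega>\<in>space M. hist n \<omega> = xs} * step_prob q d (last xs) y"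
proof -
  define x where "x = (\<lambda>i. (xs @ [y]) ! i)"
  have "last xs = xs ! n" using assms by (cases xs rule: rev_cases) (auto simp: nth_append)
  then have xn: "x n = last xs" "x (Suc n) = y" using assms by (auto simp: x_def nth_append)
  have "hist (Suc n) \<omega> = xs @ [y] \<longleftrightarrow> (\<forall>i\<le>Suc n. X i \<omega> = x i)" for \<omega>
    using assms by (auto simp: hist_eq_iff x_def)
  moreover have "hist n \<omega> = xs \<longleftrightarrow> (\<forall>i\<le>n. X i \<omega> = x i)" for \<omega>
    using assms by (auto simp: hist_eq_iff x_def nth_append)
  moreover have "\<P>(\<omega> in M. \<forall>i\<le>Suc n. X i \<omega> = x i) =
            \<P>(\<omega> in M. \<forall>i\<le>n. X i \<omega> = x i) * step_prob q d (x n) (x (Suc n))"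
    using chain unfolding markov_chain_def by blast
  ultimately show ?thesis by (simp add: xn)
qed

lemma prob_hist_eq:
  assumes "xs \<in> paths n"
  shows "prob {\<omega>\<in>space M. hist n \<omega> = xs} = path_weight xs"
  using assms
proof (induction n arbitrary: xs)
  case 0
  have "AE \<omega> in M. X 0 \<omega> = x0" using chain by (simp add: markov_chain_def)
  then have "prob {\<omega>\<in>space M. hist 0 \<omega> = [x0]} = 1"
    by (subst prob_eq_1[OF hist_eq_sets]) (auto simp: hist_def)
  then show ?case using 0 by (simp add: path_weight_def)
next
  case (Suc n)
  then obtain ys y where ys: "ys \<in> paths n" "xs = ys @ [y]" by auto
  have len: "length ys = Suc n" using length_paths[OF ys(1)] .
  then have "last ys = ys ! n" by (cases ys rule: rev_cases) (auto simp: nth_append)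
  then have "path_weight xs = path_weight ys * step_prob q d (last ys) y"
    using len by (simp add: path_weight_def ys(2) nth_append)
  then show ?case using prob_hist_Suc[OF len, of y] Suc.IH[OF ys(1)] ys(2) by simp
qed

text \<open>The tower property in finite form: the last step is summed out with the weights
  \<open>q\<close>.\<close>

lemma sum_paths_Suc:
  fixes g :: "'s list \<Rightarrow> 'b::real_vector"
  shows "(\<Sum>ys\<in>paths (Suc n). prob {\<omega>\<in>space M. hist (Suc n) \<omega> = ys} *\<^sub>R g ys)
    = (\<Sum>xs\<in>paths n. prob {\<omega>\<in>space M. hist n \<omega> = xs} *\<^sub>R (\<Sum>i\<in>UNIV. q (last xs) i *\<^sub>R g (xs @ [last xs + d i])))"
proof -
  have "(\<Sum>ys\<in>paths (Suc n). prob {\<omega>\<in>space M. hist (Suc n) \<omega> = ys} *\<^sub>R g ys)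
    = (\<Sum>xs\<in>paths n. \<Sum>ys\<in>(\<lambda>y. xs @ [y]) ` (\<lambda>i. last xs + d i) ` UNIV. prob {\<omega>\<in>space M. hist (Suc n) \<omega> = ys} *\<^sub>R g ys)"
    unfolding paths.simps by (rule sum.UNION_disjoint) (auto simp: finite_paths)
  also have "\<dots> = (\<Sum>xs\<in>paths n. \<Sum>y\<in>(\<lambda>i. last xs + d i) ` UNIV. prob {\<omega>\<in>space M. hist (Suc n) \<omega> = xs @ [y]} *\<^sub>R g (xs @ [y]))"
    by (intro sum.cong refl) (subst sum.reindex, auto simp: inj_on_def)
  also have "\<dots> = (\<Sum>xs\<in>paths n. prob {\<omega>\<in>space M. hist n \<omega> = xs} *\<^sub>R (\<Sum>i\<in>UNIV. q (last xs) i *\<^sub>R g (xs @ [last xs + d i])))"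
  proof (intro sum.cong refl)
    fix xs assume "xs \<in> paths n"
    let ?Y = "(\<lambda>i. last xs + d i) ` (UNIV :: 'i set)" and ?p = "prob {\<omega>\<in>space M. hist n \<omega> = xs}"
    have "(\<Sum>y\<in>?Y. prob {\<omega>\<in>space M. hist (Suc n) \<omega> = xs @ [y]} *\<^sub>R g (xs @ [y]))
      = (\<Sum>y\<in>?Y. \<Sum>i\<in>UNIV. if y = last xs + d i then ?p *\<^sub>R q (last xs) i *\<^sub>R g (xs @ [y]) else 0)"
      by (intro sum.cong refl)
         (auto simp: prob_hist_Suc[OF length_paths[OF \<open>xs \<in> paths n\<close>]] step_prob_def scaleR_sum_left sum_distrib_left intro!: sum.cong)
    \<comment> \<open>\<open>step_prob\<close> pools all indices that lead to the same state;
      exchanging the sums separates them again.\<close>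
    also have "\<dots> = (\<Sum>i\<in>UNIV. \<Sum>y\<in>?Y. if y = last xs + d i then ?p *\<^sub>R q (last xs) i *\<^sub>R g (xs @ [y]) else 0)"
      by (rule sum.swap)
    also have "\<dots> = ?p *\<^sub>R (\<Sum>i\<in>UNIV. q (last xs) i *\<^sub>R g (xs @ [last xs + d i]))"
      unfolding scaleR_sum_right by (intro sum.cong refl) (subst sum.delta, auto)
    finally show "(\<Sum>y\<in>?Y. prob {\<omega>\<in>space M. hist (Suc n) \<omega> = xs @ [y]} *\<^sub>R g (xs @ [y])) = \<dots>" .
  qed
  finally show ?thesis .
qed

text \<open>The weights add up to 1 on \<open>S\<close> only, so trajectories ending outside
  \<open>S\<close> must be seen to carry no mass before the masses can be summed.\<close>

lemma prob_hist_not_S: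
  assumes "last xs \<notin> S" shows "prob {\<omega>\<in>space M. hist n \<omega> = xs} = 0"
proof -
  have False if "\<omega> \<in> space M" "hist n \<omega> = xs" for \<omega>
    using X_in_S[OF that(1), of n] assms last_hist[of n \<omega>] unfolding that(2) by simp
  then have "{\<omega>\<in>space M. hist n \<omega> = xs} = {}" by blast
  then show ?thesis by (simp only: measure_empty)
qed

lemma sum_prob_paths: "(\<Sum>xs\<in>paths n. prob {\<omega>\<in>space M. hist n \<omega> = xs}) = 1"
proof (induction n)
  case 0
  then show ?case using prob_hist_eq[of "[x0]" 0] by (simp add: path_weight_def)
next
  case (Suc n)
  have "(\<Sum>ys\<in>paths (Suc n). prob {\<omega>\<in>space M. hist (Suc n) \<omega> = ys})
    = (\<Sum>xs\<in>paths n. prob {\<omega>\<in>space M. hist n \<omega> = xs} * (\<Sum>i\<in>UNIV. q (last xs) i))"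
    using sum_paths_Suc[where g="\<lambda>_. 1::real" and n=n] by simp
  also have "\<dots> = (\<Sum>xs\<in>paths n. prob {\<omega>\<in>space M. hist n \<omega> = xs})"
    by (intro sum.cong refl) (use q_sum prob_hist_not_S in force)
  finally show ?case using Suc by simp
qed

lemma AE_hist_paths: "AE \<omega> in M. hist n \<omega> \<in> paths n"
proof -
  have "prob (\<Union>xs\<in>paths n. {\<omega>\<in>space M. hist n \<omega> = xs}) = (\<Sum>xs\<in>paths n. prob {\<omega>\<in>space M. hist n \<omega> = xs})"
    by (rule finite_measure_finite_Union) (auto simp: finite_paths disjoint_family_on_def intro: hist_eq_sets)
  also have "(\<Union>xs\<in>paths n. {\<omega>\<in>space M. hist n \<omega> = xs}) = {\<omega>\<in>space M. hist n \<omega> \<in> paths n}" by auto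
  finally have "prob {\<omega>\<in>space M. hist n \<omega> \<in> paths n} = 1" using sum_prob_paths by simp
  from AE_prob_1[OF this] show ?thesis by auto
qed

lemma integrable_hist_and_expectation:
  fixes g :: "'s list \<Rightarrow> 'b::{banach, second_countable_topology}"
  shows integrable_hist: "integrable M (\<lambda>\<omega>. g (hist n \<omega>))"
    and expectation_hist: "expectation (\<lambda>\<omega>. g (hist n \<omega>)) = (\<Sum>xs\<in>paths n. prob {\<omega>\<in>space M. hist n \<omega> = xs} *\<^sub>R g xs)"
proof -
  let ?h = "\<lambda>\<omega>. \<Sum>xs\<in>paths n. indicator {\<omega>\<in>space M. hist n \<omega> = xs} \<omega> *\<^sub>R g xs"
  have int: "integrable M (\<lambda>\<omega>. indicator {\<omega>\<in>space M. hist n \<omega> = xs} \<omega> *\<^sub>R g xs)" for xs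
    using hist_eq_sets by (intro integrable_scaleR_left integrable_real_indicator) (auto simp: less_top[symmetric])
  have ae: "AE \<omega> in M. g (hist n \<omega>) = ?h \<omega>"
    using AE_hist_paths[of n] AE_space
  proof eventually_elim
    case (elim \<omega>)
    then have "?h \<omega> = (\<Sum>xs\<in>paths n. if xs = hist n \<omega> then g xs else 0)"
      by (intro sum.cong) (auto simp: indicator_def)
    then show ?case using elim finite_paths by simp
  qed
  have inth: "integrable M ?h" using int by (intro Bochner_Integration.integrable_sum)
  have exph: "expectation ?h = (\<Sum>xs\<in>paths n. prob {\<omega>\<in>space M. hist n \<omega> = xs} *\<^sub>R g xs)"
  proof (subst Bochner_Integration.integral_sum[OF int], intro sum.cong refl)
    fix xs
    have "expectation (\<lambda>\<omega>. indicator {\<omega>\<in>space M. hist n \<omega> = xs} \<omega> *\<^sub>R g xs)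
        = expectation (indicator {\<omega>\<in>space M. hist n \<omega> = xs}) *\<^sub>R g xs"
      using hist_eq_sets
      by (intro integral_scaleR_left integrable_real_indicator) (auto simp: less_top[symmetric])
    also have "expectation (indicator {\<omega>\<in>space M. hist n \<omega> = xs}) = prob ({\<omega>\<in>space M. hist n \<omega> = xs} \<inter> space M)"
      by (rule Bochner_Integration.integral_indicator)
    also have "{\<omega>\<in>space M. hist n \<omega> = xs} \<inter> space M = {\<omega>\<in>space M. hist n \<omega> = xs}" by blast
    finally show "expectation (\<lambda>\<omega>. indicator {\<omega>\<in>space M. hist n \<omega> = xs} \<omega> *\<^sub>R g xs)
      = prob {\<omega>\<in>space M. hist n \<omega> = xs} *\<^sub>R g xs" .
  qed
  show "integrable M (\<lambda>\<omega>. g (hist n \<omega>))"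
    by (rule iffD2[OF integrable_cong_AE[OF measurable_hist _ ae] inth]) (rule borel_measurable_integrable[OF inth])
  show "expectation (\<lambda>\<omega>. g (hist n \<omega>)) = (\<Sum>xs\<in>paths n. prob {\<omega>\<in>space M. hist n \<omega> = xs} *\<^sub>R g xs)"
    unfolding exph[symmetric]
    by (rule integral_cong_AE[OF measurable_hist _ ae]) (rule borel_measurable_integrable[OF inth])
qed

text \<open>The Markov property in integrated form. It takes the place of conditioning on the past
  in all martingale computations.\<close>

lemma one_step:
  fixes g :: "'s list \<Rightarrow> 'b::{banach, second_countable_topology}"
  shows "expectation (\<lambda>\<omega>. g (hist (Suc n) \<omega>))
    = expectation (\<lambda>\<omega>. \<Sum>i\<in>UNIV. q (X n \<omega>) i *\<^sub>R g (hist n \<omega> @ [X n \<omega> + d i]))"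
proof -
  have eq: "expectation (\<lambda>\<omega>. \<Sum>i\<in>UNIV. q (X n \<omega>) i *\<^sub>R g (hist n \<omega> @ [X n \<omega> + d i]))
    = (\<Sum>xs\<in>paths n. prob {\<omega>\<in>space M. hist n \<omega> = xs} *\<^sub>R (\<Sum>i\<in>UNIV. q (last xs) i *\<^sub>R g (xs @ [last xs + d i])))"
    using expectation_hist[where n=n and g="\<lambda>xs. \<Sum>i\<in>UNIV. q (last xs) i *\<^sub>R g (xs @ [last xs + d i])"]
    unfolding last_hist .
  have "expectation (\<lambda>\<omega>. g (hist (Suc n) \<omega>)) = (\<Sum>ys\<in>paths (Suc n). prob {\<omega>\<in>space M. hist (Suc n) \<omega> = ys} *\<^sub>R g ys)"
    by (rule expectation_hist)
  also note sum_paths_Suc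
  finally show ?thesis unfolding eq .
qed

lemma integrable_X:
  fixes g :: "'s \<Rightarrow> 'b::{banach, second_countable_topology}"
  shows "integrable M (\<lambda>\<omega>. g (X n \<omega>))"
  using integrable_hist[of "\<lambda>xs. g (last xs)" n] by simp

lemma expectation_X:
  fixes g :: "'s \<Rightarrow> 'b::{banach, second_countable_topology}"
  shows "expectation (\<lambda>\<omega>. g (X n \<omega>)) = (\<Sum>xs\<in>paths n. path_weight xs *\<^sub>R g (last xs))"
  using expectation_hist[of "\<lambda>xs. g (last xs)" n] by (simp add: prob_hist_eq)

lemma AE_X_0: "AE \<omega> in M. X 0 \<omega> = x0"
  using chain by (simp add: markov_chain_def)

lemma AE_step: "AE \<omega> in M. \<exists>i. X (Suc n) \<omega> = X n \<omega> + d i"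
  using AE_hist_paths[of "Suc n"]
proof eventually_elim
  case (elim \<omega>)
  then have "\<exists>xs i. hist n \<omega> @ [X (Suc n) \<omega>] = xs @ [last xs + d i]"
    unfolding hist_Suc by auto
  then obtain xs i where "hist n \<omega> = xs" "X (Suc n) \<omega> = last xs + d i" by auto
  then show ?case using last_hist[of n \<omega>] by (intro exI[of _ i]) simp
qed

end

text \<open>The weight of a trajectory depends on \<open>q\<close>, \<open>d\<close> and the start
  only, not on the underlying space. This is how the fringe process and an arbitrary gap process are
  compared in law.\<close>

lemma same_marginals:
  fixes g :: "'s::plus \<Rightarrow> 'b::{banach, second_countable_topology}"
  assumes "step_chain M S q d x0 X" "step_chain N S' q d x0 Y"
  shows "(\<integral>\<omega>. g (X n \<omega>) \<partial>M) = (\<integral>\<omega>. g (Y n \<omega>) \<partial>N)"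
proof -
  have "(\<integral>\<omega>. g (X n \<omega>) \<partial>M) = (\<Sum>xs\<in>step_chain.paths d x0 n. step_chain.path_weight q d xs *\<^sub>R g (last xs))"
    by (rule step_chain.expectation_X[OF assms(1)])
  moreover have "(\<integral>\<omega>. g (Y n \<omega>) \<partial>N) = (\<Sum>xs\<in>step_chain.paths d x0 n. step_chain.path_weight q d xs *\<^sub>R g (last xs))"
    by (rule step_chain.expectation_X[OF assms(2)])
  ultimately show ?thesis by (simp only:)
qed

text \<open>Applied to a bounded increment of mean zero, the linear term drops out and a Gaussian
  type bound for the exponential moment remains.\<close>

lemma exp_le_1_plus_square: "exp (s::real) \<le> s + exp (s\<^sup>2)"
proof -
  define E where "E = exp (s\<^sup>2)"
  have e: "1 + s\<^sup>2 \<le> E" unfolding E_def by (rule exp_ge_add_one_self)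
  consider "s > 1" | "0 \<le> s" "s \<le> 1" | "-1 \<le> s" "s < 0" | "s < -1" by linarith
  then show ?thesis
  proof cases
    case 1
    then have "s \<le> s\<^sup>2" by (simp add: power2_eq_square)
    then have "exp s \<le> exp (s\<^sup>2)" by simp
    then show ?thesis using 1 by linarith
  next
    case 2
    show ?thesis unfolding E_def[symmetric] using exp_bound[OF 2] e by linarith
  next
    case 3
    define x where "x = - s"
    have x: "0 < x" "x \<le> 1" using 3 by (auto simp: x_def)
    have "(1 - x + x\<^sup>2) * (1 + x) = 1 + x^3" by algebra
    then have "1 \<le> (1 - x + x\<^sup>2) * (1 + x)" using x by simp
    also have "\<dots> \<le> (1 - x + x\<^sup>2) * exp x"
      using x by (intro mult_left_mono exp_ge_add_one_self) (simp add: power2_eq_square)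
    finally have "exp (- x) \<le> 1 - x + x\<^sup>2" by (simp add: exp_minus field_simps)
    then show ?thesis unfolding E_def[symmetric] using e by (simp add: x_def)
  next
    case 4
    then have "1 * 1 \<le> (-s) * (-s)" by (intro mult_mono) auto
    moreover have "(-s) * 1 \<le> (-s) * (-s)" using 4 by (intro mult_left_mono) auto
    ultimately have "1 \<le> s + E" using e by (simp add: power2_eq_square)
    moreover have "exp s \<le> 1" using 4 by simp
    ultimately show ?thesis unfolding E_def[symmetric] by (rule order_trans[rotated])
  qed
qed

text \<open>A single term of the exponential series; it converts exponential moments into power
  moments.\<close>

lemma power_le_fact_exp:
  fixes x :: real assumes "x \<ge> 0" shows "x ^ n \<le> fact n * exp x"
proof -
  have s: "(\<lambda>k. x ^ k /\<^sub>R fact k) sums exp x" by (rule exp_converges)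
  have "(\<Sum>k\<in>{n}. x ^ k /\<^sub>R fact k) \<le> (\<Sum>k. x ^ k /\<^sub>R fact k)"
    using assms by (intro sum_le_suminf sums_summable[OF s]) auto
  then show ?thesis using sums_unique[OF s] by (simp add: field_simps)
qed

section \<open>Sums of increments along a chain: moments and characteristic functions\<close>

context step_chain
begin

text \<open>The step functions depend on time and, in the applications, also on the final or initial
  time as a parameter: the weight of an old increment changes with the time at which the process is
  observed.\<close>

definition msum :: "(nat \<Rightarrow> 's \<Rightarrow> 's \<Rightarrow> 'b::comm_monoid_add) \<Rightarrow> nat \<Rightarrow> 'w \<Rightarrow> 'b" where
  "msum D n \<omega> = (\<Sum>k<n. D k (X k \<omega>) (X (Suc k) \<omega>))"

definition msum_list :: "(nat \<Rightarrow> 's \<Rightarrow> 's \<Rightarrow> 'b::comm_monoid_add) \<Rightarrow> 's list \<Rightarrow> 'b" where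
  "msum_list D xs = (\<Sum>k<length xs - 1. D k (xs ! k) (xs ! Suc k))"

lemma msum_hist: "msum_list D (hist n \<omega>) = msum D n \<omega>"
  by (auto simp: msum_list_def msum_def nth_hist intro!: sum.cong)

lemma msum_list_snoc: "msum_list D (hist n \<omega> @ [y]) = msum D n \<omega> + D n (X n \<omega>) y"
  by (auto simp: msum_list_def msum_def nth_append nth_hist intro!: arg_cong2[of _ _ _ _ "(+)"] sum.cong)

lemma one_step_msum:
  fixes f :: "'c::comm_monoid_add \<Rightarrow> 's \<Rightarrow> 'b::{banach, second_countable_topology}"
  shows "expectation (\<lambda>\<omega>. f (msum D (Suc n) \<omega>) (X (Suc n) \<omega>))
    = expectation (\<lambda>\<omega>. \<Sum>i\<in>UNIV. q (X n \<omega>) i *\<^sub>R f (msum D n \<omega> + D n (X n \<omega>) (X n \<omega> + d i)) (X n \<omega> + d i))"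
  using one_step[of "\<lambda>xs. f (msum_list D xs) (last xs)" n] by (simp add: msum_hist msum_list_snoc)

lemma integrable_msum:
  fixes f :: "'c::comm_monoid_add \<Rightarrow> 's \<Rightarrow> 'b::{banach, second_countable_topology}"
  shows "integrable M (\<lambda>\<omega>. f (msum D n \<omega>) (X n \<omega>))"
  using integrable_hist[of "\<lambda>xs. f (msum_list D xs) (last xs)" n] by (simp add: msum_hist)

text \<open>This is Azuma's estimate with a non-optimal constant.\<close>

lemma exp_msum_bound:
  fixes D :: "nat \<Rightarrow> 's \<Rightarrow> 's \<Rightarrow> real"
  assumes reach: "\<And>k. AE \<omega> in M. X k \<omega> \<in> A k" and AS: "\<And>k. A k \<subseteq> S"
    and mean: "\<And>k x. x \<in> A k \<Longrightarrow> (\<Sum>i\<in>UNIV. q x i * D k x (x + d i)) = 0"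
    and bnd: "\<And>k x i. x \<in> A k \<Longrightarrow> \<bar>D k x (x + d i)\<bar> \<le> c k"
  shows "expectation (\<lambda>\<omega>. exp (t * msum D n \<omega>)) \<le> exp (t\<^sup>2 * (\<Sum>k<n. (c k)\<^sup>2))"
proof (induction n)
  case 0
  then show ?case by (simp add: msum_def prob_space)
next
  case (Suc n)
  have "expectation (\<lambda>\<omega>. exp (t * msum D (Suc n) \<omega>))
    = expectation (\<lambda>\<omega>. \<Sum>i\<in>UNIV. q (X n \<omega>) i *\<^sub>R exp (t * (msum D n \<omega> + D n (X n \<omega>) (X n \<omega> + d i))))"
    using one_step_msum[where f="\<lambda>s _. exp (t * s)" and n=n and D=D] .
  also have "\<dots> \<le> expectation (\<lambda>\<omega>. exp (t\<^sup>2 * (c n)\<^sup>2) * exp (t * msum D n \<omega>))"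
  proof (rule integral_mono_AE)
    show "AE \<omega> in M. (\<Sum>i\<in>UNIV. q (X n \<omega>) i *\<^sub>R exp (t * (msum D n \<omega> + D n (X n \<omega>) (X n \<omega> + d i))))
      \<le> exp (t\<^sup>2 * (c n)\<^sup>2) * exp (t * msum D n \<omega>)"
      using reach[of n]
    proof eventually_elim
      case (elim \<omega>)
      define x where "x = X n \<omega>"
      have x: "x \<in> A n" "x \<in> S" using elim AS by (auto simp: x_def)
      have "(\<Sum>i\<in>UNIV. q x i * exp (t * D n x (x + d i))) \<le> (\<Sum>i\<in>UNIV. q x i * (t * D n x (x + d i) + exp (t\<^sup>2 * (c n)\<^sup>2)))"
      proof (intro sum_mono mult_left_mono q_nonneg x)
        fix i
        have "(D n x (x + d i))\<^sup>2 \<le> (c n)\<^sup>2" using power_mono[OF bnd[OF x(1), of i], of 2] by simp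
        then have "exp ((t * D n x (x + d i))\<^sup>2) \<le> exp (t\<^sup>2 * (c n)\<^sup>2)"
          by (simp add: power_mult_distrib mult_left_mono)
        then show "exp (t * D n x (x + d i)) \<le> t * D n x (x + d i) + exp (t\<^sup>2 * (c n)\<^sup>2)"
          using exp_le_1_plus_square[of "t * D n x (x + d i)"] by linarith
      qed
      also have "\<dots> = t * (\<Sum>i\<in>UNIV. q x i * D n x (x + d i)) + (\<Sum>i\<in>UNIV. q x i) * exp (t\<^sup>2 * (c n)\<^sup>2)"
        by (simp add: sum.distrib sum_distrib_left sum_distrib_right algebra_simps)
      also have "\<dots> = exp (t\<^sup>2 * (c n)\<^sup>2)" using mean[OF x(1)] q_sum[OF x(2)] by simp
      finally have "(\<Sum>i\<in>UNIV. q x i * exp (t * D n x (x + d i))) * exp (t * msum D n \<omega>) \<le> exp (t\<^sup>2 * (c n)\<^sup>2) * exp (t * msum D n \<omega>)"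
        by (intro mult_right_mono) auto
      moreover have "(\<Sum>i\<in>UNIV. q x i * exp (t * D n x (x + d i))) * exp (t * msum D n \<omega>)
          = (\<Sum>i\<in>UNIV. q x i *\<^sub>R exp (t * (msum D n \<omega> + D n x (x + d i))))"
        by (simp add: sum_distrib_left distrib_left exp_add mult_ac)
      ultimately show ?case unfolding x_def[symmetric] by (simp only:)
    qed
    show "integrable M (\<lambda>\<omega>. exp (t\<^sup>2 * (c n)\<^sup>2) * exp (t * msum D n \<omega>))"
      by (rule integrable_msum[of "\<lambda>s _. exp (t\<^sup>2 * (c n)\<^sup>2) * exp (t * s)"])
    have "integrable M (\<lambda>\<omega>. (\<lambda>s x. \<Sum>i\<in>UNIV. q x i *\<^sub>R exp (t * (s + D n x (x + d i)))) (msum D n \<omega>) (X n \<omega>))"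
      by (rule integrable_msum)
    then show "integrable M (\<lambda>\<omega>. \<Sum>i\<in>UNIV. q (X n \<omega>) i *\<^sub>R exp (t * (msum D n \<omega> + D n (X n \<omega>) (X n \<omega> + d i))))"
      by simp
  qed
  also have "\<dots> = exp (t\<^sup>2 * (c n)\<^sup>2) * expectation (\<lambda>\<omega>. exp (t * msum D n \<omega>))" by simp
  also have "\<dots> \<le> exp (t\<^sup>2 * (c n)\<^sup>2) * exp (t\<^sup>2 * (\<Sum>k<n. (c k)\<^sup>2))"
    using Suc by (intro mult_left_mono) auto
  finally show ?case by (simp add: algebra_simps flip: exp_add)
qed

text \<open>The exponential estimate at \<open>t = 1/s\<close> and \<open>t = -1/s\<close> is at
  most \<open>exp 1\<close>, and one term of the exponential series bounds the power. The 6 bounds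
  \<open>2 * exp 1\<close>.\<close>

lemma moment_msum_bound:
  fixes D :: "nat \<Rightarrow> 's \<Rightarrow> 's \<Rightarrow> real"
  assumes reach: "\<And>k. AE \<omega> in M. X k \<omega> \<in> A k" and AS: "\<And>k. A k \<subseteq> S"
    and mean: "\<And>k x. x \<in> A k \<Longrightarrow> (\<Sum>i\<in>UNIV. q x i * D k x (x + d i)) = 0"
    and bnd: "\<And>k x i. x \<in> A k \<Longrightarrow> \<bar>D k x (x + d i)\<bar> \<le> c k"
    and s: "s > 0" "(\<Sum>k<n. (c k)\<^sup>2) \<le> s\<^sup>2"
  shows "expectation (\<lambda>\<omega>. \<bar>msum D n \<omega>\<bar> ^ p) \<le> 6 * fact p * s ^ p"
proof -
  have exp: "expectation (\<lambda>\<omega>. exp (t * msum D n \<omega>)) \<le> exp 1" if "t\<^sup>2 = 1 / s\<^sup>2" for t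
  proof -
    have "t\<^sup>2 * (\<Sum>k<n. (c k)\<^sup>2) \<le> t\<^sup>2 * s\<^sup>2" using s by (intro mult_left_mono) auto
    then have "t\<^sup>2 * (\<Sum>k<n. (c k)\<^sup>2) \<le> 1" using s that by simp
    then show ?thesis using exp_msum_bound[where t=t and n=n, OF reach AS mean bnd] by (meson exp_le_cancel_iff order_trans)
  qed
  have int: "integrable M (\<lambda>\<omega>. exp (t * msum D n \<omega>))" for t
    by (rule integrable_msum[of "\<lambda>s _. exp (t * s)"])
  have "expectation (\<lambda>\<omega>. \<bar>msum D n \<omega>\<bar> ^ p)
     \<le> expectation (\<lambda>\<omega>. s ^ p * fact p * (exp (1/s * msum D n \<omega>) + exp (-1/s * msum D n \<omega>)))"
  proof (rule integral_mono)
    show "integrable M (\<lambda>\<omega>. \<bar>msum D n \<omega>\<bar> ^ p)"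
      by (rule integrable_msum[of "\<lambda>s _. \<bar>s\<bar> ^ p"])
    show "integrable M (\<lambda>\<omega>. s ^ p * fact p * (exp (1/s * msum D n \<omega>) + exp (-1/s * msum D n \<omega>)))"
      by (intro integrable_mult_right Bochner_Integration.integrable_add int)
    fix \<omega>
    define y where "y = msum D n \<omega>"
    have "(\<bar>y\<bar> / s) ^ p \<le> fact p * exp (\<bar>y\<bar> / s)" using s by (intro power_le_fact_exp) auto
    also have "exp (\<bar>y\<bar> / s) \<le> exp (1/s * y) + exp (-1/s * y)" by (cases "y \<ge> 0") auto
    finally have "s ^ p * (\<bar>y\<bar> / s) ^ p \<le> s ^ p * (fact p * (exp (1/s * y) + exp (-1/s * y)))"
      using s by (intro mult_left_mono) auto
    then show "\<bar>msum D n \<omega>\<bar> ^ p \<le> s ^ p * fact p * (exp (1/s * msum D n \<omega>) + exp (-1/s * msum D n \<omega>))"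
      using s unfolding y_def[symmetric] by (simp add: power_divide mult_ac)
  qed
  also have "\<dots> = s ^ p * fact p * (expectation (\<lambda>\<omega>. exp (1/s * msum D n \<omega>)) + expectation (\<lambda>\<omega>. exp (-1/s * msum D n \<omega>)))"
    by (subst Bochner_Integration.integral_mult_right, intro Bochner_Integration.integrable_add int,
        subst Bochner_Integration.integral_add, (rule int)+, rule refl)
  also have "\<dots> \<le> s ^ p * fact p * (exp 1 + exp 1)"
    using s by (intro mult_left_mono add_mono exp) (auto simp: power_divide)
  also have "\<dots> \<le> s ^ p * fact p * 6"
    using s exp_le by (intro mult_left_mono) auto
  finally show ?thesis by (simp add: mult_ac)
qed

lemma moment_msum_bound_complex:
  fixes D :: "nat \<Rightarrow> 's \<Rightarrow> 's \<Rightarrow> complex"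
  assumes reach: "\<And>k. AE \<omega> in M. X k \<omega> \<in> A k" and AS: "\<And>k. A k \<subseteq> S"
    and mean: "\<And>k x. x \<in> A k \<Longrightarrow> (\<Sum>i\<in>UNIV. q x i *\<^sub>R D k x (x + d i)) = 0"
    and bnd: "\<And>k x i. x \<in> A k \<Longrightarrow> cmod (D k x (x + d i)) \<le> c k"
    and s: "s > 0" "(\<Sum>k<n. (c k)\<^sup>2) \<le> s\<^sup>2"
  shows "expectation (\<lambda>\<omega>. cmod (msum D n \<omega>) ^ p) \<le> 12 * 2 ^ p * fact p * s ^ p"
proof -
  let ?R = "\<lambda>k x y. Re (D k x y)" and ?I = "\<lambda>k x y. Im (D k x y)"
  have mR: "(\<Sum>i\<in>UNIV. q x i * ?R k x (x + d i)) = 0" and mI: "(\<Sum>i\<in>UNIV. q x i * ?I k x (x + d i)) = 0"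
    if "x \<in> A k" for k x using arg_cong[OF mean[OF that], of Re] arg_cong[OF mean[OF that], of Im] by auto
  have bR: "\<bar>?R k x (x + d i)\<bar> \<le> c k" and bI: "\<bar>?I k x (x + d i)\<bar> \<le> c k" if "x \<in> A k" for k x i
    using bnd[OF that, of i] abs_Re_le_cmod abs_Im_le_cmod order_trans by blast+
  have intR: "integrable M (\<lambda>\<omega>. \<bar>msum ?R n \<omega>\<bar> ^ p)" and intI: "integrable M (\<lambda>\<omega>. \<bar>msum ?I n \<omega>\<bar> ^ p)"
    by (rule integrable_msum[of "\<lambda>s _. \<bar>s\<bar> ^ p"])+
  have "expectation (\<lambda>\<omega>. cmod (msum D n \<omega>) ^ p) \<le> expectation (\<lambda>\<omega>. 2 ^ p * (\<bar>msum ?R n \<omega>\<bar> ^ p + \<bar>msum ?I n \<omega>\<bar> ^ p))"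
  proof (rule integral_mono)
    show "integrable M (\<lambda>\<omega>. cmod (msum D n \<omega>) ^ p)"
      by (rule integrable_msum[of "\<lambda>s _. cmod s ^ p"])
    show "integrable M (\<lambda>\<omega>. 2 ^ p * (\<bar>msum ?R n \<omega>\<bar> ^ p + \<bar>msum ?I n \<omega>\<bar> ^ p))"
      using intR intI by (intro integrable_mult_right Bochner_Integration.integrable_add)
    fix \<omega>
    have eq: "Re (msum D n \<omega>) = msum ?R n \<omega>" "Im (msum D n \<omega>) = msum ?I n \<omega>" by (simp_all add: msum_def)
    define a b where "a = \<bar>msum ?R n \<omega>\<bar>" and "b = \<bar>msum ?I n \<omega>\<bar>"
    have "cmod (msum D n \<omega>) \<le> a + b" using cmod_le[of "msum D n \<omega>"] by (simp add: eq a_def b_def)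
    also have "\<dots> \<le> 2 * max a b" by simp
    finally have "cmod (msum D n \<omega>) ^ p \<le> (2 * max a b) ^ p" by (intro power_mono) auto
    also have "\<dots> = 2 ^ p * max a b ^ p" by (simp add: power_mult_distrib)
    also have "max a b ^ p \<le> a ^ p + b ^ p" by (cases "a \<le> b") (auto simp: a_def b_def max_def)
    finally show "cmod (msum D n \<omega>) ^ p \<le> 2 ^ p * (\<bar>msum ?R n \<omega>\<bar> ^ p + \<bar>msum ?I n \<omega>\<bar> ^ p)"
      by (simp add: a_def b_def)
  qed
  also have "\<dots> = 2 ^ p * (expectation (\<lambda>\<omega>. \<bar>msum ?R n \<omega>\<bar> ^ p) + expectation (\<lambda>\<omega>. \<bar>msum ?I n \<omega>\<bar> ^ p))"
    using intR intI by simp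
  also have "\<dots> \<le> 2 ^ p * (6 * fact p * s ^ p + 6 * fact p * s ^ p)"
    by (intro mult_left_mono add_mono moment_msum_bound[OF reach AS mR bR s] moment_msum_bound[OF reach AS mI bI s]) auto
  finally show ?thesis by (simp add: mult_ac)
qed

text \<open>Each step replaces the conditional characteristic function of one increment by
  \<open>exp (- v k / 2)\<close>. This costs the deviation of the conditional variance from
  \<open>v k\<close>, plus Taylor remainders of third and fourth order. Earlier errors are
  multiplied by a factor of modulus at most 1, so the costs simply add up. Since \<open>v k\<close>
  is deterministic, its factor can be taken out of the expectation.\<close>

lemma char_msum_approx:
  fixes D :: "nat \<Rightarrow> 's \<Rightarrow> 's \<Rightarrow> real"
  assumes reach: "\<And>k. AE \<omega> in M. X k \<omega> \<in> A k" and AS: "\<And>k. A k \<subseteq> S"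
    and mean: "\<And>k x. x \<in> A k \<Longrightarrow> (\<Sum>i\<in>UNIV. q x i * D k x (x + d i)) = 0"
    and bnd: "\<And>k x i. x \<in> A k \<Longrightarrow> \<bar>D k x (x + d i)\<bar> \<le> c k"
    and var: "\<And>k x. x \<in> A k \<Longrightarrow> U k x = (\<Sum>i\<in>UNIV. q x i * (D k x (x + d i))\<^sup>2)"
    and v: "\<And>k. 0 \<le> v k" "\<And>k. v k \<le> (c k)\<^sup>2"
  shows "cmod (expectation (\<lambda>\<omega>. iexp (msum D n \<omega>)) - exp (- (\<Sum>k<n. v k) / 2))
     \<le> (\<Sum>k<n. expectation (\<lambda>\<omega>. \<bar>U k (X k \<omega>) - v k\<bar>) + c k ^ 3 + c k ^ 4)"
proof (induction n)
  case 0
  then show ?case by (simp add: msum_def prob_space)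
next
  case (Suc n)
  \<comment> \<open>A bound for absolute values is non-negative once \<open>A n\<close> is
    non-empty, and it is because it contains \<open>X n\<close> almost surely.\<close>
  have c0: "c n \<ge> 0"
  proof -
    obtain \<omega> where "X n \<omega> \<in> A n" using reach[of n] by (metis (mono_tags, lifting) AE_E_prob AE_False eventually_mono)
    then show ?thesis using bnd[of "X n \<omega>" n undefined] by linarith
  qed
  have intn: "integrable M (\<lambda>\<omega>. iexp (msum D n \<omega>))"
    by (rule integrable_msum[of "\<lambda>s _. iexp s"])
  \<comment> \<open>The error of one step: the conditional characteristic function of the increment
    minus its Gaussian substitute.\<close>
  define F where "F = (\<lambda>x. (\<Sum>i\<in>UNIV. q x i *\<^sub>R iexp (D n x (x + d i))) - exp (- v n / 2))"
  have intF: "integrable M (\<lambda>\<omega>. iexp (msum D n \<omega>) * F (X n \<omega>))"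
    by (rule integrable_msum[of "\<lambda>s x. iexp s * F x"])
  have "expectation (\<lambda>\<omega>. iexp (msum D (Suc n) \<omega>))
    = expectation (\<lambda>\<omega>. \<Sum>i\<in>UNIV. q (X n \<omega>) i *\<^sub>R iexp (msum D n \<omega> + D n (X n \<omega>) (X n \<omega> + d i)))"
    using one_step_msum[where f="\<lambda>s _. iexp s" and n=n and D=D] .
  also have "\<dots> = expectation (\<lambda>\<omega>. iexp (msum D n \<omega>) * F (X n \<omega>) + exp (- v n / 2) * iexp (msum D n \<omega>))"
    by (intro Bochner_Integration.integral_cong refl)
       (simp add: F_def algebra_simps exp_add sum_distrib_left sum_distrib_right scaleR_conv_of_real)
  also have "\<dots> = expectation (\<lambda>\<omega>. iexp (msum D n \<omega>) * F (X n \<omega>)) + exp (- v n / 2) * expectation (\<lambda>\<omega>. iexp (msum D n \<omega>))"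
    using intF intn by simp
  finally have split: "expectation (\<lambda>\<omega>. iexp (msum D (Suc n) \<omega>)) = \<dots>" .
  have bF: "cmod (F x) \<le> \<bar>U n x - v n\<bar> + c n ^ 3 + c n ^ 4" if x: "x \<in> A n" for x
  proof -
    have xS: "x \<in> S" using x AS by auto
    define \<delta> where "\<delta> = (\<lambda>i. D n x (x + d i))"
    have "cmod (iexp (\<delta> i) - (1 + \<i> * \<delta> i - (\<delta> i)\<^sup>2 / 2)) \<le> c n ^ 3" for i
    proof -
      have "cmod (iexp (\<delta> i) - (\<Sum>k\<le>2. (\<i> * \<delta> i)^k / fact k)) \<le> \<bar>\<delta> i\<bar>^Suc 2 / fact (Suc 2)"
        by (rule iexp_approx1)
      also have "(\<Sum>k\<le>2. (\<i> * \<delta> i)^k / fact k) = 1 + \<i> * \<delta> i - (\<delta> i)\<^sup>2 / 2"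
        by (simp add: numeral_2_eq_2 power_mult_distrib)
      also have "\<bar>\<delta> i\<bar>^Suc 2 / fact (Suc 2) \<le> \<bar>\<delta> i\<bar>^3"
      proof -
        have "\<bar>\<delta> i\<bar>^3 / fact (Suc 2) \<le> \<bar>\<delta> i\<bar>^3 / 1"
          by (intro divide_left_mono) (auto simp: numeral_2_eq_2)
        then show ?thesis by (simp add: numeral_3_eq_3 numeral_2_eq_2 del: fact_Suc)
      qed
      also have "\<dots> \<le> c n ^ 3" unfolding \<delta>_def by (intro power_mono bnd x) auto
      finally show ?thesis .
    qed
    then have "cmod (\<Sum>i\<in>UNIV. q x i *\<^sub>R (iexp (\<delta> i) - (1 + \<i> * \<delta> i - (\<delta> i)\<^sup>2 / 2))) \<le> (\<Sum>i\<in>UNIV. q x i * c n ^ 3)"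
      using q_nonneg[OF xS] by (intro sum_norm_le) (simp add: mult_left_mono)
    also have "\<dots> = c n ^ 3" using q_sum[OF xS] by (simp flip: sum_distrib_right)
    also have "(\<Sum>i\<in>UNIV. q x i *\<^sub>R (iexp (\<delta> i) - (1 + \<i> * \<delta> i - (\<delta> i)\<^sup>2 / 2)))
       = (\<Sum>i\<in>UNIV. q x i *\<^sub>R iexp (\<delta> i)) - of_real (\<Sum>i\<in>UNIV. q x i) - \<i> * of_real (\<Sum>i\<in>UNIV. q x i * \<delta> i)
         + of_real (\<Sum>i\<in>UNIV. q x i * (\<delta> i)\<^sup>2) / 2"
      by (simp add: scaleR_conv_of_real algebra_simps sum.distrib sum_subtractf sum_distrib_left sum_divide_distrib)
    also have "\<dots> = (\<Sum>i\<in>UNIV. q x i *\<^sub>R iexp (\<delta> i)) - of_real (1 - U n x / 2)"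
      using mean[OF x] var[OF x] q_sum[OF xS] by (simp add: \<delta>_def)
    finally have 1: "cmod ((\<Sum>i\<in>UNIV. q x i *\<^sub>R iexp (\<delta> i)) - of_real (1 - U n x / 2)) \<le> c n ^ 3" .
    have "\<bar>exp (- v n / 2) - (1 - v n / 2)\<bar> \<le> (v n)\<^sup>2"
    proof -
      have "exp (- v n / 2) \<le> - v n / 2 + exp ((- v n / 2)\<^sup>2)" by (rule exp_le_1_plus_square)
      define w where "w = v n / 2"
      have w: "w \<ge> 0" using v by (simp add: w_def)
      have "exp (- w) \<le> 1 / (1 + w)" using exp_ge_add_one_self[of w] w by (simp add: exp_minus field_simps)
      also have "\<dots> \<le> 1 - w + w\<^sup>2"
      proof -
        have "(1 - w + w\<^sup>2) * (1 + w) = 1 + w^3" by algebra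
        then have "1 \<le> (1 - w + w\<^sup>2) * (1 + w)" using w by simp
        then show ?thesis using w by (simp add: field_simps)
      qed
      finally have "exp (- w) - (1 - w) \<le> w\<^sup>2" by simp
      moreover have "exp (- w) - (1 - w) \<ge> 0" by (metis add.commute add_uminus_conv_diff diff_ge_0_iff_ge exp_ge_add_one_self)
      moreover have "w\<^sup>2 \<le> (v n)\<^sup>2" using v by (intro power_mono) (auto simp: w_def)
      ultimately show ?thesis by (simp add: w_def)
    qed
    moreover have "(v n)\<^sup>2 \<le> c n ^ 4" using power_mono[OF v(2,1), of n 2] by simp
    ultimately have "\<bar>(1 - U n x / 2) - exp (- v n / 2)\<bar> \<le> \<bar>U n x - v n\<bar> + c n ^ 4" by linarith
    then have "cmod (of_real (1 - U n x / 2) - exp (- v n / 2)) \<le> \<bar>U n x - v n\<bar> + c n ^ 4"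
      unfolding of_real_diff[symmetric] norm_of_real by simp
    then show ?thesis using 1 norm_triangle_ineq[of "(\<Sum>i\<in>UNIV. q x i *\<^sub>R iexp (\<delta> i)) - of_real (1 - U n x / 2)" "of_real (1 - U n x / 2) - exp (- v n / 2)"]
      unfolding F_def \<delta>_def by simp
  qed
  have "cmod (expectation (\<lambda>\<omega>. iexp (msum D n \<omega>) * F (X n \<omega>))) \<le> expectation (\<lambda>\<omega>. \<bar>U n (X n \<omega>) - v n\<bar> + (c n ^ 3 + c n ^ 4))"
  proof (rule order_trans[OF integral_norm_bound integral_mono_AE])
    show "integrable M (\<lambda>\<omega>. cmod (iexp (msum D n \<omega>) * F (X n \<omega>)))"
      using intF by (rule integrable_norm)
    show "integrable M (\<lambda>\<omega>. \<bar>U n (X n \<omega>) - v n\<bar> + (c n ^ 3 + c n ^ 4))"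
      by (rule integrable_X[of "\<lambda>x. \<bar>U n x - v n\<bar> + (c n ^ 3 + c n ^ 4)"])
    show "AE \<omega> in M. cmod (iexp (msum D n \<omega>) * F (X n \<omega>)) \<le> \<bar>U n (X n \<omega>) - v n\<bar> + (c n ^ 3 + c n ^ 4)"
      using reach[of n] by eventually_elim (use bF in \<open>simp add: norm_mult add.assoc\<close>)
  qed
  also have "\<dots> = expectation (\<lambda>\<omega>. \<bar>U n (X n \<omega>) - v n\<bar>) + (c n ^ 3 + c n ^ 4)"
    by (subst Bochner_Integration.integral_add[OF integrable_X[of "\<lambda>x. \<bar>U n x - v n\<bar>"]]) (simp_all add: prob_space)
  finally have a: "cmod (expectation (\<lambda>\<omega>. iexp (msum D n \<omega>) * F (X n \<omega>))) \<le> \<dots>" .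
  define E where "E = expectation (\<lambda>\<omega>. iexp (msum D n \<omega>))"
  define G where "G = expectation (\<lambda>\<omega>. iexp (msum D n \<omega>) * F (X n \<omega>))"
  have "exp (- (\<Sum>k<Suc n. v k) / 2) = exp (- v n / 2) * exp (- (\<Sum>k<n. v k) / 2)"
    by (simp add: exp_add[symmetric] add_divide_distrib[symmetric] diff_divide_distrib[symmetric])
  then have "expectation (\<lambda>\<omega>. iexp (msum D (Suc n) \<omega>)) - exp (- (\<Sum>k<Suc n. v k) / 2)
     = G + of_real (exp (- v n / 2)) * (E - exp (- (\<Sum>k<n. v k) / 2))"
    unfolding split E_def[symmetric] G_def[symmetric] by (simp add: algebra_simps exp_of_real)
  also have "cmod \<dots> \<le> cmod G + cmod (of_real (exp (- v n / 2)) * (E - exp (- (\<Sum>k<n. v k) / 2)))"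
    by (rule norm_triangle_ineq)
  also have "cmod (of_real (exp (- v n / 2)) * (E - exp (- (\<Sum>k<n. v k) / 2))) \<le> 1 * cmod (E - exp (- (\<Sum>k<n. v k) / 2))"
    unfolding norm_mult using v by (intro mult_right_mono) auto
  finally show ?case using Suc.IH a unfolding E_def G_def by simp
qed

end

section \<open>Gaussian vectors and convergence in law\<close>

text \<open>The form may be degenerate. If \<open>B y y = 0\<close>, the quadratic in
  \<open>t\<close> is affine and non-negative, so its slope vanishes; otherwise its minimum is
  evaluated.\<close>

lemma psd_Cauchy_Schwarz:
  fixes B :: "'a::real_vector \<Rightarrow> 'a \<Rightarrow> real"
  assumes B: "bilinear B" and sym: "\<And>x y. B x y = B y x" and psd: "\<And>x. B x x \<ge> 0"
  shows "(B x y)\<^sup>2 \<le> B x x * B y y"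
proof -
  have quad: "B x x + 2 * t * B x y + t\<^sup>2 * B y y \<ge> 0" for t
  proof -
    have "B (x + t *\<^sub>R y) (x + t *\<^sub>R y) = B x x + 2 * t * B x y + t\<^sup>2 * B y y"
      using sym[of y x] by (simp add: bilinear_ladd[OF B] bilinear_radd[OF B] bilinear_lmul[OF B] bilinear_rmul[OF B] power2_eq_square algebra_simps)
    then show ?thesis using psd by metis
  qed
  show ?thesis
  proof (cases "B y y = 0")
    case True
    have "B x y = 0"
    proof (rule ccontr)
      assume nz: "B x y \<noteq> 0"
      have "2 * (- (B x x + 1) / (2 * B x y)) * B x y = - (B x x + 1)" using nz by (simp add: field_simps)
      then show False using quad[of "- (B x x + 1) / (2 * B x y)"] True by simp
    qed
    then show ?thesis using True by simp
  next
    case False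
    then have pos: "B y y > 0" using psd[of y] by simp
    have "B x x + 2 * (- B x y / B y y) * B x y + (- B x y / B y y)\<^sup>2 * B y y = B x x - (B x y)\<^sup>2 / B y y"
      using pos by (simp add: field_simps power2_eq_square)
    then have "B x x - (B x y)\<^sup>2 / B y y \<ge> 0" using quad by metis
    then show ?thesis using pos by (simp add: field_simps)
  qed
qed

text \<open>Completing the square in one coordinate after the other.\<close>

lemma psd_sum_of_squares:
  fixes B :: "real^'n \<Rightarrow> real^'n \<Rightarrow> real"
  assumes "bilinear B" "\<And>x y. B x y = B y x" "\<And>x. B x x \<ge> 0"
  obtains l :: "'n \<Rightarrow> real^'n" where "\<And>a. B a a = (\<Sum>i\<in>UNIV. (a \<bullet> l i)\<^sup>2)"
proof -
  have "\<exists>l :: 'n \<Rightarrow> real^'n. \<forall>a. B a a = (\<Sum>i\<in>J. (a \<bullet> l i)\<^sup>2)"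
    if "finite J" "bilinear B" "\<forall>x y. B x y = B y x" "\<forall>x. B x x \<ge> 0"
      "\<forall>i. i \<notin> J \<longrightarrow> B (axis i 1) (axis i 1) = 0" for J and B :: "real^'n \<Rightarrow> real^'n \<Rightarrow> real"
    using that
  proof (induction J arbitrary: B)
    case empty
    have z: "B (axis i 1) b = 0" for i b
      using psd_Cauchy_Schwarz[of B "axis i 1" b] empty by simp
    have "B a a = 0" for a
    proof -
      have "B a a = B (\<Sum>i\<in>UNIV. a $ i *\<^sub>R axis i 1) a" by (simp add: basis_expansion flip: scalar_mult_eq_scaleR)
      also have "\<dots> = (\<Sum>i\<in>UNIV. a $ i *\<^sub>R B (axis i 1) a)"
        using empty(1) by (simp add: bilinear_def linear_sum[where f="\<lambda>x. B x a"] linear_cmul[where f="\<lambda>x. B x a"])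
      finally show ?thesis using z by simp
    qed
    then show ?case by simp
  next
    case (insert j J)
    have lin: "linear (\<lambda>y. B x y)" "linear (\<lambda>x. B x y)" for x y
      using insert.prems(1) by (simp_all add: bilinear_def)
    show ?case
    proof (cases "B (axis j 1) (axis j 1) = 0")
      case True
      then have "\<forall>i. i \<notin> J \<longrightarrow> B (axis i 1) (axis i 1) = 0" using insert.prems(4) by auto
      from insert.IH[OF insert.prems(1-3) this] obtain l :: "'n \<Rightarrow> real^'n" where l: "\<forall>a. B a a = (\<Sum>i\<in>J. (a \<bullet> l i)\<^sup>2)" by blast
      have "\<forall>a. B a a = (\<Sum>i\<in>insert j J. (a \<bullet> (l(j := 0)) i)\<^sup>2)"
        using l insert.hyps by (auto intro!: sum.cong)
      then show ?thesis by blast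
    next
      case False
      define e :: "real^'n" where "e = axis j 1"
      define b where "b = B e e"
      have b: "b > 0" using False insert.prems(3) by (metis b_def e_def order_le_less)
      \<comment> \<open>Removing the square that belongs to \<open>e\<close> leaves a form that is
        still non-negative by Cauchy-Schwarz and now vanishes on \<open>e\<close>.\<close>
      define B' where "B' = (\<lambda>x y. B x y - B e x * B e y / b)"
      have CS: "(B x y)\<^sup>2 \<le> B x x * B y y" for x y
        using psd_Cauchy_Schwarz[of B x y] insert.prems by simp
      have "linear (\<lambda>y. B' x y)" for x
        using linear_add[OF lin(1)] linear_cmul[OF lin(1)]
        by (intro linearI) (simp_all add: B'_def add_divide_distrib distrib_left right_diff_distrib)
      moreover have "linear (\<lambda>x. B' x y)" for y
        using linear_add[OF lin(1)] linear_cmul[OF lin(1)] linear_add[OF lin(2)] linear_cmul[OF lin(2)]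
        by (intro linearI) (simp_all add: B'_def add_divide_distrib distrib_right right_diff_distrib)
      ultimately have "bilinear B'" by (simp add: bilinear_def)
      moreover have "\<forall>x y. B' x y = B' y x" using insert.prems(2) by (simp add: B'_def)
      moreover have "\<forall>x. B' x x \<ge> 0"
        using CS[of e] b by (simp add: B'_def b_def power2_eq_square field_simps)
      moreover have "\<forall>i. i \<notin> J \<longrightarrow> B' (axis i 1) (axis i 1) = 0"
      proof (intro allI impI)
        fix i assume "i \<notin> J"
        show "B' (axis i 1) (axis i 1) = 0"
        proof (cases "i = j")
          case True
          then show ?thesis using b by (simp add: B'_def b_def e_def)
        next
          case False
          then have z: "B (axis i 1) (axis i 1) = 0" using insert.prems(4) \<open>i \<notin> J\<close> by auto
          then have "B e (axis i 1) = 0" using CS[of e "axis i 1"] by simp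
          then show ?thesis using z by (simp add: B'_def)
        qed
      qed
      ultimately obtain l where l: "\<forall>a. B' a a = (\<Sum>i\<in>J. (a \<bullet> l i)\<^sup>2)" using insert.IH[of B'] by blast
      define v :: "real^'n" where "v = (\<chi> i. B e (axis i 1) / sqrt b)"
      have v: "a \<bullet> v = B e a / sqrt b" for a
      proof -
        have "B e a = B e (\<Sum>i\<in>UNIV. a $ i *\<^sub>R axis i 1)" by (simp add: basis_expansion flip: scalar_mult_eq_scaleR)
        also have "\<dots> = (\<Sum>i\<in>UNIV. a $ i * B e (axis i 1))"
          by (simp add: linear_sum[OF lin(1)] linear_cmul[OF lin(1)])
        finally show ?thesis by (simp add: v_def inner_vec_def sum_divide_distrib)
      qed
      have "\<forall>a. B a a = (\<Sum>i\<in>insert j J. (a \<bullet> (l(j := v)) i)\<^sup>2)"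
      proof
        fix a
        have "(\<Sum>i\<in>insert j J. (a \<bullet> (l(j := v)) i)\<^sup>2) = (a \<bullet> v)\<^sup>2 + (\<Sum>i\<in>J. (a \<bullet> l i)\<^sup>2)"
          using insert.hyps by (auto intro!: sum.cong)
        also have "(\<Sum>i\<in>J. (a \<bullet> l i)\<^sup>2) = B' a a" using l by metis
        also have "(a \<bullet> v)\<^sup>2 + B' a a = B a a" using b by (simp add: v B'_def power_divide power2_eq_square)
        finally show "B a a = (\<Sum>i\<in>insert j J. (a \<bullet> (l(j := v)) i)\<^sup>2)" by simp
      qed
      then show ?thesis by blast
    qed
  qed
  from this[of UNIV B] show ?thesis using that assms by auto
qed

text \<open>As the image of the standard normal law under multiplication by \<open>\<sigma>\<close>,
  the Dirac mass for \<open>\<sigma> = 0\<close> is treated along with the other cases.\<close>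

lemma centered_normal_char:
  assumes "\<sigma> \<ge> 0"
  shows "real_distribution (centered_normal \<sigma>)"
    and "char (centered_normal \<sigma>) t = of_real (exp (- (\<sigma>\<^sup>2 * t\<^sup>2) / 2))"
proof -
  interpret N: real_distribution std_normal_distribution by (rule real_dist_normal_dist)
  have "centered_normal \<sigma> = distr std_normal_distribution borel (\<lambda>x. \<sigma> * x)"
  proof (cases "\<sigma> = 0")
    case True
    then have "distr std_normal_distribution borel (\<lambda>x. \<sigma> * x) = distr std_normal_distribution borel (\<lambda>x. 0)" by simp
    also have "\<dots> = return borel 0" by (rule N.distr_const) simp
    finally show ?thesis using True by (simp add: centered_normal_def)
  next
    case False
    have "distributed std_normal_distribution lborel (\<lambda>x. x) std_normal_density"
    proof -
      have "distr std_normal_distribution lborel (\<lambda>x. x) = std_normal_distribution"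
        by (rule distr_id2) simp
      then show ?thesis unfolding distributed_def by auto
    qed
    from N.normal_density_affine[OF this, of \<sigma> 0] False assms
    have "distributed std_normal_distribution lborel (\<lambda>x. \<sigma> * x) (normal_density 0 \<sigma>)" by simp
    then have "distr std_normal_distribution lborel (\<lambda>x. \<sigma> * x) = density lborel (normal_density 0 \<sigma>)"
      by (simp add: distributed_def)
    moreover have "distr std_normal_distribution lborel (\<lambda>x. \<sigma> * x) = distr std_normal_distribution borel (\<lambda>x. \<sigma> * x)"
      by (rule distr_cong) auto
    ultimately show ?thesis using False by (simp add: centered_normal_def)
  qed
  moreover have "real_distribution (distr std_normal_distribution borel (\<lambda>x. \<sigma> * x))"
    by (rule N.real_distribution_distr) simp
  moreover have "char (distr std_normal_distribution borel (\<lambda>x. \<sigma> * x)) t = char std_normal_distribution (t * \<sigma>)"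
    by (simp add: char_def integral_distr mult_ac)
  ultimately show "real_distribution (centered_normal \<sigma>)"
    "char (centered_normal \<sigma>) t = of_real (exp (- (\<sigma>\<^sup>2 * t\<^sup>2) / 2))"
    by (simp_all add: char_std_normal_distribution power_mult_distrib mult_ac)
qed

text \<open>With \<open>B\<close> written as a sum of squares
  \<open>(a \<bullet> l i)\<^sup>2\<close>, the law of the sum of
  \<open>\<omega> i *\<^sub>R l i\<close> for independent standard normal \<open>\<omega> i\<close>
  is as desired, whatever the rank of \<open>B\<close>.\<close>

lemma gaussian_exists:
  fixes B :: "real^'n \<Rightarrow> real^'n \<Rightarrow> real"
  assumes B: "bilinear B" "\<And>x y. B x y = B y x" "\<And>x. B x x \<ge> 0"
  obtains \<mu> :: "(real^'n) measure" where "centered_gaussian \<mu>"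
    "\<And>a. (CLINT x|\<mu>. iexp (a \<bullet> x)) = of_real (exp (- B a a / 2))"
proof -
  obtain l :: "'n \<Rightarrow> real^'n" where l: "\<And>a. B a a = (\<Sum>i\<in>UNIV. (a \<bullet> l i)\<^sup>2)" by (rule psd_sum_of_squares[OF B]) blast
  interpret N: real_distribution std_normal_distribution by (rule real_dist_normal_dist)
  define \<Omega> where "\<Omega> = PiM (UNIV :: 'n set) (\<lambda>_. std_normal_distribution)"
  interpret P: product_prob_space "\<lambda>_::'n. std_normal_distribution" UNIV by unfold_locales
  interpret P': finite_product_prob_space "\<lambda>_::'n. std_normal_distribution" UNIV by unfold_locales auto
  have prob: "prob_space \<Omega>" unfolding \<Omega>_def by (rule P.prob_space_axioms)
  define X :: "('n \<Rightarrow> real) \<Rightarrow> real^'n" where "X = (\<lambda>\<omega>. \<Sum>i\<in>UNIV. \<omega> i *\<^sub>R l i)"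
  have [measurable]: "(\<lambda>\<omega>. \<omega> i) \<in> borel_measurable \<Omega>" for i
    using measurable_component_singleton[of i UNIV "\<lambda>_. std_normal_distribution"] unfolding \<Omega>_def by simp
  have X [measurable]: "X \<in> borel_measurable \<Omega>" unfolding X_def by measurable
  define \<mu> where "\<mu> = distr \<Omega> borel X"
  have char: "(CLINT x|\<mu>. iexp (a \<bullet> x)) = of_real (exp (- B a a / 2))" for a
  proof -
    have "(CLINT x|\<mu>. iexp (a \<bullet> x)) = (CLINT \<omega>|\<Omega>. iexp (a \<bullet> X \<omega>))"
      unfolding \<mu>_def by (rule integral_distr) measurable
    also have "\<dots> = (CLINT \<omega>|\<Omega>. (\<Prod>i\<in>UNIV. iexp ((a \<bullet> l i) * \<omega> i)))"
      by (simp add: X_def inner_sum_right exp_sum[symmetric] sum_distrib_left mult_ac)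
    also have "\<dots> = (\<Prod>i\<in>UNIV. (CLINT x|std_normal_distribution. iexp ((a \<bullet> l i) * x)))"
      unfolding \<Omega>_def by (rule P.product_integral_prod) (auto intro!: N.integrable_iexp)
    also have "\<dots> = (\<Prod>i\<in>UNIV. of_real (exp (- (a \<bullet> l i)\<^sup>2 / 2)))"
      using char_std_normal_distribution by (simp add: char_def fun_eq_iff)
    also have "\<dots> = of_real (exp (- B a a / 2))"
      by (simp add: l sum_negf sum_divide_distrib flip: of_real_prod exp_sum)
    finally show ?thesis .
  qed
  have "centered_gaussian \<mu>"
    unfolding centered_gaussian_def
  proof (intro conjI allI)
    show prob\<mu>: "prob_space \<mu>" unfolding \<mu>_def using prob X by (rule prob_space.prob_space_distr)
    show sets\<mu>: "sets \<mu> = sets borel" by (simp add: \<mu>_def)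
    fix a
    define \<sigma> where "\<sigma> = sqrt (B a a)"
    have \<sigma>: "\<sigma> \<ge> 0" "\<sigma>\<^sup>2 = B a a" using B(3)[of a] by (auto simp: \<sigma>_def)
    have [measurable]: "(\<lambda>x. a \<bullet> x) \<in> borel_measurable \<mu>" using sets\<mu> by (simp cong: measurable_cong_sets)
    have "distr \<mu> borel (\<lambda>x. a \<bullet> x) = centered_normal \<sigma>"
    proof (rule Levy_uniqueness)
      show "real_distribution (distr \<mu> borel ((\<bullet>) a))"
        by (intro prob_space.real_distribution_distr prob\<mu>) measurable
      show "real_distribution (centered_normal \<sigma>)" by (rule centered_normal_char(1)[OF \<sigma>(1)])
      show "char (distr \<mu> borel ((\<bullet>) a)) = char (centered_normal \<sigma>)"
      proof
        fix t
        have "char (distr \<mu> borel ((\<bullet>) a)) t = (CLINT x|\<mu>. iexp ((t *\<^sub>R a) \<bullet> x))"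
          by (simp add: char_def integral_distr)
        also have "\<dots> = of_real (exp (- B (t *\<^sub>R a) (t *\<^sub>R a) / 2))" by (rule char)
        also have "\<dots> = char (centered_normal \<sigma>) t"
          unfolding centered_normal_char(2)[OF \<sigma>(1)] \<sigma>(2)
          by (simp add: bilinear_lmul[OF B(1)] bilinear_rmul[OF B(1)] power2_eq_square mult_ac)
        finally show "char (distr \<mu> borel ((\<bullet>) a)) t = char (centered_normal \<sigma>) t" .
      qed
    qed
    then show "\<exists>\<sigma>\<ge>0. distr \<mu> borel ((\<bullet>) a) = centered_normal \<sigma>" using \<sigma> by blast
  qed
  then show ?thesis using that char by blast
qed

section \<open>Trigonometric polynomials and convergence in law\<close>

definition trig_sum :: "(complex \<times> 'a::real_inner) list \<Rightarrow> 'a \<Rightarrow> complex" where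
  "trig_sum L x = (\<Sum>(c, a)\<leftarrow>L. c * iexp (a \<bullet> x))"

definition trig_fun :: "('a::real_inner \<Rightarrow> complex) \<Rightarrow> bool" where
  "trig_fun h \<longleftrightarrow> (\<exists>L. h = trig_sum L)"

lemma trig_fun_add: "trig_fun g \<Longrightarrow> trig_fun h \<Longrightarrow> trig_fun (\<lambda>x. g x + h x)"
  unfolding trig_fun_def by (metis (no_types, lifting) ext map_append sum_list_append trig_sum_def)

lemma trig_fun_iexp: "trig_fun (\<lambda>x. c * iexp (a \<bullet> x))"
  unfolding trig_fun_def by (intro exI[of _ "[(c, a)]"]) (simp add: trig_sum_def fun_eq_iff)

lemma trig_fun_const: "trig_fun (\<lambda>x. c)"
  using trig_fun_iexp[of c 0] by simp

lemma trig_fun_mult_iexp: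
  assumes "trig_fun h" shows "trig_fun (\<lambda>x. c * iexp (a \<bullet> x) * h x)"
proof -
  obtain L where L: "h = trig_sum L" using assms by (auto simp: trig_fun_def)
  have "(\<lambda>x. c * iexp (a \<bullet> x) * h x) = trig_sum (map (\<lambda>(c', a'). (c * c', a + a')) L)"
  proof
    fix x
    show "c * iexp (a \<bullet> x) * h x = trig_sum (map (\<lambda>(c', a'). (c * c', a + a')) L) x"
      unfolding L trig_sum_def
      by (induction L) (auto simp: algebra_simps exp_add inner_add_left)
  qed
  then show ?thesis by (auto simp: trig_fun_def)
qed

lemma trig_fun_mult:
  assumes "trig_fun g" "trig_fun h" shows "trig_fun (\<lambda>x. g x * h x)"
proof -
  obtain L where L: "g = trig_sum L" using assms by (auto simp: trig_fun_def)
  have "trig_fun (\<lambda>x. trig_sum L x * h x)"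
  proof (induction L)
    case Nil
    then show ?case using trig_fun_const[of 0] by (simp add: trig_sum_def)
  next
    case (Cons p L)
    have "(\<lambda>x. trig_sum (p # L) x * h x) = (\<lambda>x. fst p * iexp (snd p \<bullet> x) * h x + trig_sum L x * h x)"
      by (cases p) (simp add: trig_sum_def algebra_simps fun_eq_iff)
    then show ?case using trig_fun_add[OF trig_fun_mult_iexp[OF assms(2)] Cons] by simp
  qed
  then show ?thesis by (simp add: L)
qed

lemma trig_fun_sum:
  assumes "finite A" "\<And>i. i \<in> A \<Longrightarrow> trig_fun (f i)" shows "trig_fun (\<lambda>x. \<Sum>i\<in>A. f i x)"
  using assms by (induction A) (auto intro: trig_fun_add trig_fun_const)

lemma trig_fun_cos: "trig_fun (\<lambda>x. of_real (c * cos (a \<bullet> x)))"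
proof -
  have "of_real (c * cos t) = of_real c / 2 * iexp t + of_real c / 2 * iexp (- t)" for t
    by (simp add: complex_eq_iff Re_exp Im_exp)
  then have "(\<lambda>x. of_real (c * cos (a \<bullet> x))) = (\<lambda>x. of_real c / 2 * iexp (a \<bullet> x) + of_real c / 2 * iexp ((- a) \<bullet> x))"
    by auto
  then show ?thesis by (simp only:) (intro trig_fun_add trig_fun_iexp)
qed

lemma trig_fun_sin: "trig_fun (\<lambda>x. of_real (c * sin (a \<bullet> x)))"
proof -
  have "of_real (c * sin t) = (- \<i> * of_real c / 2) * iexp t + (\<i> * of_real c / 2) * iexp (- t)" for t
    by (simp add: complex_eq_iff Re_exp Im_exp)
  then have "(\<lambda>x. of_real (c * sin (a \<bullet> x))) = (\<lambda>x. (- \<i> * of_real c / 2) * iexp (a \<bullet> x) + (\<i> * of_real c / 2) * iexp ((- a) \<bullet> x))"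
    by auto
  then show ?thesis by (simp only:) (intro trig_fun_add trig_fun_iexp)
qed

text \<open>Wraps every coordinate around the unit circle with period \<open>2 * H\<close>, so that
  real polynomials on the image become trigonometric polynomials in \<open>x\<close>.\<close>

definition torus_map :: "real \<Rightarrow> real^'n \<Rightarrow> complex^'n" where
  "torus_map H x = (\<chi> i. cis (pi * x $ i / H))"

text \<open>A real linear functional of a torus point is a combination of cosines and sines of the
  coordinates; sums and products stay in the class.\<close>

lemma trig_fun_poly_torus:
  assumes "real_polynomial_function p"
  shows "trig_fun (\<lambda>x::real^'n. of_real (p (torus_map H x)))"
  using assms
proof (induction p rule: real_polynomial_function.induct)
  case (linear f)
  interpret f: bounded_linear f by fact
  have "f (torus_map H x) = (\<Sum>i\<in>UNIV. f (axis i 1) * cos (((pi / H) *\<^sub>R axis i 1) \<bullet> x) + f (axis i \<i>) * sin (((pi / H) *\<^sub>R axis i 1) \<bullet> x))"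
    for x :: "real^'n"
  proof -
    have "torus_map H x = (\<Sum>i\<in>UNIV. cos (pi * x $ i / H) *\<^sub>R axis i 1 + sin (pi * x $ i / H) *\<^sub>R axis i \<i>)"
      by (simp add: vec_eq_iff torus_map_def axis_def complex_eq_iff if_distrib cong: if_cong)
    then show ?thesis by (simp add: f.sum f.add f.scaleR inner_axis' mult_ac)
  qed
  then show ?case
    by (simp only: of_real_sum of_real_add) (intro trig_fun_sum trig_fun_add trig_fun_cos trig_fun_sin finite)
qed (auto intro: trig_fun_const trig_fun_add trig_fun_mult)

text \<open>Outside a large ball nothing but the uniform bound is claimed, so it does not matter that the
  trigonometric polynomial approximates the periodic continuation of a cut-off version of the function.\<close>

lemma trig_approximation:
  fixes f :: "real^'n \<Rightarrow> real"
  assumes f: "continuous_on UNIV f" "\<And>x. \<bar>f x\<bar> \<le> B" and T: "T > 0" and \<epsilon>: "\<epsilon> > 0"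
  obtains P where "trig_fun (\<lambda>x. of_real (P x))" "continuous_on UNIV P"
    "\<And>x. \<bar>f x - P x\<bar> \<le> \<epsilon> + 2 * B * indicator {x. norm x \<ge> T} x"
proof -
  \<comment> \<open>The cut-off function vanishes beyond norm \<open>2 * T\<close>, two thirds of
    the half period. The remaining margin makes it extend continuously across the cut of
    \<open>Arg\<close>.\<close>
  define H where "H = 3 * T"
  have H: "H > 0" using T by (simp add: H_def)
  define \<chi>' where "\<chi>' = (\<lambda>x::real^'n. max 0 (min 1 (2 - norm x / T)))"
  define f' where "f' = (\<lambda>x. \<chi>' x * f x)"
  have B: "B \<ge> 0" using f(2)[of 0] by linarith
  have \<chi>: "0 \<le> \<chi>' x" "\<chi>' x \<le> 1" for x by (auto simp: \<chi>'_def)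
  have f'_bound: "\<bar>f' x\<bar> \<le> B" for x
    using mult_mono[OF \<chi>(2)[of x] f(2)[of x]] \<chi>[of x] by (simp add: f'_def abs_mult)
  have f'_eq: "f' x = f x" if "norm x < T" for x using that T by (simp add: f'_def \<chi>'_def)
  have f'_0: "f' x = 0" if "norm x \<ge> 2 * T" for x using that T by (simp add: f'_def \<chi>'_def field_simps)
  have cont_f': "continuous_on UNIV f'" unfolding f'_def \<chi>'_def using f(1) by (intro continuous_intros) (use T in auto)
  define \<psi> where "\<psi> = (\<lambda>z::complex^'n. (\<chi> i. H / pi * Arg (z $ i)) :: real^'n)"
  define g where "g = (\<lambda>z. f' (\<psi> z))"
  define K where "K = {z::complex^'n. \<forall>i. cmod (z $ i) = 1}"
  have "closed K" unfolding K_def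
    by (intro closed_Collect_all closed_Collect_eq continuous_intros)
  moreover have "bounded K"
  proof (rule boundedI)
    fix z :: "complex^'n" assume "z \<in> K"
    have "norm z \<le> (\<Sum>i\<in>UNIV. cmod (z $ i))" unfolding norm_vec_def by (rule L2_set_le_sum) simp
    also have "\<dots> = real CARD('n)" using \<open>z \<in> K\<close> by (simp add: K_def)
    finally show "norm z \<le> real CARD('n)" .
  qed
  ultimately have K: "compact K" by (simp add: compact_eq_bounded_closed)
  \<comment> \<open>A real part below -1/2 means an argument beyond 2 pi / 3, hence a coordinate of
    \<open>\<psi> z\<close> beyond \<open>2 * T\<close>, where the cut-off has removed
    \<open>f\<close>.\<close>
  have g_0: "g z = 0" if "z \<in> K" "Re (z $ i) < - 1/2" for z i
  proof -
    have "cmod (z $ i) = 1" using that(1) by (simp add: K_def)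
    then have "z $ i = cis (Arg (z $ i))" using rcis_cmod_Arg[of "z $ i"] by (simp add: rcis_def)
    then have "Re (z $ i) = Re (cis (Arg (z $ i)))" by (rule arg_cong)
    then have "cos (Arg (z $ i)) = Re (z $ i)" by simp
    then have c: "cos \<bar>Arg (z $ i)\<bar> < - 1/2" using that(2) by simp
    have "\<bar>Arg (z $ i)\<bar> > 2 * pi / 3"
    proof (rule ccontr)
      assume "\<not> \<bar>Arg (z $ i)\<bar> > 2 * pi / 3"
      then have "cos (2 * pi / 3) \<le> cos \<bar>Arg (z $ i)\<bar>" by (intro cos_monotone_0_pi_le) auto
      moreover have "cos (2 * pi / 3) = - 1/2" using cos_120 by simp
      ultimately show False using c by simp
    qed
    then have "H / pi * (2 * pi / 3) \<le> H / pi * \<bar>Arg (z $ i)\<bar>" using H by (intro mult_left_mono) auto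
    also have "\<dots> = \<bar>\<psi> z $ i\<bar>" using H by (simp add: \<psi>_def abs_mult)
    also have "\<dots> \<le> norm (\<psi> z)" by (rule component_le_norm_cart)
    finally show ?thesis unfolding g_def by (intro f'_0) (simp add: H_def)
  qed
  have "continuous_on K g"
    unfolding continuous_on_eq_continuous_within
  proof
    fix z assume z: "z \<in> K"
    show "continuous (at z within K) g"
    proof (cases "\<forall>i. z $ i \<notin> \<real>\<^sub>\<le>\<^sub>0")
      case True
      have "isCont \<psi> z"
        unfolding isCont_def
      proof (rule vec_tendstoI)
        fix i
        have "((\<lambda>w. w $ i) \<longlongrightarrow> z $ i) (at z)" by (intro tendsto_intros)
        from isCont_tendsto_compose[OF continuous_at_Arg this] True
        show "((\<lambda>w. \<psi> w $ i) \<longlongrightarrow> \<psi> z $ i) (at z)"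
          by (auto simp: \<psi>_def intro!: tendsto_intros)
      qed
      moreover have "isCont f' (\<psi> z)" using cont_f' by (simp add: continuous_on_eq_continuous_at)
      ultimately have "isCont g z" unfolding g_def by (rule isCont_o2)
      then show ?thesis by (rule continuous_at_imp_continuous_at_within)
    next
      case False
      \<comment> \<open>On the branch cut \<open>\<psi>\<close> jumps, but there \<open>g\<close> is
        zero on a whole neighbourhood within \<open>K\<close>.\<close>
      then obtain i where i: "z $ i \<in> \<real>\<^sub>\<le>\<^sub>0" by blast
      then have "Re (z $ i) \<le> 0" "Im (z $ i) = 0" by (auto simp: complex_nonpos_Reals_iff)
      moreover have "cmod (z $ i) = 1" using z by (simp add: K_def)
      ultimately have "Re (z $ i) < - 1/2" by (simp add: cmod_eq_Re)
      moreover have "open {z::complex^'n. Re (z $ i) < - 1/2}"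
        by (intro open_Collect_less continuous_intros)
      ultimately have "\<forall>\<^sub>F w in at z within K. Re (w $ i) < - 1/2 \<and> w \<in> K"
        unfolding eventually_at_topological by blast
      then have "\<forall>\<^sub>F w in at z within K. g w = g z"
        by eventually_elim (use g_0 z \<open>Re (z $ i) < - 1/2\<close> in auto)
      then show ?thesis unfolding continuous_within by (rule tendsto_eventually)
    qed
  qed
  from Stone_Weierstrass_real_polynomial_function[OF K this \<epsilon>]
  obtain p where p: "real_polynomial_function p" "\<And>z. z \<in> K \<Longrightarrow> \<bar>g z - p z\<bar> < \<epsilon>" by blast
  have torus_K: "torus_map H x \<in> K" for x :: "real^'n" by (simp add: torus_map_def K_def)
  show ?thesis
  proof
    show "trig_fun (\<lambda>x::real^'n. of_real (p (torus_map H x)))" by (rule trig_fun_poly_torus[OF p(1)])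
    have ct: "continuous_on UNIV (torus_map H :: real^'n \<Rightarrow> _)"
      unfolding torus_map_def cis_conv_exp by (intro continuous_intros) (use H in auto)
    have cp: "continuous_on UNIV p" using p(1) by (intro continuous_on_polymonial_function) (simp add: real_polynomial_function_eq)
    show "continuous_on UNIV (\<lambda>x::real^'n. p (torus_map H x))"
      by (rule continuous_on_compose2[OF cp ct]) simp
    fix x :: "real^'n"
    have 1: "\<bar>g (torus_map H x) - p (torus_map H x)\<bar> < \<epsilon>" by (rule p(2)[OF torus_K])
    have gb: "\<bar>g (torus_map H x)\<bar> \<le> B" unfolding g_def by (rule f'_bound)
    show "\<bar>f x - p (torus_map H x)\<bar> \<le> \<epsilon> + 2 * B * indicator {x. norm x \<ge> T} x"
    proof (cases "norm x \<ge> T")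
      case True
      then show ?thesis using 1 gb f(2)[of x] by simp
    next
      case False
      have "\<psi> (torus_map H x) = x"
      proof (simp only: vec_eq_iff, rule allI)
        fix i
        have "\<bar>x $ i\<bar> < H" using False component_le_norm_cart[of x i] T by (simp add: H_def)
        then have "\<bar>x $ i / H\<bar> < 1" using H by simp
        then have "pi * \<bar>x $ i / H\<bar> < pi * 1" by (intro mult_strict_left_mono) auto
        then have "\<bar>pi * x $ i / H\<bar> < pi" by (simp add: abs_mult)
        then have "pi * x $ i / H \<in> {-pi<..pi}"
          unfolding abs_less_iff greaterThanAtMost_iff by linarith
        then have "Arg (cis (pi * x $ i / H)) = pi * x $ i / H" by (rule Arg_cis)
        then show "\<psi> (torus_map H x) $ i = x $ i" using H by (simp add: \<psi>_def torus_map_def)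
      qed
      then show ?thesis using 1 f'_eq[of x] False by (simp add: g_def)
    qed
  qed
qed

lemma tendsto_integral_trig_fun:
  fixes X :: "nat \<Rightarrow> 'w \<Rightarrow> real^'n"
  assumes M: "prob_space M" and X: "\<And>n. X n \<in> borel_measurable M"
    and \<mu>: "prob_space \<mu>" "sets \<mu> = sets borel"
    and char: "\<And>a. (\<lambda>n. CLINT \<omega>|M. iexp (a \<bullet> X n \<omega>)) \<longlonglongrightarrow> (CLINT x|\<mu>. iexp (a \<bullet> x))"
    and h: "trig_fun h"
  shows "(\<lambda>n. CLINT \<omega>|M. h (X n \<omega>)) \<longlonglongrightarrow> (CLINT x|\<mu>. h x)"
    and "integrable M (\<lambda>\<omega>. h (X n \<omega>))" and "integrable \<mu> h"
proof -
  interpret M: prob_space M by fact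
  interpret \<mu>: prob_space \<mu> by fact
  note [measurable] = X
  have [measurable]: "(\<lambda>x. x) \<in> borel_measurable \<mu>" using \<mu>(2) by (simp cong: measurable_cong_sets)
  obtain L where L: "h = trig_sum L" using h by (auto simp: trig_fun_def)
  have i1: "integrable M (\<lambda>\<omega>. c * iexp (a \<bullet> X n \<omega>))" for a c n
    by (intro integrable_mult_right M.integrable_const_bound[of _ 1]) auto
  have i2: "integrable \<mu> (\<lambda>x. c * iexp (a \<bullet> x))" for a c
    by (intro integrable_mult_right \<mu>.integrable_const_bound[of _ 1]) auto
  have "(\<lambda>n. CLINT \<omega>|M. trig_sum L (X n \<omega>)) \<longlonglongrightarrow> (CLINT x|\<mu>. trig_sum L x)
    \<and> (\<forall>n. integrable M (\<lambda>\<omega>. trig_sum L (X n \<omega>))) \<and> integrable \<mu> (trig_sum L)"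
  proof (induction L)
    case Nil
    then show ?case by (simp add: trig_sum_def)
  next
    case (Cons p L)
    have eq: "trig_sum (p # L) = (\<lambda>x. fst p * iexp (snd p \<bullet> x) + trig_sum L x)"
      by (cases p) (simp add: trig_sum_def fun_eq_iff)
    have "(\<lambda>n. fst p * (CLINT \<omega>|M. iexp (snd p \<bullet> X n \<omega>)) + (CLINT \<omega>|M. trig_sum L (X n \<omega>)))
       \<longlonglongrightarrow> fst p * (CLINT x|\<mu>. iexp (snd p \<bullet> x)) + (CLINT x|\<mu>. trig_sum L x)"
      using Cons by (intro tendsto_intros char) auto
    moreover have "(CLINT \<omega>|M. fst p * iexp (snd p \<bullet> X n \<omega>) + trig_sum L (X n \<omega>))
      = fst p * (CLINT \<omega>|M. iexp (snd p \<bullet> X n \<omega>)) + (CLINT \<omega>|M. trig_sum L (X n \<omega>))" for n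
      using Cons i1[of "fst p" "snd p" n] by (subst Bochner_Integration.integral_add) auto
    moreover have "(CLINT x|\<mu>. fst p * iexp (snd p \<bullet> x) + trig_sum L x)
      = fst p * (CLINT x|\<mu>. iexp (snd p \<bullet> x)) + (CLINT x|\<mu>. trig_sum L x)"
      using Cons i2[of "fst p" "snd p"] by (subst Bochner_Integration.integral_add) auto
    ultimately show ?case unfolding eq using Cons i1 i2 by (auto intro!: Bochner_Integration.integrable_add)
  qed
  then show "(\<lambda>n. CLINT \<omega>|M. h (X n \<omega>)) \<longlonglongrightarrow> (CLINT x|\<mu>. h x)"
    and "integrable M (\<lambda>\<omega>. h (X n \<omega>))" and "integrable \<mu> h" by (auto simp: L)
qed

theorem converges_in_law_char:
  fixes X :: "nat \<Rightarrow> 'w \<Rightarrow> real^'n"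
  assumes M: "prob_space M" and X: "\<And>n. X n \<in> borel_measurable M"
    and second: "\<And>n. integrable M (\<lambda>\<omega>. (norm (X n \<omega>))\<^sup>2)" "\<And>n. (\<integral>\<omega>. (norm (X n \<omega>))\<^sup>2 \<partial>M) \<le> C"
    and \<mu>: "prob_space \<mu>" "sets \<mu> = sets borel"
    and char: "\<And>a. (\<lambda>n. CLINT \<omega>|M. iexp (a \<bullet> X n \<omega>)) \<longlonglongrightarrow> (CLINT x|\<mu>. iexp (a \<bullet> x))"
  shows "converges_in_law M X \<mu>"
  unfolding converges_in_law_def
proof (intro allI impI)
  interpret M: prob_space M by fact
  interpret \<mu>: prob_space \<mu> by fact
  note [measurable] = X
  have mid [measurable]: "(\<lambda>x. x) \<in> borel_measurable \<mu>" using \<mu>(2) by (simp cong: measurable_cong_sets)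
  fix f :: "real^'n \<Rightarrow> real"
  assume f: "continuous_on UNIV f \<and> bounded (range f)"
  then obtain B0 where "\<And>x. \<bar>f x\<bar> \<le> B0" unfolding bounded_iff by auto
  define B where "B = max B0 1"
  have B: "\<bar>f x\<bar> \<le> B" "B > 0" for x using \<open>\<bar>f x\<bar> \<le> B0\<close> by (auto simp: B_def)
  have fm [measurable]: "f \<in> borel_measurable borel" using f by (intro borel_measurable_continuous_onI) auto
  show "(\<lambda>n. \<integral>\<omega>. f (X n \<omega>) \<partial>M) \<longlonglongrightarrow> (\<integral>x. f x \<partial>\<mu>)"
  proof (rule LIMSEQ_I)
    fix r :: real assume r: "r > 0"
    \<comment> \<open>Five errors have to fit into \<open>r\<close>: two for replacing
      \<open>f\<close> by \<open>P\<close> under the law of \<open>X n\<close>, two for the same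
      under \<open>\<mu>\<close>, and one for the convergence of the integrals of
      \<open>P\<close>.\<close>
    define \<epsilon> where "\<epsilon> = r / 5"
    define \<delta> where "\<delta> = r / (10 * B)"
    have \<epsilon>: "\<epsilon> > 0" and \<delta>: "\<delta> > 0" "2 * B * \<delta> = \<epsilon>" using r B(2) by (auto simp: \<epsilon>_def \<delta>_def)
    have "(\<lambda>k. \<mu>.prob {x\<in>space \<mu>. norm x \<ge> real k}) \<longlonglongrightarrow> \<mu>.prob (\<Inter>k. {x\<in>space \<mu>. norm x \<ge> real k})"
      by (intro \<mu>.finite_Lim_measure_decseq) (auto simp: decseq_def image_subset_iff)
    also have "(\<Inter>k. {x\<in>space \<mu>. norm x \<ge> real k}) = {}"
    proof -
      have "\<exists>k. \<not> norm x \<ge> real k" for x :: "real^'n" using reals_Archimedean2[of "norm x"] by (auto simp: not_le)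
      then show ?thesis by blast
    qed
    finally have "\<forall>\<^sub>F k in sequentially. \<mu>.prob {x\<in>space \<mu>. norm x \<ge> real k} < \<delta>"
      using \<delta> by (intro order_tendstoD(2)[where y=0]) auto
    then obtain k0 where k0: "\<And>k. k \<ge> k0 \<Longrightarrow> \<mu>.prob {x\<in>space \<mu>. norm x \<ge> real k} < \<delta>"
      by (auto simp: eventually_sequentially)
    obtain k1 :: nat where k1: "real k1 > \<bar>C\<bar> / \<delta>" using reals_Archimedean2 by blast
    \<comment> \<open>\<open>k0\<close> controls the tail of \<open>\<mu>\<close> and
      \<open>k1\<close> the tails of all \<open>X n\<close> by Markov's inequality for the square;
      \<open>T \<ge> 1\<close> allows \<open>T\<^sup>2\<close> to be replaced by
      \<open>T\<close>.\<close>
    define T where "T = real (max k0 (max k1 1))"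
    have T: "T \<ge> 1" "T > 0" "T \<ge> real k1" by (auto simp: T_def)
    have \<mu>T: "\<mu>.prob {x\<in>space \<mu>. norm x \<ge> T} \<le> \<delta>" unfolding T_def by (rule less_imp_le[OF k0]) simp
    have MT: "M.prob {\<omega>\<in>space M. norm (X n \<omega>) \<ge> T} \<le> \<delta>" for n
    proof -
      have "M.prob {\<omega>\<in>space M. (norm (X n \<omega>))\<^sup>2 \<ge> T\<^sup>2} \<le> M.expectation (\<lambda>\<omega>. (norm (X n \<omega>))\<^sup>2) / T\<^sup>2"
        using T second(1) by (intro integral_Markov_inequality_measure[where A="{}"]) auto
      also have "\<dots> \<le> \<bar>C\<bar> / T\<^sup>2" using second(2)[of n] by (intro divide_right_mono) auto
      also have "\<dots> \<le> \<bar>C\<bar> / T" using T by (intro divide_left_mono) (auto simp: power2_eq_square)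
      also have "\<dots> \<le> \<delta>"
      proof -
        have "\<bar>C\<bar> / \<delta> \<le> T" using k1 T by linarith
        then show ?thesis using \<delta> T by (simp add: field_simps)
      qed
      also have "{\<omega>\<in>space M. (norm (X n \<omega>))\<^sup>2 \<ge> T\<^sup>2} = {\<omega>\<in>space M. norm (X n \<omega>) \<ge> T}"
        using T by (auto simp: abs_le_square_iff[symmetric])
      finally show ?thesis .
    qed
    obtain P where P: "trig_fun (\<lambda>x. of_real (P x))" "continuous_on UNIV P"
      "\<And>x. \<bar>f x - P x\<bar> \<le> \<epsilon> + 2 * B * indicator {x. norm x \<ge> T} x"
      using trig_approximation[of f B T \<epsilon>] f B T \<epsilon> by blast
    note trig = tendsto_integral_trig_fun[OF M X \<mu> char P(1)]
    have intP: "integrable M (\<lambda>\<omega>. P (X n \<omega>))" for n using trig(2)[of n] by (simp add: complex_of_real_integrable_eq)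
    have intP\<mu>: "integrable \<mu> P" using trig(3) by (simp add: complex_of_real_integrable_eq)
    have "(\<lambda>n. complex_of_real (\<integral>\<omega>. P (X n \<omega>) \<partial>M)) \<longlonglongrightarrow> of_real (\<integral>x. P x \<partial>\<mu>)"
      using trig(1) by (simp add: integral_complex_of_real)
    then have "(\<lambda>n. \<integral>\<omega>. P (X n \<omega>) \<partial>M) \<longlonglongrightarrow> (\<integral>x. P x \<partial>\<mu>)" by (simp only: tendsto_of_real_iff)
    from LIMSEQ_D[OF this \<epsilon>] obtain n0 where n0: "\<And>n. n \<ge> n0 \<Longrightarrow> \<bar>(\<integral>\<omega>. P (X n \<omega>) \<partial>M) - (\<integral>x. P x \<partial>\<mu>)\<bar> < \<epsilon>"
      by auto
    have d1: "\<bar>(\<integral>\<omega>. f (X n \<omega>) \<partial>M) - (\<integral>\<omega>. P (X n \<omega>) \<partial>M)\<bar> \<le> 2 * \<epsilon>" for n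
    proof -
      have intf: "integrable M (\<lambda>\<omega>. f (X n \<omega>))" using B by (intro M.integrable_const_bound[of _ B]) auto
      have inti: "integrable M (\<lambda>\<omega>. indicator {x. norm x \<ge> T} (X n \<omega>) :: real)"
        by (intro M.integrable_const_bound[of _ 1]) (auto simp: indicator_def)
      have "\<bar>(\<integral>\<omega>. f (X n \<omega>) \<partial>M) - (\<integral>\<omega>. P (X n \<omega>) \<partial>M)\<bar> = \<bar>\<integral>\<omega>. f (X n \<omega>) - P (X n \<omega>) \<partial>M\<bar>"
        using intf intP by simp
      also have "\<dots> \<le> (\<integral>\<omega>. \<bar>f (X n \<omega>) - P (X n \<omega>)\<bar> \<partial>M)" by (rule integral_abs_bound)
      also have "\<dots> \<le> (\<integral>\<omega>. \<epsilon> + 2 * B * indicator {x. norm x \<ge> T} (X n \<omega>) \<partial>M)"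
        using intf intP inti P(3) by (intro integral_mono) auto
      also have "\<dots> = \<epsilon> + 2 * B * (\<integral>\<omega>. indicator {x. norm x \<ge> T} (X n \<omega>) \<partial>M)"
        using inti by (simp add: M.prob_space)
      also have "(\<integral>\<omega>. indicator {x. norm x \<ge> T} (X n \<omega>) \<partial>M) = (\<integral>\<omega>. indicator {\<omega>\<in>space M. norm (X n \<omega>) \<ge> T} \<omega> \<partial>M)"
        by (intro Bochner_Integration.integral_cong) (auto simp: indicator_def)
      also have "\<dots> = M.prob ({\<omega>\<in>space M. norm (X n \<omega>) \<ge> T} \<inter> space M)" by (rule Bochner_Integration.integral_indicator)
      also have "{\<omega>\<in>space M. norm (X n \<omega>) \<ge> T} \<inter> space M = {\<omega>\<in>space M. norm (X n \<omega>) \<ge> T}" by blast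
      also have "\<epsilon> + 2 * B * M.prob {\<omega>\<in>space M. norm (X n \<omega>) \<ge> T} \<le> \<epsilon> + 2 * B * \<delta>" using MT[of n] B(2) by (intro add_left_mono mult_left_mono) auto
      finally show ?thesis using \<delta> by simp
    qed
    have d2: "\<bar>(\<integral>x. f x \<partial>\<mu>) - (\<integral>x. P x \<partial>\<mu>)\<bar> \<le> 2 * \<epsilon>"
    proof -
      have intf: "integrable \<mu> f" using B by (intro \<mu>.integrable_const_bound[of _ B]) (auto intro: measurable_compose[OF mid])
      have inti: "integrable \<mu> (\<lambda>x. indicator {x. norm x \<ge> T} x :: real)"
        by (intro \<mu>.integrable_const_bound[of _ 1]) (auto simp: indicator_def intro: measurable_compose[OF mid])
      have "\<bar>(\<integral>x. f x \<partial>\<mu>) - (\<integral>x. P x \<partial>\<mu>)\<bar> = \<bar>\<integral>x. f x - P x \<partial>\<mu>\<bar>"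
        using intf intP\<mu> by simp
      also have "\<dots> \<le> (\<integral>x. \<bar>f x - P x\<bar> \<partial>\<mu>)" by (rule integral_abs_bound)
      also have "\<dots> \<le> (\<integral>x. \<epsilon> + 2 * B * indicator {x. norm x \<ge> T} x \<partial>\<mu>)"
        using intf intP\<mu> inti P(3) by (intro integral_mono) auto
      also have "\<dots> = \<epsilon> + 2 * B * (\<integral>x. indicator {x. norm x \<ge> T} x \<partial>\<mu>)"
        using inti by (simp add: \<mu>.prob_space)
      also have "(\<integral>x. indicator {x. norm x \<ge> T} x \<partial>\<mu>) = (\<integral>\<omega>. indicator {\<omega>\<in>space \<mu>. norm \<omega> \<ge> T} \<omega> \<partial>\<mu>)"
        by (intro Bochner_Integration.integral_cong) (auto simp: indicator_def)
      also have "\<dots> = \<mu>.prob ({\<omega>\<in>space \<mu>. norm \<omega> \<ge> T} \<inter> space \<mu>)" by (rule Bochner_Integration.integral_indicator)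
      also have "{\<omega>\<in>space \<mu>. norm \<omega> \<ge> T} \<inter> space \<mu> = {\<omega>\<in>space \<mu>. norm \<omega> \<ge> T}" by blast
      also have "\<epsilon> + 2 * B * \<mu>.prob {\<omega>\<in>space \<mu>. norm \<omega> \<ge> T} \<le> \<epsilon> + 2 * B * \<delta>" using \<mu>T B(2) by (intro add_left_mono mult_left_mono) auto
      finally show ?thesis using \<delta> by simp
    qed
    show "\<exists>n0. \<forall>n\<ge>n0. norm ((\<integral>\<omega>. f (X n \<omega>) \<partial>M) - (\<integral>x. f x \<partial>\<mu>)) < r"
    proof (intro exI[of _ n0] allI impI)
      fix n assume "n \<ge> n0"
      then show "norm ((\<integral>\<omega>. f (X n \<omega>) \<partial>M) - (\<integral>x. f x \<partial>\<mu>)) < r"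
        using n0[of n] d1[of n] d2 unfolding \<epsilon>_def real_norm_def by linarith
    qed
  qed
qed

section \<open>Growth factors\<close>

lemma sum_inverse_squares_le: "(\<Sum>j<n. 1 / (real j + 1)\<^sup>2) \<le> 2"
proof -
  have shift: "(\<Sum>j<m. 1 / (real (Suc j) + 1)\<^sup>2) \<le> 1 - 1 / (real m + 1)" for m
  proof (induction m)
    case (Suc m)
    have "1 / (real (Suc m) + 1)\<^sup>2 \<le> 1 / ((real m + 1) * (real m + 2))"
      by (intro divide_left_mono) (auto simp: power2_eq_square intro!: mult_mono)
    also have "\<dots> = 1 / (real m + 1) - 1 / (real m + 2)" by (simp add: field_simps)
    finally show ?case using Suc by (simp add: add.commute)
  qed simp
  show ?thesis
  proof (cases n)
    case (Suc m)
    have "1 - 1 / (real m + 1) \<le> 1" by simp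
    with shift[of m] have "(\<Sum>j<m. 1 / (real (Suc j) + 1)\<^sup>2) \<le> 1" by (rule order_trans)
    then show ?thesis unfolding Suc by (subst sum.lessThan_Suc_shift) (simp add: o_def)
  qed simp
qed

text \<open>Comparison with the integral of the power over one unit interval, by the mean value
  theorem. \<open>powr_neg_le_diff_tail\<close> is the version for exponents above 1, where the
  integral is taken towards infinity.\<close>

lemma powr_neg_le_diff:
  fixes r x :: real
  assumes "0 \<le> r" "r < 1" "x > 0"
  shows "(x + 1) powr - r \<le> ((x + 1) powr (1 - r) - x powr (1 - r)) / (1 - r)"
proof -
  obtain z where z: "x < z" "z < x + 1"
    "(x + 1) powr (1 - r) - x powr (1 - r) = (x + 1 - x) * ((1 - r) * z powr (1 - r - 1))"
    using MVT2[of x "x + 1" "\<lambda>t. t powr (1 - r)" "\<lambda>t. (1 - r) * t powr (1 - r - 1)"] assms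
    by (force intro!: derivative_eq_intros simp: field_simps)
  have "(x + 1) powr - r \<le> z powr - r" using z assms by (intro powr_mono2') auto
  also have "\<dots> = ((x + 1) powr (1 - r) - x powr (1 - r)) / (1 - r)" using z(3) assms by simp
  finally show ?thesis .
qed

lemma powr_neg_le_diff_tail:
  fixes r x :: real
  assumes "1 < r" "x > 0"
  shows "(x + 1) powr - r \<le> (x powr (1 - r) - (x + 1) powr (1 - r)) / (r - 1)"
proof -
  obtain z where z: "x < z" "z < x + 1"
    "(x + 1) powr (1 - r) - x powr (1 - r) = (x + 1 - x) * ((1 - r) * z powr (1 - r - 1))"
    using MVT2[of x "x + 1" "\<lambda>t. t powr (1 - r)" "\<lambda>t. (1 - r) * t powr (1 - r - 1)"] assms
    by (force intro!: derivative_eq_intros simp: field_simps)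
  have "(x + 1) powr - r \<le> z powr - r" using z assms by (intro powr_mono2') auto
  also have "\<dots> = (x powr (1 - r) - (x + 1) powr (1 - r)) / (r - 1)" using z(3) assms by (simp add: field_simps)
  finally show ?thesis .
qed

lemma sum_powr_neg_le:
  assumes "0 \<le> r" "r < 1"
  shows "(\<Sum>k<n. (real k + 2) powr - r) \<le> (real n + 1) powr (1 - r) / (1 - r)"
proof (induction n)
  case 0
  then show ?case using assms by simp
next
  case (Suc n)
  have "(real n + 2) powr - r \<le> ((real n + 2) powr (1 - r) - (real n + 1) powr (1 - r)) / (1 - r)"
    using powr_neg_le_diff[OF assms, of "real n + 1"] by (simp add: add.commute)
  then show ?case using Suc by (simp add: diff_divide_distrib add_ac)
qed

lemma sum_powr_tail_le:
  assumes "1 < r"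
  shows "(\<Sum>k=N..<n. (real k + 2) powr - r) \<le> (real N + 1) powr (1 - r) / (r - 1)"
proof (cases "N \<le> n")
  case True
  then have "(\<Sum>k=N..<n. (real k + 2) powr - r) \<le> ((real N + 1) powr (1 - r) - (real n + 1) powr (1 - r)) / (r - 1)"
  proof (induction n rule: dec_induct)
    case (step n)
    have "(real n + 2) powr - r \<le> ((real n + 1) powr (1 - r) - (real n + 2) powr (1 - r)) / (r - 1)"
      using powr_neg_le_diff_tail[OF assms, of "real n + 1"] by (simp add: add.commute)
    then show ?case using step by (simp add: diff_divide_distrib add_ac)
  qed simp
  also have "\<dots> \<le> (real N + 1) powr (1 - r) / (r - 1)" using assms by (intro divide_right_mono) auto
  finally show ?thesis .
qed (use assms in simp)

text \<open>The weights \<open>(k + 2) powr - r\<close> add up to order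
  \<open>(n + 1) powr (1 - r)\<close>, so up to a bounded factor this is a weighted mean of a null
  sequence in which each single weight becomes negligible.\<close>

lemma toeplitz_powr:
  fixes \<epsilon> :: "nat \<Rightarrow> real"
  assumes r: "0 \<le> r" "r < 1" and \<epsilon>: "\<epsilon> \<longlonglongrightarrow> 0"
  shows "(\<lambda>n. (real n + 1) powr (r - 1) * (\<Sum>k<n. (real k + 2) powr - r * \<epsilon> k)) \<longlonglongrightarrow> 0"
proof (rule LIMSEQ_I)
  fix e :: real assume e: "e > 0"
  define e' where "e' = e / 2 * (1 - r)"
  have e': "e' > 0" using e r by (simp add: e'_def)
  obtain N where N: "\<And>k. k \<ge> N \<Longrightarrow> \<bar>\<epsilon> k\<bar> < e'" using LIMSEQ_D[OF \<epsilon> e'] by auto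
  define H where "H = (\<Sum>k<N. (real k + 2) powr - r * \<bar>\<epsilon> k\<bar>)"
  have "((\<lambda>x. x powr (r - 1)) \<longlongrightarrow> 0) at_top" using r by (intro tendsto_neg_powr) (auto simp: filterlim_ident)
  moreover have "filterlim (\<lambda>n. real n + 1) at_top sequentially"
    using filterlim_tendsto_add_at_top[OF tendsto_const[of 1] filterlim_real_sequentially] by (simp add: add.commute)
  ultimately have "(\<lambda>n. (real n + 1) powr (r - 1)) \<longlonglongrightarrow> 0" by (rule filterlim_compose)
  then have "(\<lambda>n. (real n + 1) powr (r - 1) * H) \<longlonglongrightarrow> 0" by (rule tendsto_mult_left_zero)
  from LIMSEQ_D[OF this, of "e/2"] e obtain n0 where n0: "\<And>n. n \<ge> n0 \<Longrightarrow> \<bar>(real n + 1) powr (r - 1) * H\<bar> < e/2" by auto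
  show "\<exists>n0. \<forall>n\<ge>n0. norm ((real n + 1) powr (r - 1) * (\<Sum>k<n. (real k + 2) powr - r * \<epsilon> k) - 0) < e"
  proof (intro exI[of _ n0] allI impI)
    fix n assume n: "n \<ge> n0"
    have "\<bar>\<Sum>k<n. (real k + 2) powr - r * \<epsilon> k\<bar> \<le> (\<Sum>k<n. (real k + 2) powr - r * \<bar>\<epsilon> k\<bar>)"
      by (rule order_trans[OF sum_abs]) (simp add: abs_mult)
    also have "\<dots> \<le> (\<Sum>k<n. (if k < N then (real k + 2) powr - r * \<bar>\<epsilon> k\<bar> else 0) + (real k + 2) powr - r * e')"
      using N e' by (intro sum_mono) (auto simp: not_less intro!: mult_left_mono less_imp_le)
    also have "\<dots> = (\<Sum>k\<in>{..<n} \<inter> {..<N}. (real k + 2) powr - r * \<bar>\<epsilon> k\<bar>) + (\<Sum>k<n. (real k + 2) powr - r) * e'"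
      by (simp add: sum.distrib sum_distrib_right sum.inter_restrict lessThan_def)
    also have "\<dots> \<le> H + (real n + 1) powr (1 - r) / (1 - r) * e'"
      unfolding H_def using e' by (intro add_mono sum_mono2 mult_right_mono sum_powr_neg_le r) auto
    finally have "(real n + 1) powr (r - 1) * \<bar>\<Sum>k<n. (real k + 2) powr - r * \<epsilon> k\<bar>
      \<le> (real n + 1) powr (r - 1) * (H + (real n + 1) powr (1 - r) / (1 - r) * e')" by (intro mult_left_mono) auto
    also have "\<dots> = (real n + 1) powr (r - 1) * H + ((real n + 1) powr (r - 1) * (real n + 1) powr (1 - r)) * (e' / (1 - r))"
      by (simp add: algebra_simps)
    also have "(real n + 1) powr (r - 1) * (real n + 1) powr (1 - r) = 1" by (simp flip: powr_add)
    also have "1 * (e' / (1 - r)) = e / 2" using r unfolding e'_def by (metis diff_gt_0_iff_gt less_irrefl mult_1 nonzero_mult_div_cancel_right)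
    also have "(real n + 1) powr (r - 1) * H + e / 2 < e" using n0[OF n] by linarith
    finally show "norm ((real n + 1) powr (r - 1) * (\<Sum>k<n. (real k + 2) powr - r * \<epsilon> k) - 0) < e"
      by (simp add: abs_mult)
  qed
qed

text \<open>The factor by which the conditional mean of \<open>u_form l\<close> is multiplied
  between times \<open>k\<close> and \<open>n\<close> in an urn with initial total
  \<open>K\<close>.\<close>

definition growth :: "real \<Rightarrow> complex \<Rightarrow> nat \<Rightarrow> nat \<Rightarrow> complex" where
  "growth K l k n = (\<Prod>j=k..<n. 1 + l / of_real (K + real j))"

lemma growth_Suc: "k \<le> n \<Longrightarrow> growth K l k (Suc n) = growth K l k n * (1 + l / of_real (K + real n))"
  by (simp add: growth_def)

lemma growth_same [simp]: "growth K l n n = 1"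
  by (simp add: growth_def)

lemma growth_cnj: "growth K (cnj l) k n = cnj (growth K l k n)"
  by (simp add: growth_def)

text \<open>The cost of replacing one factor by a power of \<open>(j + 2) / (j + 1)\<close>, in
  units of \<open>1 / (j + 1)\<^sup>2\<close>. The first summand stems from the square of
  \<open>l / (K + j)\<close>, the second from trading \<open>1 / (K + j)\<close> for an increment of
  the logarithm.\<close>

definition growth_err :: "real \<Rightarrow> complex \<Rightarrow> real" where
  "growth_err K l = (cmod l)\<^sup>2 / 2 + \<bar>Re l\<bar> * (K + 1)"

text \<open>Increments of the logarithm telescope, and the errors are summable; this yields growth
  of exact power order with explicit constants.\<close>

lemma inverse_minus_ln_bound:
  assumes "K \<ge> 1"
  shows "\<bar>1 / (K + real j) - ln ((real j + 2) / (real j + 1))\<bar> \<le> (K + 1) / (real j + 1)\<^sup>2"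
proof -
  define x where "x = 1 / (real j + 1)"
  have x: "0 < x" "x \<le> 1" by (auto simp: x_def)
  have "(real j + 2) / (real j + 1) = 1 + x" by (simp add: x_def field_simps)
  moreover have "x - x\<^sup>2 \<le> ln (1 + x)" using x by (intro ln_one_plus_pos_lower_bound) auto
  moreover have "ln (1 + x) \<le> x" using x by (intro ln_add_one_self_le_self) auto
  ultimately have 1: "\<bar>x - ln ((real j + 2) / (real j + 1))\<bar> \<le> 1 / (real j + 1)\<^sup>2"
    by (simp add: x_def power_divide)
  have "x - 1 / (K + real j) = (K - 1) / ((K + real j) * (real j + 1))"
    using assms by (simp add: x_def field_simps)
  also have "\<dots> \<le> K / ((real j + 1) * (real j + 1))"
    using assms by (intro frac_le mult_mono) auto
  finally have "x - 1 / (K + real j) \<le> K / (real j + 1)\<^sup>2" by (simp add: power2_eq_square)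
  moreover have "x - 1 / (K + real j) \<ge> 0" using assms by (simp add: x_def frac_le)
  ultimately show ?thesis using 1 by (simp add: add_divide_distrib)
qed

lemma growth_factor_upper:
  assumes "K \<ge> 1"
  shows "cmod (1 + l / of_real (K + real j)) \<le> ((real j + 2) / (real j + 1)) powr Re l * exp (growth_err K l / (real j + 1)\<^sup>2)"
proof -
  define y where "y = K + real j"
  define q where "q = ln ((real j + 2) / (real j + 1))"
  have y: "y \<ge> real j + 1" "y > 0" using assms by (auto simp: y_def)
  have "(cmod (1 + l / of_real y))\<^sup>2 = 1 + 2 * Re l / y + (cmod l)\<^sup>2 / y\<^sup>2"
    using y unfolding cmod_power2 by (simp add: power2_eq_square field_simps)
  also have "\<dots> \<le> exp (2 * Re l / y + (cmod l)\<^sup>2 / y\<^sup>2)"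
    by (rule order_trans[OF _ exp_ge_add_one_self]) simp
  also have "\<dots> = (exp (Re l / y + (cmod l)\<^sup>2 / (2 * y\<^sup>2)))\<^sup>2"
    by (simp add: power2_eq_square flip: exp_add)
  finally have "cmod (1 + l / of_real y) \<le> exp (Re l / y + (cmod l)\<^sup>2 / (2 * y\<^sup>2))"
    by (rule power2_le_imp_le) simp
  also have "Re l / y + (cmod l)\<^sup>2 / (2 * y\<^sup>2) \<le> Re l * q + growth_err K l / (real j + 1)\<^sup>2"
  proof -
    have "Re l / y - Re l * q = Re l * (1 / y - q)" by (simp add: algebra_simps)
    also have "\<dots> \<le> \<bar>Re l\<bar> * \<bar>1 / y - q\<bar>" by (metis abs_ge_self abs_mult)
    also have "\<dots> \<le> \<bar>Re l\<bar> * ((K + 1) / (real j + 1)\<^sup>2)"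
      unfolding y_def q_def by (intro mult_left_mono inverse_minus_ln_bound assms) auto
    finally have a: "Re l / y \<le> Re l * q + \<bar>Re l\<bar> * (K + 1) / (real j + 1)\<^sup>2" by simp
    have "(real j + 1)\<^sup>2 \<le> y\<^sup>2" using y by (intro power_mono) auto
    then have "(cmod l)\<^sup>2 / (2 * y\<^sup>2) \<le> (cmod l)\<^sup>2 / (2 * (real j + 1)\<^sup>2)"
      using y by (intro divide_left_mono) (auto intro!: mult_pos_pos)
    also have "\<dots> = (cmod l)\<^sup>2 / 2 / (real j + 1)\<^sup>2" by simp
    finally show ?thesis using a unfolding growth_err_def add_divide_distrib by linarith
  qed
  also have "exp (Re l * q + growth_err K l / (real j + 1)\<^sup>2) = ((real j + 2) / (real j + 1)) powr Re l * exp (growth_err K l / (real j + 1)\<^sup>2)"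
    by (simp add: exp_add powr_def q_def)
  finally show ?thesis by (simp add: y_def)
qed

text \<open>Only the real part \<open>1 + x\<close> of the factor is kept, with \<open>x\<close>
  between 0 and 1, where \<open>x - x\<^sup>2 \<le> ln (1 + x)\<close> holds.\<close>

lemma growth_factor_lower:
  assumes "K \<ge> 1" "0 \<le> Re l" "Re l \<le> 1"
  shows "cmod (1 + l / of_real (K + real j)) \<ge> ((real j + 2) / (real j + 1)) powr Re l * exp (- (K + 2) / (real j + 1)\<^sup>2)"
proof -
  define y where "y = K + real j"
  define q where "q = ln ((real j + 2) / (real j + 1))"
  have y: "y \<ge> real j + 1" "y \<ge> 1" using assms by (auto simp: y_def)
  define x where "x = Re l / y"
  have x: "0 \<le> x" "x \<le> 1" using assms y by (auto simp: x_def)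
  have "x\<^sup>2 \<le> 1 / (real j + 1)\<^sup>2"
  proof -
    have "x \<le> 1 / (real j + 1)" unfolding x_def using assms y by (intro frac_le) auto
    then have "x\<^sup>2 \<le> (1 / (real j + 1))\<^sup>2" using x by (intro power_mono)
    then show ?thesis by (simp add: power_divide)
  qed
  moreover have "Re l * (q - 1 / y) \<le> (K + 1) / (real j + 1)\<^sup>2"
  proof -
    have "Re l * (q - 1 / y) \<le> Re l * \<bar>1 / y - q\<bar>" using assms by (intro mult_left_mono) auto
    also have "\<dots> \<le> 1 * ((K + 1) / (real j + 1)\<^sup>2)"
      unfolding y_def q_def using assms by (intro mult_mono inverse_minus_ln_bound) auto
    finally show ?thesis by simp
  qed
  moreover have "Re l * (q - 1 / y) = Re l * q - x" by (simp add: x_def algebra_simps)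
  moreover have "x - x\<^sup>2 \<le> ln (1 + x)" using x by (intro ln_one_plus_pos_lower_bound) auto
  ultimately have "Re l * q + (- (K + 2) / (real j + 1)\<^sup>2) \<le> ln (1 + x)"
    by (simp add: add_divide_distrib diff_divide_distrib)
  then have "exp (Re l * q + (- (K + 2) / (real j + 1)\<^sup>2)) \<le> exp (ln (1 + x))" by simp
  also have "\<dots> = 1 + x" using x by simp
  also have "\<dots> = Re (1 + l / of_real y)" by (simp add: x_def)
  also have "\<dots> \<le> cmod (1 + l / of_real y)" by (rule complex_Re_le_cmod)
  finally show ?thesis by (simp only: exp_add powr_def q_def y_def) simp
qed

lemma prod_growth_powr:
  assumes "k \<le> n"
  shows "(\<Prod>j=k..<n. ((real j + 2) / (real j + 1)) powr a * exp (c / (real j + 1)\<^sup>2))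
    = ((real n + 1) / (real k + 1)) powr a * exp (c * (\<Sum>j=k..<n. 1 / (real j + 1)\<^sup>2))"
  using assms
proof (induction n rule: dec_induct)
  case (step n)
  have "((real n + 1) / (real k + 1)) powr a * ((real n + 2) / (real n + 1)) powr a = ((real n + 2) / (real k + 1)) powr a"
    by (subst powr_mult[symmetric]) auto
  then show ?case using step by (simp add: exp_add algebra_simps)
qed simp

lemma sum_inverse_squares_between: "0 \<le> (\<Sum>j=k..<n. 1 / (real j + 1)\<^sup>2)" "(\<Sum>j=k..<n. 1 / (real j + 1)\<^sup>2) \<le> 2"
proof -
  have "(\<Sum>j=k..<n. 1 / (real j + 1)\<^sup>2) \<le> (\<Sum>j<n. 1 / (real j + 1)\<^sup>2)" by (intro sum_mono2) auto
  then show "(\<Sum>j=k..<n. 1 / (real j + 1)\<^sup>2) \<le> 2" using sum_inverse_squares_le[of n] by linarith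
qed (intro sum_nonneg, simp)

lemma growth_upper:
  assumes "K \<ge> 1" "k \<le> n"
  shows "cmod (growth K l k n) \<le> exp (2 * growth_err K l) * ((real n + 1) / (real k + 1)) powr Re l"
proof -
  have "cmod (growth K l k n) \<le> (\<Prod>j=k..<n. ((real j + 2) / (real j + 1)) powr Re l * exp (growth_err K l / (real j + 1)\<^sup>2))"
    unfolding growth_def prod_norm[symmetric] using assms(1)
    by (intro prod_mono conjI growth_factor_upper) auto
  also have "\<dots> = ((real n + 1) / (real k + 1)) powr Re l * exp (growth_err K l * (\<Sum>j=k..<n. 1 / (real j + 1)\<^sup>2))"
    by (rule prod_growth_powr[OF assms(2)])
  also have "\<dots> \<le> ((real n + 1) / (real k + 1)) powr Re l * exp (growth_err K l * 2)"
  proof -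
    have "growth_err K l \<ge> 0" using assms(1) by (simp add: growth_err_def)
    then have "growth_err K l * (\<Sum>j=k..<n. 1 / (real j + 1)\<^sup>2) \<le> growth_err K l * 2"
      using sum_inverse_squares_between[of k n] by (intro mult_left_mono)
    then show ?thesis by (simp add: mult_left_mono)
  qed
  finally show ?thesis by (simp add: mult_ac)
qed

lemma growth_lower:
  assumes "K \<ge> 1" "0 \<le> Re l" "Re l \<le> 1"
  shows "cmod (growth K l 0 n) \<ge> exp (- 2 * (K + 2)) * (real n + 1) powr Re l"
proof -
  have "(real n + 1) powr Re l * exp (- (K + 2) * 2) \<le> ((real n + 1) / (real 0 + 1)) powr Re l * exp (- (K + 2) * (\<Sum>j=0..<n. 1 / (real j + 1)\<^sup>2))"
  proof -
    have "(K + 2) * (\<Sum>j=0..<n. 1 / (real j + 1)\<^sup>2) \<le> (K + 2) * 2"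
      using assms(1) sum_inverse_squares_between[of 0 n] by (intro mult_left_mono) auto
    then have "- (K + 2) * 2 \<le> - (K + 2) * (\<Sum>j=0..<n. 1 / (real j + 1)\<^sup>2)" by linarith
    then show ?thesis by (simp add: mult_left_mono)
  qed
  also have "\<dots> = (\<Prod>j=0..<n. ((real j + 2) / (real j + 1)) powr Re l * exp (- (K + 2) / (real j + 1)\<^sup>2))"
    by (rule prod_growth_powr[symmetric]) simp
  also have "\<dots> \<le> cmod (growth K l 0 n)"
    unfolding growth_def prod_norm[symmetric] using growth_factor_lower[OF assms]
    by (intro prod_mono) auto
  finally show ?thesis by (simp add: mult_ac)
qed

section \<open>The gap process\<close>

lemma countable_nonzero_nat_vecs: "countable (nonzero_nat_vecs :: (real^'m::{finite,linorder}) set)"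
proof -
  have "countable {x::real^'m::{finite,linorder}. \<forall>i. x $ i \<in> \<nat>}"
  proof (rule countable_subset)
    show "{x::real^'m::{finite,linorder}. \<forall>i. x $ i \<in> \<nat>} \<subseteq> (\<lambda>f. \<chi> i. f i) ` (UNIV \<rightarrow>\<^sub>E \<nat>)"
    proof
      fix x :: "real^'m::{finite,linorder}" assume "x \<in> {x. \<forall>i. x $ i \<in> \<nat>}"
      then have "($) x \<in> UNIV \<rightarrow>\<^sub>E \<nat>" by auto
      moreover have "x = (\<chi> i. x $ i)" by simp
      ultimately show "x \<in> (\<lambda>f. \<chi> i. f i) ` (UNIV \<rightarrow>\<^sub>E \<nat>)" by (metis image_eqI)
    qed
    show "countable ((\<lambda>f. \<chi> i. f i :: real^'m::{finite,linorder}) ` (UNIV \<rightarrow>\<^sub>E \<nat>))"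
      by (intro countable_image countable_PiE) (auto simp: Nats_def)
  qed
  then show ?thesis by (rule countable_subset[rotated]) (auto simp: nonzero_nat_vecs_def)
qed

lemma nonzero_nat_vecs_nonneg: "x \<in> nonzero_nat_vecs \<Longrightarrow> x $ i \<ge> 0"
  by (auto simp: nonzero_nat_vecs_def elim!: Nats_cases) (metis Nats_cases of_nat_0_le_iff)

lemma coord_sum_ge_1:
  assumes "x \<in> (nonzero_nat_vecs :: (real^'m::{finite,linorder}) set)" shows "coord_sum x \<ge> 1"
proof -
  obtain i where "x $ i \<noteq> 0" using assms by (auto simp: nonzero_nat_vecs_def vec_eq_iff)
  moreover have "x $ i \<in> \<nat>" using assms by (auto simp: nonzero_nat_vecs_def)
  ultimately have "1 \<le> x $ i" by (auto elim!: Nats_cases)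
  also have "\<dots> \<le> coord_sum x"
    unfolding coord_sum_def using nonzero_nat_vecs_nonneg[OF assms] by (intro member_le_sum) auto
  finally show ?thesis .
qed

lemma coord_sum_add: "coord_sum (x + y) = coord_sum x + coord_sum y"
  by (simp add: coord_sum_def sum.distrib)

text \<open>A sum in place of a maximum; it serves as a common bound for the coefficients.\<close>

definition u_max :: "nat \<Rightarrow> complex \<Rightarrow> real" where
  "u_max n l = (\<Sum>k=1..n. cmod (u_coeff n l k))"

lemma u_coeff_le_max:
  fixes i :: "'m::{finite,linorder}"
  shows "cmod (u_coeff CARD('m) l (idx i)) \<le> u_max CARD('m) l"
  unfolding u_max_def using idx_ge_1[of i] idx_le[of i]
  by (intro member_le_sum[of "idx i" _ "\<lambda>k. cmod (u_coeff CARD('m) l k)"]) auto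

lemma u_max_nonneg: "u_max n l \<ge> 0"
  unfolding u_max_def by (intro sum_nonneg) auto

abbreviation gap_prob :: "real^'m::{finite,linorder} \<Rightarrow> 'm \<Rightarrow> real" where
  "gap_prob \<equiv> \<lambda>x i. x $ i / coord_sum x"

abbreviation gap_step :: "'m::{finite,linorder} \<Rightarrow> real^'m::{finite,linorder}" where
  "gap_step \<equiv> \<lambda>i. row i R_mat"

locale gap_urn = step_chain M "nonzero_nat_vecs :: (real^'m::{finite,linorder}) set" gap_prob gap_step x0 G
  for M :: "'w measure" and x0 :: "real^'m::{finite,linorder}" and G +
  assumes m_ge_2: "CARD('m) \<ge> 2" and x0: "x0 \<in> nonzero_nat_vecs"

lemma gap_urnI:
  fixes x0 :: "real^'m::{finite,linorder}"
  assumes "CARD('m) \<ge> 2" "x0 \<in> nonzero_nat_vecs" "gap_process M x0 G"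
  shows "gap_urn M x0 G"
proof -
  have "prob_space M" using assms(3) by (simp add: gap_process_def markov_chain_def)
  moreover have "step_chain_axioms M nonzero_nat_vecs gap_prob (gap_step :: 'm::{finite,linorder} \<Rightarrow> _) x0 G"
  proof
    show "markov_chain M nonzero_nat_vecs (step_prob gap_prob gap_step) x0 G"
      using assms(3) by (simp add: gap_process_def)
    show "countable (nonzero_nat_vecs :: (real^'m::{finite,linorder}) set)" by (rule countable_nonzero_nat_vecs)
  next
    fix x :: "real^'m::{finite,linorder}" and i assume "x \<in> nonzero_nat_vecs"
    then show "0 \<le> x $ i / coord_sum x"
      using nonzero_nat_vecs_nonneg[of x i] coord_sum_ge_1[of x] by simp
  next
    fix x :: "real^'m::{finite,linorder}" assume "x \<in> nonzero_nat_vecs"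
    then show "(\<Sum>i\<in>UNIV. x $ i / coord_sum x) = 1"
      using coord_sum_ge_1[of x] by (simp flip: sum_divide_distrib add: coord_sum_def[symmetric])
  qed
  ultimately have "step_chain M nonzero_nat_vecs gap_prob (gap_step :: 'm::{finite,linorder} \<Rightarrow> _) x0 G"
    by (simp add: step_chain_def)
  then show ?thesis using assms by (simp add: gap_urn_def gap_urn_axioms_def)
qed

context gap_urn
begin

definition K :: real where "K = coord_sum x0"

lemma K_ge_1: "K \<ge> 1"
  using coord_sum_ge_1[OF x0] by (simp add: K_def)

text \<open>Contains the states reached at time \<open>n\<close> almost surely. Balance makes the
  total deterministic, so the recursion for the forms has deterministic factors.\<close>

definition level :: "nat \<Rightarrow> (real^'m::{finite,linorder}) set" where
  "level n = {x\<in>nonzero_nat_vecs. coord_sum x = K + real n}"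

lemma level_subset: "level n \<subseteq> nonzero_nat_vecs"
  by (auto simp: level_def)

lemma AE_coord_sum: "AE \<omega> in M. coord_sum (G n \<omega>) = K + real n"
proof (induction n)
  case 0
  show ?case using AE_X_0 by eventually_elim (simp add: K_def)
next
  case (Suc n)
  show ?case using Suc AE_step[of n]
    by eventually_elim (auto simp: coord_sum_add coord_sum_row[OF m_ge_2])
qed

lemma AE_level: "AE \<omega> in M. G n \<omega> \<in> level n"
  using AE_coord_sum[of n] AE_space by eventually_elim (auto simp: level_def X_in_S)

lemma u_form_le:
  assumes "x \<in> nonzero_nat_vecs"
  shows "cmod (u_form l (x :: real^'m::{finite,linorder})) \<le> u_max CARD('m) l * coord_sum x"
proof -
  have "cmod (u_form l x) \<le> (\<Sum>i\<in>UNIV. u_max CARD('m) l * x $ i)"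
    unfolding u_form_eq using nonzero_nat_vecs_nonneg[OF assms]
    by (intro sum_norm_le) (auto simp: norm_mult intro!: mult_right_mono u_coeff_le_max)
  then show ?thesis by (simp add: coord_sum_def sum_distrib_left)
qed

text \<open>The deviation of \<open>u_form l\<close> after one step from its conditional mean, which
  is \<open>1 + l / coord_sum x\<close> times the old value.\<close>

definition incr :: "complex \<Rightarrow> real^'m::{finite,linorder} \<Rightarrow> real^'m::{finite,linorder} \<Rightarrow> complex" where
  "incr l x y = u_form l y - (1 + l / of_real (coord_sum x)) * u_form l x"

lemma incr_step:
  assumes "poly (chi_poly CARD('m)) l = 0"
  shows "incr l x (x + gap_step i) = l * (u_coeff CARD('m) l (idx i) - u_form l x / of_real (coord_sum x))"
  unfolding incr_def u_form_add u_form_row[OF m_ge_2 assms] by (simp add: algebra_simps)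

lemma incr_mean:
  assumes "poly (chi_poly CARD('m)) l = 0" "x \<in> nonzero_nat_vecs"
  shows "(\<Sum>i\<in>UNIV. gap_prob x i *\<^sub>R incr l x (x + gap_step i)) = 0"
proof -
  have "(\<Sum>i\<in>UNIV. gap_prob x i *\<^sub>R incr l x (x + gap_step i))
    = l * (\<Sum>i\<in>UNIV. of_real (gap_prob x i) * u_coeff CARD('m) l (idx i)) - l * (u_form l x / of_real (coord_sum x)) * of_real (\<Sum>i\<in>UNIV. gap_prob x i)"
    unfolding incr_step[OF assms(1)] scaleR_conv_of_real
    by (simp add: algebra_simps sum_subtractf sum_distrib_left sum_distrib_right)
  also have "(\<Sum>i\<in>UNIV. of_real (gap_prob x i) * u_coeff CARD('m) l (idx i)) = u_form l x / of_real (coord_sum x)"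
    unfolding u_form_eq sum_divide_distrib by (intro sum.cong) auto
  finally show ?thesis using q_sum[OF assms(2)] by simp
qed

lemma incr_bound:
  assumes "poly (chi_poly CARD('m)) l = 0" "x \<in> nonzero_nat_vecs"
  shows "cmod (incr l x (x + gap_step i)) \<le> 2 * cmod l * u_max CARD('m) l"
proof -
  have "cmod (u_coeff CARD('m) l (idx i) - u_form l x / of_real (coord_sum x)) \<le> u_max CARD('m) l + u_max CARD('m) l"
  proof (rule order_trans[OF norm_triangle_ineq4 add_mono[OF u_coeff_le_max]])
    show "cmod (u_form l x / of_real (coord_sum x)) \<le> u_max CARD('m) l"
      using u_form_le[OF assms(2), of l] coord_sum_ge_1[OF assms(2)] by (simp add: norm_divide field_simps)
  qed
  then have "cmod l * cmod (u_coeff CARD('m) l (idx i) - u_form l x / of_real (coord_sum x)) \<le> cmod l * (u_max CARD('m) l + u_max CARD('m) l)"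
    by (intro mult_left_mono) auto
  then show ?thesis unfolding incr_step[OF assms(1)] norm_mult by simp
qed

text \<open>Variation of constants: the increment made at step \<open>k\<close> enters at time
  \<open>k + 1\<close> and is carried to time \<open>n\<close> by the remaining factors.\<close>

lemma u_form_expansion:
  assumes "poly (chi_poly CARD('m)) l = 0"
  shows "AE \<omega> in M. u_form l (G n \<omega>) = growth K l 0 n * u_form l x0
    + msum (\<lambda>k x y. growth K l (Suc k) n * incr l x y) n \<omega>"
proof (induction n)
  case 0
  show ?case using AE_X_0 by eventually_elim (simp add: msum_def)
next
  case (Suc n)
  show ?case using Suc AE_coord_sum[of n]
  proof eventually_elim
    case (elim \<omega>)
    let ?f = "1 + l / of_real (K + real n)"
    have "u_form l (G (Suc n) \<omega>) = ?f * u_form l (G n \<omega>) + incr l (G n \<omega>) (G (Suc n) \<omega>)"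
      using elim(2) by (simp add: incr_def)
    also have "?f * u_form l (G n \<omega>) = growth K l 0 (Suc n) * u_form l x0 + (\<Sum>k<n. growth K l (Suc k) (Suc n) * incr l (G k \<omega>) (G (Suc k) \<omega>))"
      unfolding elim(1) msum_def by (simp add: growth_Suc sum_distrib_left distrib_left mult_ac)
    finally show ?case by (simp add: msum_def add_ac)
  qed
qed

lemma growth_sq_le:
  assumes "Re l \<le> r" "k < n"
  shows "(cmod (growth K l (Suc k) n))\<^sup>2 \<le> (exp (2 * growth_err K l))\<^sup>2 * (real n + 1) powr (2 * r) * (real k + 2) powr - (2 * r)"
proof -
  have "cmod (growth K l (Suc k) n) \<le> exp (2 * growth_err K l) * ((real n + 1) / (real k + 2)) powr Re l"
    using growth_upper[OF K_ge_1, of "Suc k" n l] assms by (simp add: add.commute)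
  also have "\<dots> \<le> exp (2 * growth_err K l) * ((real n + 1) / (real k + 2)) powr r"
    using assms by (intro mult_left_mono powr_mono) (auto simp: field_simps)
  finally have "(cmod (growth K l (Suc k) n))\<^sup>2 \<le> (exp (2 * growth_err K l) * ((real n + 1) / (real k + 2)) powr r)\<^sup>2"
    by (intro power_mono) auto
  also have "\<dots> = (exp (2 * growth_err K l))\<^sup>2 * ((real n + 1) / (real k + 2)) powr (2 * r)"
    by (simp add: power_mult_distrib powr_power mult.commute)
  also have "((real n + 1) / (real k + 2)) powr (2 * r) = (real n + 1) powr (2 * r) * (real k + 2) powr - (2 * r)"
    by (simp add: powr_divide powr_minus field_simps)
  finally show ?thesis by (simp add: mult_ac)
qed

text \<open>This is where 1/2 becomes critical. For \<open>2 * r < 1\<close> the sum over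
  \<open>k\<close> has order \<open>n powr (1 - 2 * r)\<close> and the total is of order
  \<open>n\<close>; for \<open>2 * r > 1\<close> it converges and the prefactor
  \<open>n powr (2 * r)\<close> remains. Using some \<open>r\<close> above \<open>Re l\<close>
  avoids the logarithm of the borderline case.\<close>

lemma growth_sq_sum_le:
  assumes "Re l \<le> r" "2 * r \<noteq> 1" "r \<ge> 0"
  shows "(\<Sum>k<n. (cmod (growth K l (Suc k) n))\<^sup>2)
    \<le> (exp (2 * growth_err K l))\<^sup>2 / \<bar>1 - 2 * r\<bar> * (real n + 1) powr (2 * max r (1/2))"
proof -
  let ?E = "(exp (2 * growth_err K l))\<^sup>2"
  have "(\<Sum>k<n. (cmod (growth K l (Suc k) n))\<^sup>2) \<le> (\<Sum>k<n. ?E * (real n + 1) powr (2 * r) * (real k + 2) powr - (2 * r))"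
    by (intro sum_mono growth_sq_le assms) auto
  also have "\<dots> = ?E * (real n + 1) powr (2 * r) * (\<Sum>k<n. (real k + 2) powr - (2 * r))" by (simp add: sum_distrib_left)
  also have "\<dots> \<le> ?E / \<bar>1 - 2 * r\<bar> * (real n + 1) powr (2 * max r (1/2))"
  proof (cases "2 * r < 1")
    case True
    have "?E * (real n + 1) powr (2 * r) * (\<Sum>k<n. (real k + 2) powr - (2 * r))
      \<le> ?E * (real n + 1) powr (2 * r) * ((real n + 1) powr (1 - 2 * r) / (1 - 2 * r))"
      using True assms by (intro mult_left_mono sum_powr_neg_le) auto
    also have "\<dots> = ?E / (1 - 2 * r) * ((real n + 1) powr (2 * r) * (real n + 1) powr (1 - 2 * r))" by simp
    also have "(real n + 1) powr (2 * r) * (real n + 1) powr (1 - 2 * r) = (real n + 1) powr 1" by (simp flip: powr_add)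
    finally show ?thesis using True by (simp add: max_def)
  next
    case False
    have "(\<Sum>k<n. (real k + 2) powr - (2 * r)) \<le> (real 0 + 1) powr (1 - 2 * r) / (2 * r - 1)"
      using False assms sum_powr_tail_le[of "2 * r" 0 n] by (simp add: atLeast0LessThan)
    then have "?E * (real n + 1) powr (2 * r) * (\<Sum>k<n. (real k + 2) powr - (2 * r)) \<le> ?E * (real n + 1) powr (2 * r) * (1 / (2 * r - 1))"
      by (intro mult_left_mono) auto
    moreover have "2 * r > 1" using False assms by simp
    ultimately show ?thesis by (simp add: max_def)
  qed
  finally show ?thesis .
qed

lemma u_form_moments:
  assumes l: "poly (chi_poly CARD('m)) l = 0" and r: "Re l \<le> r" "2 * r \<noteq> 1" "r \<ge> 0"
  obtains C where "\<And>n. expectation (\<lambda>\<omega>. cmod (u_form l (G n \<omega>)) ^ p) \<le> C * ((real n + 1) powr max r (1/2)) ^ p"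
proof
  define E where "E = exp (2 * growth_err K l)"
  define b where "b = 2 * cmod l * u_max CARD('m) l"
  \<comment> \<open>\<open>h * R\<close> plays the part of \<open>s\<close> in
    \<open>moment_msum_bound_complex\<close>; the \<open>b + 1\<close> keeps it positive even if all
    increments vanish.\<close>
  define h where "h = sqrt (E\<^sup>2 / \<bar>1 - 2 * r\<bar>) * (b + 1)"
  define c where "c = E * cmod (u_form l x0)"
  fix n
  define R where "R = (real n + 1) powr max r (1/2)"
  have b: "b \<ge> 0" unfolding b_def using u_max_nonneg by simp
  have R: "R > 0" by (simp add: R_def)
  have h: "h > 0" using b r by (simp add: h_def E_def)
  let ?D = "\<lambda>k x y. growth K l (Suc k) n * incr l x y"
  have mom: "expectation (\<lambda>\<omega>. cmod (msum ?D n \<omega>) ^ p) \<le> 12 * 2 ^ p * fact p * (h * R) ^ p"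
  proof (rule moment_msum_bound_complex[where A=level and c="\<lambda>k. cmod (growth K l (Suc k) n) * b"])
    show "AE \<omega> in M. G k \<omega> \<in> level k" for k by (rule AE_level)
    show "level k \<subseteq> nonzero_nat_vecs" for k by (rule level_subset)
    show "(\<Sum>i\<in>UNIV. gap_prob x i *\<^sub>R (growth K l (Suc k) n * incr l x (x + gap_step i))) = 0" if "x \<in> level k" for k x
    proof -
      have "(\<Sum>i\<in>UNIV. gap_prob x i *\<^sub>R (growth K l (Suc k) n * incr l x (x + gap_step i)))
        = growth K l (Suc k) n * (\<Sum>i\<in>UNIV. gap_prob x i *\<^sub>R incr l x (x + gap_step i))" by (simp add: sum_distrib_left)
      then show ?thesis using incr_mean[OF l] that level_subset by auto
    qed
    show "cmod (growth K l (Suc k) n * incr l x (x + gap_step i)) \<le> cmod (growth K l (Suc k) n) * b" if "x \<in> level k" for k x i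
      unfolding norm_mult b_def using that level_subset by (intro mult_left_mono incr_bound l) auto
    show "0 < h * R" using h R by simp
    have "(\<Sum>k<n. (cmod (growth K l (Suc k) n) * b)\<^sup>2) = (\<Sum>k<n. (cmod (growth K l (Suc k) n))\<^sup>2) * b\<^sup>2"
      by (simp add: power_mult_distrib sum_distrib_right)
    also have "\<dots> \<le> (E\<^sup>2 / \<bar>1 - 2 * r\<bar> * (real n + 1) powr (2 * max r (1/2))) * (b + 1)\<^sup>2"
      unfolding E_def using b by (intro mult_mono growth_sq_sum_le r power_mono) (auto intro!: divide_nonneg_nonneg mult_nonneg_nonneg)
    also have "(real n + 1) powr (2 * max r (1/2)) = R\<^sup>2" by (simp add: R_def powr_power mult.commute)
    also have "E\<^sup>2 / \<bar>1 - 2 * r\<bar> * R\<^sup>2 * (b + 1)\<^sup>2 = (h * R)\<^sup>2"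
      by (simp add: h_def power_mult_distrib)
    finally show "(\<Sum>k<n. (cmod (growth K l (Suc k) n) * b)\<^sup>2) \<le> (h * R)\<^sup>2" .
  qed
  have det: "cmod (growth K l 0 n * u_form l x0) \<le> c * R"
  proof -
    have "cmod (growth K l 0 n) \<le> E * (real n + 1) powr Re l"
      using growth_upper[OF K_ge_1, of 0 n l] by (simp add: E_def)
    also have "\<dots> \<le> E * R" unfolding R_def E_def using r by (intro mult_left_mono powr_mono) auto
    finally have "cmod (growth K l 0 n) * cmod (u_form l x0) \<le> E * R * cmod (u_form l x0)" by (intro mult_right_mono) auto
    then show ?thesis unfolding norm_mult c_def by (simp add: mult_ac)
  qed
  have c: "c \<ge> 0" by (simp add: c_def E_def)
  have "expectation (\<lambda>\<omega>. cmod (u_form l (G n \<omega>)) ^ p) \<le> expectation (\<lambda>\<omega>. 2 ^ p * ((c * R) ^ p + cmod (msum ?D n \<omega>) ^ p))"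
  proof (rule integral_mono_AE)
    show "integrable M (\<lambda>\<omega>. cmod (u_form l (G n \<omega>)) ^ p)" by (rule integrable_X[of "\<lambda>x. cmod (u_form l x) ^ p"])
    show "integrable M (\<lambda>\<omega>. 2 ^ p * ((c * R) ^ p + cmod (msum ?D n \<omega>) ^ p))"
      by (rule integrable_msum[of "\<lambda>s _. 2 ^ p * ((c * R) ^ p + cmod s ^ p)"])
    show "AE \<omega> in M. cmod (u_form l (G n \<omega>)) ^ p \<le> 2 ^ p * ((c * R) ^ p + cmod (msum ?D n \<omega>) ^ p)"
      using u_form_expansion[OF l, of n]
    proof eventually_elim
      case (elim \<omega>)
      define s where "s = cmod (msum ?D n \<omega>)"
      have "cmod (u_form l (G n \<omega>)) \<le> c * R + s" unfolding elim s_def using det norm_triangle_ineq order_trans add_right_mono by blast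
      also have "\<dots> \<le> 2 * max (c * R) s" by simp
      finally have "cmod (u_form l (G n \<omega>)) ^ p \<le> (2 * max (c * R) s) ^ p" by (intro power_mono) auto
      also have "\<dots> = 2 ^ p * max (c * R) s ^ p" by (simp add: power_mult_distrib)
      also have "max (c * R) s ^ p \<le> (c * R) ^ p + s ^ p" using c R by (cases "c * R \<le> s") (auto simp: s_def max_def)
      finally show ?case by (simp add: s_def)
    qed
  qed
  also have "\<dots> = 2 ^ p * ((c * R) ^ p + expectation (\<lambda>\<omega>. cmod (msum ?D n \<omega>) ^ p))"
    using integrable_msum[of "\<lambda>s _. cmod s ^ p" ?D n] by (simp add: prob_space)
  also have "\<dots> \<le> 2 ^ p * ((c * R) ^ p + 12 * 2 ^ p * fact p * (h * R) ^ p)"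
    using mom by (intro mult_left_mono add_left_mono) auto
  also have "\<dots> = 2 ^ p * (c ^ p + 12 * 2 ^ p * fact p * h ^ p) * R ^ p"
    by (simp add: power_mult_distrib algebra_simps)
  finally show "expectation (\<lambda>\<omega>. cmod (u_form l (G n \<omega>)) ^ p) \<le> 2 ^ p * (c ^ p + 12 * 2 ^ p * fact p * h ^ p) * ((real n + 1) powr max r (1/2)) ^ p"
    by (simp add: R_def)
qed

end

section \<open>Limits almost surely and in \<open>L\<^sup>p\<close>\<close>

lemma AE_summable_of_expectation:
  fixes f :: "nat \<Rightarrow> 'w \<Rightarrow> real"
  assumes int: "\<And>n. integrable M (f n)" and nn: "\<And>n \<omega>. f n \<omega> \<ge> 0"
    and sum: "summable (\<lambda>n. \<integral>\<omega>. f n \<omega> \<partial>M)"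
  shows "AE \<omega> in M. summable (\<lambda>n. f n \<omega>)"
proof -
  have [measurable]: "f n \<in> borel_measurable M" for n using int by auto
  have "(\<integral>\<^sup>+\<omega>. (\<Sum>n. ennreal (f n \<omega>)) \<partial>M) = (\<Sum>n. \<integral>\<^sup>+\<omega>. ennreal (f n \<omega>) \<partial>M)"
    by (rule nn_integral_suminf) measurable
  also have "\<dots> = (\<Sum>n. ennreal (\<integral>\<omega>. f n \<omega> \<partial>M))"
    using int nn by (simp add: nn_integral_eq_integral)
  also have "\<dots> = ennreal (\<Sum>n. \<integral>\<omega>. f n \<omega> \<partial>M)"
    using sum nn by (intro suminf_ennreal2) (auto intro: integral_nonneg_AE)
  finally have "(\<integral>\<^sup>+\<omega>. (\<Sum>n. ennreal (f n \<omega>)) \<partial>M) \<noteq> \<infinity>" by simp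
  then have "AE \<omega> in M. (\<Sum>n. ennreal (f n \<omega>)) \<noteq> \<infinity>" by (intro nn_integral_PInf_AE) auto
  then show ?thesis
  proof eventually_elim
    case (elim \<omega>)
    then show ?case using nn by (intro summable_suminf_not_top) (auto simp: top_ennreal_def infinity_ennreal_def)
  qed
qed

lemma summable_powr_neg:
  assumes "a > (1::real)" shows "summable (\<lambda>n. (real n + 1) powr - a)"
proof -
  have "summable (\<lambda>n. real n powr - a)" using assms by (subst summable_real_powr_iff) auto
  then have "summable (\<lambda>n. real (Suc n) powr - a)" by (subst summable_Suc_iff)
  then show ?thesis by (simp add: add.commute)
qed

lemma tendsto_0_le_seq:
  fixes f g :: "nat \<Rightarrow> real"
  assumes "g \<longlonglongrightarrow> 0" "\<And>n. 0 \<le> f n" "\<And>n. f n \<le> g n"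
  shows "f \<longlonglongrightarrow> 0"
  by (rule tendsto_sandwich[OF _ _ tendsto_const assms(1)]) (simp_all add: assms(2,3) always_eventually)

text \<open>A version of \<open>small_o_as_Lp\<close> with integer exponents, in a form that is stable under sums.\<close>

definition lp_small :: "'w measure \<Rightarrow> (nat \<Rightarrow> 'w \<Rightarrow> 'v::{real_normed_vector, second_countable_topology}) \<Rightarrow> real \<Rightarrow> bool" where
  "lp_small M X s \<longleftrightarrow> (\<forall>n. X n \<in> borel_measurable M) \<and>
     (AE \<omega> in M. (\<lambda>n. norm (X n \<omega>) / (real n + 1) powr s) \<longlonglongrightarrow> 0) \<and>
     (\<forall>q\<ge>1. (\<forall>n. integrable M (\<lambda>\<omega>. norm (X n \<omega>) ^ q)) \<and>
       (\<lambda>n. (\<integral>\<omega>. norm (X n \<omega>) ^ q \<partial>M) / ((real n + 1) powr s) ^ q) \<longlonglongrightarrow> 0)"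

lemma lp_small_mono:
  assumes "lp_small M X s" "\<And>n. Y n \<in> borel_measurable M" "\<And>n. AE \<omega> in M. norm (Y n \<omega>) \<le> c * norm (X n \<omega>)" "c \<ge> 0"
  shows "lp_small M Y s"
proof -
  from assms(1) have X: "X n \<in> borel_measurable M"
    and a: "AE \<omega> in M. (\<lambda>n. norm (X n \<omega>) / (real n + 1) powr s) \<longlonglongrightarrow> 0"
    and i: "q \<ge> 1 \<Longrightarrow> integrable M (\<lambda>\<omega>. norm (X n \<omega>) ^ q)"
    and l: "q \<ge> 1 \<Longrightarrow> (\<lambda>n. (\<integral>\<omega>. norm (X n \<omega>) ^ q \<partial>M) / ((real n + 1) powr s) ^ q) \<longlonglongrightarrow> 0" for n q
    unfolding lp_small_def by blast+
  have le: "AE \<omega> in M. norm (Y n \<omega>) ^ q \<le> c ^ q * norm (X n \<omega>) ^ q" for n q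
    using assms(3)[of n] by eventually_elim (auto simp flip: power_mult_distrib intro: power_mono)
  have iY: "integrable M (\<lambda>\<omega>. norm (Y n \<omega>) ^ q)" if "q \<ge> 1" for n q
  proof (rule Bochner_Integration.integrable_bound[OF integrable_mult_right[OF i[OF that], of "c ^ q" n]])
    show "(\<lambda>\<omega>. norm (Y n \<omega>) ^ q) \<in> borel_measurable M"
      using assms(2)[of n] by measurable
    show "AE \<omega> in M. norm (norm (Y n \<omega>) ^ q) \<le> norm (c ^ q * norm (X n \<omega>) ^ q)"
      using le[of n q] by eventually_elim (use assms(4) in simp)
  qed
  show ?thesis unfolding lp_small_def
  proof (intro conjI allI impI iY assms(2))
    have "AE \<omega> in M. \<forall>n. norm (Y n \<omega>) \<le> c * norm (X n \<omega>)" using assms(3) by (simp add: AE_all_countable)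
    then show "AE \<omega> in M. (\<lambda>n. norm (Y n \<omega>) / (real n + 1) powr s) \<longlonglongrightarrow> 0"
      using a
    proof eventually_elim
      case (elim \<omega>)
      have "(\<lambda>n. c * (norm (X n \<omega>) / (real n + 1) powr s)) \<longlonglongrightarrow> 0" using tendsto_mult_right_zero[OF elim(2)] .
      then show ?case
      proof (rule tendsto_0_le_seq)
        fix n
        show "norm (Y n \<omega>) / (real n + 1) powr s \<le> c * (norm (X n \<omega>) / (real n + 1) powr s)"
          using elim(1) by (simp add: divide_right_mono)
      qed simp
    qed
  next
    fix q :: nat assume q: "1 \<le> q"
    have "(\<lambda>n. c ^ q * ((\<integral>\<omega>. norm (X n \<omega>) ^ q \<partial>M) / ((real n + 1) powr s) ^ q)) \<longlonglongrightarrow> 0"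
      using tendsto_mult_right_zero[OF l[OF q]] .
    then show "(\<lambda>n. (\<integral>\<omega>. norm (Y n \<omega>) ^ q \<partial>M) / ((real n + 1) powr s) ^ q) \<longlonglongrightarrow> 0"
    proof (rule tendsto_0_le_seq)
      fix n
      show "0 \<le> (\<integral>\<omega>. norm (Y n \<omega>) ^ q \<partial>M) / ((real n + 1) powr s) ^ q"
        by (auto intro!: divide_nonneg_nonneg integral_nonneg_AE)
      show "(\<integral>\<omega>. norm (Y n \<omega>) ^ q \<partial>M) / ((real n + 1) powr s) ^ q \<le> c ^ q * ((\<integral>\<omega>. norm (X n \<omega>) ^ q \<partial>M) / ((real n + 1) powr s) ^ q)"
      proof -
        have "(\<integral>\<omega>. norm (Y n \<omega>) ^ q \<partial>M) \<le> (\<integral>\<omega>. c ^ q * norm (X n \<omega>) ^ q \<partial>M)"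
          by (rule integral_mono_AE[OF iY[OF q] integrable_mult_right[OF i[OF q]] le])
        then show "(\<integral>\<omega>. norm (Y n \<omega>) ^ q \<partial>M) / ((real n + 1) powr s) ^ q \<le> c ^ q * ((\<integral>\<omega>. norm (X n \<omega>) ^ q \<partial>M) / ((real n + 1) powr s) ^ q)"
          by (simp add: divide_right_mono)
      qed
    qed
  qed
qed

lemma power_add_le:
  fixes a b :: real assumes "a \<ge> 0" "b \<ge> 0"
  shows "(a + b) ^ q \<le> 2 ^ q * (a ^ q + b ^ q)"
proof -
  have "(a + b) ^ q \<le> (2 * max a b) ^ q" using assms by (intro power_mono) auto
  also have "\<dots> = 2 ^ q * max a b ^ q" by (simp add: power_mult_distrib)
  also have "max a b ^ q \<le> a ^ q + b ^ q" using assms by (cases "a \<le> b") (auto simp: max_def)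
  finally show ?thesis by simp
qed

lemma lp_small_add:
  assumes X: "lp_small M X s" and Y: "lp_small M Y s"
  shows "lp_small M (\<lambda>n \<omega>. X n \<omega> + Y n \<omega>) s"
proof -
  have [measurable]: "X n \<in> borel_measurable M" "Y n \<in> borel_measurable M" for n
    using X Y by (auto simp: lp_small_def)
  have iX: "integrable M (\<lambda>\<omega>. norm (X n \<omega>) ^ q)" and iY: "integrable M (\<lambda>\<omega>. norm (Y n \<omega>) ^ q)" if "q \<ge> 1" for n q
    using X Y that by (auto simp: lp_small_def)
  have le: "norm (X n \<omega> + Y n \<omega>) ^ q \<le> 2 ^ q * (norm (X n \<omega>) ^ q + norm (Y n \<omega>) ^ q)" for n q \<omega>
    by (rule order_trans[OF power_mono[OF norm_triangle_ineq] power_add_le]) auto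
  have iS: "integrable M (\<lambda>\<omega>. norm (X n \<omega> + Y n \<omega>) ^ q)" if "q \<ge> 1" for n q
    by (rule Bochner_Integration.integrable_bound[OF integrable_mult_right[OF Bochner_Integration.integrable_add[OF iX[OF that, of n] iY[OF that, of n]], of "2 ^ q"]])
       (use le[of n _ q] in \<open>auto simp: abs_mult\<close>)
  have aX: "AE \<omega> in M. (\<lambda>n. norm (X n \<omega>) / (real n + 1) powr s) \<longlonglongrightarrow> 0"
    and aY: "AE \<omega> in M. (\<lambda>n. norm (Y n \<omega>) / (real n + 1) powr s) \<longlonglongrightarrow> 0"
    using X Y by (auto simp: lp_small_def)
  show ?thesis unfolding lp_small_def
  proof (intro conjI allI impI iS)
    show "AE \<omega> in M. (\<lambda>n. norm (X n \<omega> + Y n \<omega>) / (real n + 1) powr s) \<longlonglongrightarrow> 0"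
      using aX aY
    proof eventually_elim
      case (elim \<omega>)
      have "(\<lambda>n. norm (X n \<omega>) / (real n + 1) powr s + norm (Y n \<omega>) / (real n + 1) powr s) \<longlonglongrightarrow> 0"
        using tendsto_add[OF elim] by simp
      then show ?case
      proof (rule tendsto_0_le_seq)
        fix n
        show "norm (X n \<omega> + Y n \<omega>) / (real n + 1) powr s \<le> norm (X n \<omega>) / (real n + 1) powr s + norm (Y n \<omega>) / (real n + 1) powr s"
          unfolding add_divide_distrib[symmetric] by (intro divide_right_mono norm_triangle_ineq) simp
      qed simp
    qed
  next
    fix q :: nat assume q: "1 \<le> q"
    let ?d = "\<lambda>n. ((real n + 1) powr s) ^ q"
    have "(\<lambda>n. (\<integral>\<omega>. norm (X n \<omega>) ^ q \<partial>M) / ?d n) \<longlonglongrightarrow> 0" "(\<lambda>n. (\<integral>\<omega>. norm (Y n \<omega>) ^ q \<partial>M) / ?d n) \<longlonglongrightarrow> 0"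
      using X Y q by (auto simp: lp_small_def)
    from tendsto_mult_right_zero[OF tendsto_add[OF this, simplified], of "2 ^ q"]
    show "(\<lambda>n. (\<integral>\<omega>. norm (X n \<omega> + Y n \<omega>) ^ q \<partial>M) / ?d n) \<longlonglongrightarrow> 0"
    proof (rule tendsto_0_le_seq)
      fix n
      show "0 \<le> (\<integral>\<omega>. norm (X n \<omega> + Y n \<omega>) ^ q \<partial>M) / ?d n"
        by (auto intro!: divide_nonneg_nonneg integral_nonneg_AE)
      show "(\<integral>\<omega>. norm (X n \<omega> + Y n \<omega>) ^ q \<partial>M) / ?d n
        \<le> 2 ^ q * ((\<integral>\<omega>. norm (X n \<omega>) ^ q \<partial>M) / ?d n + (\<integral>\<omega>. norm (Y n \<omega>) ^ q \<partial>M) / ?d n)"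
      proof -
        have "(\<integral>\<omega>. norm (X n \<omega> + Y n \<omega>) ^ q \<partial>M) \<le> (\<integral>\<omega>. 2 ^ q * (norm (X n \<omega>) ^ q + norm (Y n \<omega>) ^ q) \<partial>M)"
          by (rule integral_mono[OF iS[OF q] integrable_mult_right[OF Bochner_Integration.integrable_add[OF iX[OF q] iY[OF q]]] le])
        also have "\<dots> = 2 ^ q * ((\<integral>\<omega>. norm (X n \<omega>) ^ q \<partial>M) + (\<integral>\<omega>. norm (Y n \<omega>) ^ q \<partial>M))"
          using iX[OF q] iY[OF q] by simp
        finally show "(\<integral>\<omega>. norm (X n \<omega> + Y n \<omega>) ^ q \<partial>M) / ?d n
          \<le> 2 ^ q * ((\<integral>\<omega>. norm (X n \<omega>) ^ q \<partial>M) / ?d n + (\<integral>\<omega>. norm (Y n \<omega>) ^ q \<partial>M) / ?d n)"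
          by (simp add: divide_right_mono flip: add_divide_distrib)
      qed
    qed
  qed measurable
qed

lemma lp_small_zero: "lp_small M (\<lambda>n \<omega>. 0) s"
  by (auto simp: lp_small_def power_0_left)

lemma lp_small_sum:
  assumes "finite A" "\<And>i. i \<in> A \<Longrightarrow> lp_small M (X i) s"
  shows "lp_small M (\<lambda>n \<omega>. \<Sum>i\<in>A. X i n \<omega>) s"
  using assms by (induction A) (auto intro: lp_small_zero lp_small_add)

lemma lp_small_bounded_linear:
  fixes f :: "'v::{real_normed_vector, second_countable_topology} \<Rightarrow> 'u::{real_normed_vector, second_countable_topology}"
  assumes "bounded_linear f" "lp_small M X s"
  shows "lp_small M (\<lambda>n \<omega>. f (X n \<omega>)) s"
proof -
  obtain C where C: "C \<ge> 0" "\<And>x. norm (f x) \<le> C * norm x"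
    using bounded_linear.nonneg_bounded[OF assms(1)] by (metis mult.commute)
  have f: "f \<in> borel_measurable borel"
    using assms(1) by (intro borel_measurable_continuous_onI linear_continuous_on)
  show ?thesis
  proof (rule lp_small_mono[OF assms(2) _ _ C(1)])
    show "(\<lambda>\<omega>. f (X n \<omega>)) \<in> borel_measurable M" for n
      using assms(2) f by (auto simp: lp_small_def intro: measurable_compose)
  qed (use C in auto)
qed

lemma lp_small_moments:
  fixes X :: "nat \<Rightarrow> 'w \<Rightarrow> 'v::{real_normed_vector, second_countable_topology}"
  assumes X: "\<And>n. X n \<in> borel_measurable M" and "\<rho> < s"
    and int: "\<And>n q. integrable M (\<lambda>\<omega>. norm (X n \<omega>) ^ q)"
    and mom: "\<And>q. \<exists>C. \<forall>n. (\<integral>\<omega>. norm (X n \<omega>) ^ q \<partial>M) \<le> C * ((real n + 1) powr \<rho>) ^ q"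
  shows "lp_small M X s"
proof -
  have ratio: "((real n + 1) powr \<rho>) ^ q / ((real n + 1) powr s) ^ q = (real n + 1) powr - (real q * (s - \<rho>))" for n q
    by (simp add: powr_power flip: powr_diff) (simp add: algebra_simps)
  \<comment> \<open>The order \<open>q0\<close> makes the normalised moments summable over
    \<open>n\<close>, and summability of the expectations gives almost sure convergence to
    0.\<close>
  obtain q0 :: nat where "real q0 > 2 / (s - \<rho>)" using reals_Archimedean2 by blast
  then have q0: "real q0 * (s - \<rho>) > 2" using assms(2) by (simp add: field_simps)
  have q00: "q0 > 0" using q0 by (cases q0) auto
  have bound: "\<exists>C. \<forall>n. (\<integral>\<omega>. norm (X n \<omega>) ^ q \<partial>M) / ((real n + 1) powr s) ^ q \<le> C * (real n + 1) powr - (real q * (s - \<rho>))" for q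
  proof -
    obtain C where C: "\<And>n. (\<integral>\<omega>. norm (X n \<omega>) ^ q \<partial>M) \<le> C * ((real n + 1) powr \<rho>) ^ q" using mom by blast
    have "(\<integral>\<omega>. norm (X n \<omega>) ^ q \<partial>M) / ((real n + 1) powr s) ^ q \<le> C * (((real n + 1) powr \<rho>) ^ q / ((real n + 1) powr s) ^ q)" for n
      using divide_right_mono[OF C, of "((real n + 1) powr s) ^ q" n] by simp
    then show ?thesis unfolding ratio by blast
  qed
  show ?thesis unfolding lp_small_def
  proof (intro conjI allI impI X int)
    obtain C where C: "\<And>n. (\<integral>\<omega>. norm (X n \<omega>) ^ q0 \<partial>M) / ((real n + 1) powr s) ^ q0 \<le> C * (real n + 1) powr - (real q0 * (s - \<rho>))"
      using bound by blast
    have "AE \<omega> in M. summable (\<lambda>n. norm (X n \<omega>) ^ q0 / ((real n + 1) powr s) ^ q0)"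
    proof (rule AE_summable_of_expectation)
      show "integrable M (\<lambda>\<omega>. norm (X n \<omega>) ^ q0 / ((real n + 1) powr s) ^ q0)" for n
        by (intro integrable_divide int)
      show "summable (\<lambda>n. \<integral>\<omega>. norm (X n \<omega>) ^ q0 / ((real n + 1) powr s) ^ q0 \<partial>M)"
      proof (rule summable_comparison_test')
        show "summable (\<lambda>n. C * (real n + 1) powr - (real q0 * (s - \<rho>)))"
          using q0 by (intro summable_mult summable_powr_neg) auto
        fix n :: nat
        have "(\<integral>\<omega>. norm (X n \<omega>) ^ q0 \<partial>M) \<ge> 0" by (intro integral_nonneg_AE) auto
        then show "norm (\<integral>\<omega>. norm (X n \<omega>) ^ q0 / ((real n + 1) powr s) ^ q0 \<partial>M) \<le> C * (real n + 1) powr - (real q0 * (s - \<rho>))"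
          using C[of n] by simp
      qed
    qed auto
    then show "AE \<omega> in M. (\<lambda>n. norm (X n \<omega>) / (real n + 1) powr s) \<longlonglongrightarrow> 0"
    proof eventually_elim
      case (elim \<omega>)
      then have "(\<lambda>n. (norm (X n \<omega>) / (real n + 1) powr s) ^ q0) \<longlonglongrightarrow> 0"
        by (auto dest: summable_LIMSEQ_zero simp: power_divide)
      then have "(\<lambda>n. root q0 ((norm (X n \<omega>) / (real n + 1) powr s) ^ q0)) \<longlonglongrightarrow> root q0 0"
        by (intro tendsto_real_root)
      then show ?case using q00 by (simp add: real_root_power_cancel)
    qed
  next
    fix q :: nat assume q: "1 \<le> q"
    obtain C where C: "\<And>n. (\<integral>\<omega>. norm (X n \<omega>) ^ q \<partial>M) / ((real n + 1) powr s) ^ q \<le> C * (real n + 1) powr - (real q * (s - \<rho>))"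
      using bound by blast
    have "((\<lambda>x. x powr - (real q * (s - \<rho>))) \<longlongrightarrow> 0) at_top"
      using q assms(2) by (intro tendsto_neg_powr) (auto simp: filterlim_ident)
    moreover have "filterlim (\<lambda>n. real n + 1) at_top sequentially"
      using filterlim_tendsto_add_at_top[OF tendsto_const[of 1] filterlim_real_sequentially] by (simp add: add.commute)
    ultimately have "(\<lambda>n. (real n + 1) powr - (real q * (s - \<rho>))) \<longlonglongrightarrow> 0" by (rule filterlim_compose)
    from tendsto_mult_right_zero[OF this, of C]
    show "(\<lambda>n. (\<integral>\<omega>. norm (X n \<omega>) ^ q \<partial>M) / ((real n + 1) powr s) ^ q) \<longlonglongrightarrow> 0"
      by (rule tendsto_0_le_seq) (use C in \<open>auto intro!: divide_nonneg_nonneg integral_nonneg_AE\<close>)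
  qed
qed

text \<open>Serves to exchange a deterministic factor for an asymptotically equivalent one in front
  of a fixed limit variable.\<close>

lemma lp_small_scale:
  fixes Z :: "'w \<Rightarrow> 'v::{real_normed_field, second_countable_topology}"
  assumes Z: "Z \<in> borel_measurable M" and int: "\<And>q. integrable M (\<lambda>\<omega>. norm (Z \<omega>) ^ q)"
    and a: "(\<lambda>n. norm (a n) / (real n + 1) powr s) \<longlonglongrightarrow> 0"
  shows "lp_small M (\<lambda>n \<omega>. a n * Z \<omega>) s"
  unfolding lp_small_def
proof (intro conjI allI impI)
  show "(\<lambda>\<omega>. a n * Z \<omega>) \<in> borel_measurable M" for n using Z by measurable
  show "AE \<omega> in M. (\<lambda>n. norm (a n * Z \<omega>) / (real n + 1) powr s) \<longlonglongrightarrow> 0"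
  proof (rule AE_I2)
    fix \<omega>
    show "(\<lambda>n. norm (a n * Z \<omega>) / (real n + 1) powr s) \<longlonglongrightarrow> 0"
      using tendsto_mult_left_zero[OF a, of "norm (Z \<omega>)"] by (simp add: norm_mult)
  qed
  show "integrable M (\<lambda>\<omega>. norm (a n * Z \<omega>) ^ q)" for n q
    using integrable_mult_right[OF int[of q], of "norm (a n) ^ q"] by (simp add: norm_mult power_mult_distrib)
  fix q :: nat assume q: "1 \<le> q"
  have "(\<lambda>n. (norm (a n) / (real n + 1) powr s) ^ q * (\<integral>\<omega>. norm (Z \<omega>) ^ q \<partial>M)) \<longlonglongrightarrow> 0 ^ q * (\<integral>\<omega>. norm (Z \<omega>) ^ q \<partial>M)"
    by (intro tendsto_intros a)
  then show "(\<lambda>n. (\<integral>\<omega>. norm (a n * Z \<omega>) ^ q \<partial>M) / ((real n + 1) powr s) ^ q) \<longlonglongrightarrow> 0"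
    using q by (simp add: norm_mult power_mult_distrib power_divide power_0_left)
qed

text \<open>Real exponents are reduced to integer ones by \<open>t powr p \<le> 1 + t ^ q\<close> for \<open>p \<le> q\<close>, applied to
  \<open>norm (X n) / (e * (n + 1) powr s)\<close>.\<close>

lemma lp_small_imp_small_o_as_Lp:
  fixes X :: "nat \<Rightarrow> 'w \<Rightarrow> 'v::{real_normed_vector, second_countable_topology}"
  assumes M: "prob_space M" and X: "lp_small M X s" and s: "s > 0"
  shows "small_o_as_Lp M X s"
proof -
  interpret prob_space M by fact
  have [measurable]: "X n \<in> borel_measurable M" for n using X by (simp add: lp_small_def)
  have toO: "f \<in> o(\<lambda>n. real n powr s)" if "(\<lambda>n. f n / (real n + 1) powr s) \<longlonglongrightarrow> 0" for f :: "nat \<Rightarrow> real"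
  proof -
    have "f \<in> o(\<lambda>n. (real n + 1) powr s)"
      using that by (intro smalloI_tendsto) auto
    moreover have "(\<lambda>n. (real n + 1) powr s) \<in> O(\<lambda>n. real n powr s)"
    proof (rule bigoI[of _ "2 powr s"])
      show "\<forall>\<^sub>F n in sequentially. norm ((real n + 1) powr s) \<le> 2 powr s * norm (real n powr s)"
        using eventually_ge_at_top[of 1]
      proof eventually_elim
        case (elim n)
        have "(real n + 1) powr s \<le> (2 * real n) powr s" using elim s by (intro powr_mono2) auto
        then show ?case by (simp add: powr_mult)
      qed
    qed
    ultimately show ?thesis by (rule landau_o.small_big_trans)
  qed
  show ?thesis unfolding small_o_as_Lp_def
  proof (intro conjI allI impI)
    have "AE \<omega> in M. (\<lambda>n. norm (X n \<omega>) / (real n + 1) powr s) \<longlonglongrightarrow> 0" using X by (simp add: lp_small_def)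
    then show "AE \<omega> in M. (\<lambda>n. norm (X n \<omega>)) \<in> o(\<lambda>n. real n powr s)" by eventually_elim (rule toO)
  next
    fix p :: real assume p: "p \<ge> 1"
    define q where "q = nat \<lceil>p\<rceil>"
    have q: "q \<ge> 1" "real q \<ge> p" using p unfolding q_def by linarith+
    have iq: "integrable M (\<lambda>\<omega>. norm (X n \<omega>) ^ q)" for n using X q by (auto simp: lp_small_def)
    have le: "y powr p \<le> 1 + y ^ q" if "y \<ge> 0" for y :: real
    proof (cases "y \<le> 1")
      case True
      then have "y powr p \<le> 1" using that p powr_mono2[of p y 1] by simp
      then show ?thesis using that by (simp add: add_increasing2)
    next
      case False
      then have "y powr p \<le> y powr real q" using q by (intro powr_mono) auto
      then show ?thesis using False by (simp add: powr_realpow)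
    qed
    show ip: "integrable M (\<lambda>\<omega>. norm (X n \<omega>) powr p)" for n
    proof (rule Bochner_Integration.integrable_bound)
      show "integrable M (\<lambda>\<omega>. 1 + norm (X n \<omega>) ^ q)" using iq by simp
      show "AE \<omega> in M. norm (norm (X n \<omega>) powr p) \<le> norm (1 + norm (X n \<omega>) ^ q)"
        using le[of "norm (X n _)"] by (intro AE_I2) (auto simp: abs_of_nonneg)
    qed measurable
    let ?R = "\<lambda>n. (real n + 1) powr s"
    have lim: "(\<lambda>n. (\<integral>\<omega>. norm (X n \<omega>) ^ q \<partial>M) / ?R n ^ q) \<longlonglongrightarrow> 0" using X q by (auto simp: lp_small_def)
    have "(\<lambda>n. (\<integral>\<omega>. norm (X n \<omega>) powr p \<partial>M) / ?R n powr p) \<longlonglongrightarrow> 0"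
    proof (rule LIMSEQ_I)
      fix r :: real assume r: "r > 0"
      \<comment> \<open>The final bound is \<open>2 * e powr p\<close>, which is two thirds of
        \<open>r\<close>.\<close>
      define e where "e = (r / 3) powr (1 / p)"
      have e: "e > 0" "e powr p = r / 3" using r p by (auto simp: e_def powr_powr)
      obtain n0 where n0: "\<And>n. n \<ge> n0 \<Longrightarrow> \<bar>(\<integral>\<omega>. norm (X n \<omega>) ^ q \<partial>M) / ?R n ^ q\<bar> < e ^ q"
        using LIMSEQ_D[OF lim, of "e ^ q"] e by auto
      show "\<exists>n0. \<forall>n\<ge>n0. norm ((\<integral>\<omega>. norm (X n \<omega>) powr p \<partial>M) / ?R n powr p - 0) < r"
      proof (intro exI[of _ n0] allI impI)
        fix n assume n: "n \<ge> n0"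
        define t where "t = e * ?R n"
        have t: "t > 0" using e by (simp add: t_def)
        have "(\<integral>\<omega>. norm (X n \<omega>) powr p \<partial>M) \<le> (\<integral>\<omega>. t powr p * (1 + norm (X n \<omega>) ^ q / t ^ q) \<partial>M)"
        proof (rule integral_mono[OF ip])
          show "integrable M (\<lambda>\<omega>. t powr p * (1 + norm (X n \<omega>) ^ q / t ^ q))" using iq by simp
          fix \<omega>
          have "norm (X n \<omega>) powr p = t powr p * (norm (X n \<omega>) / t) powr p"
            using t by (simp flip: powr_mult)
          also have "\<dots> \<le> t powr p * (1 + (norm (X n \<omega>) / t) ^ q)" using t by (intro mult_left_mono le) auto
          finally show "norm (X n \<omega>) powr p \<le> t powr p * (1 + norm (X n \<omega>) ^ q / t ^ q)" by (simp add: power_divide)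
        qed
        also have "\<dots> = t powr p * (1 + (\<integral>\<omega>. norm (X n \<omega>) ^ q \<partial>M) / t ^ q)" using iq by (simp add: prob_space)
        also have "(\<integral>\<omega>. norm (X n \<omega>) ^ q \<partial>M) / t ^ q = ((\<integral>\<omega>. norm (X n \<omega>) ^ q \<partial>M) / ?R n ^ q) / e ^ q"
          by (simp add: t_def power_mult_distrib)
        also have "t powr p * (1 + ((\<integral>\<omega>. norm (X n \<omega>) ^ q \<partial>M) / ?R n ^ q) / e ^ q) \<le> t powr p * (1 + 1)"
        proof -
          have "(\<integral>\<omega>. norm (X n \<omega>) ^ q \<partial>M) / ?R n ^ q \<le> e ^ q" using n0[OF n] by linarith
          moreover have "e ^ q > 0" using e by simp
          ultimately have "((\<integral>\<omega>. norm (X n \<omega>) ^ q \<partial>M) / ?R n ^ q) / e ^ q \<le> 1" by (simp only: divide_le_eq_1_pos)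
          then show ?thesis by (intro mult_left_mono add_left_mono) auto
        qed
        also have "t powr p = e powr p * ?R n powr p" using e by (simp add: t_def powr_mult)
        finally have "(\<integral>\<omega>. norm (X n \<omega>) powr p \<partial>M) / ?R n powr p \<le> 2 * e powr p" by (simp add: divide_le_eq)
        moreover have "(\<integral>\<omega>. norm (X n \<omega>) powr p \<partial>M) / ?R n powr p \<ge> 0"
          by (intro divide_nonneg_nonneg integral_nonneg_AE) auto
        ultimately show "norm ((\<integral>\<omega>. norm (X n \<omega>) powr p \<partial>M) / ?R n powr p - 0) < r"
          using e(2) r unfolding diff_0_right real_norm_def by linarith
      qed
    qed
    then have "(\<lambda>n. ((\<integral>\<omega>. norm (X n \<omega>) powr p \<partial>M) / ?R n powr p) powr (1 / p)) \<longlonglongrightarrow> 0"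
      using p by (intro tendsto_zero_powrI[where b="1/p"]) (auto intro!: divide_nonneg_nonneg integral_nonneg_AE tendsto_const)
    moreover have "((\<integral>\<omega>. norm (X n \<omega>) powr p \<partial>M) / ?R n powr p) powr (1 / p) = (\<integral>\<omega>. norm (X n \<omega>) powr p \<partial>M) powr (1 / p) / ?R n" for n
      using p by (subst powr_divide) (auto intro!: integral_nonneg_AE simp: powr_powr)
    ultimately show "(\<lambda>n. (\<integral>\<omega>. norm (X n \<omega>) powr p \<partial>M) powr (1 / p)) \<in> o(\<lambda>n. real n powr s)"
      by (intro toO) simp
  qed
qed

text \<open>The first moments give a limit along the powers of 2. By Fatou's lemma it inherits the moment bounds,
  and those of high order are summable over all \<open>n\<close>.\<close>

lemma Lp_Cauchy_limit:
  fixes Z :: "nat \<Rightarrow> 'w \<Rightarrow> complex"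
  assumes M: "prob_space M" and Z: "\<And>n. Z n \<in> borel_measurable M"
    and int: "\<And>n q. integrable M (\<lambda>\<omega>. cmod (Z n \<omega>) ^ q)" "\<And>n N q. integrable M (\<lambda>\<omega>. cmod (Z n \<omega> - Z N \<omega>) ^ q)"
    and \<delta>: "\<delta> > 0"
    and mom: "\<And>q. \<exists>C. \<forall>N n. N \<le> n \<longrightarrow> (\<integral>\<omega>. cmod (Z n \<omega> - Z N \<omega>) ^ q \<partial>M) \<le> C * ((real N + 1) powr - \<delta>) ^ q"
  obtains Y where "Y \<in> borel_measurable M" "\<And>q. integrable M (\<lambda>\<omega>. cmod (Y \<omega>) ^ q)"
    "AE \<omega> in M. (\<lambda>n. Z n \<omega>) \<longlonglongrightarrow> Y \<omega>"
    "\<And>n q. integrable M (\<lambda>\<omega>. cmod (Z n \<omega> - Y \<omega>) ^ q)"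
    "\<And>q. \<exists>C. \<forall>n. (\<integral>\<omega>. cmod (Z n \<omega> - Y \<omega>) ^ q \<partial>M) \<le> C * ((real n + 1) powr - \<delta>) ^ q"
proof -
  interpret prob_space M by fact
  note [measurable] = Z
  have "AE \<omega> in M. summable (\<lambda>k. cmod (Z (2 ^ Suc k) \<omega> - Z (2 ^ k) \<omega>))"
  proof (rule AE_summable_of_expectation)
    show "integrable M (\<lambda>\<omega>. cmod (Z (2 ^ Suc k) \<omega> - Z (2 ^ k) \<omega>))" for k
      using int(2)[of "2 ^ Suc k" "2 ^ k" 1] by simp
    obtain C where C: "\<And>N n. N \<le> n \<Longrightarrow> (\<integral>\<omega>. cmod (Z n \<omega> - Z N \<omega>) ^ 1 \<partial>M) \<le> C * ((real N + 1) powr - \<delta>) ^ 1"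
      using mom[of 1] by blast
    show "summable (\<lambda>k. \<integral>\<omega>. cmod (Z (2 ^ Suc k) \<omega> - Z (2 ^ k) \<omega>) \<partial>M)"
    proof (rule summable_comparison_test')
      have "2 powr - \<delta> < 1" using \<delta> by (simp add: powr_less_one)
      then show "summable (\<lambda>k. \<bar>C\<bar> * (2 powr - \<delta>) ^ k)" by (intro summable_mult summable_geometric) simp
      fix k :: nat
      have nn: "(\<integral>\<omega>. cmod (Z (2 ^ Suc k) \<omega> - Z (2 ^ k) \<omega>) \<partial>M) \<ge> 0" by (intro integral_nonneg_AE) auto
      have "(\<integral>\<omega>. cmod (Z (2 ^ Suc k) \<omega> - Z (2 ^ k) \<omega>) \<partial>M) \<le> C * (real (2 ^ k) + 1) powr - \<delta>"
        using C[of "2 ^ k" "2 ^ Suc k"] by simp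
      also have "\<dots> \<le> \<bar>C\<bar> * (real (2 ^ k)) powr - \<delta>"
        using \<delta> by (intro mult_mono powr_mono2') auto
      also have "real (2 ^ k) powr - \<delta> = (2 powr - \<delta>) ^ k"
        by (simp add: powr_power powr_powr flip: powr_realpow) (simp add: mult.commute)
      finally show "norm (\<integral>\<omega>. cmod (Z (2 ^ Suc k) \<omega> - Z (2 ^ k) \<omega>) \<partial>M) \<le> \<bar>C\<bar> * (2 powr - \<delta>) ^ k"
        using nn by simp
    qed
  qed simp
  then have conv: "AE \<omega> in M. convergent (\<lambda>k. Z (2 ^ k) \<omega>)"
  proof eventually_elim
    case (elim \<omega>)
    then have "summable (\<lambda>k. Z (2 ^ Suc k) \<omega> - Z (2 ^ k) \<omega>)" by (rule summable_norm_cancel)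
    then have "convergent (\<lambda>n. \<Sum>k<n. Z (2 ^ Suc k) \<omega> - Z (2 ^ k) \<omega>)" by (simp only: summable_iff_convergent)
    then have "convergent (\<lambda>n. Z (2 ^ n) \<omega> - Z (2 ^ 0) \<omega>)" by (simp only: sum_lessThan_telescope[of "\<lambda>k. Z (2 ^ k) \<omega>"])
    then have "convergent (\<lambda>n. (Z (2 ^ n) \<omega> - Z (2 ^ 0) \<omega>) + Z (2 ^ 0) \<omega>)" by (rule convergent_add[OF _ convergent_const])
    then show ?case by simp
  qed
  define Y where "Y = (\<lambda>\<omega>. lim (\<lambda>k. Z (2 ^ k) \<omega>))"
  have Ym [measurable]: "Y \<in> borel_measurable M" unfolding Y_def by (rule borel_measurable_lim_metric) measurable
  have sub: "AE \<omega> in M. (\<lambda>k. Z (2 ^ k) \<omega>) \<longlonglongrightarrow> Y \<omega>"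
    using conv by eventually_elim (simp add: Y_def convergent_LIMSEQ_iff)
  have fatou: "integrable M (\<lambda>\<omega>. cmod (Z N \<omega> - Y \<omega>) ^ q) \<and> (\<integral>\<omega>. cmod (Z N \<omega> - Y \<omega>) ^ q \<partial>M) \<le> B"
    if B: "\<And>n. N \<le> n \<Longrightarrow> (\<integral>\<omega>. cmod (Z n \<omega> - Z N \<omega>) ^ q \<partial>M) \<le> B" for N q B
  proof -
    have "(\<integral>\<omega>. cmod (Z N \<omega> - Z N \<omega>) ^ q \<partial>M) \<ge> 0" by (intro integral_nonneg_AE) auto
    then have B0: "B \<ge> 0" using B[of N] by linarith
    have "AE \<omega> in M. ennreal (cmod (Z N \<omega> - Y \<omega>) ^ q) = liminf (\<lambda>k. ennreal (cmod (Z (2 ^ k) \<omega> - Z N \<omega>) ^ q))"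
      using sub
    proof eventually_elim
      case (elim \<omega>)
      have "(\<lambda>k. ennreal (cmod (Z (2 ^ k) \<omega> - Z N \<omega>) ^ q)) \<longlonglongrightarrow> ennreal (cmod (Y \<omega> - Z N \<omega>) ^ q)"
        by (intro tendsto_intros elim)
      from lim_imp_Liminf[OF _ this] show ?case by (simp add: norm_minus_commute)
    qed
    then have "(\<integral>\<^sup>+\<omega>. ennreal (cmod (Z N \<omega> - Y \<omega>) ^ q) \<partial>M) = (\<integral>\<^sup>+\<omega>. liminf (\<lambda>k. ennreal (cmod (Z (2 ^ k) \<omega> - Z N \<omega>) ^ q)) \<partial>M)"
      by (rule nn_integral_cong_AE)
    also have "\<dots> \<le> liminf (\<lambda>k. \<integral>\<^sup>+\<omega>. ennreal (cmod (Z (2 ^ k) \<omega> - Z N \<omega>) ^ q) \<partial>M)"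
      by (rule nn_integral_liminf) measurable
    also have "\<dots> \<le> limsup (\<lambda>k. \<integral>\<^sup>+\<omega>. ennreal (cmod (Z (2 ^ k) \<omega> - Z N \<omega>) ^ q) \<partial>M)"
      by (rule Liminf_le_Limsup) simp
    also have "\<dots> \<le> ennreal B"
    proof (rule Limsup_bounded)
      show "\<forall>\<^sub>F k in sequentially. (\<integral>\<^sup>+\<omega>. ennreal (cmod (Z (2 ^ k) \<omega> - Z N \<omega>) ^ q) \<partial>M) \<le> ennreal B"
        using eventually_ge_at_top[of N]
      proof eventually_elim
        case (elim k)
        have "N \<le> 2 ^ k" using elim by (meson le_trans less_exp less_imp_le)
        have "(\<integral>\<^sup>+\<omega>. ennreal (cmod (Z (2 ^ k) \<omega> - Z N \<omega>) ^ q) \<partial>M) = ennreal (\<integral>\<omega>. cmod (Z (2 ^ k) \<omega> - Z N \<omega>) ^ q \<partial>M)"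
          by (rule nn_integral_eq_integral[OF int(2)]) simp
        then show ?case using B[OF \<open>N \<le> 2 ^ k\<close>] by (simp add: ennreal_leI)
      qed
    qed
    finally have le: "(\<integral>\<^sup>+\<omega>. ennreal (cmod (Z N \<omega> - Y \<omega>) ^ q) \<partial>M) \<le> ennreal B" .
    have I: "integrable M (\<lambda>\<omega>. cmod (Z N \<omega> - Y \<omega>) ^ q)"
    proof (rule integrableI_bounded)
      have "(\<integral>\<^sup>+\<omega>. ennreal (norm (cmod (Z N \<omega> - Y \<omega>) ^ q)) \<partial>M) \<le> ennreal B" using le by simp
      also have "ennreal B < \<infinity>" by simp
      finally show "(\<integral>\<^sup>+\<omega>. ennreal (norm (cmod (Z N \<omega> - Y \<omega>) ^ q)) \<partial>M) < \<infinity>" .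
    qed measurable
    moreover have "ennreal (\<integral>\<omega>. cmod (Z N \<omega> - Y \<omega>) ^ q \<partial>M) \<le> ennreal B"
      using le nn_integral_eq_integral[OF I] by simp
    ultimately show ?thesis using B0 by (simp add: ennreal_le_iff)
  qed
  have bound: "\<exists>C. \<forall>N. integrable M (\<lambda>\<omega>. cmod (Z N \<omega> - Y \<omega>) ^ q) \<and> (\<integral>\<omega>. cmod (Z N \<omega> - Y \<omega>) ^ q \<partial>M) \<le> C * ((real N + 1) powr - \<delta>) ^ q" for q
  proof -
    obtain C where C: "\<And>N n. N \<le> n \<Longrightarrow> (\<integral>\<omega>. cmod (Z n \<omega> - Z N \<omega>) ^ q \<partial>M) \<le> C * ((real N + 1) powr - \<delta>) ^ q"
      using mom[of q] by blast
    show ?thesis using fatou[OF C] by blast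
  qed
  have iY: "integrable M (\<lambda>\<omega>. cmod (Z n \<omega> - Y \<omega>) ^ q)" for n q using bound[of q] by blast
  have "lp_small M (\<lambda>n \<omega>. Z n \<omega> - Y \<omega>) 0"
  proof (rule lp_small_moments[where \<rho>="-\<delta>"])
    show "(\<lambda>\<omega>. Z n \<omega> - Y \<omega>) \<in> borel_measurable M" for n by measurable
    show "\<exists>C. \<forall>n. (\<integral>\<omega>. norm (Z n \<omega> - Y \<omega>) ^ q \<partial>M) \<le> C * ((real n + 1) powr - \<delta>) ^ q" for q
      using bound[of q] by blast
  qed (use \<delta> iY in simp_all)
  then have "AE \<omega> in M. (\<lambda>n. norm (Z n \<omega> - Y \<omega>) / (real n + 1) powr 0) \<longlonglongrightarrow> 0" by (simp only: lp_small_def)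
  then have lim: "AE \<omega> in M. (\<lambda>n. Z n \<omega>) \<longlonglongrightarrow> Y \<omega>"
  proof eventually_elim
    case (elim \<omega>)
    have "(\<lambda>n. norm (Z n \<omega> - Y \<omega>)) \<longlonglongrightarrow> 0" using elim by simp
    then show ?case by (simp only: tendsto_norm_zero_iff LIM_zero_iff)
  qed
  have iYY: "integrable M (\<lambda>\<omega>. cmod (Y \<omega>) ^ q)" for q
  proof (rule Bochner_Integration.integrable_bound)
    show "integrable M (\<lambda>\<omega>. 2 ^ q * (cmod (Z 0 \<omega>) ^ q + cmod (Z 0 \<omega> - Y \<omega>) ^ q))"
      by (intro integrable_mult_right Bochner_Integration.integrable_add int iY)
    show "AE \<omega> in M. norm (cmod (Y \<omega>) ^ q) \<le> norm (2 ^ q * (cmod (Z 0 \<omega>) ^ q + cmod (Z 0 \<omega> - Y \<omega>) ^ q))"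
    proof (rule AE_I2)
      fix \<omega>
      have "cmod (Y \<omega>) \<le> cmod (Z 0 \<omega>) + cmod (Z 0 \<omega> - Y \<omega>)"
        using norm_triangle_ineq4[of "Z 0 \<omega>" "Z 0 \<omega> - Y \<omega>"] by simp
      then have "cmod (Y \<omega>) ^ q \<le> (cmod (Z 0 \<omega>) + cmod (Z 0 \<omega> - Y \<omega>)) ^ q" by (intro power_mono) auto
      also have "\<dots> \<le> 2 ^ q * (cmod (Z 0 \<omega>) ^ q + cmod (Z 0 \<omega> - Y \<omega>) ^ q)" by (rule power_add_le) auto
      finally show "norm (cmod (Y \<omega>) ^ q) \<le> norm (2 ^ q * (cmod (Z 0 \<omega>) ^ q + cmod (Z 0 \<omega> - Y \<omega>) ^ q))" by simp
    qed
  qed measurable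
  show ?thesis using that[OF Ym iYY lim iY] bound by blast
qed

text \<open>Equality of the laws for each \<open>n\<close> passes to the limit for bounded
  continuous test functions by dominated convergence. Closed sets are reached by approximation from
  above, and they are an intersection stable generator.\<close>

lemma distr_eq_of_limits:
  fixes X :: "nat \<Rightarrow> 'a \<Rightarrow> 'v::{metric_space, second_countable_topology}" and Y :: "nat \<Rightarrow> 'b \<Rightarrow> 'v"
  assumes M: "prob_space M" and N: "prob_space N"
    and X: "\<And>n. X n \<in> borel_measurable M" "A \<in> borel_measurable M" "AE \<omega> in M. (\<lambda>n. X n \<omega>) \<longlonglongrightarrow> A \<omega>"
    and Y: "\<And>n. Y n \<in> borel_measurable N" "B \<in> borel_measurable N" "AE \<omega> in N. (\<lambda>n. Y n \<omega>) \<longlonglongrightarrow> B \<omega>"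
    and eq: "\<And>n (f::'v \<Rightarrow> real). (\<integral>\<omega>. f (X n \<omega>) \<partial>M) = (\<integral>\<omega>. f (Y n \<omega>) \<partial>N)"
  shows "distr M borel A = distr N borel B"
proof -
  interpret M: prob_space M by fact
  interpret N: prob_space N by fact
  note [measurable] = X(1,2) Y(1,2)
  have bc: "(\<integral>\<omega>. f (A \<omega>) \<partial>M) = (\<integral>\<omega>. f (B \<omega>) \<partial>N)"
    if f: "continuous_on UNIV f" and f1: "\<And>x. \<bar>f x\<bar> \<le> 1" for f :: "'v \<Rightarrow> real"
  proof -
    have fm [measurable]: "f \<in> borel_measurable borel" using f by (rule borel_measurable_continuous_onI)
    have cont: "isCont f x" for x using f by (simp add: continuous_on_eq_continuous_at)
    have "(\<lambda>n. \<integral>\<omega>. f (X n \<omega>) \<partial>M) \<longlonglongrightarrow> (\<integral>\<omega>. f (A \<omega>) \<partial>M)"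
    proof (rule integral_dominated_convergence[where w="\<lambda>_. 1"])
      show "AE \<omega> in M. (\<lambda>n. f (X n \<omega>)) \<longlonglongrightarrow> f (A \<omega>)"
        using X(3) by eventually_elim (rule isCont_tendsto_compose[OF cont])
    qed (use f1 in auto)
    moreover have "(\<lambda>n. \<integral>\<omega>. f (Y n \<omega>) \<partial>N) \<longlonglongrightarrow> (\<integral>\<omega>. f (B \<omega>) \<partial>N)"
    proof (rule integral_dominated_convergence[where w="\<lambda>_. 1"])
      show "AE \<omega> in N. (\<lambda>n. f (Y n \<omega>)) \<longlonglongrightarrow> f (B \<omega>)"
        using Y(3) by eventually_elim (rule isCont_tendsto_compose[OF cont])
    qed (use f1 in auto)
    ultimately show ?thesis unfolding eq by (rule LIMSEQ_unique)
  qed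
  have closed: "M.prob (A -` C \<inter> space M) = N.prob (B -` C \<inter> space N)" if C: "closed C" for C
  proof (cases "C = {}")
    case False
    \<comment> \<open>Continuous functions that decrease to the indicator of
      \<open>C\<close>.\<close>
    define f where "f = (\<lambda>k x. max 0 (1 - real k * infdist x C))"
    have fc: "continuous_on UNIV (f k)" for k
      unfolding f_def by (intro continuous_intros)
    have fm [measurable]: "f k \<in> borel_measurable borel" for k using fc by (rule borel_measurable_continuous_onI)
    have f1: "\<bar>f k x\<bar> \<le> 1" for k x by (auto simp: f_def infdist_nonneg)
    have lim: "(\<lambda>k. f k x) \<longlonglongrightarrow> indicator C x" for x
    proof (cases "x \<in> C")
      case True
      then have "f k x = 1" for k using False by (simp add: f_def)
      then show ?thesis using True by simp
    next
      case nin: False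
      then have pos: "infdist x C > 0"
        using in_closed_iff_infdist_zero[OF C False, of x] infdist_nonneg[of x C] by linarith
      obtain k0 :: nat where k0: "real k0 > 1 / infdist x C" using reals_Archimedean2 by blast
      have "f k x = 0" if "k \<ge> k0" for k
      proof -
        have "real k > 1 / infdist x C" using k0 that by linarith
        then have "real k * infdist x C > 1" using pos by (simp add: field_simps)
        then show ?thesis by (simp add: f_def)
      qed
      then have "\<forall>\<^sub>F k in sequentially. f k x = 0" by (auto simp: eventually_sequentially)
      then show ?thesis using nin by (simp add: tendsto_eventually)
    qed
    have [measurable]: "C \<in> sets borel" using C by simp
    have "(\<lambda>k. \<integral>\<omega>. f k (A \<omega>) \<partial>M) \<longlonglongrightarrow> (\<integral>\<omega>. indicator C (A \<omega>) \<partial>M)"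
      by (rule integral_dominated_convergence[where w="\<lambda>_. 1"]) (use f1 lim in auto)
    moreover have "(\<lambda>k. \<integral>\<omega>. f k (B \<omega>) \<partial>N) \<longlonglongrightarrow> (\<integral>\<omega>. indicator C (B \<omega>) \<partial>N)"
      by (rule integral_dominated_convergence[where w="\<lambda>_. 1"]) (use f1 lim in auto)
    ultimately have "(\<integral>\<omega>. indicator C (A \<omega>) \<partial>M) = (\<integral>\<omega>. indicator C (B \<omega>) \<partial>N :: real)"
      unfolding bc[OF fc f1] by (rule LIMSEQ_unique)
    moreover have "(\<integral>\<omega>. indicator C (A \<omega>) \<partial>M) = M.prob (A -` C \<inter> space M)"
      by (simp add: indicator_vimage[symmetric] del: indicator_vimage)
    moreover have "(\<integral>\<omega>. indicator C (B \<omega>) \<partial>N) = N.prob (B -` C \<inter> space N)"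
      by (simp add: indicator_vimage[symmetric] del: indicator_vimage)
    ultimately show ?thesis by simp
  qed simp
  show ?thesis
  proof (rule measure_eqI_generator_eq[where \<Omega>=UNIV and E="Collect closed" and A="\<lambda>_. UNIV"])
    show "Int_stable (Collect closed :: 'v set set)" by (auto simp: Int_stable_def)
    show "emeasure (distr M borel A) C = emeasure (distr N borel B) C" if "C \<in> Collect closed" for C
      using that closed[of C] by (simp add: emeasure_distr M.emeasure_eq_measure N.emeasure_eq_measure)
    show "sets (distr M borel A) = sigma_sets UNIV (Collect closed)"
      by (simp add: borel_eq_closed)
    show "sets (distr N borel B) = sigma_sets UNIV (Collect closed)"
      by (simp add: borel_eq_closed)
    show "emeasure (distr M borel A) UNIV \<noteq> \<infinity>" for i :: nat
      by (simp add: emeasure_distr M.emeasure_eq_measure)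
  qed auto
qed

section \<open>Large phases\<close>

text \<open>The product is a quotient of two Pochhammer symbols, so the limit formula for
  \<open>Gamma_series\<close> gives the constant \<open>Gamma K / Gamma (K + l)\<close>.\<close>

lemma growth_limit:
  assumes K: "K \<ge> 1" and l: "Re l > 0"
  obtains c where "(\<lambda>n. of_nat n powr (- l) * growth K l 0 n) \<longlonglongrightarrow> c"
proof -
  define z where "z = complex_of_real K"
  have z: "Re z > 0" "Re (z + l) > 0" using assms by (auto simp: z_def)
  have notin: "w \<notin> \<int>\<^sub>\<le>\<^sub>0" if "Re w > 0" for w :: complex
  proof
    assume "w \<in> \<int>\<^sub>\<le>\<^sub>0"
    then obtain n where "w = of_int n" "n \<le> 0" by (rule nonpos_Ints_cases)
    then show False using that by simp
  qed
  have np: "z \<notin> \<int>\<^sub>\<le>\<^sub>0" "z + l \<notin> \<int>\<^sub>\<le>\<^sub>0" using z by (intro notin; simp)+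
  have nz: "z + of_nat j \<noteq> 0" for j using z by (auto simp: complex_eq_iff)
  have poch: "growth K l 0 n = pochhammer (z + l) n / pochhammer z n" for n
  proof (induction n)
    case (Suc n)
    have "1 + l / (z + of_nat n) = (z + l + of_nat n) / (z + of_nat n)" using nz[of n] by (simp add: field_simps)
    then show ?case using Suc by (simp add: growth_Suc pochhammer_Suc z_def)
  qed simp
  have Gz: "Gamma (z + l) \<noteq> 0" using np by (simp add: Gamma_eq_zero_iff)
  have "(\<lambda>n. Gamma_series z n / Gamma_series (z + l) n) \<longlonglongrightarrow> Gamma z / Gamma (z + l)"
    by (intro tendsto_divide Gamma_series_LIMSEQ Gz)
  moreover have "\<forall>\<^sub>F n in sequentially. Gamma_series z n / Gamma_series (z + l) n = of_nat n powr (- l) * growth K l 0 (Suc n)"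
    using eventually_gt_at_top[of 0]
  proof eventually_elim
    case (elim n)
    define L where "L = complex_of_real (ln (real n))"
    have L: "Ln (of_nat n) = L" using elim by (metis L_def Ln_of_nat)
    have p: "of_nat n powr (- l) = exp (- l * L)" using elim by (simp add: powr_def L)
    have "Gamma_series z n / Gamma_series (z + l) n = exp (z * L - (z + l) * L) * (pochhammer (z + l) (Suc n) / pochhammer z (Suc n))"
      unfolding Gamma_series_def L_def[symmetric] by (simp add: exp_diff)
    also have "z * L - (z + l) * L = - l * L" by (simp add: algebra_simps)
    finally show ?case by (simp add: p poch)
  qed
  ultimately have "(\<lambda>n. of_nat n powr (- l) * growth K l 0 (Suc n)) \<longlonglongrightarrow> Gamma z / Gamma (z + l)"
    by (rule Lim_transform_eventually)
  \<comment> \<open>\<open>Gamma_series\<close> at \<open>n\<close> has \<open>n + 1\<close>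
    factors; dividing by the last one, which tends to 1, gives the product up to
    \<open>n\<close>.\<close>
  moreover have "(\<lambda>n. 1 / (1 + l / of_real (K + real n))) \<longlonglongrightarrow> 1 / (1 + 0)"
  proof (intro tendsto_intros)
    have "filterlim (\<lambda>n. K + real n) at_top sequentially"
      by (rule filterlim_tendsto_add_at_top[OF tendsto_const filterlim_real_sequentially])
    then have "(\<lambda>n. inverse (K + real n)) \<longlonglongrightarrow> 0" by (rule tendsto_inverse_0_at_top)
    from tendsto_mult_right_zero[OF tendsto_of_real[OF this, simplified], of l]
    show "(\<lambda>n. l / of_real (K + real n)) \<longlonglongrightarrow> 0" by (simp add: field_simps)
  qed simp
  ultimately have lim: "(\<lambda>n. of_nat n powr (- l) * growth K l 0 (Suc n) * (1 / (1 + l / of_real (K + real n)))) \<longlonglongrightarrow> Gamma z / Gamma (z + l) * (1 / (1 + 0))"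
    by (rule tendsto_mult)
  have eq: "growth K l 0 (Suc n) * (1 / (1 + l / of_real (K + real n))) = growth K l 0 n" for n
  proof -
    have "Re (1 + l / of_real (K + real n)) > 0" using K l by (simp add: add_pos_nonneg)
    then have "1 + l / of_real (K + real n) \<noteq> 0" by (metis less_irrefl zero_complex.sel(1))
    then show ?thesis by (simp add: growth_Suc)
  qed
  show ?thesis using that lim unfolding mult.assoc eq by blast
qed

section \<open>Random limits of the dominant forms\<close>

context gap_urn
begin

text \<open>With \<open>\<sigma> = Re l\<close>, the increments of the martingale \<open>Z\<close>
  at step \<open>k\<close> have order \<open>k powr - \<sigma>\<close>, and the squares from
  \<open>N\<close> on add up to order \<open>N powr (1 - 2 * \<sigma>)\<close>. Hence
  \<open>Z\<close> converges at rate \<open>N powr - \<delta>\<close> with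
  \<open>\<delta> = \<sigma> - 1/2\<close>. Multiplying back by \<open>\<gamma> n\<close> leaves an
  error of order \<open>n powr (1/2)\<close>, which is of smaller order than
  \<open>n powr \<sigma>\<close>.\<close>

lemma dominant_limit:
  assumes l: "poly (chi_poly CARD('m)) l = 0" "1/2 < Re l" "Re l \<le> 1"
  obtains W where "W \<in> borel_measurable M"
    "AE \<omega> in M. (\<lambda>n. of_nat n powr (- l) * u_form l (G n \<omega>)) \<longlonglongrightarrow> W \<omega>"
    "lp_small M (\<lambda>n \<omega>. u_form l (G n \<omega>) - of_nat n powr l * W \<omega>) (Re l)"
proof -
  define \<sigma> where "\<sigma> = Re l"
  define \<delta> where "\<delta> = \<sigma> - 1/2"
  define \<gamma> where "\<gamma> = growth K l 0"
  define E where "E = exp (2 * (K + 2))"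
  define F where "F = exp (2 * growth_err K l)"
  have \<sigma>: "1/2 < \<sigma>" "\<sigma> \<le> 1" "\<delta> > 0" using l by (auto simp: \<sigma>_def \<delta>_def)
  have \<gamma>_lower: "cmod (\<gamma> n) \<ge> inverse E * (real n + 1) powr \<sigma>" for n
    using growth_lower[OF K_ge_1, of l n] l by (simp add: \<gamma>_def \<sigma>_def E_def flip: exp_minus)
  have E: "E > 0" by (simp add: E_def)
  have \<gamma>_nz: "\<gamma> n \<noteq> 0" for n
  proof -
    have "inverse E * (real n + 1) powr \<sigma> > 0" using E by simp
    then show ?thesis using \<gamma>_lower[of n] by auto
  qed
  have \<gamma>_upper: "cmod (\<gamma> n) \<le> F * (real n + 1) powr \<sigma>" for n
    using growth_upper[OF K_ge_1, of 0 n l] by (simp add: \<gamma>_def \<sigma>_def F_def)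
  have \<gamma>_Suc: "\<gamma> (Suc n) = \<gamma> n * (1 + l / of_real (K + real n))" for n by (simp add: \<gamma>_def growth_Suc)
  define Z where "Z = (\<lambda>n \<omega>. u_form l (G n \<omega>) / \<gamma> n)"
  \<comment> \<open>Increments before time \<open>N\<close> are switched off, so a sum started at 0
    represents the difference from \<open>Z N\<close>.\<close>
  define D where "D = (\<lambda>N k x y. if k < N then 0 else incr l x y / \<gamma> (Suc k))"
  have ZD: "AE \<omega> in M. Z n \<omega> - Z N \<omega> = msum (D N) n \<omega>" if "N \<le> n" for N n
    using that
  proof (induction n rule: dec_induct)
    case base
    have "msum (D N) N \<omega> = 0" for \<omega> by (simp add: msum_def D_def)
    then show ?case by simp
  next
    case (step n)
    show ?case using step.IH AE_coord_sum[of n]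
    proof eventually_elim
      case (elim \<omega>)
      have "u_form l (G (Suc n) \<omega>) = (1 + l / of_real (K + real n)) * u_form l (G n \<omega>) + incr l (G n \<omega>) (G (Suc n) \<omega>)"
        using elim(2) by (simp add: incr_def)
      moreover have "1 + l / of_real (K + real n) \<noteq> 0" using \<gamma>_nz[of "Suc n"] unfolding \<gamma>_Suc by auto
      ultimately have "Z (Suc n) \<omega> = Z n \<omega> + incr l (G n \<omega>) (G (Suc n) \<omega>) / \<gamma> (Suc n)"
        using \<gamma>_nz[of n] unfolding Z_def \<gamma>_Suc by (simp add: add_divide_distrib)
      then show ?case using elim(1) step.hyps by (simp add: msum_def D_def)
    qed
  qed
  have ZDm: "integrable M (\<lambda>\<omega>. cmod (Z n \<omega> - Z N \<omega>) ^ q)" if "N \<le> n" for N n q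
  proof -
    have eq: "AE \<omega> in M. cmod (Z n \<omega> - Z N \<omega>) ^ q = cmod (msum (D N) n \<omega>) ^ q"
      using ZD[OF that] by eventually_elim simp
    have I: "integrable M (\<lambda>\<omega>. cmod (msum (D N) n \<omega>) ^ q)" by (rule integrable_msum[of "\<lambda>s _. cmod s ^ q"])
    have meas: "(\<lambda>\<omega>. cmod (Z n \<omega> - Z N \<omega>) ^ q) \<in> borel_measurable M"
    proof -
      have [measurable]: "(\<lambda>\<omega>. Z n \<omega>) \<in> borel_measurable M" for n unfolding Z_def by (rule measurable_X[of "\<lambda>x. u_form l x / \<gamma> n"])
      show ?thesis by measurable
    qed
    show ?thesis by (rule iffD2[OF integrable_cong_AE[OF meas _ eq] I]) (rule borel_measurable_integrable[OF I])
  qed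
  define b where "b = 2 * cmod l * u_max CARD('m) l"
  have b: "b \<ge> 0" unfolding b_def using u_max_nonneg by simp
  have mom: "\<exists>C. \<forall>N n. N \<le> n \<longrightarrow> expectation (\<lambda>\<omega>. cmod (Z n \<omega> - Z N \<omega>) ^ q) \<le> C * ((real N + 1) powr - \<delta>) ^ q" for q
  proof (intro exI allI impI)
    fix N n :: nat assume Nn: "N \<le> n"
    define h where "h = (b + 1) * E / sqrt (2 * \<sigma> - 1)"
    define R where "R = (real N + 1) powr - \<delta>"
    have h: "h > 0" using b E \<sigma> by (simp add: h_def)
    have R: "R > 0" by (simp add: R_def)
    have "expectation (\<lambda>\<omega>. cmod (Z n \<omega> - Z N \<omega>) ^ q) = expectation (\<lambda>\<omega>. cmod (msum (D N) n \<omega>) ^ q)"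
    proof (rule integral_cong_AE)
      show "(\<lambda>\<omega>. cmod (Z n \<omega> - Z N \<omega>) ^ q) \<in> borel_measurable M" using ZDm[OF Nn] by (rule borel_measurable_integrable)
      show "(\<lambda>\<omega>. cmod (msum (D N) n \<omega>) ^ q) \<in> borel_measurable M"
        by (rule borel_measurable_integrable[OF integrable_msum[of "\<lambda>s _. cmod s ^ q"]])
      show "AE \<omega> in M. cmod (Z n \<omega> - Z N \<omega>) ^ q = cmod (msum (D N) n \<omega>) ^ q"
        using ZD[OF Nn] by eventually_elim simp
    qed
    also have "\<dots> \<le> 12 * 2 ^ q * fact q * (h * R) ^ q"
    proof (rule moment_msum_bound_complex[where A=level and c="\<lambda>k. if k < N then 0 else b * (E * (real k + 2) powr - \<sigma>)"])
      show "AE \<omega> in M. G k \<omega> \<in> level k" for k by (rule AE_level)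
      show "level k \<subseteq> nonzero_nat_vecs" for k by (rule level_subset)
      show "(\<Sum>i\<in>UNIV. gap_prob x i *\<^sub>R D N k x (x + gap_step i)) = 0" if "x \<in> level k" for k x
      proof (cases "k < N")
        case False
        then have "(\<Sum>i\<in>UNIV. gap_prob x i *\<^sub>R D N k x (x + gap_step i)) = (\<Sum>i\<in>UNIV. gap_prob x i *\<^sub>R incr l x (x + gap_step i)) / \<gamma> (Suc k)"
          by (simp add: D_def sum_divide_distrib scaleR_conv_of_real)
        then show ?thesis using incr_mean[OF l(1)] that level_subset by auto
      qed (simp add: D_def)
      show "cmod (D N k x (x + gap_step i)) \<le> (if k < N then 0 else b * (E * (real k + 2) powr - \<sigma>))" if "x \<in> level k" for k x i
      proof (cases "k < N")
        case False
        have "inverse (cmod (\<gamma> (Suc k))) \<le> inverse (inverse E * (real (Suc k) + 1) powr \<sigma>)"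
          using E by (intro le_imp_inverse_le \<gamma>_lower) simp
        also have "\<dots> = E * (real k + 2) powr - \<sigma>" by (simp add: powr_minus add.commute)
        finally have "cmod (incr l x (x + gap_step i)) * inverse (cmod (\<gamma> (Suc k))) \<le> b * (E * (real k + 2) powr - \<sigma>)"
          unfolding b_def using that level_subset u_max_nonneg by (intro mult_mono incr_bound l(1)) auto
        then show ?thesis using False by (simp add: D_def norm_divide) (simp add: divide_inverse)
      qed (simp add: D_def)
      show "0 < h * R" using h R by simp
      have "(\<Sum>k<n. (if k < N then 0 else b * (E * (real k + 2) powr - \<sigma>))\<^sup>2) = (\<Sum>k=N..<n. (b * E)\<^sup>2 * (real k + 2) powr - (2 * \<sigma>))"
      proof -
        have "(\<Sum>k<n. (if k < N then 0 else b * (E * (real k + 2) powr - \<sigma>))\<^sup>2) = (\<Sum>k=N..<n. (b * (E * (real k + 2) powr - \<sigma>))\<^sup>2)"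
          by (rule sum.mono_neutral_cong_right) auto
        then show ?thesis by (simp add: power_mult_distrib powr_power mult_ac)
      qed
      also have "\<dots> = (b * E)\<^sup>2 * (\<Sum>k=N..<n. (real k + 2) powr - (2 * \<sigma>))" by (simp add: sum_distrib_left)
      also have "\<dots> \<le> ((b + 1) * E)\<^sup>2 * ((real N + 1) powr (1 - 2 * \<sigma>) / (2 * \<sigma> - 1))"
        using \<sigma> b E by (intro mult_mono sum_powr_tail_le power_mono) (auto intro!: sum_nonneg)
      also have "(real N + 1) powr (1 - 2 * \<sigma>) = R\<^sup>2" by (simp add: R_def powr_power \<delta>_def algebra_simps)
      also have "((b + 1) * E)\<^sup>2 * (R\<^sup>2 / (2 * \<sigma> - 1)) = (h * R)\<^sup>2"
        using \<sigma> by (simp add: h_def power_mult_distrib power_divide)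
      finally show "(\<Sum>k<n. (if k < N then 0 else b * (E * (real k + 2) powr - \<sigma>))\<^sup>2) \<le> (h * R)\<^sup>2" .
    qed
    finally show "expectation (\<lambda>\<omega>. cmod (Z n \<omega> - Z N \<omega>) ^ q)
      \<le> (12 * 2 ^ q * fact q * ((b + 1) * E / sqrt (2 * \<sigma> - 1)) ^ q) * ((real N + 1) powr - \<delta>) ^ q"
      unfolding h_def[symmetric] R_def[symmetric] by (simp only: power_mult_distrib mult.assoc)
  qed
  have Zm: "(\<lambda>\<omega>. Z n \<omega>) \<in> borel_measurable M" for n unfolding Z_def by (rule measurable_X[of "\<lambda>x. u_form l x / \<gamma> n"])
  have ZDm2: "integrable M (\<lambda>\<omega>. cmod (Z n \<omega> - Z N \<omega>) ^ q)" for n N q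
    using ZDm[of N n q] ZDm[of n N q] by (cases "N \<le> n") (auto simp: norm_minus_commute)
  have Zi: "integrable M (\<lambda>\<omega>. cmod (Z n \<omega>) ^ q)" for n q
    unfolding Z_def by (rule integrable_X[of "\<lambda>x. cmod (u_form l x / \<gamma> n) ^ q"])
  obtain Y where Y: "Y \<in> borel_measurable M" "\<And>q. integrable M (\<lambda>\<omega>. cmod (Y \<omega>) ^ q)"
    "AE \<omega> in M. (\<lambda>n. Z n \<omega>) \<longlonglongrightarrow> Y \<omega>"
    "\<And>n q. integrable M (\<lambda>\<omega>. cmod (Z n \<omega> - Y \<omega>) ^ q)"
    "\<And>q. \<exists>C. \<forall>n. (\<integral>\<omega>. cmod (Z n \<omega> - Y \<omega>) ^ q \<partial>M) \<le> C * ((real n + 1) powr - \<delta>) ^ q"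
    by (rule Lp_Cauchy_limit[OF prob_space_axioms Zm Zi ZDm2 \<sigma>(3) mom]) blast
  obtain c where c: "(\<lambda>n. of_nat n powr (- l) * \<gamma> n) \<longlonglongrightarrow> c"
    using growth_limit[OF K_ge_1, of l] l unfolding \<gamma>_def by auto
  define W where "W = (\<lambda>\<omega>. c * Y \<omega>)"
  have "W \<in> borel_measurable M" unfolding W_def using Y(1) by measurable
  moreover have "AE \<omega> in M. (\<lambda>n. of_nat n powr (- l) * u_form l (G n \<omega>)) \<longlonglongrightarrow> W \<omega>"
    using Y(3)
  proof eventually_elim
    case (elim \<omega>)
    have "(\<lambda>n. of_nat n powr (- l) * \<gamma> n * Z n \<omega>) \<longlonglongrightarrow> c * Y \<omega>" by (intro tendsto_mult c elim)
    then show ?case using \<gamma>_nz by (simp add: Z_def W_def)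
  qed
  moreover have "lp_small M (\<lambda>n \<omega>. u_form l (G n \<omega>) - of_nat n powr l * W \<omega>) (Re l)"
  proof -
    have "lp_small M (\<lambda>n \<omega>. \<gamma> n * (Z n \<omega> - Y \<omega>)) \<sigma>"
    proof (rule lp_small_moments[where \<rho>="1/2"])
      show "(\<lambda>\<omega>. \<gamma> n * (Z n \<omega> - Y \<omega>)) \<in> borel_measurable M" for n using Zm[of n] Y(1) by measurable
      show "integrable M (\<lambda>\<omega>. cmod (\<gamma> n * (Z n \<omega> - Y \<omega>)) ^ q)" for n q
        using integrable_mult_right[OF Y(4)[of n q], of "cmod (\<gamma> n) ^ q"] by (simp add: norm_mult power_mult_distrib)
      fix q :: nat
      obtain C where C: "\<And>n. (\<integral>\<omega>. cmod (Z n \<omega> - Y \<omega>) ^ q \<partial>M) \<le> C * ((real n + 1) powr - \<delta>) ^ q" using Y(5) by blast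
      show "\<exists>C. \<forall>n. (\<integral>\<omega>. cmod (\<gamma> n * (Z n \<omega> - Y \<omega>)) ^ q \<partial>M) \<le> C * ((real n + 1) powr (1/2)) ^ q"
      proof (intro exI allI)
        fix n
        have nn: "(\<integral>\<omega>. cmod (Z n \<omega> - Y \<omega>) ^ q \<partial>M) \<ge> 0" by (intro integral_nonneg_AE) auto
        have "(\<integral>\<omega>. cmod (\<gamma> n * (Z n \<omega> - Y \<omega>)) ^ q \<partial>M) = cmod (\<gamma> n) ^ q * (\<integral>\<omega>. cmod (Z n \<omega> - Y \<omega>) ^ q \<partial>M)"
          by (simp add: norm_mult power_mult_distrib)
        also have "\<dots> \<le> (F * (real n + 1) powr \<sigma>) ^ q * (C * ((real n + 1) powr - \<delta>) ^ q)"
          using nn by (intro mult_mono power_mono \<gamma>_upper C) (auto simp: F_def)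
        also have "\<dots> = F ^ q * C * ((real n + 1) powr \<sigma> * (real n + 1) powr - \<delta>) ^ q"
          by (simp add: power_mult_distrib mult_ac)
        also have "(real n + 1) powr \<sigma> * (real n + 1) powr - \<delta> = (real n + 1) powr (1/2)"
          by (simp add: \<delta>_def flip: powr_add)
        finally show "(\<integral>\<omega>. cmod (\<gamma> n * (Z n \<omega> - Y \<omega>)) ^ q \<partial>M) \<le> F ^ q * C * ((real n + 1) powr (1/2)) ^ q" .
      qed
    qed (use \<sigma> in simp)
    \<comment> \<open>The second error comes from exchanging \<open>\<gamma> n\<close> for its
      asymptotic equivalent \<open>c * n powr l\<close> in front of the limit variable.\<close>
    moreover have "lp_small M (\<lambda>n \<omega>. (\<gamma> n - of_nat n powr l * c) * Y \<omega>) \<sigma>"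
    proof (rule lp_small_scale[OF Y(1,2)])
      have "(\<lambda>n. cmod (of_nat n powr (- l) * \<gamma> n - c)) \<longlonglongrightarrow> 0"
        using c by (simp add: LIM_zero tendsto_norm_zero)
      then show "(\<lambda>n. cmod (\<gamma> n - of_nat n powr l * c) / (real n + 1) powr \<sigma>) \<longlonglongrightarrow> 0"
      proof (rule tendsto_sandwich[OF _ _ tendsto_const, rotated 2])
        show "\<forall>\<^sub>F n in sequentially. cmod (\<gamma> n - of_nat n powr l * c) / (real n + 1) powr \<sigma> \<le> cmod (of_nat n powr (- l) * \<gamma> n - c)"
          using eventually_gt_at_top[of 0]
        proof eventually_elim
          case (elim n)
          have "of_nat n powr l * of_nat n powr (- l) = (1::complex)" using elim by (simp flip: powr_add)
          then have "\<gamma> n - of_nat n powr l * c = of_nat n powr l * (of_nat n powr (- l) * \<gamma> n - c)"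
            by (simp add: right_diff_distrib mult.assoc[symmetric])
          then have "cmod (\<gamma> n - of_nat n powr l * c) = cmod (of_nat n powr l) * cmod (of_nat n powr (- l) * \<gamma> n - c)"
            by (simp only: norm_mult)
          also have "cmod (of_nat n powr l) = real n powr \<sigma>"
            using norm_powr_real_powr[of "of_nat n" l] elim by (simp add: \<sigma>_def)
          also have "real n powr \<sigma> * cmod (of_nat n powr (- l) * \<gamma> n - c) \<le> (real n + 1) powr \<sigma> * cmod (of_nat n powr (- l) * \<gamma> n - c)"
            using \<sigma> by (intro mult_right_mono powr_mono2) auto
          finally show ?case by (simp add: divide_le_eq mult.commute)
        qed
      qed simp
    qed
    ultimately have "lp_small M (\<lambda>n \<omega>. \<gamma> n * (Z n \<omega> - Y \<omega>) + (\<gamma> n - of_nat n powr l * c) * Y \<omega>) \<sigma>"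
      by (rule lp_small_add)
    moreover have "\<gamma> n * (Z n \<omega> - Y \<omega>) + (\<gamma> n - of_nat n powr l * c) * Y \<omega> = u_form l (G n \<omega>) - of_nat n powr l * W \<omega>" for n \<omega>
      using \<gamma>_nz[of n] by (simp add: Z_def W_def algebra_simps)
    ultimately show ?thesis by (simp add: \<sigma>_def)
  qed
  ultimately show ?thesis using that by blast
qed

lemma u_form_lp_small:
  assumes l: "poly (chi_poly CARD('m)) l = 0" and s: "Re l < s" "1/2 < s"
  shows "lp_small M (\<lambda>n \<omega>. u_form l (G n \<omega>)) s"
proof -
  \<comment> \<open>An exponent at least \<open>Re l\<close>, strictly above 1/2 and strictly below
    \<open>s\<close>; so the borderline case excluded in \<open>u_form_moments\<close> does not
    occur.\<close>
  define r where "r = max (Re l) ((s + 1/2) / 2)"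
  have r: "Re l \<le> r" "2 * r \<noteq> 1" "r \<ge> 0" "r > 1/2" "r < s" using s by (auto simp: r_def max_def)
  have "max r (1/2) = r" using r by simp
  show ?thesis
  proof (rule lp_small_moments[OF _ r(5)])
    show "(\<lambda>\<omega>. u_form l (G n \<omega>)) \<in> borel_measurable M" for n by (rule measurable_X)
    show "integrable M (\<lambda>\<omega>. cmod (u_form l (G n \<omega>)) ^ q)" for n q by (rule integrable_X[of "\<lambda>x. cmod (u_form l x) ^ q"])
    show "\<exists>C. \<forall>n. expectation (\<lambda>\<omega>. cmod (u_form l (G n \<omega>)) ^ q) \<le> C * ((real n + 1) powr r) ^ q" for q
      using u_form_moments[OF l r(1-3), of q] unfolding \<open>max r (1/2) = r\<close> by metis
  qed
qed

text \<open>In the spectral decomposition the root 1 gives the drift up to a bounded term,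
  \<open>lambda2\<close> and its conjugate give the main fluctuation. For every other root both
  \<open>Re l\<close> and the noise exponent 1/2 are below \<open>sigma2\<close>.\<close>

theorem gap_asymptotics_large:
  assumes m: "CARD('m) \<ge> 60"
  obtains W where "W \<in> borel_measurable M"
    "AE \<omega> in M. (\<lambda>n. of_nat n powr (- lambda2 CARD('m)) * u_form (lambda2 CARD('m)) (G n \<omega>)) \<longlonglongrightarrow> W \<omega>"
    "lp_small M (\<lambda>n \<omega>. G n \<omega> - (real n *\<^sub>R v_vec 1 + 2 *\<^sub>R Re_vec ((of_nat n powr lambda2 CARD('m) * W \<omega>) *s v_vec (lambda2 CARD('m))))) (sigma2 CARD('m))"
proof -
  let ?m = "CARD('m)" and ?l = "lambda2 CARD('m)" and ?s = "sigma2 CARD('m)"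
  note l2 = lambda2_props[OF m]
  have s: "1/2 < ?s" "?s < 1" using sigma2_large[OF m] sigma2_less_1[OF m_ge_2] by auto
  obtain W where W: "W \<in> borel_measurable M"
    "AE \<omega> in M. (\<lambda>n. of_nat n powr (- ?l) * u_form ?l (G n \<omega>)) \<longlonglongrightarrow> W \<omega>"
    "lp_small M (\<lambda>n \<omega>. u_form ?l (G n \<omega>) - of_nat n powr ?l * W \<omega>) ?s"
    using dominant_limit[OF l2(1)] s l2(2) by auto
  define O' where "O' = {z. poly (chi_poly ?m) z = 0} - {1, ?l, cnj ?l}"
  have fin: "finite {z. poly (chi_poly ?m) z = 0}" using chi_poly_nonzero[of ?m] m by (intro poly_roots_finite) auto
  have finO: "finite O'" using fin by (simp add: O'_def)
  \<comment> \<open>A real linear map into real vectors, which makes the rule for bounded linear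
    images available for each spectral component.\<close>
  define T where "T = (\<lambda>v::complex^'m::{finite,linorder}. \<lambda>z. (\<chi> i. Re (z * v $ i)) :: real^'m::{finite,linorder})"
  have T: "bounded_linear (T v)" for v
    unfolding T_def by (intro linear_conv_bounded_linear[THEN iffD1] linearI) (auto simp: vec_eq_iff algebra_simps)
  \<comment> \<open>Almost surely equal to the constant \<open>K\<close>; this is the bounded error
    from writing \<open>n\<close> for the total.\<close>
  define X1 where "X1 = (\<lambda>n \<omega>. complex_of_real (coord_sum (G n \<omega>) - real n))"
  have X1: "lp_small M X1 ?s"
  proof (rule lp_small_moments[where \<rho>=0])
    show "X1 n \<in> borel_measurable M" for n unfolding X1_def by (rule measurable_X)
    show "integrable M (\<lambda>\<omega>. cmod (X1 n \<omega>) ^ q)" for n q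
      unfolding X1_def by (rule integrable_X[of "\<lambda>x. cmod (complex_of_real (coord_sum x - real n)) ^ q"])
    show "\<exists>C. \<forall>n. expectation (\<lambda>\<omega>. cmod (X1 n \<omega>) ^ q) \<le> C * ((real n + 1) powr 0) ^ q" for q
    proof (intro exI allI)
      fix n
      have "expectation (\<lambda>\<omega>. cmod (X1 n \<omega>) ^ q) = expectation (\<lambda>\<omega>. K ^ q)"
      proof (rule integral_cong_AE)
        show "(\<lambda>\<omega>. cmod (X1 n \<omega>) ^ q) \<in> borel_measurable M"
          unfolding X1_def by (rule measurable_X[of "\<lambda>x. cmod (complex_of_real (coord_sum x - real n)) ^ q"])
        show "AE \<omega> in M. cmod (X1 n \<omega>) ^ q = K ^ q"
          using AE_coord_sum[of n] by eventually_elim (use K_ge_1 in \<open>simp add: X1_def\<close>)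
      qed simp
      then show "expectation (\<lambda>\<omega>. cmod (X1 n \<omega>) ^ q) \<le> K ^ q * ((real n + 1) powr 0) ^ q" by (simp add: prob_space)
    qed
  qed (use s in simp)
  define X2 where "X2 = (\<lambda>n \<omega>. u_form ?l (G n \<omega>) - of_nat n powr ?l * W \<omega>)"
  have "lp_small M (\<lambda>n \<omega>. \<Sum>z\<in>O'. T (v_vec z) (u_form z (G n \<omega>))) ?s"
  proof (intro lp_small_sum finO lp_small_bounded_linear[OF T] u_form_lp_small)
    fix z assume "z \<in> O'"
    then show "poly (chi_poly CARD('m)) z = 0" "Re z < ?s" "1/2 < ?s"
      using Re_less_sigma2[OF m, of z] s by (auto simp: O'_def)
  qed
  moreover have "lp_small M (\<lambda>n \<omega>. T (v_vec 1) (X1 n \<omega>)) ?s" by (rule lp_small_bounded_linear[OF T X1])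
  \<comment> \<open>The factor 2 accounts for the conjugate root, whose component has the same real
    part.\<close>
  moreover have "lp_small M (\<lambda>n \<omega>. T (\<chi> i. 2 * v_vec ?l $ i) (X2 n \<omega>)) ?s"
    unfolding X2_def by (rule lp_small_bounded_linear[OF T W(3)])
  ultimately have sm: "lp_small M (\<lambda>n \<omega>. (\<Sum>z\<in>O'. T (v_vec z) (u_form z (G n \<omega>))) + (T (v_vec 1) (X1 n \<omega>) + T (\<chi> i. 2 * v_vec ?l $ i) (X2 n \<omega>))) ?s"
    by (intro lp_small_add)
  have "(\<Sum>z\<in>O'. T (v_vec z) (u_form z (G n \<omega>))) + (T (v_vec 1) (X1 n \<omega>) + T (\<chi> i. 2 * v_vec ?l $ i) (X2 n \<omega>))
    = G n \<omega> - (real n *\<^sub>R v_vec 1 + 2 *\<^sub>R Re_vec ((of_nat n powr ?l * W \<omega>) *s v_vec ?l))" for n \<omega>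
  proof (simp only: vec_eq_iff, rule allI)
    fix i :: 'm
    define x where "x = G n \<omega>"
    define S where "S = (\<Sum>z\<in>O'. u_form z x * v_vec z $ i)"
    have roots: "{z. poly (chi_poly ?m) z = 0} = insert 1 (insert ?l (insert (cnj ?l) O'))"
      using chi_root_one[of ?m] l2(1) chi_root_cnj[OF _ l2(1)] m by (auto simp: O'_def)
    have ne: "1 \<noteq> ?l" "1 \<noteq> cnj ?l" "?l \<noteq> cnj ?l" using l2 by (auto simp: complex_eq_iff)
    have "complex_of_real (x $ i) = (\<Sum>l | poly (chi_poly CARD('m)) l = 0. u_form l x * v_vec l $ i)"
      by (rule spectral_decomposition[OF m_ge_2])
    also have "\<dots> = u_form 1 x * v_vec 1 $ i + (u_form ?l x * v_vec ?l $ i + (u_form (cnj ?l) x * v_vec (cnj ?l) $ i + S))"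
      unfolding roots S_def using ne finO by (simp add: O'_def)
    finally have "x $ i = Re (u_form 1 x * v_vec 1 $ i + (u_form ?l x * v_vec ?l $ i + (u_form (cnj ?l) x * v_vec (cnj ?l) $ i + S)))"
      by (metis Re_complex_of_real)
    also have "\<dots> = coord_sum x * v_vec 1 $ i + 2 * Re (u_form ?l x * v_vec ?l $ i) + Re S"
      using v_vec_of_real[of 1 i] by (simp add: u_form_one u_form_cnj v_vec_cnj)
    finally have xi: "x $ i = coord_sum x * v_vec 1 $ i + 2 * Re (u_form ?l x * v_vec ?l $ i) + Re S" .
    have "(\<Sum>z\<in>O'. T (v_vec z) (u_form z x)) $ i = Re S" by (simp add: T_def S_def)
    moreover have "T (v_vec 1) (X1 n \<omega>) $ i = (coord_sum x - real n) * v_vec 1 $ i"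
      using v_vec_of_real[of 1 i] by (simp add: T_def X1_def x_def)
    moreover have "T (\<chi> i. 2 * v_vec ?l $ i) (X2 n \<omega>) $ i = 2 * Re (u_form ?l x * v_vec ?l $ i) - 2 * Re (of_nat n powr ?l * W \<omega> * v_vec ?l $ i)"
      by (simp add: T_def X2_def x_def algebra_simps)
    ultimately show "((\<Sum>z\<in>O'. T (v_vec z) (u_form z (G n \<omega>))) + (T (v_vec 1) (X1 n \<omega>) + T (\<chi> i. 2 * v_vec ?l $ i) (X2 n \<omega>))) $ i
      = (G n \<omega> - (real n *\<^sub>R v_vec 1 + 2 *\<^sub>R Re_vec ((of_nat n powr ?l * W \<omega>) *s v_vec ?l))) $ i"
      unfolding x_def[symmetric] vector_add_component vector_minus_component
      using xi by (simp add: Re_vec_def algebra_simps)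
  qed
  with sm show ?thesis using that W(1,2) by simp
qed

end

section \<open>Small phases\<close>

lemma growth_le_powr:
  assumes "K \<ge> 1" "Re l \<le> r" "k < n"
  shows "cmod (growth K l (Suc k) n) \<le> exp (2 * growth_err K l) * ((real n + 1) powr r * (real k + 2) powr - r)"
proof -
  have "cmod (growth K l (Suc k) n) \<le> exp (2 * growth_err K l) * ((real n + 1) / (real k + 2)) powr Re l"
    using growth_upper[OF assms(1), of "Suc k" n l] assms by (simp add: add.commute)
  also have "\<dots> \<le> exp (2 * growth_err K l) * ((real n + 1) / (real k + 2)) powr r"
    using assms by (intro mult_left_mono powr_mono) (auto simp: field_simps)
  also have "((real n + 1) / (real k + 2)) powr r = (real n + 1) powr r * (real k + 2) powr - r"
    by (simp add: powr_divide powr_minus field_simps)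
  finally show ?thesis .
qed

lemma growth_0_le_powr:
  assumes "K \<ge> 1" "Re l \<le> r"
  shows "cmod (growth K l 0 n) \<le> exp (2 * growth_err K l) * (real n + 1) powr r"
proof -
  have "cmod (growth K l 0 n) \<le> exp (2 * growth_err K l) * (real n + 1) powr Re l"
    using growth_upper[OF assms(1), of 0 n l] by simp
  also have "\<dots> \<le> exp (2 * growth_err K l) * (real n + 1) powr r"
    using assms by (intro mult_left_mono powr_mono) auto
  finally show ?thesis .
qed

lemma powr_over_n_le: "(real n + 1) powr (2 * r) / real n \<le> 2 * (real n + 1) powr (2 * r - 1)"
proof (cases "n = 0")
  case False
  have "(real n + 1) powr (2 * r) / real n = (real n + 1) powr (2 * r - 1) * ((real n + 1) / real n)"
    by (simp add: powr_diff)
  also have "\<dots> \<le> (real n + 1) powr (2 * r - 1) * 2"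
    using False by (intro mult_left_mono) (auto simp: field_simps)
  finally show ?thesis by (simp add: mult.commute)
qed simp

lemma tendsto_Suc_powr_neg: "a < 0 \<Longrightarrow> (\<lambda>n. (real n + 1) powr a) \<longlonglongrightarrow> 0"
proof -
  assume a: "a < 0"
  have "((\<lambda>x. x powr a) \<longlongrightarrow> 0) at_top" using a by (intro tendsto_neg_powr) (auto simp: filterlim_ident)
  moreover have "filterlim (\<lambda>n. real n + 1) at_top sequentially"
    using filterlim_tendsto_add_at_top[OF tendsto_const[of 1] filterlim_real_sequentially] by (simp add: add.commute)
  ultimately show ?thesis by (rule filterlim_compose)
qed

lemma squeeze_0:
  fixes f g :: "nat \<Rightarrow> real"
  assumes "g \<longlonglongrightarrow> 0" "\<And>n. \<bar>f n\<bar> \<le> g n"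
  shows "f \<longlonglongrightarrow> 0"
  by (rule Lim_null_comparison[OF _ assms(1)]) (simp add: assms(2) always_eventually)

text \<open>With \<open>t = 1 / (1 - l - l')\<close>, the differences \<open>T n - (K + n) * t\<close> satisfy the same recursion as
  the sums \<open>T n\<close> below, but with a source term that tends to zero.\<close>

lemma growth_product_sum_limit:
  assumes K: "K \<ge> 1" and r: "0 \<le> r" "r < 1/2" "Re l \<le> r" "Re l' \<le> r"
  shows "(\<lambda>n. (\<Sum>k<n. growth K l (Suc k) n * growth K l' (Suc k) n) / of_nat n) \<longlonglongrightarrow> 1 / (1 - l - l')"
proof -
  define t where "t = 1 / (1 - l - l')"
  define T where "T = (\<lambda>n. \<Sum>k<n. growth K l (Suc k) n * growth K l' (Suc k) n)"
  define g where "g = (\<lambda>k n. growth K l k n * growth K l' k n)"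
  define y where "y = (\<lambda>n. T n - of_real (K + real n) * t)"
  define F where "F = exp (2 * growth_err K l) * exp (2 * growth_err K l')"
  have "Re (1 - l - l') > 0" using r by simp
  then have "1 - l - l' \<noteq> 0" by (metis less_irrefl zero_complex.sel(1))
  then have t: "t - (l + l') * t = 1" by (simp add: t_def field_simps)
  have yeq: "y n = g 0 n * y 0 + (\<Sum>k<n. g (Suc k) n * (l * l' * t / of_real (K + real k)))" for n
  proof (induction n)
    case 0
    then show ?case by (simp add: g_def)
  next
    case (Suc n)
    define x where "x = complex_of_real (K + real n)"
    have x: "x \<noteq> 0" using K by (simp add: x_def) (metis add_nonneg_pos le_iff_add less_irrefl of_nat_0_le_iff of_real_eq_0_iff of_real_add of_real_of_nat_eq add.commute zero_less_one add_pos_nonneg order_less_le_trans)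
    define f where "f = (1 + l / x) * (1 + l' / x)"
    have gS: "g k (Suc n) = g k n * f" if "k \<le> n" for k
      using that by (simp add: g_def f_def x_def growth_Suc mult_ac)
    have TS: "T (Suc n) = f * T n + 1"
    proof -
      have "T (Suc n) = (\<Sum>k<n. g (Suc k) (Suc n)) + 1" by (simp add: T_def g_def)
      also have "(\<Sum>k<n. g (Suc k) (Suc n)) = f * (\<Sum>k<n. g (Suc k) n)"
        unfolding sum_distrib_left by (intro sum.cong) (auto simp: gS)
      finally show ?thesis by (simp add: T_def g_def)
    qed
    have "y (Suc n) = f * (y n + x * t) + 1 - (x + 1) * t"
      by (simp add: y_def TS x_def algebra_simps)
    also have "\<dots> = f * y n + l * l' * t / x + (1 - (t - (l + l') * t))"
      using x by (simp add: f_def field_simps)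
    finally have "y (Suc n) = f * y n + l * l' * t / x" using t by simp
    also have "f * y n = g 0 (Suc n) * y 0 + (\<Sum>k<n. g (Suc k) (Suc n) * (l * l' * t / of_real (K + real k)))"
      unfolding Suc.IH by (simp add: gS distrib_left sum_distrib_left mult_ac)
    finally show ?case by (simp add: x_def g_def)
  qed
  have gb: "cmod (g (Suc k) n) \<le> F * ((real n + 1) powr (2 * r) * (real k + 2) powr - (2 * r))" if "k < n" for k n
  proof -
    have "cmod (g (Suc k) n) \<le> (exp (2 * growth_err K l) * ((real n + 1) powr r * (real k + 2) powr - r)) * (exp (2 * growth_err K l') * ((real n + 1) powr r * (real k + 2) powr - r))"
      unfolding g_def norm_mult using that r K by (intro mult_mono growth_le_powr) auto
    also have "\<dots> = F * (((real n + 1) powr r * (real n + 1) powr r) * ((real k + 2) powr - r * (real k + 2) powr - r))"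
      by (simp add: F_def mult_ac)
    finally show ?thesis by (simp flip: powr_add)
  qed
  have g0: "cmod (g 0 n) \<le> F * (real n + 1) powr (2 * r)" for n
  proof -
    have "cmod (g 0 n) \<le> (exp (2 * growth_err K l) * (real n + 1) powr r) * (exp (2 * growth_err K l') * (real n + 1) powr r)"
      unfolding g_def norm_mult using r K by (intro mult_mono growth_0_le_powr) auto
    also have "\<dots> = F * ((real n + 1) powr r * (real n + 1) powr r)" by (simp add: F_def mult_ac)
    finally show ?thesis by (simp flip: powr_add)
  qed
  have "(\<lambda>n. cmod (y n / of_nat n)) \<longlonglongrightarrow> 0"
  proof (rule squeeze_0)
    let ?S = "\<lambda>n. \<Sum>k<n. (real k + 2) powr - (2 * r) * inverse (K + real k)"
    have "filterlim (\<lambda>n. K + real n) at_top sequentially"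
      by (rule filterlim_tendsto_add_at_top[OF tendsto_const filterlim_real_sequentially])
    then have "(\<lambda>n. inverse (K + real n)) \<longlonglongrightarrow> 0" by (rule tendsto_inverse_0_at_top)
    then have a: "(\<lambda>n. (real n + 1) powr (2 * r - 1) * ?S n) \<longlonglongrightarrow> 0"
      using r by (intro toeplitz_powr) auto
    have b: "(\<lambda>n. (real n + 1) powr (2 * r - 1)) \<longlonglongrightarrow> 0" using r by (intro tendsto_Suc_powr_neg) auto
    show "(\<lambda>n. 2 * F * cmod (y 0) * (real n + 1) powr (2 * r - 1) + 2 * F * cmod (l * l' * t) * ((real n + 1) powr (2 * r - 1) * ?S n)) \<longlonglongrightarrow> 0"
      using tendsto_add[OF tendsto_mult_right_zero[OF b] tendsto_mult_right_zero[OF a]] by simp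
    fix n
    have F: "F \<ge> 0" by (simp add: F_def)
    have S0: "?S n \<ge> 0" using K by (intro sum_nonneg) auto
    have "cmod (y n) \<le> cmod (g 0 n * y 0) + (\<Sum>k<n. cmod (g (Suc k) n * (l * l' * t / of_real (K + real k))))"
      unfolding yeq[of n] by (intro order_trans[OF norm_triangle_ineq] add_left_mono norm_sum)
    also have "(\<Sum>k<n. cmod (g (Suc k) n * (l * l' * t / of_real (K + real k)))) \<le>
      (\<Sum>k<n. F * ((real n + 1) powr (2 * r) * (real k + 2) powr - (2 * r)) * (cmod (l * l' * t) * inverse (K + real k)))"
    proof (intro sum_mono)
      fix k assume "k \<in> {..<n}"
      have "cmod (of_real (K + real k)) = K + real k" unfolding norm_of_real using K by simp
      then have "cmod (l * l' * t / of_real (K + real k)) = cmod (l * l' * t) * inverse (K + real k)"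
        unfolding norm_divide by (simp only: divide_inverse)
      then show "cmod (g (Suc k) n * (l * l' * t / of_real (K + real k))) \<le> F * ((real n + 1) powr (2 * r) * (real k + 2) powr - (2 * r)) * (cmod (l * l' * t) * inverse (K + real k))"
        unfolding norm_mult[of "g (Suc k) n"] using gb[of k n] \<open>k \<in> {..<n}\<close> K F by (auto intro!: mult_mono)
    qed
    also have "\<dots> = F * cmod (l * l' * t) * (real n + 1) powr (2 * r) * ?S n"
      by (simp add: sum_distrib_left mult_ac)
    also have "cmod (g 0 n * y 0) \<le> F * (real n + 1) powr (2 * r) * cmod (y 0)"
      unfolding norm_mult using g0 by (intro mult_right_mono) auto
    finally have "cmod (y n) \<le> (F * cmod (y 0) + F * cmod (l * l' * t) * ?S n) * (real n + 1) powr (2 * r)"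
      by (simp add: algebra_simps)
    then have "cmod (y n) / real n \<le> (F * cmod (y 0) + F * cmod (l * l' * t) * ?S n) * ((real n + 1) powr (2 * r) / real n)"
      unfolding times_divide_eq_right by (intro divide_right_mono) auto
    also have "\<dots> \<le> (F * cmod (y 0) + F * cmod (l * l' * t) * ?S n) * (2 * (real n + 1) powr (2 * r - 1))"
      using F S0 by (intro mult_left_mono powr_over_n_le) auto
    finally show "\<bar>cmod (y n / of_nat n)\<bar> \<le> 2 * F * cmod (y 0) * (real n + 1) powr (2 * r - 1) + 2 * F * cmod (l * l' * t) * ((real n + 1) powr (2 * r - 1) * ?S n)"
      by (simp add: norm_divide algebra_simps)
  qed
  then have y0: "(\<lambda>n. y n / of_nat n) \<longlonglongrightarrow> 0" by (rule tendsto_norm_zero_cancel)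
  have "(\<lambda>n. of_real K / of_nat n :: complex) \<longlonglongrightarrow> 0" by (rule tendsto_divide_0[OF tendsto_const tendsto_of_nat])
  from tendsto_add[OF y0 tendsto_mult_right[OF tendsto_add[OF this tendsto_const[of 1]], of t]]
  have "(\<lambda>n. y n / of_nat n + t * (of_real K / of_nat n + 1)) \<longlonglongrightarrow> t" by (simp add: mult.commute)
  moreover have "\<forall>\<^sub>F n in sequentially. y n / of_nat n + t * (of_real K / of_nat n + 1) = T n / of_nat n"
    using eventually_gt_at_top[of 0] by eventually_elim (simp add: y_def field_simps)
  ultimately have "(\<lambda>n. T n / of_nat n) \<longlonglongrightarrow> t" by (rule Lim_transform_eventually)
  then show ?thesis by (simp add: T_def t_def)
qed

lemma v1_pos: "(v_vec 1 :: real^'m::{finite,linorder}) $ i > 0"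
proof -
  have "H_fun CARD('m) (real CARD('m) + 1 - 1) > 0"
    unfolding H_fun_def by (intro sum_pos) (auto simp: add_pos_pos)
  then show ?thesis unfolding v_vec_def vec_lambda_beta
    by (intro mult_pos_pos divide_pos_pos prod_pos) (auto intro: add_pos_pos)
qed

lemma sum_v1:
  assumes "CARD('m::{finite,linorder}) \<ge> 2"
  shows "(\<Sum>i\<in>(UNIV::'m::{finite,linorder} set). (v_vec 1 :: real^'m::{finite,linorder}) $ i) = 1"
proof -
  have "u_form 1 (v_vec 1 :: real^'m::{finite,linorder}) = 1" using u_form_v1[OF assms chi_root_one] assms by simp
  then show ?thesis unfolding u_form_one coord_sum_def by (simp only: of_real_eq_1_iff)
qed

text \<open>The coefficient of \<open>u_form l\<close> when the functional
  \<open>x \<mapsto> a \<bullet> x\<close> is expanded in the eigenforms.\<close>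

definition v_dual :: "real^'m::{finite,linorder} \<Rightarrow> complex \<Rightarrow> complex" where
  "v_dual a l = (\<Sum>i\<in>UNIV. of_real (a $ i) * v_vec l $ i)"

lemma v_dual_cnj: "v_dual a (cnj l) = cnj (v_dual a l)"
  by (simp add: v_dual_def v_vec_cnj)

lemma v_dual_add: "v_dual (a + b) l = v_dual a l + v_dual b l"
  by (simp add: v_dual_def algebra_simps sum.distrib)

lemma v_dual_scaleR: "v_dual (c *\<^sub>R a) l = of_real c * v_dual a l"
  by (simp add: v_dual_def sum_distrib_left mult_ac)

definition minor_roots :: "nat \<Rightarrow> complex set" where
  "minor_roots n = {l. poly (chi_poly n) l = 0} - {1}"

lemma finite_minor_roots: "n \<ge> 1 \<Longrightarrow> finite (minor_roots n)"
  using chi_poly_nonzero[of n] by (auto simp: minor_roots_def intro: finite_subset[OF _ poly_roots_finite])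

lemma cnj_minor_roots: "n \<ge> 1 \<Longrightarrow> bij_betw cnj (minor_roots n) (minor_roots n)"
  by (rule bij_betwI[where g=cnj]) (auto simp: minor_roots_def intro: chi_root_cnj)

text \<open>Conjugation permutes the roots. In \<open>of_real_weight\<close> this lets a real part
  be replaced by the full complex sum, so that its square expands into a double sum over
  roots.\<close>

lemma real_sum_minor_roots:
  assumes "n \<ge> 1" "\<And>l. f (cnj l) = cnj (f l)"
  shows "of_real (Re (\<Sum>l\<in>minor_roots n. f l)) = (\<Sum>l\<in>minor_roots n. f l)"
proof -
  have "cnj (\<Sum>l\<in>minor_roots n. f l) = (\<Sum>l\<in>minor_roots n. f (cnj l))" by (simp add: assms(2))
  also have "\<dots> = (\<Sum>l\<in>minor_roots n. f l)" by (rule sum.reindex_bij_betw[OF cnj_minor_roots[OF assms(1)]])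
  finally have "(\<Sum>l\<in>minor_roots n. f l) \<in> \<real>" by (simp add: Reals_cnj_iff)
  then show ?thesis by (rule of_real_Re)
qed

lemma inner_spectral:
  fixes x :: "real^'m::{finite,linorder}"
  assumes m: "CARD('m) \<ge> 2"
  shows "a \<bullet> x = coord_sum x * (a \<bullet> v_vec 1) + Re (\<Sum>l\<in>minor_roots CARD('m). v_dual a l * u_form l x)"
proof -
  let ?R = "{l. poly (chi_poly CARD('m)) l = 0}"
  have m1: "CARD('m) \<ge> 1" using m by simp
  have fin: "finite ?R" using chi_poly_nonzero[OF m1] by (rule poly_roots_finite)
  have "complex_of_real (a \<bullet> x) = (\<Sum>i\<in>UNIV. of_real (a $ i) * (\<Sum>l\<in>?R. u_form l x * v_vec l $ i))"
    unfolding spectral_decomposition[OF m, symmetric] by (simp add: inner_vec_def)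
  also have "\<dots> = (\<Sum>l\<in>?R. v_dual a l * u_form l x)"
    unfolding sum_distrib_left v_dual_def sum_distrib_right by (subst sum.swap) (simp add: mult_ac)
  also have "\<dots> = v_dual a 1 * u_form 1 x + (\<Sum>l\<in>minor_roots CARD('m). v_dual a l * u_form l x)"
    unfolding minor_roots_def using chi_root_one[OF m1] fin by (subst sum.remove[of _ 1]) auto
  also have "v_dual a 1 = of_real (a \<bullet> v_vec 1)"
    unfolding v_dual_def inner_vec_def using v_vec_of_real[of 1, where ?'m='m] by simp
  also have "of_real (a \<bullet> v_vec 1) * u_form 1 x = of_real (coord_sum x * (a \<bullet> v_vec 1))" by (simp add: u_form_one)
  finally show ?thesis by (metis Re_complex_of_real plus_complex.sel(1))
qed

context gap_urn
begin

text \<open>The covariance of the limit law, in the spectral basis.\<close>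

definition cov_coeff :: "complex \<Rightarrow> complex \<Rightarrow> complex" where
  "cov_coeff l l' = (\<Sum>i\<in>(UNIV::'m set). of_real ((v_vec 1 :: real^'m::{finite,linorder}) $ i) * (l * u_coeff CARD('m) l (idx i)) * (l' * u_coeff CARD('m) l' (idx i)))"

text \<open>\<open>cov_coeff l l'\<close> is the covariance of the drawn coefficients when the urn
  has its limit composition \<open>v_vec 1\<close>; \<open>1 / (1 - l - l')\<close> is the limit of
  the averaged products of growth factors.\<close>

definition cov :: "real^'m::{finite,linorder} \<Rightarrow> real^'m::{finite,linorder} \<Rightarrow> real" where
  "cov a b = Re (\<Sum>l\<in>minor_roots CARD('m). \<Sum>l'\<in>minor_roots CARD('m). v_dual a l * v_dual b l' * (cov_coeff l l' / (1 - l - l')))"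

lemma cov_sym: "cov a b = cov b a"
proof -
  have "(\<Sum>l\<in>minor_roots CARD('m). \<Sum>l'\<in>minor_roots CARD('m). v_dual a l * v_dual b l' * (cov_coeff l l' / (1 - l - l')))
    = (\<Sum>l\<in>minor_roots CARD('m). \<Sum>l'\<in>minor_roots CARD('m). v_dual b l * v_dual a l' * (cov_coeff l l' / (1 - l - l')))"
    by (subst sum.swap) (intro sum.cong refl, simp add: cov_coeff_def mult_ac diff_diff_eq add.commute)
  then show ?thesis by (simp add: cov_def)
qed

lemma cov_bilinear: "bilinear cov"
proof -
  define S where "S = (\<lambda>a b. \<Sum>l\<in>minor_roots CARD('m). \<Sum>l'\<in>minor_roots CARD('m). v_dual (a :: real^'m::{finite,linorder}) l * v_dual (b :: real^'m::{finite,linorder}) l' * (cov_coeff l l' / (1 - l - l')))"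
  have add: "S (a + a') b = S a b + S a' b" for a a' b
    unfolding S_def v_dual_add distrib_right sum.distrib ..
  have scale: "S (c *\<^sub>R a) b = of_real c * S a b" for c a b
    unfolding S_def v_dual_scaleR mult.assoc sum_distrib_left ..
  have cov: "cov a b = Re (S a b)" for a b by (simp add: cov_def S_def)
  have l: "linear (\<lambda>a. cov a b)" for b
    by (intro linearI) (simp_all add: cov add scale)
  moreover have "linear (\<lambda>b. cov a b)" for a using l[of a] by (simp add: cov_sym[of a])
  ultimately show ?thesis by (simp add: bilinear_def)
qed

text \<open>What drawing type \<open>i\<close> at step \<open>k\<close> contributes to direction
  \<open>a\<close> at time \<open>n\<close>, before centring and normalisation.\<close>

definition weight :: "real^'m::{finite,linorder} \<Rightarrow> nat \<Rightarrow> nat \<Rightarrow> 'm \<Rightarrow> real" where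
  "weight a n k i = Re (\<Sum>l\<in>minor_roots CARD('m). v_dual a l * growth K l (Suc k) n * (l * u_coeff CARD('m) l (idx i)))"

definition clt_incr :: "real^'m::{finite,linorder} \<Rightarrow> nat \<Rightarrow> nat \<Rightarrow> real^'m::{finite,linorder} \<Rightarrow> real^'m::{finite,linorder} \<Rightarrow> real" where
  "clt_incr a n k x y = Re (\<Sum>l\<in>minor_roots CARD('m). v_dual a l * growth K l (Suc k) n * incr l x y) / sqrt (real n)"

text \<open>A deterministic substitute for the conditional variance of \<open>clt_incr\<close>: the
  random composition is replaced by \<open>v_vec 1\<close>, under which the weights have mean
  0.\<close>

definition clt_var :: "real^'m::{finite,linorder} \<Rightarrow> nat \<Rightarrow> nat \<Rightarrow> real" where
  "clt_var a n k = (\<Sum>i\<in>UNIV. (v_vec 1 :: real^'m::{finite,linorder}) $ i * (weight a n k i)\<^sup>2) / real n"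

lemma m_ge_1: "CARD('m) \<ge> 1"
  using m_ge_2 by simp

lemma sum_q_weight:
  "(\<Sum>i\<in>UNIV. y i * weight a n k i) = Re (\<Sum>l\<in>minor_roots CARD('m). v_dual a l * growth K l (Suc k) n * (l * u_form l (\<chi> i. y i)))"
proof -
  have aux: "c * Re z = Re (of_real c * z)" for c z by simp
  have "(\<Sum>i\<in>UNIV. y i * weight a n k i) = (\<Sum>i\<in>(UNIV::'m set). Re (of_real (y i) * (\<Sum>l\<in>minor_roots CARD('m). v_dual a l * growth K l (Suc k) n * (l * u_coeff CARD('m) l (idx i)))))"
    unfolding weight_def aux ..
  also have "\<dots> = Re (\<Sum>i\<in>(UNIV::'m set). \<Sum>l\<in>minor_roots CARD('m). of_real (y i) * (v_dual a l * growth K l (Suc k) n * (l * u_coeff CARD('m) l (idx i))))"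
    by (simp only: Re_sum sum_distrib_left)
  also have "(\<Sum>i\<in>(UNIV::'m set). \<Sum>l\<in>minor_roots CARD('m). of_real (y i) * (v_dual a l * growth K l (Suc k) n * (l * u_coeff CARD('m) l (idx i))))
    = (\<Sum>l\<in>minor_roots CARD('m). v_dual a l * growth K l (Suc k) n * (l * u_form l (\<chi> i. y i)))"
    by (subst sum.swap) (simp add: u_form_eq sum_distrib_left mult_ac)
  finally show ?thesis .
qed

lemma clt_incr_step:
  "clt_incr a n k x (x + gap_step i) = (weight a n k i - (\<Sum>j\<in>UNIV. gap_prob x j * weight a n k j)) / sqrt (real n)"
proof -
  have u: "u_form l (\<chi> j. gap_prob x j) = u_form l x / of_real (coord_sum x)" for l
    by (simp add: u_form_eq sum_divide_distrib)
  have "(\<Sum>l\<in>minor_roots CARD('m). v_dual a l * growth K l (Suc k) n * incr l x (x + gap_step i))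
    = (\<Sum>l\<in>minor_roots CARD('m). v_dual a l * growth K l (Suc k) n * (l * u_coeff CARD('m) l (idx i)))
    - (\<Sum>l\<in>minor_roots CARD('m). v_dual a l * growth K l (Suc k) n * (l * u_form l (\<chi> j. gap_prob x j)))"
    unfolding sum_subtractf[symmetric]
    by (intro sum.cong refl) (simp add: incr_step minor_roots_def u algebra_simps)
  moreover have B: "(\<Sum>j\<in>UNIV. gap_prob x j * weight a n k j) = Re (\<Sum>l\<in>minor_roots CARD('m). v_dual a l * growth K l (Suc k) n * (l * u_form l (\<chi> j. gap_prob x j)))"
    by (rule sum_q_weight)
  ultimately show ?thesis unfolding clt_incr_def B weight_def by (simp only: minus_complex.sel)
qed

lemma sum_v1_weight: "(\<Sum>i\<in>UNIV. (v_vec 1 :: real^'m::{finite,linorder}) $ i * weight a n k i) = 0"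
proof -
  have "u_form l (v_vec 1 :: real^'m::{finite,linorder}) = 0" if "l \<in> minor_roots CARD('m)" for l
    using u_form_v1[OF m_ge_2, of l] that by (auto simp: minor_roots_def)
  then show ?thesis unfolding sum_q_weight by (simp add: vec_lambda_eta)
qed

lemma coord_dev:
  assumes "x \<in> nonzero_nat_vecs"
  shows "(\<Sum>i\<in>UNIV. \<bar>gap_prob x i - (v_vec 1 :: real^'m::{finite,linorder}) $ i\<bar>) \<le> (\<Sum>l\<in>minor_roots CARD('m). (\<Sum>i\<in>UNIV. cmod ((v_vec l :: complex^'m::{finite,linorder}) $ i)) * cmod (u_form l x)) / coord_sum x"
proof -
  have pos: "coord_sum x > 0" using coord_sum_ge_1[OF assms] by simp
  have "\<bar>gap_prob x i - (v_vec 1 :: real^'m::{finite,linorder}) $ i\<bar> \<le> (\<Sum>l\<in>minor_roots CARD('m). cmod ((v_vec l :: complex^'m::{finite,linorder}) $ i) * cmod (u_form l x)) / coord_sum x" for i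
  proof -
    have dual: "v_dual (axis i 1) l = (v_vec l :: complex^'m::{finite,linorder}) $ i" for l
    proof -
      have "v_dual (axis i 1) l = (\<Sum>j\<in>UNIV. if j = i then (v_vec l :: complex^'m::{finite,linorder}) $ j else 0)"
        unfolding v_dual_def by (intro sum.cong) (auto simp: axis_def)
      then show ?thesis by simp
    qed
    have "x $ i = coord_sum x * (v_vec 1 :: real^'m::{finite,linorder}) $ i + Re (\<Sum>l\<in>minor_roots CARD('m). v_vec l $ i * u_form l x)"
      using inner_spectral[OF m_ge_2, of "axis i 1" x] unfolding dual by (simp add: inner_axis')
    then have "gap_prob x i - (v_vec 1 :: real^'m::{finite,linorder}) $ i = Re (\<Sum>l\<in>minor_roots CARD('m). v_vec l $ i * u_form l x) / coord_sum x"
      using pos by (simp add: field_simps)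
    then have "\<bar>gap_prob x i - (v_vec 1 :: real^'m::{finite,linorder}) $ i\<bar> = \<bar>Re (\<Sum>l\<in>minor_roots CARD('m). v_vec l $ i * u_form l x)\<bar> / coord_sum x"
      using pos by (simp only: abs_divide abs_of_pos)
    also have "\<dots> \<le> (\<Sum>l\<in>minor_roots CARD('m). cmod ((v_vec l :: complex^'m::{finite,linorder}) $ i) * cmod (u_form l x)) / coord_sum x"
      using pos by (intro divide_right_mono order_trans[OF abs_Re_le_cmod] sum_norm_le) (auto simp: norm_mult)
    finally show ?thesis .
  qed
  then have "(\<Sum>i\<in>UNIV. \<bar>gap_prob x i - (v_vec 1 :: real^'m::{finite,linorder}) $ i\<bar>) \<le> (\<Sum>i\<in>UNIV. (\<Sum>l\<in>minor_roots CARD('m). cmod ((v_vec l :: complex^'m::{finite,linorder}) $ i) * cmod (u_form l x)) / coord_sum x)"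
    by (intro sum_mono)
  also have "\<dots> = (\<Sum>l\<in>minor_roots CARD('m). (\<Sum>i\<in>UNIV. cmod ((v_vec l :: complex^'m::{finite,linorder}) $ i)) * cmod (u_form l x)) / coord_sum x"
    unfolding sum_divide_distrib[symmetric] sum_distrib_right by (subst sum.swap) (rule refl)
  finally show ?thesis .
qed

text \<open>As \<open>w\<close> has mean zero under \<open>v\<close>, its mean under
  \<open>p\<close> is the sum of \<open>(p i - v i) * w i\<close> and thus small. The squared mean
  and the change of the second moment are each at most \<open>W\<^sup>2\<close> times the distance
  of \<open>p\<close> and \<open>v\<close>.\<close>

lemma weighted_variance_bound:
  fixes p v w :: "'m \<Rightarrow> real"
  assumes p: "\<And>i. p i \<ge> 0" "sum p UNIV = 1" and W: "\<And>i. \<bar>w i\<bar> \<le> W"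
    and v: "(\<Sum>i\<in>UNIV. v i * w i) = 0"
  shows "\<bar>(\<Sum>i\<in>UNIV. p i * (w i - (\<Sum>j\<in>UNIV. p j * w j))\<^sup>2) - (\<Sum>i\<in>UNIV. v i * (w i)\<^sup>2)\<bar> \<le> 2 * W\<^sup>2 * (\<Sum>i\<in>UNIV. \<bar>p i - v i\<bar>)"
proof -
  define \<mu> where "\<mu> = (\<Sum>j\<in>UNIV. p j * w j)"
  define \<Delta> where "\<Delta> = (\<Sum>i\<in>UNIV. \<bar>p i - v i\<bar>)"
  have W0: "W \<ge> 0" using W[of undefined] by linarith
  have "(\<Sum>i\<in>UNIV. p i * (w i - \<mu>)\<^sup>2) = (\<Sum>i\<in>UNIV. p i * (w i)\<^sup>2 - 2 * \<mu> * (p i * w i) + \<mu>\<^sup>2 * p i)"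
    by (intro sum.cong refl) (simp add: power2_eq_square algebra_simps)
  also have "\<dots> = (\<Sum>i\<in>UNIV. p i * (w i)\<^sup>2) - 2 * \<mu> * \<mu> + \<mu>\<^sup>2 * 1"
    by (simp only: sum.distrib sum_subtractf sum_distrib_left[symmetric] p(2) \<mu>_def)
  finally have 1: "(\<Sum>i\<in>UNIV. p i * (w i - \<mu>)\<^sup>2) = (\<Sum>i\<in>UNIV. p i * (w i)\<^sup>2) - \<mu>\<^sup>2" by (simp add: power2_eq_square)
  have "\<bar>\<mu>\<bar> \<le> (\<Sum>i\<in>UNIV. p i * W)"
    unfolding \<mu>_def using p(1) W by (intro order_trans[OF sum_abs] sum_mono) (auto simp: abs_mult intro!: mult_left_mono)
  then have b1: "\<bar>\<mu>\<bar> \<le> W" using p(2) by (simp flip: sum_distrib_right)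
  have "\<mu> = (\<Sum>i\<in>UNIV. (p i - v i) * w i)" using v by (simp add: \<mu>_def left_diff_distrib sum_subtractf)
  then have "\<bar>\<mu>\<bar> \<le> (\<Sum>i\<in>UNIV. \<bar>p i - v i\<bar> * W)"
    using W by (simp only:) (intro order_trans[OF sum_abs] sum_mono, auto simp: abs_mult intro!: mult_left_mono)
  then have b2: "\<bar>\<mu>\<bar> \<le> \<Delta> * W" by (simp add: \<Delta>_def sum_distrib_right)
  have b3: "\<mu>\<^sup>2 \<le> W * (\<Delta> * W)"
    using mult_mono[OF b1 b2] W0 by (simp add: power2_eq_square)
  have "(\<Sum>i\<in>UNIV. p i * (w i)\<^sup>2) - (\<Sum>i\<in>UNIV. v i * (w i)\<^sup>2) = (\<Sum>i\<in>UNIV. (p i - v i) * (w i)\<^sup>2)"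
    by (simp add: left_diff_distrib sum_subtractf)
  also have "\<bar>\<dots>\<bar> \<le> (\<Sum>i\<in>UNIV. \<bar>p i - v i\<bar> * W\<^sup>2)"
    using W by (intro order_trans[OF sum_abs] sum_mono) (auto simp: abs_mult abs_le_square_iff[symmetric] W0 intro!: mult_left_mono)
  also have "\<dots> = \<Delta> * W\<^sup>2" by (simp add: \<Delta>_def sum_distrib_right)
  finally have b4: "\<bar>(\<Sum>i\<in>UNIV. p i * (w i)\<^sup>2) - (\<Sum>i\<in>UNIV. v i * (w i)\<^sup>2)\<bar> \<le> \<Delta> * W\<^sup>2" .
  have b3': "\<mu>\<^sup>2 \<le> \<Delta> * W\<^sup>2" using b3 by (simp add: power2_eq_square mult_ac)
  have b5: "0 \<le> \<mu>\<^sup>2" by simp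
  have "\<bar>(\<Sum>i\<in>UNIV. p i * (w i)\<^sup>2) - \<mu>\<^sup>2 - (\<Sum>i\<in>UNIV. v i * (w i)\<^sup>2)\<bar> \<le> 2 * (\<Delta> * W\<^sup>2)"
    using b3' b4 b5 by linarith
  then show ?thesis unfolding \<mu>_def[symmetric] 1 \<Delta>_def[symmetric] by (simp add: mult_ac)
qed

end

section \<open>Conditional variances and the Gaussian approximation\<close>

context gap_urn
begin

definition amp :: "real^'m::{finite,linorder} \<Rightarrow> real" where
  "amp a = (\<Sum>l\<in>minor_roots CARD('m). cmod (v_dual a l) * exp (2 * growth_err K l) * (cmod l * u_max CARD('m) l))"

lemma amp_nonneg: "amp a \<ge> 0"
  unfolding amp_def by (intro sum_nonneg mult_nonneg_nonneg u_max_nonneg) auto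

lemma weight_bound:
  assumes r: "\<And>l. l \<in> minor_roots CARD('m) \<Longrightarrow> Re l \<le> r" and k: "k < n"
  shows "\<bar>weight a n k i\<bar> \<le> amp a * ((real n + 1) powr r * (real k + 2) powr - r)"
proof -
  have "\<bar>weight a n k i\<bar> \<le> (\<Sum>l\<in>minor_roots CARD('m). cmod (v_dual a l) * (exp (2 * growth_err K l) * ((real n + 1) powr r * (real k + 2) powr - r)) * (cmod l * u_max CARD('m) l))"
    unfolding weight_def
  proof (intro order_trans[OF abs_Re_le_cmod] sum_norm_le)
    fix l assume "l \<in> minor_roots CARD('m)"
    then show "cmod (v_dual a l * growth K l (Suc k) n * (l * u_coeff CARD('m) l (idx i)))
      \<le> cmod (v_dual a l) * (exp (2 * growth_err K l) * ((real n + 1) powr r * (real k + 2) powr - r)) * (cmod l * u_max CARD('m) l)"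
      unfolding norm_mult using r k by (intro mult_mono growth_le_powr K_ge_1 u_coeff_le_max order_refl) auto
  qed
  also have "\<dots> = amp a * ((real n + 1) powr r * (real k + 2) powr - r)"
    by (simp add: amp_def sum_distrib_left sum_distrib_right mult_ac)
  finally show ?thesis .
qed

lemma of_real_weight:
  "complex_of_real (weight a n k i) = (\<Sum>l\<in>minor_roots CARD('m). v_dual a l * growth K l (Suc k) n * (l * u_coeff CARD('m) l (idx i)))"
  unfolding weight_def
  by (rule real_sum_minor_roots[OF m_ge_1]) (simp add: v_dual_cnj growth_cnj u_coeff_def)

text \<open>The squared weight expands over pairs of roots, and in each term only the growth factors
  depend on \<open>k\<close>, so \<open>growth_product_sum_limit\<close> applies to each
  pair.\<close>

lemma clt_var_limit:
  assumes r: "\<And>l. l \<in> minor_roots CARD('m) \<Longrightarrow> Re l \<le> r" "0 \<le> r" "r < 1/2"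
  shows "(\<lambda>n. \<Sum>k<n. clt_var a n k) \<longlonglongrightarrow> cov a a"
proof -
  let ?R = "minor_roots CARD('m)"
  have "of_real (\<Sum>k<n. clt_var a n k) = (\<Sum>l\<in>?R. \<Sum>l'\<in>?R. v_dual a l * v_dual a l' * (cov_coeff l l' * ((\<Sum>k<n. growth K l (Suc k) n * growth K l' (Suc k) n) / of_nat n)))" for n
  proof -
    define f where "f = (\<lambda>k i l. v_dual a l * growth K l (Suc k) n * (l * u_coeff CARD('m) l (idx (i::'m))))"
    have "complex_of_real (\<Sum>k<n. clt_var a n k) = (\<Sum>k<n. \<Sum>i\<in>UNIV. of_real ((v_vec 1 :: real^'m::{finite,linorder}) $ i) * ((\<Sum>l\<in>?R. f k i l) * (\<Sum>l'\<in>?R. f k i l'))) / of_nat n"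
      by (simp add: clt_var_def power2_eq_square of_real_weight f_def sum_divide_distrib)
    also have "(\<Sum>k<n. \<Sum>i\<in>UNIV. of_real ((v_vec 1 :: real^'m::{finite,linorder}) $ i) * ((\<Sum>l\<in>?R. f k i l) * (\<Sum>l'\<in>?R. f k i l')))
      = (\<Sum>k<n. \<Sum>i\<in>UNIV. \<Sum>l\<in>?R. \<Sum>l'\<in>?R. of_real ((v_vec 1 :: real^'m::{finite,linorder}) $ i) * (f k i l * f k i l'))"
      by (simp only: sum_product) (simp only: sum_distrib_left)
    also have "\<dots> = (\<Sum>k<n. \<Sum>l\<in>?R. \<Sum>l'\<in>?R. \<Sum>i\<in>UNIV. of_real ((v_vec 1 :: real^'m::{finite,linorder}) $ i) * (f k i l * f k i l'))"
      by (intro sum.cong refl) (subst sum.swap, intro sum.cong refl sum.swap)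
    also have "\<dots> = (\<Sum>l\<in>?R. \<Sum>k<n. \<Sum>l'\<in>?R. \<Sum>i\<in>UNIV. of_real ((v_vec 1 :: real^'m::{finite,linorder}) $ i) * (f k i l * f k i l'))"
      by (rule sum.swap)
    also have "\<dots> = (\<Sum>l\<in>?R. \<Sum>l'\<in>?R. \<Sum>k<n. \<Sum>i\<in>UNIV. of_real ((v_vec 1 :: real^'m::{finite,linorder}) $ i) * (f k i l * f k i l'))"
      by (intro sum.cong refl sum.swap)
    also have "\<dots> = (\<Sum>l\<in>?R. \<Sum>l'\<in>?R. v_dual a l * v_dual a l' * (cov_coeff l l' * (\<Sum>k<n. growth K l (Suc k) n * growth K l' (Suc k) n)))"
    proof (intro sum.cong refl)
      fix l l'
      have "(\<Sum>i\<in>UNIV. of_real ((v_vec 1 :: real^'m::{finite,linorder}) $ i) * (f k i l * f k i l')) = v_dual a l * v_dual a l' * (cov_coeff l l' * (growth K l (Suc k) n * growth K l' (Suc k) n))" for k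
        unfolding f_def cov_coeff_def by (simp add: sum_distrib_left sum_distrib_right mult_ac)
      then show "(\<Sum>k<n. \<Sum>i\<in>UNIV. of_real ((v_vec 1 :: real^'m::{finite,linorder}) $ i) * (f k i l * f k i l')) = v_dual a l * v_dual a l' * (cov_coeff l l' * (\<Sum>k<n. growth K l (Suc k) n * growth K l' (Suc k) n))"
        by (simp only: sum_distrib_left)
    qed
    finally show ?thesis by (simp only: sum_divide_distrib[where A="minor_roots CARD('m)"] times_divide_eq_right)
  qed
  moreover have "(\<lambda>n. \<Sum>l\<in>?R. \<Sum>l'\<in>?R. v_dual a l * v_dual a l' * (cov_coeff l l' * ((\<Sum>k<n. growth K l (Suc k) n * growth K l' (Suc k) n) / of_nat n)))
    \<longlonglongrightarrow> (\<Sum>l\<in>?R. \<Sum>l'\<in>?R. v_dual a l * v_dual a l' * (cov_coeff l l' * (1 / (1 - l - l'))))"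
    by (intro tendsto_sum tendsto_mult tendsto_const growth_product_sum_limit[OF K_ge_1 r(2,3)] r(1))
  ultimately have "(\<lambda>n. complex_of_real (\<Sum>k<n. clt_var a n k)) \<longlonglongrightarrow> (\<Sum>l\<in>?R. \<Sum>l'\<in>?R. v_dual a l * v_dual a l' * (cov_coeff l l' / (1 - l - l')))"
    by simp
  from tendsto_Re[OF this] show ?thesis by (simp add: cov_def)
qed

text \<open>The deviation is bounded by forms of roots other than 1, whose first moments have order
  \<open>sqrt k\<close>, divided by the total \<open>K + k\<close>.\<close>

lemma mean_deviation_tendsto_0:
  assumes r: "\<And>l. l \<in> minor_roots CARD('m) \<Longrightarrow> Re l \<le> r" "0 \<le> r" "r < 1/2"
  shows "(\<lambda>k. expectation (\<lambda>\<omega>. \<Sum>i\<in>UNIV. \<bar>gap_prob (G k \<omega>) i - (v_vec 1 :: real^'m::{finite,linorder}) $ i\<bar>)) \<longlonglongrightarrow> 0"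
proof -
  let ?R = "minor_roots CARD('m)"
  define c where "c = (\<lambda>l. \<Sum>i\<in>UNIV. cmod ((v_vec l :: complex^'m::{finite,linorder}) $ i))"
  have c0: "c l \<ge> 0" for l by (simp add: c_def sum_nonneg)
  have "\<exists>C. \<forall>n. expectation (\<lambda>\<omega>. cmod (u_form l (G n \<omega>))) \<le> C * (real n + 1) powr (1/2)" if "l \<in> ?R" for l
  proof -
    have "poly (chi_poly CARD('m)) l = 0" using that by (simp add: minor_roots_def)
    from u_form_moments[OF this r(1)[OF that] _ r(2), of 1] r(3) show ?thesis
      by (auto simp: max_def split: if_splits)
  qed
  then obtain C where C: "\<And>l n. l \<in> ?R \<Longrightarrow> expectation (\<lambda>\<omega>. cmod (u_form l (G n \<omega>))) \<le> C l * (real n + 1) powr (1/2)"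
    by metis
  define B where "B = (\<Sum>l\<in>?R. c l * \<bar>C l\<bar>)"
  show ?thesis
  proof (rule squeeze_0)
    show "(\<lambda>k. B * (real k + 1) powr (- (1/2))) \<longlonglongrightarrow> 0"
      by (rule tendsto_mult_right_zero[OF tendsto_Suc_powr_neg]) simp
    fix k
    have i1: "integrable M (\<lambda>\<omega>. \<Sum>i\<in>UNIV. \<bar>gap_prob (G k \<omega>) i - (v_vec 1 :: real^'m::{finite,linorder}) $ i\<bar>)"
      by (rule integrable_X[of "\<lambda>x. \<Sum>i\<in>UNIV. \<bar>gap_prob x i - (v_vec 1 :: real^'m::{finite,linorder}) $ i\<bar>"])
    have i2: "integrable M (\<lambda>\<omega>. cmod (u_form l (G k \<omega>)))" for l by (rule integrable_X[of "\<lambda>x. cmod (u_form l x)"])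
    have "expectation (\<lambda>\<omega>. \<Sum>i\<in>UNIV. \<bar>gap_prob (G k \<omega>) i - (v_vec 1 :: real^'m::{finite,linorder}) $ i\<bar>)
      \<le> expectation (\<lambda>\<omega>. (\<Sum>l\<in>?R. c l * cmod (u_form l (G k \<omega>))) / (K + real k))"
    proof (rule integral_mono_AE[OF i1])
      show "integrable M (\<lambda>\<omega>. (\<Sum>l\<in>?R. c l * cmod (u_form l (G k \<omega>))) / (K + real k))"
        by (rule integrable_X[of "\<lambda>x. (\<Sum>l\<in>?R. c l * cmod (u_form l x)) / (K + real k)"])
      show "AE \<omega> in M. (\<Sum>i\<in>UNIV. \<bar>gap_prob (G k \<omega>) i - (v_vec 1 :: real^'m::{finite,linorder}) $ i\<bar>) \<le> (\<Sum>l\<in>?R. c l * cmod (u_form l (G k \<omega>))) / (K + real k)"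
        using AE_level[of k]
      proof eventually_elim
        case (elim \<omega>)
        then have "G k \<omega> \<in> nonzero_nat_vecs" "coord_sum (G k \<omega>) = K + real k" by (auto simp: level_def)
        then show ?case using coord_dev[of "G k \<omega>"] by (simp add: c_def)
      qed
    qed
    also have "\<dots> = (\<Sum>l\<in>?R. c l * expectation (\<lambda>\<omega>. cmod (u_form l (G k \<omega>)))) / (K + real k)"
      using i2 by (simp add: Bochner_Integration.integral_sum)
    also have "\<dots> \<le> (\<Sum>l\<in>?R. c l * (\<bar>C l\<bar> * (real k + 1) powr (1/2))) / (real k + 1)"
    proof (rule frac_le)
      show "(\<Sum>l\<in>?R. c l * expectation (\<lambda>\<omega>. cmod (u_form l (G k \<omega>)))) \<le> (\<Sum>l\<in>?R. c l * (\<bar>C l\<bar> * (real k + 1) powr (1/2)))"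
      proof (intro sum_mono mult_left_mono c0)
        fix l assume "l \<in> ?R"
        then have "expectation (\<lambda>\<omega>. cmod (u_form l (G k \<omega>))) \<le> C l * (real k + 1) powr (1/2)" by (rule C)
        also have "\<dots> \<le> \<bar>C l\<bar> * (real k + 1) powr (1/2)" by (intro mult_right_mono) auto
        finally show "expectation (\<lambda>\<omega>. cmod (u_form l (G k \<omega>))) \<le> \<bar>C l\<bar> * (real k + 1) powr (1/2)" .
      qed
      show "0 \<le> (\<Sum>l\<in>?R. c l * (\<bar>C l\<bar> * (real k + 1) powr (1/2)))" using c0 by (intro sum_nonneg) auto
    qed (use K_ge_1 in auto)
    also have "\<dots> = B * ((real k + 1) powr (1/2) / (real k + 1))"
      by (simp only: B_def sum_distrib_right sum_divide_distrib) (simp add: mult_ac)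
    also have "(real k + 1) powr (1/2) / (real k + 1) = (real k + 1) powr (1/2 - 1)" by (subst powr_diff) simp
    finally have "expectation (\<lambda>\<omega>. \<Sum>i\<in>UNIV. \<bar>gap_prob (G k \<omega>) i - (v_vec 1 :: real^'m::{finite,linorder}) $ i\<bar>) \<le> B * (real k + 1) powr (- (1/2))" by simp
    moreover have "expectation (\<lambda>\<omega>. \<Sum>i\<in>UNIV. \<bar>gap_prob (G k \<omega>) i - (v_vec 1 :: real^'m::{finite,linorder}) $ i\<bar>) \<ge> 0"
      by (intro integral_nonneg_AE AE_I2 sum_nonneg) auto
    ultimately show "\<bar>expectation (\<lambda>\<omega>. \<Sum>i\<in>UNIV. \<bar>gap_prob (G k \<omega>) i - (v_vec 1 :: real^'m::{finite,linorder}) $ i\<bar>)\<bar> \<le> B * (real k + 1) powr (- (1/2))" by simp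
  qed
qed

text \<open>Of the error terms in \<open>char_msum_approx\<close>, the deviation of the conditional
  variances is a weighted mean of a null sequence, treated by \<open>toeplitz_powr\<close> with
  exponent \<open>2 * r\<close>. The higher order terms are a uniform bound on the increments times
  a bounded sum of squares.\<close>

lemma clt_char_approx:
  assumes r: "\<And>l. l \<in> minor_roots CARD('m) \<Longrightarrow> Re l \<le> r" "0 \<le> r" "r < 1/2"
  shows "(\<lambda>n. cmod (expectation (\<lambda>\<omega>. iexp (msum (clt_incr a n) n \<omega>)) - exp (- (\<Sum>k<n. clt_var a n k) / 2))) \<longlonglongrightarrow> 0"
proof (rule squeeze_0)
  define \<epsilon> where "\<epsilon> = (\<lambda>k. expectation (\<lambda>\<omega>. \<Sum>i\<in>UNIV. \<bar>gap_prob (G k \<omega>) i - (v_vec 1 :: real^'m::{finite,linorder}) $ i\<bar>))"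
  define A where "A = amp a"
  have A: "A \<ge> 0" by (simp add: A_def amp_nonneg)
  let ?S = "\<lambda>n. \<Sum>k<n. (real k + 2) powr - (2 * r) * \<epsilon> k"
  \<comment> \<open>\<open>\<eta> n\<close> bounds every increment and tends to zero because
    \<open>r < 1/2\<close>; \<open>B\<close> bounds the sum of the squared increment bounds
    uniformly in \<open>n\<close>.\<close>
  define \<eta> where "\<eta> = (\<lambda>n. 2 * A * 2 * (real n + 1) powr (r - 1/2))"
  define B where "B = 8 * A\<^sup>2 / (1 - 2 * r)"
  have "(\<lambda>n. (real n + 1) powr (2 * r - 1) * ?S n) \<longlonglongrightarrow> 0"
    using r mean_deviation_tendsto_0[OF r] by (intro toeplitz_powr) (auto simp: \<epsilon>_def)
  from tendsto_mult_right_zero[OF this, of "4 * A\<^sup>2"]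
  have l1: "(\<lambda>n. 4 * A\<^sup>2 * ((real n + 1) powr (2 * r - 1) * ?S n)) \<longlonglongrightarrow> 0" .
  have l2: "\<eta> \<longlonglongrightarrow> 0" unfolding \<eta>_def using r by (intro tendsto_mult_right_zero tendsto_Suc_powr_neg) auto
  have "(\<lambda>n. (\<eta> n + \<eta> n ^ 2) * B) \<longlonglongrightarrow> (0 + 0 ^ 2) * B" by (intro tendsto_intros l2)
  from tendsto_add[OF l1 this]
  show "(\<lambda>n. 4 * A\<^sup>2 * ((real n + 1) powr (2 * r - 1) * ?S n) + (\<eta> n + \<eta> n ^ 2) * B) \<longlonglongrightarrow> 0" by simp
  fix n
  define W where "W = (\<lambda>k. A * ((real n + 1) powr r * (real k + 2) powr - r))"
  \<comment> \<open>\<open>weight_bound\<close> covers \<open>k < n\<close> only, while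
    \<open>char_msum_approx\<close> speaks of all \<open>k\<close>; so everything is continued by 0
    from \<open>n\<close> on.\<close>
  define c where "c = (\<lambda>k. if k < n then 2 * W k / sqrt (real n) else 0)"
  define D where "D = (\<lambda>k x y. if k < n then clt_incr a n k x y else 0)"
  define U where "U = (\<lambda>k x. \<Sum>i\<in>UNIV. gap_prob x i * (D k x (x + gap_step i))\<^sup>2)"
  define v where "v = (\<lambda>k. if k < n then clt_var a n k else 0)"
  have W0: "W k \<ge> 0" for k using A by (simp add: W_def)
  have w: "\<bar>weight a n k i\<bar> \<le> W k" if "k < n" for k i
    using weight_bound[OF r(1) that] by (simp add: W_def A_def)
  have W2: "(W k)\<^sup>2 = A\<^sup>2 * ((real n + 1) powr (2 * r) * (real k + 2) powr - (2 * r))" for k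
    by (simp add: W_def power_mult_distrib powr_power mult.commute)
  have q: "(\<Sum>i\<in>UNIV. gap_prob x i) = 1" "gap_prob x i \<ge> 0" if "x \<in> level k" for x k i
    using that level_subset q_sum q_nonneg by blast+
  have mean: "(\<Sum>i\<in>UNIV. gap_prob x i * D k x (x + gap_step i)) = 0" if "x \<in> level k" for k x
  proof (cases "k < n")
    case True
    define \<mu> where "\<mu> = (\<Sum>j\<in>UNIV. gap_prob x j * weight a n k j)"
    have "(\<Sum>i\<in>UNIV. gap_prob x i * D k x (x + gap_step i)) = (\<Sum>i\<in>UNIV. gap_prob x i * (weight a n k i - \<mu>) / sqrt (real n))"
      using True unfolding D_def clt_incr_step \<mu>_def by simp
    also have "\<dots> = ((\<Sum>i\<in>UNIV. gap_prob x i * weight a n k i) - (\<Sum>i\<in>UNIV. gap_prob x i) * \<mu>) / sqrt (real n)"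
      by (simp only: right_diff_distrib sum_subtractf sum_distrib_right sum_divide_distrib diff_divide_distrib)
    also have "\<dots> = 0" unfolding q(1)[OF that] \<mu>_def by simp
    finally show ?thesis .
  qed (simp add: D_def)
  have bnd: "\<bar>D k x (x + gap_step i)\<bar> \<le> c k" if "x \<in> level k" for k x i
  proof (cases "k < n")
    case True
    have "\<bar>\<Sum>j\<in>UNIV. gap_prob x j * weight a n k j\<bar> \<le> (\<Sum>j\<in>UNIV. gap_prob x j * W k)"
    proof (intro order_trans[OF sum_abs] sum_mono)
      fix j
      show "\<bar>gap_prob x j * weight a n k j\<bar> \<le> gap_prob x j * W k"
        using q(2)[OF that, of j] w[OF True, of j] by (simp only: abs_mult abs_of_nonneg) (rule mult_left_mono)
    qed
    also have "\<dots> = W k" using q(1)[OF that] by (simp only: sum_distrib_right[symmetric] mult_1)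
    finally have "\<bar>weight a n k i - (\<Sum>j\<in>UNIV. gap_prob x j * weight a n k j)\<bar> \<le> 2 * W k" using w[OF True, of i] by linarith
    then show ?thesis using True unfolding D_def clt_incr_step c_def by (simp add: divide_right_mono)
  qed (simp add: D_def c_def)
  have v0: "0 \<le> v k" for k
    unfolding v_def clt_var_def by (auto intro!: divide_nonneg_nonneg sum_nonneg mult_nonneg_nonneg less_imp_le[OF v1_pos])
  have vc: "v k \<le> (c k)\<^sup>2" for k
  proof (cases "k < n")
    case True
    have "(\<Sum>i\<in>UNIV. (v_vec 1 :: real^'m::{finite,linorder}) $ i * (weight a n k i)\<^sup>2) \<le> (\<Sum>i\<in>UNIV. (v_vec 1 :: real^'m::{finite,linorder}) $ i * (W k)\<^sup>2)"
      using v1_pos[where ?'m='m] w[OF True] W0 by (intro sum_mono mult_left_mono) (auto simp: abs_le_square_iff[symmetric] less_imp_le)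
    also have "\<dots> = (W k)\<^sup>2" using sum_v1[OF m_ge_2] by (simp flip: sum_distrib_right)
    finally have "clt_var a n k \<le> (W k)\<^sup>2 / real n" unfolding clt_var_def by (intro divide_right_mono) auto
    also have "\<dots> \<le> 4 * (W k)\<^sup>2 / real n" by (intro divide_right_mono) auto
    also have "\<dots> = (c k)\<^sup>2" using True by (simp add: c_def power_divide power_mult_distrib)
    finally show ?thesis using True by (simp add: v_def)
  qed (simp add: v_def c_def)
  have main: "cmod (expectation (\<lambda>\<omega>. iexp (msum D n \<omega>)) - exp (- (\<Sum>k<n. v k) / 2))
     \<le> (\<Sum>k<n. expectation (\<lambda>\<omega>. \<bar>U k (G k \<omega>) - v k\<bar>) + c k ^ 3 + c k ^ 4)"
    by (rule char_msum_approx[where A=level]) (use AE_level level_subset mean bnd v0 vc in \<open>simp_all add: U_def\<close>)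
  have "msum D n \<omega> = msum (clt_incr a n) n \<omega>" for \<omega> by (simp add: msum_def D_def)
  moreover have "(\<Sum>k<n. v k) = (\<Sum>k<n. clt_var a n k)" by (simp add: v_def)
  moreover have "(\<Sum>k<n. expectation (\<lambda>\<omega>. \<bar>U k (G k \<omega>) - v k\<bar>)) \<le> 4 * A\<^sup>2 * ((real n + 1) powr (2 * r - 1) * ?S n)"
  proof -
    have "(\<Sum>k<n. expectation (\<lambda>\<omega>. \<bar>U k (G k \<omega>) - v k\<bar>)) \<le> (\<Sum>k<n. 2 * (W k)\<^sup>2 / real n * \<epsilon> k)"
    proof (rule sum_mono)
      fix k assume "k \<in> {..<n}"
      then have k: "k < n" by simp
      have "expectation (\<lambda>\<omega>. \<bar>U k (G k \<omega>) - v k\<bar>) \<le> expectation (\<lambda>\<omega>. 2 * (W k)\<^sup>2 / real n * (\<Sum>i\<in>UNIV. \<bar>gap_prob (G k \<omega>) i - (v_vec 1 :: real^'m::{finite,linorder}) $ i\<bar>))"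
      proof (rule integral_mono_AE)
        show "integrable M (\<lambda>\<omega>. \<bar>U k (G k \<omega>) - v k\<bar>)" by (rule integrable_X[of "\<lambda>x. \<bar>U k x - v k\<bar>"])
        show "integrable M (\<lambda>\<omega>. 2 * (W k)\<^sup>2 / real n * (\<Sum>i\<in>UNIV. \<bar>gap_prob (G k \<omega>) i - (v_vec 1 :: real^'m::{finite,linorder}) $ i\<bar>))"
          by (rule integrable_X[of "\<lambda>x. 2 * (W k)\<^sup>2 / real n * (\<Sum>i\<in>UNIV. \<bar>gap_prob x i - (v_vec 1 :: real^'m::{finite,linorder}) $ i\<bar>)"])
        show "AE \<omega> in M. \<bar>U k (G k \<omega>) - v k\<bar> \<le> 2 * (W k)\<^sup>2 / real n * (\<Sum>i\<in>UNIV. \<bar>gap_prob (G k \<omega>) i - (v_vec 1 :: real^'m::{finite,linorder}) $ i\<bar>)"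
          using AE_level[of k]
        proof eventually_elim
          case (elim \<omega>)
          define x where "x = G k \<omega>"
          have x: "x \<in> level k" using elim by (simp add: x_def)
          have "U k x - v k = ((\<Sum>i\<in>UNIV. gap_prob x i * (weight a n k i - (\<Sum>j\<in>UNIV. gap_prob x j * weight a n k j))\<^sup>2)
            - (\<Sum>i\<in>UNIV. (v_vec 1 :: real^'m::{finite,linorder}) $ i * (weight a n k i)\<^sup>2)) / real n"
          proof -
            define \<mu> where "\<mu> = (\<Sum>j\<in>UNIV. gap_prob x j * weight a n k j)"
            have "U k x = (\<Sum>i\<in>UNIV. gap_prob x i * (weight a n k i - \<mu>)\<^sup>2) / real n"
              using k unfolding U_def D_def clt_incr_step \<mu>_def[symmetric] by (simp add: power_divide sum_divide_distrib)
            then show ?thesis using k unfolding \<mu>_def[symmetric] diff_divide_distrib by (simp add: v_def clt_var_def)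
          qed
          then have "\<bar>U k x - v k\<bar> = \<bar>(\<Sum>i\<in>UNIV. gap_prob x i * (weight a n k i - (\<Sum>j\<in>UNIV. gap_prob x j * weight a n k j))\<^sup>2)
            - (\<Sum>i\<in>UNIV. (v_vec 1 :: real^'m::{finite,linorder}) $ i * (weight a n k i)\<^sup>2)\<bar> / real n" by simp
          also have "\<dots> \<le> 2 * (W k)\<^sup>2 * (\<Sum>i\<in>UNIV. \<bar>gap_prob x i - (v_vec 1 :: real^'m::{finite,linorder}) $ i\<bar>) / real n"
            by (intro divide_right_mono weighted_variance_bound q[OF x] w[OF k] sum_v1_weight) auto
          finally show ?case by (simp add: x_def)
        qed
      qed
      also have "\<dots> = 2 * (W k)\<^sup>2 / real n * \<epsilon> k" unfolding \<epsilon>_def by (rule Bochner_Integration.integral_mult_right_zero)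
      finally show "expectation (\<lambda>\<omega>. \<bar>U k (G k \<omega>) - v k\<bar>) \<le> 2 * (W k)\<^sup>2 / real n * \<epsilon> k" .
    qed
    also have "\<dots> = 2 * A\<^sup>2 * ?S n * ((real n + 1) powr (2 * r) / real n)"
      unfolding W2 by (simp add: sum_distrib_left sum_distrib_right sum_divide_distrib mult_ac)
    also have "\<dots> \<le> 2 * A\<^sup>2 * ?S n * (2 * (real n + 1) powr (2 * r - 1))"
    proof (intro mult_left_mono powr_over_n_le)
      have "\<epsilon> k \<ge> 0" for k unfolding \<epsilon>_def by (intro integral_nonneg_AE AE_I2 sum_nonneg) auto
      then show "0 \<le> 2 * A\<^sup>2 * ?S n" by (intro mult_nonneg_nonneg sum_nonneg) auto
    qed
    finally show ?thesis by (simp add: mult_ac)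
  qed
  moreover have "(\<Sum>k<n. c k ^ 3 + c k ^ 4) \<le> (\<eta> n + \<eta> n ^ 2) * B"
  proof -
    have c0: "c k \<ge> 0" for k using W0 by (simp add: c_def)
    have \<eta>0: "\<eta> n \<ge> 0" using A by (simp add: \<eta>_def)
    have c\<eta>: "c k \<le> \<eta> n" if "k < n" for k
    proof -
      have n: "n > 0" using that by simp
      have "(real k + 2) powr - r \<le> 1" using r by (simp add: powr_le_one_le powr_minus_divide ge_one_powr_ge_zero)
      then have "W k \<le> A * ((real n + 1) powr r * 1)" unfolding W_def using A by (intro mult_left_mono) auto
      then have "c k \<le> 2 * A * ((real n + 1) powr r / sqrt (real n))"
        using that n by (simp add: c_def divide_right_mono mult_left_mono)
      also have "(real n + 1) powr r / sqrt (real n) \<le> 2 * (real n + 1) powr (r - 1/2)"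
      proof -
        have "sqrt (real n + 1) \<le> sqrt (4 * real n)" using n by (intro real_sqrt_le_mono) auto
        then have "sqrt (real n + 1) \<le> 2 * sqrt (real n)" by (simp add: real_sqrt_mult)
        then have "1 / sqrt (real n) \<le> 2 / sqrt (real n + 1)" using n by (simp add: field_simps)
        then have "(real n + 1) powr r * (1 / sqrt (real n)) \<le> (real n + 1) powr r * (2 / sqrt (real n + 1))" by (intro mult_left_mono) auto
        also have "\<dots> = 2 * (real n + 1) powr (r - 1/2)" by (simp add: powr_diff powr_half_sqrt)
        finally show ?thesis by simp
      qed
      finally show ?thesis using A by (simp add: \<eta>_def mult_left_mono mult.assoc)
    qed
    have "(\<Sum>k<n. c k ^ 3 + c k ^ 4) \<le> (\<Sum>k<n. (\<eta> n + \<eta> n ^ 2) * (c k)\<^sup>2)"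
    proof (rule sum_mono)
      fix k assume "k \<in> {..<n}"
      then have le: "c k \<le> \<eta> n" by (intro c\<eta>) auto
      have "(c k)\<^sup>2 \<le> (\<eta> n)\<^sup>2" using le c0 by (intro power_mono)
      then have "(c k + (c k)\<^sup>2) * (c k)\<^sup>2 \<le> (\<eta> n + \<eta> n ^ 2) * (c k)\<^sup>2" using le by (intro mult_right_mono add_mono) auto
      moreover have "c k ^ 3 + c k ^ 4 = (c k + (c k)\<^sup>2) * (c k)\<^sup>2" by algebra
      ultimately show "c k ^ 3 + c k ^ 4 \<le> (\<eta> n + \<eta> n ^ 2) * (c k)\<^sup>2" by simp
    qed
    also have "\<dots> = (\<eta> n + \<eta> n ^ 2) * (\<Sum>k<n. (c k)\<^sup>2)" by (simp add: sum_distrib_left)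
    also have "(\<Sum>k<n. (c k)\<^sup>2) \<le> B"
    proof -
      have "(\<Sum>k<n. (c k)\<^sup>2) = (\<Sum>k<n. 4 * (W k)\<^sup>2 / real n)"
        by (intro sum.cong refl) (simp add: c_def power_divide power_mult_distrib)
      also have "\<dots> = 4 * A\<^sup>2 * (\<Sum>k<n. (real k + 2) powr - (2 * r)) * ((real n + 1) powr (2 * r) / real n)"
        unfolding W2 by (simp add: sum_distrib_left sum_distrib_right sum_divide_distrib mult_ac)
      also have "\<dots> \<le> 4 * A\<^sup>2 * ((real n + 1) powr (1 - 2 * r) / (1 - 2 * r)) * (2 * (real n + 1) powr (2 * r - 1))"
        using r by (intro mult_mono mult_left_mono sum_powr_neg_le powr_over_n_le) auto
      also have "\<dots> = 8 * A\<^sup>2 / (1 - 2 * r) * ((real n + 1) powr (1 - 2 * r) * (real n + 1) powr (2 * r - 1))" by simp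
      also have "(real n + 1) powr (1 - 2 * r) * (real n + 1) powr (2 * r - 1) = 1" by (simp flip: powr_add)
      finally show ?thesis by (simp add: B_def)
    qed
    finally show ?thesis using \<eta>0 by (simp add: mult_left_mono)
  qed
  ultimately show "\<bar>cmod (expectation (\<lambda>\<omega>. iexp (msum (clt_incr a n) n \<omega>)) - exp (- (\<Sum>k<n. clt_var a n k) / 2))\<bar>
    \<le> 4 * A\<^sup>2 * ((real n + 1) powr (2 * r - 1) * ?S n) + (\<eta> n + \<eta> n ^ 2) * B"
    using main by (simp add: sum.distrib)
qed

end

section \<open>The central limit theorem for the gap process\<close>

context gap_urn
begin

text \<open>The contribution of the initial state, all randomness being in the sum of the
  increments.\<close>

definition clt_det :: "real^'m::{finite,linorder} \<Rightarrow> nat \<Rightarrow> real" where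
  "clt_det a n = (K * (a \<bullet> v_vec 1) + Re (\<Sum>l\<in>minor_roots CARD('m). v_dual a l * growth K l 0 n * u_form l x0)) / sqrt (real n)"

lemma inner_normalized:
  "AE \<omega> in M. a \<bullet> ((G n \<omega> - real n *\<^sub>R v_vec 1) /\<^sub>R sqrt (real n)) = clt_det a n + msum (clt_incr a n) n \<omega>"
proof -
  have "AE \<omega> in M. \<forall>l\<in>minor_roots CARD('m). u_form l (G n \<omega>) = growth K l 0 n * u_form l x0
    + msum (\<lambda>k x y. growth K l (Suc k) n * incr l x y) n \<omega>"
    by (rule AE_finite_allI[OF finite_minor_roots[OF m_ge_1]]) (simp add: u_form_expansion minor_roots_def)
  then show ?thesis using AE_coord_sum[of n]
  proof eventually_elim
    case (elim \<omega>)
    have "(\<Sum>l\<in>minor_roots CARD('m). v_dual a l * u_form l (G n \<omega>))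
      = (\<Sum>l\<in>minor_roots CARD('m). v_dual a l * growth K l 0 n * u_form l x0 + (\<Sum>k<n. v_dual a l * growth K l (Suc k) n * incr l (G k \<omega>) (G (Suc k) \<omega>)))"
      using elim(1) by (intro sum.cong refl) (simp add: msum_def distrib_left sum_distrib_left mult_ac)
    also have "\<dots> = (\<Sum>l\<in>minor_roots CARD('m). v_dual a l * growth K l 0 n * u_form l x0)
      + (\<Sum>k<n. \<Sum>l\<in>minor_roots CARD('m). v_dual a l * growth K l (Suc k) n * incr l (G k \<omega>) (G (Suc k) \<omega>))"
      unfolding sum.distrib by (subst (2) sum.swap) (rule refl)
    finally have S: "Re (\<Sum>l\<in>minor_roots CARD('m). v_dual a l * u_form l (G n \<omega>))
      = Re (\<Sum>l\<in>minor_roots CARD('m). v_dual a l * growth K l 0 n * u_form l x0)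
      + (\<Sum>k<n. Re (\<Sum>l\<in>minor_roots CARD('m). v_dual a l * growth K l (Suc k) n * incr l (G k \<omega>) (G (Suc k) \<omega>)))"
      by (simp only: plus_complex.sel Re_sum)
    have "a \<bullet> (G n \<omega> - real n *\<^sub>R v_vec 1) = K * (a \<bullet> v_vec 1) + Re (\<Sum>l\<in>minor_roots CARD('m). v_dual a l * u_form l (G n \<omega>))"
      using inner_spectral[OF m_ge_2, of a "G n \<omega>"] elim(2) by (simp only: inner_diff_right inner_scaleR_right) (simp add: algebra_simps)
    then have "a \<bullet> ((G n \<omega> - real n *\<^sub>R v_vec 1) /\<^sub>R sqrt (real n)) = (K * (a \<bullet> v_vec 1) + Re (\<Sum>l\<in>minor_roots CARD('m). v_dual a l * u_form l (G n \<omega>))) / sqrt (real n)"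
      by (simp only: inner_scaleR_right divide_inverse mult.commute)
    then show ?case unfolding S clt_det_def msum_def clt_incr_def
      by (simp only: sum_divide_distrib[where A="{..<n}", symmetric] add_divide_distrib add.assoc)
  qed
qed

lemma clt_det_tendsto_0:
  assumes r: "\<And>l. l \<in> minor_roots CARD('m) \<Longrightarrow> Re l \<le> r" "0 \<le> r" "r < 1/2"
  shows "clt_det a \<longlonglongrightarrow> 0"
proof (rule squeeze_0)
  define A where "A = (\<Sum>l\<in>minor_roots CARD('m). cmod (v_dual a l) * exp (2 * growth_err K l) * cmod (u_form l x0))"
  define B where "B = \<bar>K * (a \<bullet> v_vec 1)\<bar> + A"
  show "(\<lambda>n. B * (2 * (real n + 1) powr (r - 1/2))) \<longlonglongrightarrow> 0"
    using r by (intro tendsto_mult_right_zero tendsto_Suc_powr_neg) auto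
  fix n
  define R where "R = (real n + 1) powr r"
  have R: "R \<ge> 1" using r by (simp add: R_def ge_one_powr_ge_zero)
  have A: "A \<ge> 0" by (simp add: A_def sum_nonneg)
  have "\<bar>Re (\<Sum>l\<in>minor_roots CARD('m). v_dual a l * growth K l 0 n * u_form l x0)\<bar>
    \<le> (\<Sum>l\<in>minor_roots CARD('m). cmod (v_dual a l) * (exp (2 * growth_err K l) * R) * cmod (u_form l x0))"
    unfolding R_def
  proof (intro order_trans[OF abs_Re_le_cmod] sum_norm_le)
    fix l assume "l \<in> minor_roots CARD('m)"
    then show "cmod (v_dual a l * growth K l 0 n * u_form l x0) \<le> cmod (v_dual a l) * (exp (2 * growth_err K l) * (real n + 1) powr r) * cmod (u_form l x0)"
      unfolding norm_mult using r(1) by (intro mult_mono growth_0_le_powr K_ge_1 order_refl) auto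
  qed
  also have "\<dots> = A * R" unfolding A_def sum_distrib_right by (intro sum.cong refl) (simp add: mult_ac)
  finally have "\<bar>K * (a \<bullet> v_vec 1) + Re (\<Sum>l\<in>minor_roots CARD('m). v_dual a l * growth K l 0 n * u_form l x0)\<bar> \<le> \<bar>K * (a \<bullet> v_vec 1)\<bar> * 1 + A * R"
    by linarith
  also have "\<dots> \<le> \<bar>K * (a \<bullet> v_vec 1)\<bar> * R + A * R" using R by (intro add_right_mono mult_left_mono) auto
  also have "\<dots> = B * R" by (simp add: B_def distrib_right)
  finally have "\<bar>clt_det a n\<bar> \<le> B * R / sqrt (real n)"
    unfolding clt_det_def abs_divide by (simp add: divide_right_mono)
  also have "\<dots> = B * (R / sqrt (real n))" by simp
  also have "\<dots> \<le> B * (2 * (real n + 1) powr (r - 1/2))"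
  proof (intro mult_left_mono)
    show "R / sqrt (real n) \<le> 2 * (real n + 1) powr (r - 1/2)"
    proof (cases "n = 0")
      case False
      have "sqrt (real n + 1) \<le> sqrt (4 * real n)" using False by (intro real_sqrt_le_mono) auto
      then have "sqrt (real n + 1) \<le> 2 * sqrt (real n)" by (simp add: real_sqrt_mult)
      then have "1 / sqrt (real n) \<le> 2 / sqrt (real n + 1)" using False by (simp add: field_simps)
      then have "R * (1 / sqrt (real n)) \<le> R * (2 / sqrt (real n + 1))" using R by (intro mult_left_mono) auto
      also have "\<dots> = 2 * (real n + 1) powr (r - 1/2)" by (simp add: R_def powr_diff powr_half_sqrt)
      finally show ?thesis by simp
    qed simp
    show "0 \<le> B" using A by (simp add: B_def)
  qed
  finally show "\<bar>clt_det a n\<bar> \<le> B * (2 * (real n + 1) powr (r - 1/2))" .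
qed

lemma clt_char_limit:
  assumes r: "\<And>l. l \<in> minor_roots CARD('m) \<Longrightarrow> Re l \<le> r" "0 \<le> r" "r < 1/2"
  shows "(\<lambda>n. CLINT \<omega>|M. iexp (a \<bullet> ((G n \<omega> - real n *\<^sub>R v_vec 1) /\<^sub>R sqrt (real n)))) \<longlonglongrightarrow> of_real (exp (- cov a a / 2))"
proof -
  have eq: "(CLINT \<omega>|M. iexp (a \<bullet> ((G n \<omega> - real n *\<^sub>R v_vec 1) /\<^sub>R sqrt (real n))))
    = iexp (clt_det a n) * (CLINT \<omega>|M. iexp (msum (clt_incr a n) n \<omega>))" for n
  proof -
    have "(CLINT \<omega>|M. iexp (a \<bullet> ((G n \<omega> - real n *\<^sub>R v_vec 1) /\<^sub>R sqrt (real n)))) = (CLINT \<omega>|M. iexp (clt_det a n) * iexp (msum (clt_incr a n) n \<omega>))"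
    proof (rule integral_cong_AE)
      show "(\<lambda>\<omega>. iexp (a \<bullet> ((G n \<omega> - real n *\<^sub>R v_vec 1) /\<^sub>R sqrt (real n)))) \<in> borel_measurable M"
        by (rule measurable_X[of "\<lambda>x. iexp (a \<bullet> ((x - real n *\<^sub>R v_vec 1) /\<^sub>R sqrt (real n)))"])
      show "(\<lambda>\<omega>. iexp (clt_det a n) * iexp (msum (clt_incr a n) n \<omega>)) \<in> borel_measurable M"
        by (rule borel_measurable_integrable[OF integrable_msum[of "\<lambda>s _. iexp (clt_det a n) * iexp s"]])
      show "AE \<omega> in M. iexp (a \<bullet> ((G n \<omega> - real n *\<^sub>R v_vec 1) /\<^sub>R sqrt (real n))) = iexp (clt_det a n) * iexp (msum (clt_incr a n) n \<omega>)"
        using inner_normalized[of a n] by eventually_elim (simp only: of_real_add distrib_left exp_add)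
    qed
    then show ?thesis by simp
  qed
  have "(\<lambda>n. exp (- (\<Sum>k<n. clt_var a n k) / 2)) \<longlonglongrightarrow> exp (- cov a a / 2)"
    by (intro tendsto_intros clt_var_limit[OF r]) simp_all
  then have "(\<lambda>n. complex_of_real (exp (- (\<Sum>k<n. clt_var a n k) / 2))) \<longlonglongrightarrow> of_real (exp (- cov a a / 2))"
    by (rule tendsto_of_real)
  moreover have "(\<lambda>n. (CLINT \<omega>|M. iexp (msum (clt_incr a n) n \<omega>)) - complex_of_real (exp (- (\<Sum>k<n. clt_var a n k) / 2))) \<longlonglongrightarrow> 0"
    using tendsto_norm_zero_cancel[OF clt_char_approx[OF r, of a]] by simp
  ultimately have "(\<lambda>n. (CLINT \<omega>|M. iexp (msum (clt_incr a n) n \<omega>))) \<longlonglongrightarrow> of_real (exp (- cov a a / 2))"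
    using tendsto_add by fastforce
  moreover have "(\<lambda>n. iexp (clt_det a n)) \<longlonglongrightarrow> iexp 0"
    by (intro tendsto_intros clt_det_tendsto_0[OF r])
  ultimately show ?thesis unfolding eq using tendsto_mult by fastforce
qed

lemma second_moment_bound:
  assumes r: "\<And>l. l \<in> minor_roots CARD('m) \<Longrightarrow> Re l \<le> r" "0 \<le> r" "r < 1/2"
  obtains C where "\<And>n. expectation (\<lambda>\<omega>. (norm ((G n \<omega> - real n *\<^sub>R v_vec 1) /\<^sub>R sqrt (real n)))\<^sup>2) \<le> C"
proof -
  let ?R = "minor_roots CARD('m)"
  define c where "c = (\<lambda>l. \<Sum>i\<in>UNIV. cmod ((v_vec l :: complex^'m::{finite,linorder}) $ i))"
  have "\<exists>C. \<forall>n. expectation (\<lambda>\<omega>. (cmod (u_form l (G n \<omega>)))\<^sup>2) \<le> C * (real n + 1)" if "l \<in> ?R" for l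
  proof -
    have "poly (chi_poly CARD('m)) l = 0" using that by (simp add: minor_roots_def)
    from u_form_moments[OF this r(1)[OF that] _ r(2), of 2] r(3) obtain C where
      C: "\<And>n. expectation (\<lambda>\<omega>. (cmod (u_form l (G n \<omega>)))\<^sup>2) \<le> C * ((real n + 1) powr max r (1/2))\<^sup>2" by auto
    have "((real n + 1) powr max r (1/2))\<^sup>2 = real n + 1" for n using r(3) by (simp add: powr_power max_def)
    then show ?thesis using C by auto
  qed
  then obtain C where C: "\<And>l n. l \<in> ?R \<Longrightarrow> expectation (\<lambda>\<omega>. (cmod (u_form l (G n \<omega>)))\<^sup>2) \<le> C l * (real n + 1)"
    by metis
  define B where "B = 2 * K\<^sup>2 + 2 * real (card ?R) * (\<Sum>l\<in>?R. (c l)\<^sup>2 * C l)"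
  have norm_le: "AE \<omega> in M. norm (G n \<omega> - real n *\<^sub>R v_vec 1) \<le> K + (\<Sum>l\<in>?R. c l * cmod (u_form l (G n \<omega>)))" for n
    using AE_level[of n]
  proof eventually_elim
    case (elim \<omega>)
    define x where "x = G n \<omega>"
    have x: "x \<in> nonzero_nat_vecs" "coord_sum x = K + real n" using elim by (auto simp: level_def x_def)
    have "norm (x - real n *\<^sub>R v_vec 1) \<le> (\<Sum>i\<in>UNIV. \<bar>x $ i - real n * v_vec 1 $ i\<bar>)"
      using norm_le_l1_cart[of "x - real n *\<^sub>R v_vec 1"] by simp
    also have "\<dots> \<le> (\<Sum>i\<in>UNIV. coord_sum x * \<bar>gap_prob x i - (v_vec 1 :: real^'m::{finite,linorder}) $ i\<bar> + K * (v_vec 1 :: real^'m::{finite,linorder}) $ i)"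
    proof (rule sum_mono)
      fix i
      have "x $ i - real n * v_vec 1 $ i = coord_sum x * (gap_prob x i - v_vec 1 $ i) + K * v_vec 1 $ i"
        using coord_sum_ge_1[OF x(1)] x(2) by (simp add: field_simps)
      then show "\<bar>x $ i - real n * v_vec 1 $ i\<bar> \<le> coord_sum x * \<bar>gap_prob x i - v_vec 1 $ i\<bar> + K * v_vec 1 $ i"
        using coord_sum_ge_1[OF x(1)] K_ge_1 less_imp_le[OF v1_pos, of i]
        by (simp only:) (rule order_trans[OF abs_triangle_ineq], simp add: abs_mult)
    qed
    also have "\<dots> = coord_sum x * (\<Sum>i\<in>UNIV. \<bar>gap_prob x i - (v_vec 1 :: real^'m::{finite,linorder}) $ i\<bar>) + K"
      using sum_v1[OF m_ge_2] by (simp add: sum.distrib flip: sum_distrib_left)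
    also have "\<dots> \<le> coord_sum x * ((\<Sum>l\<in>?R. c l * cmod (u_form l x)) / coord_sum x) + K"
      unfolding c_def using coord_sum_ge_1[OF x(1)] by (intro add_right_mono mult_left_mono coord_dev x) auto
    also have "\<dots> = K + (\<Sum>l\<in>?R. c l * cmod (u_form l x))" using coord_sum_ge_1[OF x(1)] by simp
    finally show ?case by (simp add: x_def)
  qed
  have i2: "integrable M (\<lambda>\<omega>. (cmod (u_form l (G n \<omega>)))\<^sup>2)" for l n by (rule integrable_X[of "\<lambda>x. (cmod (u_form l x))\<^sup>2"])
  have bound: "expectation (\<lambda>\<omega>. (norm (G n \<omega> - real n *\<^sub>R v_vec 1))\<^sup>2) \<le> B * (real n + 1)" for n
  proof -
    have "expectation (\<lambda>\<omega>. (norm (G n \<omega> - real n *\<^sub>R v_vec 1))\<^sup>2)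
      \<le> expectation (\<lambda>\<omega>. 2 * K\<^sup>2 + 2 * real (card ?R) * (\<Sum>l\<in>?R. (c l)\<^sup>2 * (cmod (u_form l (G n \<omega>)))\<^sup>2))"
    proof (rule integral_mono_AE)
      show "integrable M (\<lambda>\<omega>. (norm (G n \<omega> - real n *\<^sub>R v_vec 1))\<^sup>2)"
        by (rule integrable_X[of "\<lambda>x. (norm (x - real n *\<^sub>R v_vec 1))\<^sup>2"])
      show "integrable M (\<lambda>\<omega>. 2 * K\<^sup>2 + 2 * real (card ?R) * (\<Sum>l\<in>?R. (c l)\<^sup>2 * (cmod (u_form l (G n \<omega>)))\<^sup>2))"
        by (rule integrable_X[of "\<lambda>x. 2 * K\<^sup>2 + 2 * real (card ?R) * (\<Sum>l\<in>?R. (c l)\<^sup>2 * (cmod (u_form l x))\<^sup>2)"])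
      show "AE \<omega> in M. (norm (G n \<omega> - real n *\<^sub>R v_vec 1))\<^sup>2 \<le> 2 * K\<^sup>2 + 2 * real (card ?R) * (\<Sum>l\<in>?R. (c l)\<^sup>2 * (cmod (u_form l (G n \<omega>)))\<^sup>2)"
        using norm_le[of n]
      proof eventually_elim
        case (elim \<omega>)
        define s where "s = (\<Sum>l\<in>?R. c l * cmod (u_form l (G n \<omega>)))"
        have "s\<^sup>2 \<le> real (card ?R) * (\<Sum>l\<in>?R. (c l * cmod (u_form l (G n \<omega>)))\<^sup>2)"
          unfolding s_def using sum_squared_le_sum_of_squares[of "\<lambda>l. c l * cmod (u_form l (G n \<omega>))" ?R]
            finite_minor_roots[OF m_ge_1] by (simp add: mult.commute)
        then have s: "s\<^sup>2 \<le> real (card ?R) * (\<Sum>l\<in>?R. (c l)\<^sup>2 * (cmod (u_form l (G n \<omega>)))\<^sup>2)" by (simp add: power_mult_distrib)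
        have "(norm (G n \<omega> - real n *\<^sub>R v_vec 1))\<^sup>2 \<le> (K + s)\<^sup>2" using elim by (intro power_mono) (auto simp: s_def)
        also have "\<dots> \<le> 2 * K\<^sup>2 + 2 * s\<^sup>2" using zero_le_power2[of "K - s"] by (simp add: power2_eq_square algebra_simps)
        finally show ?case using s by linarith
      qed
    qed
    also have "\<dots> = 2 * K\<^sup>2 + 2 * real (card ?R) * (\<Sum>l\<in>?R. (c l)\<^sup>2 * expectation (\<lambda>\<omega>. (cmod (u_form l (G n \<omega>)))\<^sup>2))"
      using i2 by (simp add: Bochner_Integration.integral_sum prob_space)
    also have "\<dots> \<le> 2 * K\<^sup>2 * (real n + 1) + 2 * real (card ?R) * (\<Sum>l\<in>?R. (c l)\<^sup>2 * (C l * (real n + 1)))"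
    proof (intro add_mono mult_left_mono sum_mono C)
      have "2 * K\<^sup>2 * 1 \<le> 2 * K\<^sup>2 * (real n + 1)" by (intro mult_left_mono) auto
      then show "2 * K\<^sup>2 \<le> 2 * K\<^sup>2 * (real n + 1)" by simp
    qed auto
    also have "(\<Sum>l\<in>?R. (c l)\<^sup>2 * (C l * (real n + 1))) = (\<Sum>l\<in>?R. (c l)\<^sup>2 * C l) * (real n + 1)"
      by (simp only: sum_distrib_right mult.assoc)
    also have "2 * K\<^sup>2 * (real n + 1) + 2 * real (card ?R) * ((\<Sum>l\<in>?R. (c l)\<^sup>2 * C l) * (real n + 1)) = B * (real n + 1)"
      unfolding B_def by (simp only: distrib_right mult.assoc)
    finally show ?thesis .
  qed
  \<comment> \<open>The factor 2 bounds \<open>(n + 1) / n\<close>. At \<open>n = 0\<close> the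
    normalised vector is 0, because \<open>inverse 0 = 0\<close>.\<close>
  have "expectation (\<lambda>\<omega>. (norm ((G n \<omega> - real n *\<^sub>R v_vec 1) /\<^sub>R sqrt (real n)))\<^sup>2) \<le> 2 * \<bar>B\<bar>" for n
  proof (cases "n = 0")
    case False
    have "expectation (\<lambda>\<omega>. (norm ((G n \<omega> - real n *\<^sub>R v_vec 1) /\<^sub>R sqrt (real n)))\<^sup>2) = expectation (\<lambda>\<omega>. (norm (G n \<omega> - real n *\<^sub>R v_vec 1))\<^sup>2 / real n)"
      by (intro Bochner_Integration.integral_cong refl) (simp add: power_mult_distrib power_inverse divide_inverse mult.commute)
    also have "\<dots> = expectation (\<lambda>\<omega>. (norm (G n \<omega> - real n *\<^sub>R v_vec 1))\<^sup>2) / real n" by simp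
    also have "\<dots> \<le> B * (real n + 1) / real n" by (intro divide_right_mono bound) auto
    also have "\<dots> \<le> \<bar>B\<bar> * ((real n + 1) / real n)" by (simp add: divide_right_mono mult_right_mono)
    also have "\<dots> \<le> \<bar>B\<bar> * 2" using False by (intro mult_left_mono) (auto simp: field_simps)
    finally show ?thesis by simp
  qed simp
  then show ?thesis using that by blast
qed

theorem gap_clt:
  assumes m: "CARD('m) \<le> 59"
  obtains \<mu> where "centered_gaussian \<mu>"
    "converges_in_law M (\<lambda>n \<omega>. (G n \<omega> - real n *\<^sub>R v_vec 1) /\<^sub>R sqrt (real n)) \<mu>"
proof -
  \<comment> \<open>There are finitely many roots, so their real parts have a common bound strictly
    below 1/2; inserting 0 makes it non-negative.\<close>
  define r where "r = Max (insert 0 (Re ` minor_roots CARD('m)))"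
  have fin: "finite (insert 0 (Re ` minor_roots CARD('m)))" using finite_minor_roots[OF m_ge_1] by simp
  have r: "Re l \<le> r" if "l \<in> minor_roots CARD('m)" for l
    unfolding r_def using fin that by (intro Max_ge) auto
  have r0: "0 \<le> r" unfolding r_def using fin by (intro Max_ge) auto
  have "r \<in> insert 0 (Re ` minor_roots CARD('m))" unfolding r_def using fin by (intro Max_in) auto
  then have r1: "r < 1/2" using chi_root_Re_small[OF m_ge_1 m] by (auto simp: minor_roots_def)
  note r = r r0 r1
  \<comment> \<open>The spectral formula does not show the sign, but it is a limit of sums of
    variances.\<close>
  have psd: "cov a a \<ge> 0" for a
  proof (rule tendsto_lowerbound)
    show "(\<lambda>n. \<Sum>k<n. clt_var a n k) \<longlonglongrightarrow> cov a a" by (rule clt_var_limit[OF r])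
    have "0 \<le> (\<Sum>k<n. clt_var a n k)" for n
      unfolding clt_var_def by (auto intro!: divide_nonneg_nonneg sum_nonneg mult_nonneg_nonneg less_imp_le[OF v1_pos])
    then show "\<forall>\<^sub>F n in sequentially. 0 \<le> (\<Sum>k<n. clt_var a n k)" by (simp add: always_eventually)
  qed simp
  obtain \<mu> :: "(real^'m::{finite,linorder}) measure" where \<mu>: "centered_gaussian \<mu>" "\<And>a. (CLINT x|\<mu>. iexp (a \<bullet> x)) = of_real (exp (- cov a a / 2))"
    by (rule gaussian_exists[OF cov_bilinear cov_sym psd]) blast
  obtain C where C: "\<And>n. expectation (\<lambda>\<omega>. (norm ((G n \<omega> - real n *\<^sub>R v_vec 1) /\<^sub>R sqrt (real n)))\<^sup>2) \<le> C"
    using second_moment_bound[OF r, of thesis] by blast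
  have "converges_in_law M (\<lambda>n \<omega>. (G n \<omega> - real n *\<^sub>R v_vec 1) /\<^sub>R sqrt (real n)) \<mu>"
  proof (rule converges_in_law_char[OF prob_space_axioms _ _ C])
    show "(\<lambda>\<omega>. (G n \<omega> - real n *\<^sub>R v_vec 1) /\<^sub>R sqrt (real n)) \<in> borel_measurable M" for n
      by (rule measurable_X[of "\<lambda>x. (x - real n *\<^sub>R v_vec 1) /\<^sub>R sqrt (real n)"])
    show "integrable M (\<lambda>\<omega>. (norm ((G n \<omega> - real n *\<^sub>R v_vec 1) /\<^sub>R sqrt (real n)))\<^sup>2)" for n
      by (rule integrable_X[of "\<lambda>x. (norm ((x - real n *\<^sub>R v_vec 1) /\<^sub>R sqrt (real n)))\<^sup>2"])
    show "prob_space \<mu>" "sets \<mu> = sets borel" using \<mu>(1) by (auto simp: centered_gaussian_def)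
    show "(\<lambda>n. CLINT \<omega>|M. iexp (a \<bullet> ((G n \<omega> - real n *\<^sub>R v_vec 1) /\<^sub>R sqrt (real n)))) \<longlonglongrightarrow> (CLINT x|\<mu>. iexp (a \<bullet> x))" for a
      unfolding \<mu>(2) by (rule clt_char_limit[OF r])
  qed
  then show ?thesis using that \<mu>(1) by blast
qed

end

section \<open>The fringe node process\<close>

lemma P_mat_mult_add: "P_mat *v (x + y) = P_mat *v x + P_mat *v (y :: real^'m::{finite,linorder})"
  by (simp add: matrix_vector_right_distrib)

lemma P_mat_cancel: "matrix_inv P_mat *v (P_mat *v x) = (x :: real^'m::{finite,linorder})"
proof (simp only: vec_eq_iff, rule allI)
  fix i :: 'm
  have "0 < CARD('m)" by simp
  then have "real (CARD('m) + idx i - 1) \<noteq> 0" unfolding of_nat_eq_0_iff using idx_ge_1[of i] by linarith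
  then show "(matrix_inv P_mat *v (P_mat *v x)) $ i = x $ i" by (simp only: P_mat_inv P_mat_mult) simp
qed

lemma P_mat_inj: "P_mat *v x = P_mat *v y \<longleftrightarrow> x = (y :: real^'m::{finite,linorder})"
  by (metis P_mat_cancel)

lemma P_mat_cancel': "P_mat *v (matrix_inv P_mat *v x) = (x :: real^'m::{finite,linorder})"
proof (simp only: vec_eq_iff, rule allI)
  fix i :: 'm
  have "0 < CARD('m)" by simp
  then have "real (CARD('m) + idx i - 1) \<noteq> 0" unfolding of_nat_eq_0_iff using idx_ge_1[of i] by linarith
  then show "(P_mat *v (matrix_inv P_mat *v x)) $ i = x $ i" by (simp only: P_mat_inv P_mat_mult) simp
qed

lemma P_mat_nonzero_nat_vecs:
  assumes "x \<in> nonzero_nat_vecs"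
  shows "P_mat *v (x :: real^'m::{finite,linorder}) \<in> nonzero_nat_vecs"
proof -
  have "P_mat *v x \<noteq> 0" using P_mat_inj[of x 0] assms by (auto simp: nonzero_nat_vecs_def)
  then show ?thesis using assms by (auto simp: nonzero_nat_vecs_def P_mat_mult intro!: Nats_mult)
qed

text \<open>The diagonal entries of \<open>P_mat\<close> are the weights in the fringe transition
  probabilities, and \<open>P_mat\<close> maps the displacement \<open>w_vec k\<close> to row
  \<open>k\<close> of \<open>R_mat\<close>.\<close>

lemma gap_process_of_fringe:
  fixes V :: "real^'m::{finite,linorder}"
  assumes m: "CARD('m) \<ge> 2" and L: "fringe_process M V L"
  shows "gap_process M (P_mat *v V) (\<lambda>n \<omega>. P_mat *v L n \<omega>)"
proof -
  let ?fq = "\<lambda>(x::real^'m::{finite,linorder}) i. real (CARD('m) + idx i - 1) * x $ i / (\<Sum>j\<in>UNIV. real (CARD('m) + idx j - 1) * x $ j)"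
  let ?fp = "step_prob ?fq (\<lambda>i::'m. w_vec (idx i) :: real^'m::{finite,linorder})"
  let ?gp = "step_prob (\<lambda>(x::real^'m::{finite,linorder}) i. x $ i / coord_sum x) (\<lambda>i. row i R_mat)"
  have mc: "markov_chain M nonzero_nat_vecs ?fp V L" using L by (simp add: fringe_process_def)
  have step: "?gp (P_mat *v x) (P_mat *v y) = ?fp x y" for x y :: "real^'m::{finite,linorder}"
  proof -
    have "P_mat *v y = P_mat *v x + row i R_mat \<longleftrightarrow> y = x + w_vec (idx i)" for i :: 'm
      unfolding P_mat_w_vec[OF m, symmetric] P_mat_mult_add[symmetric] P_mat_inj ..
    then show ?thesis unfolding step_prob_def by (intro sum.cong refl) (simp add: P_mat_mult coord_sum_def)
  qed
  show ?thesis unfolding gap_process_def markov_chain_def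
  proof (intro conjI allI)
    show "prob_space M" using mc by (simp add: markov_chain_def)
    show "(\<lambda>\<omega>. P_mat *v L n \<omega>) \<in> M \<rightarrow>\<^sub>M count_space nonzero_nat_vecs" for n
    proof (rule measurable_compose[where g = "(*v) P_mat"])
      show "L n \<in> M \<rightarrow>\<^sub>M count_space nonzero_nat_vecs" using mc by (simp add: markov_chain_def)
      show "(*v) P_mat \<in> count_space nonzero_nat_vecs \<rightarrow>\<^sub>M count_space (nonzero_nat_vecs :: (real^'m::{finite,linorder}) set)"
        using P_mat_nonzero_nat_vecs by auto
    qed
    have "AE \<omega> in M. L 0 \<omega> = V" using mc by (simp add: markov_chain_def)
    then show "AE \<omega> in M. P_mat *v L 0 \<omega> = P_mat *v V" by eventually_elim simp
    fix n and x :: "nat \<Rightarrow> real^'m::{finite,linorder}"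
    \<comment> \<open>\<open>markov_chain\<close> quantifies over arbitrary sequences of states, so
      every \<open>x i\<close> is pulled back along \<open>P_mat\<close>, which is
      bijective.\<close>
    define y where "y = (\<lambda>i. matrix_inv P_mat *v x i)"
    have x: "x i = P_mat *v y i" for i by (simp add: y_def P_mat_cancel')
    have "\<P>(\<omega> in M. \<forall>i\<le>Suc n. L i \<omega> = y i) = \<P>(\<omega> in M. \<forall>i\<le>n. L i \<omega> = y i) * ?fp (y n) (y (Suc n))"
      using mc unfolding markov_chain_def by blast
    then show "\<P>(\<omega> in M. \<forall>i\<le>Suc n. P_mat *v L i \<omega> = x i) = \<P>(\<omega> in M. \<forall>i\<le>n. P_mat *v L i \<omega> = x i) * ?gp (x n) (x (Suc n))"
      unfolding x P_mat_inj step .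
  qed
qed

lemma centered_gaussian_linear_image:
  fixes f :: "real^'n \<Rightarrow> real^'n"
  assumes f: "linear f" and \<mu>: "centered_gaussian \<mu>"
  shows "centered_gaussian (distr \<mu> borel f)"
proof -
  have sets: "sets \<mu> = sets borel" and prob: "prob_space \<mu>" using \<mu> by (auto simp: centered_gaussian_def)
  have fm: "f \<in> borel_measurable borel"
    using f by (intro borel_measurable_continuous_onI linear_continuous_on) (simp add: linear_conv_bounded_linear)
  then have f\<mu>: "f \<in> borel_measurable \<mu>" using sets by (simp cong: measurable_cong_sets)
  show ?thesis unfolding centered_gaussian_def
  proof (intro conjI allI)
    show "prob_space (distr \<mu> borel f)" using prob f\<mu> by (rule prob_space.prob_space_distr)
    show "sets (distr \<mu> borel f) = sets borel" by simp
    fix a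
    have "distr (distr \<mu> borel f) borel (\<lambda>x. a \<bullet> x) = distr \<mu> borel (\<lambda>x. a \<bullet> f x)"
      using f\<mu> by (subst distr_distr) (auto simp: o_def)
    also have "(\<lambda>x. a \<bullet> f x) = (\<lambda>x. adjoint f a \<bullet> x)" using adjoint_works[OF f] by (metis inner_commute)
    finally show "\<exists>\<sigma>\<ge>0. distr (distr \<mu> borel f) borel ((\<bullet>) a) = centered_normal \<sigma>"
      using \<mu> by (simp add: centered_gaussian_def)
  qed
qed

lemma converges_in_law_linear_image:
  fixes f :: "real^'n \<Rightarrow> real^'n"
  assumes f: "linear f" and \<mu>: "sets \<mu> = sets borel" and X: "converges_in_law M X \<mu>"
  shows "converges_in_law M (\<lambda>n \<omega>. f (X n \<omega>)) (distr \<mu> borel f)"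
  unfolding converges_in_law_def
proof (intro allI impI)
  fix g :: "real^'n \<Rightarrow> real" assume g: "continuous_on UNIV g \<and> bounded (range g)"
  have cf: "continuous_on UNIV f" using f by (intro linear_continuous_on) (simp add: linear_conv_bounded_linear)
  have fm: "f \<in> borel_measurable \<mu>" using borel_measurable_continuous_onI[OF cf] \<mu> by (simp cong: measurable_cong_sets)
  have gm: "g \<in> borel_measurable borel" using g by (intro borel_measurable_continuous_onI) auto
  have "continuous_on UNIV (\<lambda>x. g (f x))"
    using g by (intro continuous_on_compose2[OF _ cf, of UNIV g]) auto
  moreover have "bounded (range (\<lambda>x. g (f x)))" using g by (auto intro: bounded_subset)
  ultimately have "(\<lambda>n. \<integral>\<omega>. g (f (X n \<omega>)) \<partial>M) \<longlonglongrightarrow> (\<integral>x. g (f x) \<partial>\<mu>)"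
    using X unfolding converges_in_law_def by blast
  then show "(\<lambda>n. \<integral>\<omega>. g (f (X n \<omega>)) \<partial>M) \<longlonglongrightarrow> (\<integral>x. g x \<partial>distr \<mu> borel f)"
    by (simp add: integral_distr[OF fm gm])
qed

text \<open>\<open>P_mat\<close> is diagonal with the same integer entries over the real and the
  complex numbers, so its inverse commutes with taking real parts.\<close>

lemma matrix_inv_P_Re_vec:
  "matrix_inv P_mat *v Re_vec (c *s z) = Re_vec (c *s (matrix_inv P_mat *v (z :: complex^'m::{finite,linorder})))"
proof (simp only: vec_eq_iff, rule allI)
  fix i :: 'm
  have "Re (c * (w / of_nat n)) = Re (c * w) / real n" for w n
    by (simp only: times_divide_eq_right Re_divide_of_nat)
  then show "(matrix_inv P_mat *v Re_vec (c *s z)) $ i = Re_vec (c *s (matrix_inv P_mat *v z)) $ i"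
    unfolding P_mat_inv Re_vec_def vec_lambda_beta vector_smult_component by simp
qed

theorem theorem2:
  fixes M :: "'a measure"
    and V :: "real ^ 'm::{finite,linorder}"
    and L :: "nat \<Rightarrow> 'a \<Rightarrow> real ^ 'm::{finite,linorder}"
  assumes "CARD('m) \<ge> 2"
    and "V \<in> nonzero_nat_vecs"
    and "fringe_process M V L"
  shows
    "(CARD('m) \<le> 59 \<longrightarrow>
       (\<exists>\<mu>. centered_gaussian \<mu> \<and>
         converges_in_law M
           (\<lambda>n \<omega>. (L n \<omega> - real n *\<^sub>R (matrix_inv P_mat *v v_vec 1)) /\<^sub>R sqrt (real n)) \<mu>))
     \<and>
     (CARD('m) \<ge> 60 \<longrightarrow>
       (let l2 = lambda2 CARD('m); s2 = sigma2 CARD('m);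
            v1 = v_vec 1 :: (real, 'm) vec; v2 = v_vec l2 :: (complex, 'm) vec in
        \<exists>W :: 'a \<Rightarrow> complex. W \<in> borel_measurable M \<and>
          small_o_as_Lp M
            (\<lambda>n \<omega>. L n \<omega> - (real n *\<^sub>R (matrix_inv P_mat *v v1)
               + 2 *\<^sub>R Re_vec ((of_nat n powr l2 * W \<omega>) *s (matrix_inv P_mat *v v2)))) s2 \<and>
          (\<forall>(N :: 'b measure) G. gap_process N (P_mat *v V) G \<longrightarrow>
            (\<exists>W' :: 'b \<Rightarrow> complex. W' \<in> borel_measurable N \<and>
              (AE \<omega> in N. (\<lambda>n. of_nat n powr (- l2) * u_form l2 (G n \<omega>)) \<longlonglongrightarrow> W' \<omega>) \<and>
              small_o_as_Lp N
                (\<lambda>n \<omega>. G n \<omega> - (real n *\<^sub>R v1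
                   + 2 *\<^sub>R Re_vec ((of_nat n powr l2 * W' \<omega>) *s v2))) s2 \<and>
              distr M borel W = distr N borel W'))))"
proof -
  define PL where "PL = (\<lambda>n \<omega>. P_mat *v L n \<omega>)"
  let ?Pi = "\<lambda>x :: real^'m::{finite,linorder}. matrix_inv P_mat *v x"
  have PV: "P_mat *v V \<in> nonzero_nat_vecs" by (rule P_mat_nonzero_nat_vecs[OF assms(2)])
  interpret P: gap_urn M "P_mat *v V" PL
    unfolding PL_def by (rule gap_urnI[OF assms(1) PV gap_process_of_fringe[OF assms(1,3)]])
  have L: "L n \<omega> = ?Pi (PL n \<omega>)" for n \<omega> by (simp add: PL_def P_mat_cancel)
  have lin: "linear ?Pi" by (rule matrix_vector_mul_linear)
  have blin: "bounded_linear ?Pi" using lin by (simp add: linear_conv_bounded_linear)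
  have small: "\<exists>\<mu>. centered_gaussian \<mu> \<and>
         converges_in_law M
           (\<lambda>n \<omega>. (L n \<omega> - real n *\<^sub>R (matrix_inv P_mat *v v_vec 1)) /\<^sub>R sqrt (real n)) \<mu>"
    if m: "CARD('m) \<le> 59"
  proof -
    obtain \<mu> where \<mu>: "centered_gaussian \<mu>"
      "converges_in_law M (\<lambda>n \<omega>. (PL n \<omega> - real n *\<^sub>R v_vec 1) /\<^sub>R sqrt (real n)) \<mu>"
      by (rule P.gap_clt[OF m])
    have "converges_in_law M (\<lambda>n \<omega>. ?Pi ((PL n \<omega> - real n *\<^sub>R v_vec 1) /\<^sub>R sqrt (real n))) (distr \<mu> borel ?Pi)"
      using \<mu> by (intro converges_in_law_linear_image[OF lin]) (auto simp: centered_gaussian_def)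
    moreover have "?Pi ((PL n \<omega> - real n *\<^sub>R v_vec 1) /\<^sub>R sqrt (real n)) = (L n \<omega> - real n *\<^sub>R ?Pi (v_vec 1)) /\<^sub>R sqrt (real n)" for n \<omega>
      by (simp only: L linear_scale[OF lin] linear_diff[OF lin])
    ultimately show ?thesis using centered_gaussian_linear_image[OF lin \<mu>(1)] by auto
  qed
  define l2 s2 where "l2 = lambda2 CARD('m)" and "s2 = sigma2 CARD('m)"
  define v1 v2 where "v1 = (v_vec 1 :: real^'m::{finite,linorder})" and "v2 = (v_vec l2 :: complex^'m::{finite,linorder})"
  have large: "\<exists>W :: 'a \<Rightarrow> complex. W \<in> borel_measurable M \<and>
          small_o_as_Lp M
            (\<lambda>n \<omega>. L n \<omega> - (real n *\<^sub>R (matrix_inv P_mat *v v1)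
               + 2 *\<^sub>R Re_vec ((of_nat n powr l2 * W \<omega>) *s (matrix_inv P_mat *v v2)))) s2 \<and>
          (\<forall>(N :: 'b measure) G. gap_process N (P_mat *v V) G \<longrightarrow>
            (\<exists>W' :: 'b \<Rightarrow> complex. W' \<in> borel_measurable N \<and>
              (AE \<omega> in N. (\<lambda>n. of_nat n powr (- l2) * u_form l2 (G n \<omega>)) \<longlonglongrightarrow> W' \<omega>) \<and>
              small_o_as_Lp N
                (\<lambda>n \<omega>. G n \<omega> - (real n *\<^sub>R v1
                   + 2 *\<^sub>R Re_vec ((of_nat n powr l2 * W' \<omega>) *s v2))) s2 \<and>
              distr M borel W = distr N borel W'))"
    if m: "CARD('m) \<ge> 60"
  proof -
    have s2: "s2 > 0" using sigma2_large[OF m] by (simp add: s2_def)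
    \<comment> \<open>\<open>W\<close> lives on the space of \<open>L\<close>: it is the limit
      variable of the gap process \<open>P L\<close>.\<close>
    obtain W where W: "W \<in> borel_measurable M"
      "AE \<omega> in M. (\<lambda>n. of_nat n powr (- l2) * u_form l2 (PL n \<omega>)) \<longlonglongrightarrow> W \<omega>"
      "lp_small M (\<lambda>n \<omega>. PL n \<omega> - (real n *\<^sub>R v1 + 2 *\<^sub>R Re_vec ((of_nat n powr l2 * W \<omega>) *s v2))) s2"
      unfolding l2_def s2_def v1_def v2_def by (rule P.gap_asymptotics_large[OF m])
    have "lp_small M (\<lambda>n \<omega>. ?Pi (PL n \<omega> - (real n *\<^sub>R v1 + 2 *\<^sub>R Re_vec ((of_nat n powr l2 * W \<omega>) *s v2)))) s2"
      by (rule lp_small_bounded_linear[OF blin W(3)])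
    then have "lp_small M (\<lambda>n \<omega>. L n \<omega> - (real n *\<^sub>R (matrix_inv P_mat *v v1)
               + 2 *\<^sub>R Re_vec ((of_nat n powr l2 * W \<omega>) *s (matrix_inv P_mat *v v2)))) s2"
      unfolding linear_diff[OF lin] linear_add[OF lin] linear_scale[OF lin] matrix_inv_P_Re_vec L[symmetric] .
    then have sm: "small_o_as_Lp M (\<lambda>n \<omega>. L n \<omega> - (real n *\<^sub>R (matrix_inv P_mat *v v1)
               + 2 *\<^sub>R Re_vec ((of_nat n powr l2 * W \<omega>) *s (matrix_inv P_mat *v v2)))) s2"
      by (rule lp_small_imp_small_o_as_Lp[OF P.prob_space_axioms _ s2])
    have "\<exists>W' :: 'b \<Rightarrow> complex. W' \<in> borel_measurable N \<and>
              (AE \<omega> in N. (\<lambda>n. of_nat n powr (- l2) * u_form l2 (G n \<omega>)) \<longlonglongrightarrow> W' \<omega>) \<and>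
              small_o_as_Lp N
                (\<lambda>n \<omega>. G n \<omega> - (real n *\<^sub>R v1
                   + 2 *\<^sub>R Re_vec ((of_nat n powr l2 * W' \<omega>) *s v2))) s2 \<and>
              distr M borel W = distr N borel W'"
      if G: "gap_process N (P_mat *v V) G" for N :: "'b measure" and G
    proof -
      interpret N: gap_urn N "P_mat *v V" G by (rule gap_urnI[OF assms(1) PV G])
      obtain W' where W': "W' \<in> borel_measurable N"
        "AE \<omega> in N. (\<lambda>n. of_nat n powr (- l2) * u_form l2 (G n \<omega>)) \<longlonglongrightarrow> W' \<omega>"
        "lp_small N (\<lambda>n \<omega>. G n \<omega> - (real n *\<^sub>R v1 + 2 *\<^sub>R Re_vec ((of_nat n powr l2 * W' \<omega>) *s v2))) s2"
        unfolding l2_def s2_def v1_def v2_def by (rule N.gap_asymptotics_large[OF m])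
      \<comment> \<open>\<open>PL\<close> and \<open>G\<close> live on different spaces but have the
        same transition probabilities and start, so the approximating variables agree in law for
        every \<open>n\<close>.\<close>
      have "distr M borel W = distr N borel W'"
      proof (rule distr_eq_of_limits[OF P.prob_space_axioms N.prob_space_axioms _ W(1,2) _ W'(1,2)])
        show "(\<lambda>\<omega>. of_nat n powr (- l2) * u_form l2 (PL n \<omega>)) \<in> borel_measurable M" for n
          by (rule P.measurable_X[of "\<lambda>x. of_nat n powr (- l2) * u_form l2 x"])
        show "(\<lambda>\<omega>. of_nat n powr (- l2) * u_form l2 (G n \<omega>)) \<in> borel_measurable N" for n
          by (rule N.measurable_X[of "\<lambda>x. of_nat n powr (- l2) * u_form l2 x"])
        show "(\<integral>\<omega>. f (of_nat n powr (- l2) * u_form l2 (PL n \<omega>)) \<partial>M) = (\<integral>\<omega>. f (of_nat n powr (- l2) * u_form l2 (G n \<omega>)) \<partial>N)"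
          for n and f :: "complex \<Rightarrow> real"
          by (rule same_marginals[OF P.step_chain_axioms N.step_chain_axioms, of "\<lambda>x. f (of_nat n powr (- l2) * u_form l2 x)"])
      qed
      then show ?thesis using W' lp_small_imp_small_o_as_Lp[OF N.prob_space_axioms W'(3) s2] by blast
    qed
    then show ?thesis using W(1) sm by blast
  qed
  show ?thesis using small large unfolding l2_def s2_def v1_def v2_def Let_def by blast
qed

end
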